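(* Let $G$ be a locally compact group, and let $1<p<\infty$. Suppose that $L^{p}(G)$ is an injective Banach left $L^{1}(G)$-module. Then $G$ is $(p,p)$-amenable.
   Context: $m$ is a left Haar measure on $G$, $L^p(G)=L^p(G,m)$. $L^1(G)$ is the Banach algebra with convolution product $(f\star g)(s)=\int_G f(t)g(t^{-1}s)\,dm(t)$, and $L^p(G)$ is a Banach left $L^1(G)$-module under convolution, given by the same formula. Injectivity. Let $A$ be a Banach algebra. For Banach left $A$-modules $E,F$, an $A$-module morphism is a bounded linear $A$-module map $E\to F$; a monomorphism (injective morphism) $T:E\to F$ is admissible if there is a bounded linear operator $S:F\to E$ with $S\circ T=I_E$. A Banach left $A$-module $J$ is injective if, for all Banach left $A$-modules $E,F$, each admissible monomorphism $T:E\to F$ and each $A$-module morphism $S:E\to J$, there is an $A$-module morphism $R:F\to J$ with $R\circ T=S$. Weak $(p,q)$-multi-norm. For a Banach space $X$, $1\le p<\infty$ and $x=(x_1,\dots,x_n)\in X^n$, put $\mu_{p,n}(x)=\sup\{(\sum_{i=1}^n|\langle x_i,\lambda\rangle|^p)^{1/p}:\lambda\in X',\ \|\lambda\|\le1\}$. For $1\le p\le q<\infty$ and $x\in X^n$, put $$\|x\|_n^{(p,q)}=\sup\Big\{\Big(\sum_{i=1}^n|\langle x_i,\lambda_i\rangle|^q\Big)^{1/q}:\lambda=(\lambda_1,\dots,\lambda_n)\in (X')^n,\ \mu_{p,n}(\lambda)\le1\Big\}.$$ $(p,q)$-amenability. For $f\in L^1(G)$, $s\in G$, let $(s\cdot f)(t)=f(s^{-1}t)$;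 this action of $G$ is extended to $L^1(G)''$ by taking second adjoints. A mean is an element $\Lambda\in L^1(G)''$ with $\langle 1,\Lambda\rangle=\|\Lambda\|=1$, where $1\in L^\infty(G)$ is the constant function. For $1\le p\le q<\infty$, $G$ is $(p,q)$-amenable if there is a mean $\Lambda$ which is left $(p,q)$-multi-invariant, i.e. $\sup\{\|(s_1\cdot\Lambda,\dots,s_n\cdot\Lambda)\|_n^{(p,q)}:s_1,\dots,s_n\in G,\ n\in\mathbb N\}<\infty$, where the weak $(p,q)$-multi-norm is taken over the Banach space $X=L^1(G)''$. *)

theory Defs
  imports "HOL-Analysis.Analysis"
begin

section \<open>Complex normed spaces with an explicit carrier\<close>

text \<open>
  The spaces \<open>L\<^sup>p(G,m)\<close> depend on the parameters \<open>m\<close> and \<open>p\<close>, and injectivity quantifies over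
  Banach modules, so normed spaces are records with an explicit carrier set. Values of the
  operations outside the carrier are irrelevant.
\<close>

record 'v nspace =
  vcar :: "'v set"
  vzero :: 'v
  vadd :: "'v \<Rightarrow> 'v \<Rightarrow> 'v"
  vscale :: "complex \<Rightarrow> 'v \<Rightarrow> 'v"
  vnorm :: "'v \<Rightarrow> real"

definition vdiff :: "('v, 'x) nspace_scheme \<Rightarrow> 'v \<Rightarrow> 'v \<Rightarrow> 'v" where
  "vdiff V x y = vadd V x (vscale V (-1) y)"

locale complex_normed_space =
  fixes V :: "('v, 'x) nspace_scheme"
  assumes zero_closed: "vzero V \<in> vcar V"
    and add_closed: "\<lbrakk>x \<in> vcar V; y \<in> vcar V\<rbrakk> \<Longrightarrow> vadd V x y \<in> vcar V"
    and scale_closed: "x \<in> vcar V \<Longrightarrow> vscale V c x \<in> vcar V"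
    and add_assoc: "\<lbrakk>x \<in> vcar V; y \<in> vcar V; z \<in> vcar V\<rbrakk>
      \<Longrightarrow> vadd V (vadd V x y) z = vadd V x (vadd V y z)"
    and add_commute: "\<lbrakk>x \<in> vcar V; y \<in> vcar V\<rbrakk> \<Longrightarrow> vadd V x y = vadd V y x"
    and add_zero: "x \<in> vcar V \<Longrightarrow> vadd V x (vzero V) = x"
    and add_neg: "x \<in> vcar V \<Longrightarrow> vadd V x (vscale V (-1) x) = vzero V"
    and scale_one: "x \<in> vcar V \<Longrightarrow> vscale V 1 x = x"
    and scale_scale: "x \<in> vcar V \<Longrightarrow> vscale V c (vscale V d x) = vscale V (c * d) x"
    and scale_add_right: "\<lbrakk>x \<in> vcar V; y \<in> vcar V\<rbrakk>
      \<Longrightarrow> vscale V c (vadd V x y) = vadd V (vscale V c x) (vscale V c y)"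
    and scale_add_left: "x \<in> vcar V
      \<Longrightarrow> vscale V (c + d) x = vadd V (vscale V c x) (vscale V d x)"
    and norm_nonneg: "x \<in> vcar V \<Longrightarrow> 0 \<le> vnorm V x"
    and norm_zero_iff: "x \<in> vcar V \<Longrightarrow> vnorm V x = 0 \<longleftrightarrow> x = vzero V"
    and norm_triangle: "\<lbrakk>x \<in> vcar V; y \<in> vcar V\<rbrakk>
      \<Longrightarrow> vnorm V (vadd V x y) \<le> vnorm V x + vnorm V y"
    and norm_scale: "x \<in> vcar V \<Longrightarrow> vnorm V (vscale V c x) = cmod c * vnorm V x"

locale complex_banach_space = complex_normed_space +
  assumes complete: "\<lbrakk>\<And>n. \<sigma> n \<in> vcar V;
      \<And>e. e > 0 \<Longrightarrow> \<exists>N. \<forall>k\<ge>N. \<forall>l\<ge>N. vnorm V (vdiff V (\<sigma> k) (\<sigma> l)) < e\<rbrakk>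
      \<Longrightarrow> \<exists>x\<in>vcar V. (\<lambda>n. vnorm V (vdiff V (\<sigma> n) x)) \<longlonglongrightarrow> (0::real)"

definition bounded_op ::
  "('v, 'x) nspace_scheme \<Rightarrow> ('w, 'y) nspace_scheme \<Rightarrow> ('v \<Rightarrow> 'w) \<Rightarrow> bool" where
  "bounded_op V W T \<longleftrightarrow>
     (\<forall>x\<in>vcar V. T x \<in> vcar W) \<and>
     (\<forall>x\<in>vcar V. \<forall>y\<in>vcar V. T (vadd V x y) = vadd W (T x) (T y)) \<and>
     (\<forall>c. \<forall>x\<in>vcar V. T (vscale V c x) = vscale W c (T x)) \<and>
     (\<exists>K. \<forall>x\<in>vcar V. vnorm W (T x) \<le> K * vnorm V x)"

text \<open>
  Operators are made \<^const>\<open>extensional\<close>, so that equality of functions is equality on the carrier.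
\<close>

definition op_space ::
  "('v, 'x) nspace_scheme \<Rightarrow> ('w, 'y) nspace_scheme \<Rightarrow> ('v \<Rightarrow> 'w) nspace" where
  "op_space V W = \<lparr>
     vcar = {T \<in> extensional (vcar V). bounded_op V W T},
     vzero = (\<lambda>x\<in>vcar V. vzero W),
     vadd = (\<lambda>S T. \<lambda>x\<in>vcar V. vadd W (S x) (T x)),
     vscale = (\<lambda>c T. \<lambda>x\<in>vcar V. vscale W c (T x)),
     vnorm = (\<lambda>T. SUP x\<in>{x \<in> vcar V. vnorm V x \<le> 1}. vnorm W (T x))\<rparr>"

definition complex_space :: "complex nspace" where
  "complex_space = \<lparr>vcar = UNIV, vzero = 0, vadd = (+), vscale = (*), vnorm = cmod\<rparr>"

definition dual :: "('v, 'x) nspace_scheme \<Rightarrow> ('v \<Rightarrow> complex) nspace" where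
  "dual V = op_space V complex_space"

definition adjoint_op ::
  "('v, 'x) nspace_scheme \<Rightarrow> ('w, 'y) nspace_scheme \<Rightarrow> ('v \<Rightarrow> 'w) \<Rightarrow> ('w \<Rightarrow> complex) \<Rightarrow> ('v \<Rightarrow> complex)"
  where "adjoint_op V W T = (\<lambda>\<phi>\<in>vcar (dual W). \<lambda>x\<in>vcar V. \<phi> (T x))"


section \<open>Banach algebras, Banach left modules and injectivity\<close>

record 'a balgebra = "'a nspace" +
  amult :: "'a \<Rightarrow> 'a \<Rightarrow> 'a"

record ('a, 'v) lmodule = "'v nspace" +
  act :: "'a \<Rightarrow> 'v \<Rightarrow> 'v"

locale banach_algebra = complex_banach_space A for A :: "('a, 'x) balgebra_scheme" +
  assumes mult_closed: "\<lbrakk>a \<in> vcar A; b \<in> vcar A\<rbrakk> \<Longrightarrow> amult A a b \<in> vcar A"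
    and mult_assoc: "\<lbrakk>a \<in> vcar A; b \<in> vcar A; c \<in> vcar A\<rbrakk>
      \<Longrightarrow> amult A (amult A a b) c = amult A a (amult A b c)"
    and mult_add_left: "\<lbrakk>a \<in> vcar A; b \<in> vcar A; c \<in> vcar A\<rbrakk>
      \<Longrightarrow> amult A (vadd A a b) c = vadd A (amult A a c) (amult A b c)"
    and mult_add_right: "\<lbrakk>a \<in> vcar A; b \<in> vcar A; c \<in> vcar A\<rbrakk>
      \<Longrightarrow> amult A a (vadd A b c) = vadd A (amult A a b) (amult A a c)"
    and mult_scale_left: "\<lbrakk>a \<in> vcar A; b \<in> vcar A\<rbrakk>
      \<Longrightarrow> amult A (vscale A z a) b = vscale A z (amult A a b)"
    and mult_scale_right: "\<lbrakk>a \<in> vcar A; b \<in> vcar A\<rbrakk>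
      \<Longrightarrow> amult A a (vscale A z b) = vscale A z (amult A a b)"
    and norm_mult_le: "\<lbrakk>a \<in> vcar A; b \<in> vcar A\<rbrakk>
      \<Longrightarrow> vnorm A (amult A a b) \<le> vnorm A a * vnorm A b"

locale banach_left_module = A: banach_algebra A + M: complex_banach_space M
  for A :: "('a, 'x) balgebra_scheme" and M :: "('a, 'v, 'y) lmodule_scheme" +
  assumes act_closed: "\<lbrakk>a \<in> vcar A; x \<in> vcar M\<rbrakk> \<Longrightarrow> act M a x \<in> vcar M"
    and act_mult: "\<lbrakk>a \<in> vcar A; b \<in> vcar A; x \<in> vcar M\<rbrakk>
      \<Longrightarrow> act M (amult A a b) x = act M a (act M b x)"
    and act_add_left: "\<lbrakk>a \<in> vcar A; b \<in> vcar A; x \<in> vcar M\<rbrakk>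
      \<Longrightarrow> act M (vadd A a b) x = vadd M (act M a x) (act M b x)"
    and act_add_right: "\<lbrakk>a \<in> vcar A; x \<in> vcar M; y \<in> vcar M\<rbrakk>
      \<Longrightarrow> act M a (vadd M x y) = vadd M (act M a x) (act M a y)"
    and act_scale_left: "\<lbrakk>a \<in> vcar A; x \<in> vcar M\<rbrakk>
      \<Longrightarrow> act M (vscale A z a) x = vscale M z (act M a x)"
    and act_scale_right: "\<lbrakk>a \<in> vcar A; x \<in> vcar M\<rbrakk>
      \<Longrightarrow> act M a (vscale M z x) = vscale M z (act M a x)"
    and norm_act_le: "\<lbrakk>a \<in> vcar A; x \<in> vcar M\<rbrakk>
      \<Longrightarrow> vnorm M (act M a x) \<le> vnorm A a * vnorm M x"

definition module_morphism ::
  "('a, 'x) balgebra_scheme \<Rightarrow> ('a, 'v, 'y) lmodule_scheme \<Rightarrow> ('a, 'w, 'z) lmodule_scheme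
    \<Rightarrow> ('v \<Rightarrow> 'w) \<Rightarrow> bool" where
  "module_morphism A E F T \<longleftrightarrow>
     bounded_op E F T \<and> (\<forall>a\<in>vcar A. \<forall>x\<in>vcar E. T (act E a x) = act F a (T x))"

definition admissible_monomorphism ::
  "('a, 'x) balgebra_scheme \<Rightarrow> ('a, 'v, 'y) lmodule_scheme \<Rightarrow> ('a, 'w, 'z) lmodule_scheme
    \<Rightarrow> ('v \<Rightarrow> 'w) \<Rightarrow> bool" where
  "admissible_monomorphism A E F T \<longleftrightarrow>
     module_morphism A E F T \<and> inj_on T (vcar E) \<and>
     (\<exists>S. bounded_op F E S \<and> (\<forall>x\<in>vcar E. S (T x) = x))"

definition injective_wrt ::
  "'e itself \<Rightarrow> 'f itself \<Rightarrow> 'a balgebra \<Rightarrow> ('a, 'j) lmodule \<Rightarrow> bool" where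
  "injective_wrt _ _ A J \<longleftrightarrow>
     banach_left_module A J \<and>
     (\<forall>(E :: ('a, 'e) lmodule) (F :: ('a, 'f) lmodule) T S.
        banach_left_module A E \<and> banach_left_module A F \<and>
        admissible_monomorphism A E F T \<and> module_morphism A E J S \<longrightarrow>
        (\<exists>R. module_morphism A F J R \<and> (\<forall>x\<in>vcar E. R (T x) = S x)))"

text \<open>
  HOL cannot quantify over all types inside a definition, so the test modules \<open>E\<close> and \<open>F\<close> range over
  all Banach left \<open>A\<close>-modules whose elements come from one fixed type, chosen large enough to
  contain the operators from the unitization of \<open>A\<close> to \<open>J\<close>. This is no restriction: lemma
  \<open>injective_module_imp_injective_wrt\<close> below extends the property to \<open>E\<close> and \<open>F\<close> over arbitrary types.
\<close>

definition injective_module :: "'a balgebra \<Rightarrow> ('a, 'j) lmodule \<Rightarrow> bool" where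
  "injective_module A J \<longleftrightarrow>
     injective_wrt TYPE('a \<times> complex \<Rightarrow> 'j) TYPE('a \<times> complex \<Rightarrow> 'j) A J"


section \<open>The weak \<open>(p,q)\<close>-multi-norm\<close>

text \<open>An \<open>n\<close>-tuple is a function on \<^typ>\<open>nat\<close>, of which only the values at \<open>i < n\<close> matter.\<close>

definition weak_summing_norm ::
  "('v, 'x) nspace_scheme \<Rightarrow> real \<Rightarrow> nat \<Rightarrow> (nat \<Rightarrow> 'v) \<Rightarrow> real" where
  "weak_summing_norm V p n x =
     (SUP \<phi>\<in>{\<phi> \<in> vcar (dual V). vnorm (dual V) \<phi> \<le> 1}.
        (\<Sum>i<n. cmod (\<phi> (x i)) powr p) powr (1 / p))"

definition pq_multi_norm ::
  "('v, 'x) nspace_scheme \<Rightarrow> real \<Rightarrow> real \<Rightarrow> nat \<Rightarrow> (nat \<Rightarrow> 'v) \<Rightarrow> real" where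
  "pq_multi_norm V p q n x =
     (SUP \<phi>\<in>{\<phi>. (\<forall>i<n. \<phi> i \<in> vcar (dual V)) \<and> weak_summing_norm (dual V) p n \<phi> \<le> 1}.
        (\<Sum>i<n. cmod (\<phi> i (x i)) powr q) powr (1 / q))"


section \<open>Haar measure, Lebesgue spaces and convolution\<close>

text \<open>
  Groups are written additively, although \<^class>\<open>topological_group_add\<close> does not assume
  commutativity: \<open>s + t\<close>, \<open>- t\<close> and \<open>0\<close> stand for \<open>st\<close>, \<open>t\<close> inverse and the identity.
\<close>

definition left_haar_measure :: "'g::{topological_group_add, t2_space} measure \<Rightarrow> bool" where
  "left_haar_measure m \<longleftrightarrow>
     sets m = sets borel \<and>
     emeasure m UNIV \<noteq> 0 \<and>
     (\<forall>K. compact K \<longrightarrow> emeasure m K < \<infinity>) \<and>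
     (\<forall>A\<in>sets borel. emeasure m A = (INF U\<in>{U. open U \<and> A \<subseteq> U}. emeasure m U)) \<and>
     (\<forall>U. open U \<longrightarrow> emeasure m U = (SUP K\<in>{K. compact K \<and> K \<subseteq> U}. emeasure m K)) \<and>
     (\<forall>s. \<forall>A\<in>sets borel. emeasure m ((\<lambda>t. s + t) ` A) = emeasure m A)"

text \<open>Elements of \<open>L\<^sup>p\<close> are equivalence classes of functions modulo almost everywhere equality.\<close>

definition ae_class :: "'g measure \<Rightarrow> ('g \<Rightarrow> complex) \<Rightarrow> ('g \<Rightarrow> complex) set" where
  "ae_class m f = {g \<in> borel_measurable m. AE t in m. g t = f t}"

definition rep :: "('g \<Rightarrow> complex) set \<Rightarrow> 'g \<Rightarrow> complex" where
  "rep X = (SOME f. f \<in> X)"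

definition lp_space :: "'g measure \<Rightarrow> real \<Rightarrow> ('g \<Rightarrow> complex) set nspace" where
  "lp_space m p = \<lparr>
     vcar = ae_class m ` {f \<in> borel_measurable m. integrable m (\<lambda>t. cmod (f t) powr p)},
     vzero = ae_class m (\<lambda>t. 0),
     vadd = (\<lambda>X Y. ae_class m (\<lambda>t. rep X t + rep Y t)),
     vscale = (\<lambda>c X. ae_class m (\<lambda>t. c * rep X t)),
     vnorm = (\<lambda>X. (\<integral>t. cmod (rep X t) powr p \<partial>m) powr (1 / p))\<rparr>"

definition convolution ::
  "'g::group_add measure \<Rightarrow> ('g \<Rightarrow> complex) set \<Rightarrow> ('g \<Rightarrow> complex) set \<Rightarrow> ('g \<Rightarrow> complex) set" where
  "convolution m X Y = ae_class m (\<lambda>s. \<integral>t. rep X t * rep Y (- t + s) \<partial>m)"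

definition L1_algebra :: "'g::group_add measure \<Rightarrow> ('g \<Rightarrow> complex) set balgebra" where
  "L1_algebra m = nspace.extend (lp_space m 1) (balgebra.fields (convolution m))"

definition Lp_module ::
  "'g::group_add measure \<Rightarrow> real \<Rightarrow> (('g \<Rightarrow> complex) set, ('g \<Rightarrow> complex) set) lmodule" where
  "Lp_module m p = nspace.extend (lp_space m p) (lmodule.fields (convolution m))"


section \<open>\<open>(p,q)\<close>-amenability\<close>

definition L1_translate ::
  "'g::group_add measure \<Rightarrow> 'g \<Rightarrow> ('g \<Rightarrow> complex) set \<Rightarrow> ('g \<Rightarrow> complex) set" where
  "L1_translate m s X = ae_class m (\<lambda>t. rep X (- s + t))"

definition L1_bidual :: "'g measure \<Rightarrow> ((('g \<Rightarrow> complex) set \<Rightarrow> complex) \<Rightarrow> complex) nspace" where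
  "L1_bidual m = dual (dual (lp_space m 1))"

definition bidual_translate ::
  "'g::group_add measure \<Rightarrow> 'g \<Rightarrow> ((('g \<Rightarrow> complex) set \<Rightarrow> complex) \<Rightarrow> complex)
    \<Rightarrow> ((('g \<Rightarrow> complex) set \<Rightarrow> complex) \<Rightarrow> complex)" where
  "bidual_translate m s =
     adjoint_op (dual (lp_space m 1)) (dual (lp_space m 1))
       (adjoint_op (lp_space m 1) (lp_space m 1) (L1_translate m s))"

text \<open>The functional on \<open>L\<^sup>1(G)\<close> given by a bounded function \<open>h\<close>, i.e. \<open>L\<^sup>\<infinity>(G)\<close> as a dual space.\<close>

definition Linf_functional :: "'g measure \<Rightarrow> ('g \<Rightarrow> complex) \<Rightarrow> ('g \<Rightarrow> complex) set \<Rightarrow> complex" where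
  "Linf_functional m h = (\<lambda>X\<in>vcar (lp_space m 1). \<integral>t. rep X t * h t \<partial>m)"

definition is_mean :: "'g measure \<Rightarrow> ((('g \<Rightarrow> complex) set \<Rightarrow> complex) \<Rightarrow> complex) \<Rightarrow> bool" where
  "is_mean m \<Lambda> \<longleftrightarrow>
     \<Lambda> \<in> vcar (L1_bidual m) \<and> \<Lambda> (Linf_functional m (\<lambda>t. 1)) = 1 \<and> vnorm (L1_bidual m) \<Lambda> = 1"

definition left_pq_multi_invariant ::
  "'g::group_add measure \<Rightarrow> real \<Rightarrow> real \<Rightarrow> ((('g \<Rightarrow> complex) set \<Rightarrow> complex) \<Rightarrow> complex) \<Rightarrow> bool" where
  "left_pq_multi_invariant m p q \<Lambda> \<longleftrightarrow>
     bdd_above {pq_multi_norm (L1_bidual m) p q n (\<lambda>i. bidual_translate m (s i) \<Lambda>) |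
       (n::nat) (s :: nat \<Rightarrow> 'g). n \<ge> 1}"

definition pq_amenable :: "'g::group_add measure \<Rightarrow> real \<Rightarrow> real \<Rightarrow> bool" where
  "pq_amenable m p q \<longleftrightarrow> (\<exists>\<Lambda>. is_mean m \<Lambda> \<and> left_pq_multi_invariant m p q \<Lambda>)"


section \<open>Injectivity does not depend on the type that carries the test modules\<close>

context complex_normed_space
begin

lemma scale_0: "x \<in> vcar V \<Longrightarrow> vscale V 0 x = vzero V"
  using scale_add_left[of x 1 "-1"] add_neg[of x] scale_one[of x] by simp

lemma scale_vzero: "vscale V c (vzero V) = vzero V"
  using scale_scale[of "vzero V" c 0] scale_0[OF zero_closed] zero_closed by simp

lemma norm_vzero: "vnorm V (vzero V) = 0"
  using norm_zero_iff zero_closed by blast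

lemma zero_add: "x \<in> vcar V \<Longrightarrow> vadd V (vzero V) x = x"
  using add_commute add_zero zero_closed by metis

lemma add4: "\<lbrakk>a \<in> vcar V; b \<in> vcar V; c \<in> vcar V; d \<in> vcar V\<rbrakk>
   \<Longrightarrow> vadd V (vadd V a b) (vadd V c d) = vadd V (vadd V a c) (vadd V b d)"
  using add_assoc add_commute add_closed by (metis (no_types, lifting))

lemma vdiff_closed: "\<lbrakk>x \<in> vcar V; y \<in> vcar V\<rbrakk> \<Longrightarrow> vdiff V x y \<in> vcar V"
  unfolding vdiff_def using add_closed scale_closed by blast

lemma vdiff_self: "x \<in> vcar V \<Longrightarrow> vdiff V x x = vzero V"
  unfolding vdiff_def by (rule add_neg)

lemma vdiff_add_cancel: assumes "x \<in> vcar V" "y \<in> vcar V"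
  shows "vadd V (vdiff V x y) y = x"
proof -
  have "vadd V (vdiff V x y) y = vadd V x (vadd V (vscale V (-1) y) y)"
    unfolding vdiff_def using assms add_assoc scale_closed by blast
  also have "vadd V (vscale V (-1) y) y = vzero V"
    using add_neg add_commute assms scale_closed by metis
  finally show ?thesis using add_zero assms by simp
qed

lemma vdiff_trans: assumes "x \<in> vcar V" "y \<in> vcar V" "z \<in> vcar V"
  shows "vadd V (vdiff V x y) (vdiff V y z) = vdiff V x z"
proof -
  have "vadd V (vdiff V x y) (vdiff V y z)
      = vadd V (vadd V (vdiff V x y) y) (vscale V (-1) z)"
    using assms by (simp add: vdiff_def add_assoc add_closed scale_closed)
  then show ?thesis using vdiff_add_cancel assms by (simp add: vdiff_def)
qed

lemma vdiff_scale: "\<lbrakk>x \<in> vcar V; y \<in> vcar V\<rbrakk>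
    \<Longrightarrow> vdiff V (vscale V c x) (vscale V c y) = vscale V c (vdiff V x y)"
  unfolding vdiff_def using scale_add_right scale_scale scale_closed by (simp add: mult.commute)

lemma vdiff_add: "\<lbrakk>a \<in> vcar V; b \<in> vcar V; c \<in> vcar V; d \<in> vcar V\<rbrakk>
   \<Longrightarrow> vdiff V (vadd V a b) (vadd V c d) = vadd V (vdiff V a c) (vdiff V b d)"
  unfolding vdiff_def using add4 scale_add_right scale_closed by simp

lemma vdiff_swap: "\<lbrakk>x \<in> vcar V; y \<in> vcar V\<rbrakk> \<Longrightarrow> vscale V (-1) (vdiff V x y) = vdiff V y x"
  unfolding vdiff_def using add_commute scale_add_right scale_scale scale_closed scale_one by simp

lemma norm_vdiff_commute: "\<lbrakk>x \<in> vcar V; y \<in> vcar V\<rbrakk> \<Longrightarrow> vnorm V (vdiff V x y) = vnorm V (vdiff V y x)"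
  using vdiff_swap[of x y] norm_scale[of "vdiff V x y" "-1"] vdiff_closed by simp

lemma norm_vdiff_triangle: "\<lbrakk>x \<in> vcar V; y \<in> vcar V; z \<in> vcar V\<rbrakk>
   \<Longrightarrow> vnorm V (vdiff V x z) \<le> vnorm V (vdiff V x y) + vnorm V (vdiff V y z)"
  using norm_triangle[OF vdiff_closed vdiff_closed, of x y y z] vdiff_trans by simp

lemma vdiff_norm_zero: "\<lbrakk>x \<in> vcar V; y \<in> vcar V; vnorm V (vdiff V x y) = 0\<rbrakk> \<Longrightarrow> x = y"
  using norm_zero_iff vdiff_closed vdiff_add_cancel zero_add by metis

lemma norm_le_vdiff: "\<lbrakk>x \<in> vcar V; y \<in> vcar V\<rbrakk> \<Longrightarrow> vnorm V x \<le> vnorm V (vdiff V x y) + vnorm V y"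
  using norm_triangle[of "vdiff V x y" y] vdiff_add_cancel vdiff_closed by simp

definition conv_to :: "(nat \<Rightarrow> 'v) \<Rightarrow> 'v \<Rightarrow> bool" where
  "conv_to f l \<longleftrightarrow> (\<forall>n. f n \<in> vcar V) \<and> l \<in> vcar V \<and> (\<lambda>n. vnorm V (vdiff V (f n) l)) \<longlonglongrightarrow> 0"

lemma conv_to_unique: assumes "conv_to f l" "conv_to f k" shows "l = k"
proof -
  have c: "\<forall>n. f n \<in> vcar V" "l \<in> vcar V" "k \<in> vcar V"
    and L: "(\<lambda>n. vnorm V (vdiff V (f n) l)) \<longlonglongrightarrow> 0" "(\<lambda>n. vnorm V (vdiff V (f n) k)) \<longlonglongrightarrow> 0"
    using assms by (auto simp: conv_to_def)
  have "vnorm V (vdiff V l k) \<le> vnorm V (vdiff V (f n) l) + vnorm V (vdiff V (f n) k)" for n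
    using norm_vdiff_triangle[of l "f n" k] norm_vdiff_commute[of l "f n"] c by simp
  moreover have "(\<lambda>n. vnorm V (vdiff V (f n) l) + vnorm V (vdiff V (f n) k)) \<longlonglongrightarrow> 0"
    using tendsto_add[OF L] by simp
  ultimately have "vnorm V (vdiff V l k) \<le> 0" by (intro LIMSEQ_le_const) auto
  then have "vnorm V (vdiff V l k) = 0" using norm_nonneg vdiff_closed c by (simp add: order_antisym)
  then show ?thesis using vdiff_norm_zero c by blast
qed

lemma conv_to_add: assumes "conv_to f l" "conv_to g k"
  shows "conv_to (\<lambda>n. vadd V (f n) (g n)) (vadd V l k)"
proof -
  have c: "\<forall>n. f n \<in> vcar V" "l \<in> vcar V" "\<forall>n. g n \<in> vcar V" "k \<in> vcar V"
    and L: "(\<lambda>n. vnorm V (vdiff V (f n) l)) \<longlonglongrightarrow> 0" "(\<lambda>n. vnorm V (vdiff V (g n) k)) \<longlonglongrightarrow> 0"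
    using assms by (auto simp: conv_to_def)
  have le: "vnorm V (vdiff V (vadd V (f n) (g n)) (vadd V l k))
      \<le> vnorm V (vdiff V (f n) l) + vnorm V (vdiff V (g n) k)" for n
    using c norm_triangle[OF vdiff_closed vdiff_closed] by (simp add: vdiff_add)
  have ge: "0 \<le> vnorm V (vdiff V (vadd V (f n) (g n)) (vadd V l k))" for n
    using c by (intro norm_nonneg vdiff_closed add_closed) auto
  have "(\<lambda>n. vnorm V (vdiff V (vadd V (f n) (g n)) (vadd V l k))) \<longlonglongrightarrow> 0"
  proof (rule real_tendsto_sandwich[OF _ _ tendsto_const])
    show "(\<lambda>n. vnorm V (vdiff V (f n) l) + vnorm V (vdiff V (g n) k)) \<longlonglongrightarrow> 0"
      using tendsto_add[OF L] by simp
  qed (use ge le in auto)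
  then show ?thesis using c add_closed by (simp add: conv_to_def)
qed

lemma conv_to_scale: assumes "conv_to f l" shows "conv_to (\<lambda>n. vscale V c (f n)) (vscale V c l)"
proof -
  have c: "\<forall>n. f n \<in> vcar V" "l \<in> vcar V"
    and L: "(\<lambda>n. vnorm V (vdiff V (f n) l)) \<longlonglongrightarrow> 0"
    using assms by (auto simp: conv_to_def)
  have "(\<lambda>n. vnorm V (vdiff V (vscale V c (f n)) (vscale V c l))) = (\<lambda>n. cmod c * vnorm V (vdiff V (f n) l))"
    using c by (auto simp: vdiff_scale norm_scale vdiff_closed)
  then show ?thesis using c scale_closed tendsto_mult_right_zero[OF L, of "cmod c"] by (simp add: conv_to_def)
qed

lemma conv_to_const: "l \<in> vcar V \<Longrightarrow> conv_to (\<lambda>n. l) l"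
  by (simp add: conv_to_def vdiff_self norm_vzero)

lemma conv_to_norm_le: assumes "conv_to f l" "\<forall>n\<ge>N. vnorm V (f n) \<le> B" shows "vnorm V l \<le> B"
proof -
  have c: "\<forall>n. f n \<in> vcar V" "l \<in> vcar V"
    and L: "(\<lambda>n. vnorm V (vdiff V (f n) l)) \<longlonglongrightarrow> 0"
    using assms by (auto simp: conv_to_def)
  have "\<forall>n\<ge>N. vnorm V l \<le> vnorm V (vdiff V (f n) l) + B"
    using norm_le_vdiff[of l "f _"] norm_vdiff_commute[of l "f _"] c assms(2) by (smt (verit))
  moreover have "(\<lambda>n. vnorm V (vdiff V (f n) l) + B) \<longlonglongrightarrow> B"
    using tendsto_add[OF L tendsto_const[of B]] by simp
  ultimately show ?thesis by (intro LIMSEQ_le_const) auto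
qed

end

lemma bounded_opD:
  assumes "bounded_op V W T"
  shows "x \<in> vcar V \<Longrightarrow> T x \<in> vcar W"
    and "\<lbrakk>x \<in> vcar V; y \<in> vcar V\<rbrakk> \<Longrightarrow> T (vadd V x y) = vadd W (T x) (T y)"
    and "x \<in> vcar V \<Longrightarrow> T (vscale V c x) = vscale W c (T x)"
  using assms by (auto simp: bounded_op_def)

lemma bounded_op_bound:
  assumes "complex_normed_space V" "bounded_op V W T"
  obtains K where "K \<ge> 0" "\<And>x. x \<in> vcar V \<Longrightarrow> vnorm W (T x) \<le> K * vnorm V x"
proof -
  interpret V: complex_normed_space V by fact
  obtain K where K: "\<forall>x\<in>vcar V. vnorm W (T x) \<le> K * vnorm V x"
    using assms by (auto simp: bounded_op_def)
  have "vnorm W (T x) \<le> \<bar>K\<bar> * vnorm V x" if "x \<in> vcar V" for x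
    using K that V.norm_nonneg[OF that] mult_right_mono[of K "\<bar>K\<bar>" "vnorm V x"] by fastforce
  then show ?thesis using that[of "\<bar>K\<bar>"] by simp
qed

lemma bounded_op_comp:
  assumes "complex_normed_space V" "complex_normed_space W" "bounded_op V W T" "bounded_op W X S"
  shows "bounded_op V X (\<lambda>x. S (T x))"
proof -
  obtain K where K: "K \<ge> 0" "\<And>x. x \<in> vcar V \<Longrightarrow> vnorm W (T x) \<le> K * vnorm V x"
    using bounded_op_bound assms by metis
  obtain L where L: "L \<ge> 0" "\<And>x. x \<in> vcar W \<Longrightarrow> vnorm X (S x) \<le> L * vnorm W x"
    using bounded_op_bound assms by metis
  have "vnorm X (S (T x)) \<le> (L * K) * vnorm V x" if "x \<in> vcar V" for x
    using L(2)[OF bounded_opD(1)[OF assms(3) that]] mult_left_mono[OF K(2)[OF that] L(1)] by simp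
  then have "\<exists>C. \<forall>x\<in>vcar V. vnorm X (S (T x)) \<le> C * vnorm V x" by blast
  with bounded_opD[OF assms(3)] bounded_opD[OF assms(4)] show ?thesis
    unfolding bounded_op_def by simp
qed

lemma op_norm_eq: "vnorm (op_space V W) T = (SUP x\<in>{x \<in> vcar V. vnorm V x \<le> 1}. vnorm W (T x))"
  by (simp add: op_space_def)

lemma op_norm_bdd:
  assumes "complex_normed_space V" "bounded_op V W T"
  shows "bdd_above ((\<lambda>x. vnorm W (T x)) ` {x \<in> vcar V. vnorm V x \<le> 1})"
proof -
  obtain K where K: "K \<ge> 0" "\<And>x. x \<in> vcar V \<Longrightarrow> vnorm W (T x) \<le> K * vnorm V x"
    using bounded_op_bound[OF assms] by metis
  show ?thesis
  proof (rule bdd_aboveI2)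
    fix x assume x: "x \<in> {x \<in> vcar V. vnorm V x \<le> 1}"
    then have "K * vnorm V x \<le> K * 1" using K(1) by (intro mult_left_mono) auto
    then show "vnorm W (T x) \<le> K" using K(2)[of x] x by simp
  qed
qed

lemma op_norm_ge:
  assumes V: "complex_normed_space V" and W: "complex_normed_space W" and T: "bounded_op V W T"
    and x: "x \<in> vcar V"
  shows "vnorm W (T x) \<le> vnorm (op_space V W) T * vnorm V x"
proof -
  interpret V: complex_normed_space V by fact
  interpret W: complex_normed_space W by fact
  obtain K where K: "K \<ge> 0" "\<And>x. x \<in> vcar V \<Longrightarrow> vnorm W (T x) \<le> K * vnorm V x"
    using bounded_op_bound[OF V T] by metis
  show ?thesis
  proof (cases "vnorm V x = 0")
    case True
    then show ?thesis using K(2)[OF x] by simp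
  next
    case False
    then have pos: "vnorm V x > 0" using V.norm_nonneg[OF x] by simp
    define y where "y = vscale V (of_real (1 / vnorm V x)) x"
    have y: "y \<in> vcar V" unfolding y_def using V.scale_closed x by blast
    have ny: "vnorm V y = 1"
      unfolding y_def V.norm_scale[OF x] using pos by (simp del: of_real_divide)
    have Ty: "vnorm W (T y) = vnorm W (T x) / vnorm V x"
      unfolding y_def bounded_opD(3)[OF T x] W.norm_scale[OF bounded_opD(1)[OF T x]]
      using pos by (simp del: of_real_divide)
    have "vnorm W (T y) \<le> vnorm (op_space V W) T"
      unfolding op_norm_eq using y ny by (intro cSUP_upper op_norm_bdd[OF V T]) simp
    then show ?thesis unfolding Ty using pos by (simp add: divide_le_eq)
  qed
qed

lemma op_norm_le:
  assumes V: "complex_normed_space V"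
    and K: "K \<ge> 0" "\<And>x. x \<in> vcar V \<Longrightarrow> vnorm W (T x) \<le> K * vnorm V x"
  shows "vnorm (op_space V W) T \<le> K"
  unfolding op_norm_eq
proof (rule cSUP_least)
  interpret V: complex_normed_space V by fact
  show "{x \<in> vcar V. vnorm V x \<le> 1} \<noteq> {}"
    using V.zero_closed V.norm_vzero by (metis (mono_tags, lifting) empty_iff mem_Collect_eq zero_le_one)
  fix x assume x: "x \<in> {x \<in> vcar V. vnorm V x \<le> 1}"
  then have "K * vnorm V x \<le> K * 1" using K(1) by (intro mult_left_mono) auto
  then show "vnorm W (T x) \<le> K" using K(2)[of x] x by simp
qed

lemma op_norm_nonneg:
  assumes V: "complex_normed_space V" and W: "complex_normed_space W" and T: "bounded_op V W T"
  shows "0 \<le> vnorm (op_space V W) T"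
proof -
  interpret V: complex_normed_space V by fact
  interpret W: complex_normed_space W by fact
  have "vnorm W (T (vzero V)) \<le> vnorm (op_space V W) T"
    unfolding op_norm_eq using V.zero_closed V.norm_vzero by (intro cSUP_upper op_norm_bdd[OF V T]) simp
  moreover have "0 \<le> vnorm W (T (vzero V))"
    using W.norm_nonneg bounded_opD(1)[OF T V.zero_closed] by blast
  ultimately show ?thesis by simp
qed

lemma op_space_sel:
  "T \<in> vcar (op_space V W) \<longleftrightarrow> T \<in> extensional (vcar V) \<and> bounded_op V W T"
  "vzero (op_space V W) = (\<lambda>x\<in>vcar V. vzero W)"
  "vadd (op_space V W) S T = (\<lambda>x\<in>vcar V. vadd W (S x) (T x))"
  "vscale (op_space V W) c T = (\<lambda>x\<in>vcar V. vscale W c (T x))"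
  by (simp_all add: op_space_def)

lemma bounded_op_zero:
  assumes "complex_normed_space V" "complex_normed_space W"
  shows "bounded_op V W (\<lambda>x\<in>vcar V. vzero W)"
proof -
  interpret V: complex_normed_space V by fact
  interpret W: complex_normed_space W by fact
  have "\<forall>x\<in>vcar V. vnorm W ((\<lambda>x\<in>vcar V. vzero W) x) \<le> 0 * vnorm V x"
    by (simp add: W.norm_vzero)
  then have "\<exists>K. \<forall>x\<in>vcar V. vnorm W ((\<lambda>x\<in>vcar V. vzero W) x) \<le> K * vnorm V x" by blast
  then show ?thesis
    unfolding bounded_op_def
    by (simp add: V.add_closed V.scale_closed W.zero_closed W.add_zero W.scale_vzero)
qed

lemma bounded_op_add:
  assumes V: "complex_normed_space V" and W: "complex_normed_space W"
    and S: "bounded_op V W S" and T: "bounded_op V W T"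
  shows "bounded_op V W (\<lambda>x\<in>vcar V. vadd W (S x) (T x))"
proof -
  interpret V: complex_normed_space V by fact
  interpret W: complex_normed_space W by fact
  obtain K where K: "K \<ge> 0" "\<And>x. x \<in> vcar V \<Longrightarrow> vnorm W (S x) \<le> K * vnorm V x"
    using bounded_op_bound[OF V S] by metis
  obtain L where L: "L \<ge> 0" "\<And>x. x \<in> vcar V \<Longrightarrow> vnorm W (T x) \<le> L * vnorm V x"
    using bounded_op_bound[OF V T] by metis
  have "vnorm W (vadd W (S x) (T x)) \<le> (K + L) * vnorm V x" if x: "x \<in> vcar V" for x
    using K(2)[OF x] L(2)[OF x] W.norm_triangle[OF bounded_opD(1)[OF S x] bounded_opD(1)[OF T x]]
    by (simp add: distrib_right)
  then have "\<exists>K. \<forall>x\<in>vcar V. vnorm W (vadd W (S x) (T x)) \<le> K * vnorm V x" by blast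
  then show ?thesis
    unfolding bounded_op_def
    by (simp add: V.add_closed V.scale_closed W.add_closed W.add4 W.scale_add_right
        bounded_opD[OF S] bounded_opD[OF T])
qed

lemma bounded_op_scale:
  assumes V: "complex_normed_space V" and W: "complex_normed_space W"
    and T: "bounded_op V W T"
  shows "bounded_op V W (\<lambda>x\<in>vcar V. vscale W c (T x))"
proof -
  interpret V: complex_normed_space V by fact
  interpret W: complex_normed_space W by fact
  obtain L where L: "L \<ge> 0" "\<And>x. x \<in> vcar V \<Longrightarrow> vnorm W (T x) \<le> L * vnorm V x"
    using bounded_op_bound[OF V T] by metis
  have "vnorm W (vscale W c (T x)) \<le> (cmod c * L) * vnorm V x" if x: "x \<in> vcar V" for x
    using mult_left_mono[OF L(2)[OF x], of "cmod c"] by (simp add: W.norm_scale bounded_opD(1)[OF T x])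
  then have "\<exists>K. \<forall>x\<in>vcar V. vnorm W (vscale W c (T x)) \<le> K * vnorm V x" by blast
  then show ?thesis
    unfolding bounded_op_def
    by (simp add: V.add_closed V.scale_closed W.scale_closed W.scale_add_right W.scale_scale mult.commute
        bounded_opD[OF T])
qed

lemma op_space_normed:
  assumes V: "complex_normed_space V" and W: "complex_normed_space W"
  shows "complex_normed_space (op_space V W)"
proof -
  interpret V: complex_normed_space V by fact
  interpret W: complex_normed_space W by fact
  note D = bounded_opD(1)
  show ?thesis
  proof
    show "vzero (op_space V W) \<in> vcar (op_space V W)"
      using bounded_op_zero[OF V W] by (simp add: op_space_sel)
  next
    fix S T assume "S \<in> vcar (op_space V W)" "T \<in> vcar (op_space V W)"
    then have S: "bounded_op V W S" and T: "bounded_op V W T" by (simp_all add: op_space_sel)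
    show "vadd (op_space V W) S T \<in> vcar (op_space V W)"
      using bounded_op_add[OF V W S T] by (simp add: op_space_sel)
    show "vadd (op_space V W) S T = vadd (op_space V W) T S"
      using W.add_commute D[OF S] D[OF T] by (auto simp: op_space_sel restrict_def)
    show "vscale (op_space V W) c (vadd (op_space V W) S T)
        = vadd (op_space V W) (vscale (op_space V W) c S) (vscale (op_space V W) c T)" for c
      by (auto simp: op_space_sel restrict_def W.scale_add_right D[OF S] D[OF T])
    show "vnorm (op_space V W) (vadd (op_space V W) S T) \<le> vnorm (op_space V W) S + vnorm (op_space V W) T"
    proof (rule op_norm_le[OF V])
      show "0 \<le> vnorm (op_space V W) S + vnorm (op_space V W) T"
        using op_norm_nonneg[OF V W] S T by simp
      fix x assume x: "x \<in> vcar V"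
      have "vnorm W (vadd W (S x) (T x)) \<le> vnorm W (S x) + vnorm W (T x)"
        using W.norm_triangle D[OF S x] D[OF T x] by blast
      then show "vnorm W (vadd (op_space V W) S T x)
          \<le> (vnorm (op_space V W) S + vnorm (op_space V W) T) * vnorm V x"
        using op_norm_ge[OF V W S x] op_norm_ge[OF V W T x] x
        by (simp add: op_space_sel distrib_right)
    qed
  next
    fix S T U assume "S \<in> vcar (op_space V W)" "T \<in> vcar (op_space V W)" "U \<in> vcar (op_space V W)"
    then have S: "bounded_op V W S" and T: "bounded_op V W T" and U: "bounded_op V W U"
      by (simp_all add: op_space_sel)
    show "vadd (op_space V W) (vadd (op_space V W) S T) U
        = vadd (op_space V W) S (vadd (op_space V W) T U)"
      by (auto simp: op_space_sel restrict_def W.add_assoc D[OF S] D[OF T] D[OF U])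
  next
    fix T assume "T \<in> vcar (op_space V W)"
    then have T: "bounded_op V W T" and ext: "T \<in> extensional (vcar V)" by (simp_all add: op_space_sel)
    have ext': "T = (\<lambda>x\<in>vcar V. T x)" using ext by (simp add: extensional_restrict)
    show sc: "vscale (op_space V W) c T \<in> vcar (op_space V W)" for c
      using bounded_op_scale[OF V W T] by (simp add: op_space_sel)
    show "vadd (op_space V W) T (vzero (op_space V W)) = T"
      by (subst (2) ext') (auto simp: op_space_sel restrict_def W.add_zero D[OF T])
    show "vadd (op_space V W) T (vscale (op_space V W) (-1) T) = vzero (op_space V W)"
      by (auto simp: op_space_sel restrict_def W.add_neg D[OF T])
    show "vscale (op_space V W) 1 T = T"
      by (subst (2) ext') (auto simp: op_space_sel restrict_def W.scale_one D[OF T])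
    show "vscale (op_space V W) c (vscale (op_space V W) d T) = vscale (op_space V W) (c * d) T" for c d
      by (auto simp: op_space_sel restrict_def W.scale_scale D[OF T])
    show "vscale (op_space V W) (c + d) T
        = vadd (op_space V W) (vscale (op_space V W) c T) (vscale (op_space V W) d T)" for c d
      by (auto simp: op_space_sel restrict_def W.scale_add_left D[OF T])
    show "0 \<le> vnorm (op_space V W) T" by (rule op_norm_nonneg[OF V W T])
    show "vnorm (op_space V W) T = 0 \<longleftrightarrow> T = vzero (op_space V W)"
    proof
      assume 0: "vnorm (op_space V W) T = 0"
      have "T x = vzero W" if x: "x \<in> vcar V" for x
        using op_norm_ge[OF V W T x] 0 W.norm_nonneg[OF D[OF T x]] W.norm_zero_iff[OF D[OF T x]] by simp
      then show "T = vzero (op_space V W)"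
        by (subst ext') (auto simp: op_space_sel restrict_def)
    next
      assume "T = vzero (op_space V W)"
      then have "\<And>x. x \<in> vcar V \<Longrightarrow> vnorm W (T x) \<le> 0 * vnorm V x"
        by (simp add: op_space_sel W.norm_vzero)
      then have "vnorm (op_space V W) T \<le> 0" by (intro op_norm_le[OF V]) auto
      then show "vnorm (op_space V W) T = 0" using op_norm_nonneg[OF V W T] by simp
    qed
    have le: "vnorm (op_space V W) (vscale (op_space V W) c S) \<le> cmod c * vnorm (op_space V W) S"
      if S: "bounded_op V W S" for c S
    proof (rule op_norm_le[OF V])
      show "0 \<le> cmod c * vnorm (op_space V W) S" using op_norm_nonneg[OF V W S] by simp
      fix x assume x: "x \<in> vcar V"
      show "vnorm W (vscale (op_space V W) c S x) \<le> cmod c * vnorm (op_space V W) S * vnorm V x"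
        using mult_left_mono[OF op_norm_ge[OF V W S x], of "cmod c"] x
        by (simp add: op_space_sel W.norm_scale D[OF S x])
    qed
    show "vnorm (op_space V W) (vscale (op_space V W) c T) = cmod c * vnorm (op_space V W) T" for c
    proof (cases "c = 0")
      case True
      then show ?thesis using le[OF T, of c] op_norm_nonneg[OF V W] sc[of c] by (simp add: op_space_sel order_antisym)
    next
      case False
      have "vscale (op_space V W) (inverse c) (vscale (op_space V W) c T) = T"
        by (subst (2) ext') (use False in \<open>auto simp: op_space_sel restrict_def W.scale_scale W.scale_one D[OF T]\<close>)
      then have "vnorm (op_space V W) T \<le> cmod (inverse c) * vnorm (op_space V W) (vscale (op_space V W) c T)"
        using le[of "vscale (op_space V W) c T" "inverse c"] sc[of c] by (simp add: op_space_sel)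
      then have "cmod c * vnorm (op_space V W) T
          \<le> cmod c * (cmod (inverse c) * vnorm (op_space V W) (vscale (op_space V W) c T))"
        by (rule mult_left_mono) simp
      also have "\<dots> = vnorm (op_space V W) (vscale (op_space V W) c T)"
        unfolding mult.assoc[symmetric] norm_mult[symmetric] using False by simp
      finally have "cmod c * vnorm (op_space V W) T \<le> vnorm (op_space V W) (vscale (op_space V W) c T)" .
      then show ?thesis using le[OF T, of c] by simp
    qed
  qed
qed

lemma op_space_vdiff:
  assumes "x \<in> vcar V" shows "vdiff (op_space V W) S T x = vdiff W (S x) (T x)"
  using assms by (simp add: vdiff_def op_space_sel)

lemma op_space_banach:
  assumes V: "complex_normed_space V" and W: "complex_banach_space W"
  shows "complex_banach_space (op_space V W)"
proof -
  interpret V: complex_normed_space V by fact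
  interpret W: complex_banach_space W by fact
  have W': "complex_normed_space W" by unfold_locales
  interpret O: complex_normed_space "op_space V W" by (rule op_space_normed[OF V W'])
  show ?thesis
  proof
    fix \<sigma> assume \<sigma>: "\<And>n::nat. \<sigma> n \<in> vcar (op_space V W)"
      and cau: "\<And>e. e > 0 \<Longrightarrow> \<exists>N. \<forall>k\<ge>N. \<forall>l\<ge>N. vnorm (op_space V W) (vdiff (op_space V W) (\<sigma> k) (\<sigma> l)) < e"
    have b: "bounded_op V W (\<sigma> n)" for n using \<sigma> by (simp add: op_space_sel)
    have bd: "bounded_op V W (vdiff (op_space V W) (\<sigma> k) (\<sigma> l))" for k l
      using O.vdiff_closed[OF \<sigma> \<sigma>] by (simp add: op_space_sel)
    have pt: "vnorm W (vdiff W (\<sigma> k x) (\<sigma> l x)) \<le> vnorm (op_space V W) (vdiff (op_space V W) (\<sigma> k) (\<sigma> l)) * vnorm V x"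
      if "x \<in> vcar V" for k l x
      using op_norm_ge[OF V W' bd that] op_space_vdiff[OF that] by metis
    have "\<exists>y. W.conv_to (\<lambda>n. \<sigma> n x) y" if x: "x \<in> vcar V" for x
    proof -
      have "\<exists>y\<in>vcar W. (\<lambda>n. vnorm W (vdiff W (\<sigma> n x) y)) \<longlonglongrightarrow> 0"
      proof (rule W.complete)
        show "\<sigma> n x \<in> vcar W" for n using bounded_opD(1)[OF b x] .
        fix e :: real assume e: "e > 0"
        have nx: "vnorm V x \<ge> 0" using V.norm_nonneg x by blast
        obtain N where N: "\<forall>k\<ge>N. \<forall>l\<ge>N. vnorm (op_space V W) (vdiff (op_space V W) (\<sigma> k) (\<sigma> l)) < e / (vnorm V x + 1)"
          using cau[of "e / (vnorm V x + 1)"] e nx by auto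
        have "vnorm W (vdiff W (\<sigma> k x) (\<sigma> l x)) < e" if "k \<ge> N" "l \<ge> N" for k l
        proof -
          have "vnorm W (vdiff W (\<sigma> k x) (\<sigma> l x)) \<le> e / (vnorm V x + 1) * vnorm V x"
            using pt[OF x, of k l] N that nx
            by (meson less_imp_le mult_right_mono order_trans)
          also have "\<dots> < e" using e nx by (simp add: field_simps)
          finally show ?thesis .
        qed
        then show "\<exists>N. \<forall>k\<ge>N. \<forall>l\<ge>N. vnorm W (vdiff W (\<sigma> k x) (\<sigma> l x)) < e" by blast
      qed
      then show ?thesis using bounded_opD(1)[OF b x] by (auto simp: W.conv_to_def)
    qed
    then obtain L0 where L0: "\<And>x. x \<in> vcar V \<Longrightarrow> W.conv_to (\<lambda>n. \<sigma> n x) (L0 x)" by metis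
    define L where "L = (\<lambda>x\<in>vcar V. L0 x)"
    have L: "W.conv_to (\<lambda>n. \<sigma> n x) (L x)" if "x \<in> vcar V" for x using L0 that by (simp add: L_def)
    have Lc: "L x \<in> vcar W" if "x \<in> vcar V" for x using L[OF that] by (simp add: W.conv_to_def)
    have lim: "vnorm W (vdiff W (L x) (\<sigma> l x)) \<le> e * vnorm V x"
      if N: "\<forall>k\<ge>N. \<forall>l\<ge>N. vnorm (op_space V W) (vdiff (op_space V W) (\<sigma> k) (\<sigma> l)) < e"
        and l: "l \<ge> N" and x: "x \<in> vcar V" for N e l x
    proof (rule W.conv_to_norm_le[where N = N])
      show "W.conv_to (\<lambda>k. vdiff W (\<sigma> k x) (\<sigma> l x)) (vdiff W (L x) (\<sigma> l x))"
        unfolding vdiff_def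
        by (intro W.conv_to_add L x W.conv_to_const W.scale_closed bounded_opD(1)[OF b x])
      show "\<forall>k\<ge>N. vnorm W (vdiff W (\<sigma> k x) (\<sigma> l x)) \<le> e * vnorm V x"
        using pt[OF x] N l V.norm_nonneg[OF x] by (meson less_imp_le mult_right_mono order_trans)
    qed
    have Lb: "bounded_op V W L"
      unfolding bounded_op_def
    proof (intro conjI ballI allI)
      show "L x \<in> vcar W" if "x \<in> vcar V" for x using Lc that .
      show "L (vadd V x y) = vadd W (L x) (L y)" if x: "x \<in> vcar V" and y: "y \<in> vcar V" for x y
        by (rule W.conv_to_unique[OF L[OF V.add_closed[OF x y], unfolded bounded_opD(2)[OF b x y]]
              W.conv_to_add[OF L[OF x] L[OF y]]])
      show "L (vscale V c x) = vscale W c (L x)" if x: "x \<in> vcar V" for c x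
        by (rule W.conv_to_unique[OF L[OF V.scale_closed[OF x], unfolded bounded_opD(3)[OF b x]]
              W.conv_to_scale[OF L[OF x]]])
      obtain N where N: "\<forall>k\<ge>N. \<forall>l\<ge>N. vnorm (op_space V W) (vdiff (op_space V W) (\<sigma> k) (\<sigma> l)) < 1"
        using cau[of 1] by auto
      obtain K where K: "K \<ge> 0" "\<And>x. x \<in> vcar V \<Longrightarrow> vnorm W (\<sigma> N x) \<le> K * vnorm V x"
        using bounded_op_bound[OF V b] by metis
      have "vnorm W (L x) \<le> (1 + K) * vnorm V x" if x: "x \<in> vcar V" for x
        using W.norm_le_vdiff[OF Lc[OF x] bounded_opD(1)[OF b x], of N] K(2)[OF x] lim[OF N order_refl x]
        by (simp add: distrib_right)
      then show "\<exists>K. \<forall>x\<in>vcar V. vnorm W (L x) \<le> K * vnorm V x" by blast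
    qed
    have LO: "L \<in> vcar (op_space V W)" using Lb by (simp add: op_space_sel L_def)
    show "\<exists>x\<in>vcar (op_space V W). (\<lambda>n. vnorm (op_space V W) (vdiff (op_space V W) (\<sigma> n) x)) \<longlonglongrightarrow> 0"
    proof (rule bexI[OF _ LO], rule LIMSEQ_I)
      fix r :: real assume r: "r > 0"
      obtain N where N: "\<forall>k\<ge>N. \<forall>l\<ge>N. vnorm (op_space V W) (vdiff (op_space V W) (\<sigma> k) (\<sigma> l)) < r / 2"
        using cau[of "r / 2"] r by auto
      have "norm (vnorm (op_space V W) (vdiff (op_space V W) (\<sigma> n) L) - 0) < r" if n: "n \<ge> N" for n
      proof -
        have "vnorm (op_space V W) (vdiff (op_space V W) (\<sigma> n) L) \<le> r / 2"
        proof (rule op_norm_le[OF V])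
          fix x assume x: "x \<in> vcar V"
          show "vnorm W (vdiff (op_space V W) (\<sigma> n) L x) \<le> r / 2 * vnorm V x"
            unfolding op_space_vdiff[OF x]
            using lim[OF N n x] W.norm_vdiff_commute[OF Lc[OF x] bounded_opD(1)[OF b x], of n] by simp
        qed (use r in simp)
        then show ?thesis using O.norm_nonneg[OF O.vdiff_closed[OF \<sigma> LO]] r by simp
      qed
      then show "\<exists>N. \<forall>n\<ge>N. norm (vnorm (op_space V W) (vdiff (op_space V W) (\<sigma> n) L) - 0) < r" by blast
    qed
  qed
qed

definition unitization_space :: "'a balgebra \<Rightarrow> ('a \<times> complex) nspace" where
  "unitization_space A = \<lparr>
     vcar = vcar A \<times> UNIV,
     vzero = (vzero A, 0),
     vadd = (\<lambda>(a, z) (b, w). (vadd A a b, z + w)),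
     vscale = (\<lambda>c (a, z). (vscale A c a, c * z)),
     vnorm = (\<lambda>(a, z). vnorm A a + cmod z)\<rparr>"

lemma unitization_space_normed:
  assumes "complex_normed_space A" shows "complex_normed_space (unitization_space A)"
proof -
  interpret A: complex_normed_space A by fact
  show ?thesis
  proof (unfold_locales, goal_cases)
    case (13 x)
    then show ?case
      using A.norm_nonneg A.norm_zero_iff
      by (auto simp: unitization_space_def add_nonneg_eq_0_iff)
  next
    case (14 x y)
    have "cmod (snd x + snd y) \<le> cmod (snd x) + cmod (snd y)" by (rule norm_triangle_ineq)
    moreover have "vnorm A (vadd A (fst x) (fst y)) \<le> vnorm A (fst x) + vnorm A (fst y)"
      using A.norm_triangle 14 by (auto simp: unitization_space_def)
    ultimately show ?case by (cases x; cases y) (simp add: unitization_space_def)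
  qed (auto simp: unitization_space_def A.zero_closed A.add_closed A.scale_closed A.add_assoc A.add_zero
      A.add_neg A.scale_one A.scale_scale A.scale_add_right A.scale_add_left A.norm_nonneg A.norm_scale
      norm_mult algebra_simps intro: A.add_commute)
qed

definition coinduced_module :: "'a balgebra \<Rightarrow> ('a, 'j) lmodule \<Rightarrow> ('a, 'a \<times> complex \<Rightarrow> 'j) lmodule" where
  "coinduced_module A J = nspace.extend (op_space (unitization_space A) J)
     (lmodule.fields (\<lambda>b \<phi>. \<lambda>x\<in>vcar (unitization_space A).
        \<phi> (vadd A (amult A (fst x) b) (vscale A (snd x) b), 0)))"

text \<open>A copy of \<open>J\<close> carried by constant functions.\<close>

definition const_module :: "('a, 'j) lmodule \<Rightarrow> ('a, 'k \<Rightarrow> 'j) lmodule" where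
  "const_module J = \<lparr>
     vcar = (\<lambda>x _. x) ` vcar J,
     vzero = (\<lambda>_. vzero J),
     vadd = (\<lambda>f g _. vadd J (f undefined) (g undefined)),
     vscale = (\<lambda>c f _. vscale J c (f undefined)),
     vnorm = (\<lambda>f. vnorm J (f undefined)),
     act = (\<lambda>a f _. act J a (f undefined))\<rparr>"

lemma const_module_banach:
  assumes "banach_left_module A J"
  shows "banach_left_module A (const_module J :: ('a, 'k \<Rightarrow> 'j) lmodule)"
proof -
  interpret J: banach_left_module A J by fact
  let ?C = "const_module J :: ('a, 'k \<Rightarrow> 'j) lmodule"
  have n: "complex_normed_space ?C"
    by unfold_locales
      (auto simp: const_module_def J.M.zero_closed J.M.add_closed J.M.scale_closed J.M.add_assoc J.M.add_zero
        J.M.add_neg J.M.scale_one J.M.scale_scale J.M.scale_add_right J.M.scale_add_left J.M.norm_nonneg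
        J.M.norm_scale J.M.norm_zero_iff J.M.norm_triangle fun_eq_iff intro: J.M.add_commute)
  interpret C: complex_normed_space ?C by fact
  have b: "complex_banach_space ?C"
  proof
    fix \<sigma> assume \<sigma>: "\<And>n::nat. \<sigma> n \<in> vcar ?C"
      and cau: "\<And>e. e > 0 \<Longrightarrow> \<exists>N. \<forall>k\<ge>N. \<forall>l\<ge>N. vnorm ?C (vdiff ?C (\<sigma> k) (\<sigma> l)) < e"
    have d: "vnorm ?C (vdiff ?C f g) = vnorm J (vdiff J (f undefined) (g undefined))" for f g
      by (simp add: const_module_def vdiff_def)
    have "\<exists>x\<in>vcar J. (\<lambda>n. vnorm J (vdiff J (\<sigma> n undefined) x)) \<longlonglongrightarrow> 0"
    proof (rule J.M.complete)
      show "\<sigma> n undefined \<in> vcar J" for n using \<sigma>[of n] by (auto simp: const_module_def)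
    qed (use cau in \<open>simp add: d\<close>)
    then obtain x where x: "x \<in> vcar J" "(\<lambda>n. vnorm J (vdiff J (\<sigma> n undefined) x)) \<longlonglongrightarrow> 0" by blast
    show "\<exists>x\<in>vcar ?C. (\<lambda>n. vnorm ?C (vdiff ?C (\<sigma> n) x)) \<longlonglongrightarrow> 0"
      by (rule bexI[of _ "\<lambda>_. x"], unfold d) (use x in \<open>simp_all add: const_module_def\<close>)
  qed
  interpret C: complex_banach_space ?C by fact
  show ?thesis
    by unfold_locales
      (auto simp: const_module_def J.act_closed J.act_mult J.act_add_left J.act_add_right
        J.act_scale_left J.act_scale_right J.norm_act_le)
qed

lemma nspace_extend_sel [simp]:
  "vcar (nspace.extend V e) = vcar V" "vzero (nspace.extend V e) = vzero V"
  "vadd (nspace.extend V e) = vadd V" "vscale (nspace.extend V e) = vscale V"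
  "vnorm (nspace.extend V e) = vnorm V"
  by (simp_all add: nspace.extend_def)

lemma lmodule_extend_sel [simp]: "act (nspace.extend V (lmodule.fields f)) = f"
  by (simp add: nspace.extend_def lmodule.fields_def)

lemma complex_banach_space_extend:
  "complex_banach_space (nspace.extend V e) \<longleftrightarrow> complex_banach_space V"
  by (simp add: complex_banach_space_def complex_banach_space_axioms_def complex_normed_space_def vdiff_def)

lemma bounded_op_extend:
  "bounded_op V (nspace.extend W e) = bounded_op V W"
  by (simp add: bounded_op_def fun_eq_iff)

lemma bounded_op_extend':
  "bounded_op (nspace.extend V e) W = bounded_op V W"
  by (simp add: bounded_op_def fun_eq_iff)

lemma bounded_op_restrict:
  assumes "complex_normed_space V" shows "bounded_op V W (restrict T (vcar V)) \<longleftrightarrow> bounded_op V W T"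
proof -
  interpret V: complex_normed_space V by fact
  show ?thesis by (simp add: bounded_op_def V.add_closed V.scale_closed)
qed

definition unit_act :: "('a, 'v) lmodule \<Rightarrow> 'a \<times> complex \<Rightarrow> 'v \<Rightarrow> 'v" where
  "unit_act M u y = vadd M (act M (fst u) y) (vscale M (snd u) y)"

context
  fixes A :: "'a balgebra"
  assumes A: "banach_algebra A"
begin

interpretation A: banach_algebra A by (rule A)

interpretation U: complex_normed_space "unitization_space A"
  by (rule unitization_space_normed) unfold_locales

definition unit_rmult :: "'a \<Rightarrow> 'a \<times> complex \<Rightarrow> 'a \<times> complex" where
  "unit_rmult b u = (vadd A (amult A (fst u) b) (vscale A (snd u) b), 0)"

lemma unit_rmult_bound:
  assumes "b \<in> vcar A" "u \<in> vcar (unitization_space A)"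
  shows "vnorm (unitization_space A) (unit_rmult b u) \<le> vnorm A b * vnorm (unitization_space A) u"
proof -
  obtain a z where u: "u = (a, z)" "a \<in> vcar A" using assms by (auto simp: unitization_space_def)
  have "vnorm A (vadd A (amult A a b) (vscale A z b)) \<le> vnorm A (amult A a b) + vnorm A (vscale A z b)"
    using u assms by (intro A.norm_triangle A.mult_closed A.scale_closed)
  also have "\<dots> \<le> vnorm A a * vnorm A b + cmod z * vnorm A b"
    using A.norm_mult_le[of a b] A.norm_scale[of b z] u assms by simp
  finally show ?thesis using u by (simp add: unit_rmult_def unitization_space_def algebra_simps)
qed

lemma unit_rmult_closed:
  assumes "b \<in> vcar A" "u \<in> vcar (unitization_space A)"
  shows "unit_rmult b u \<in> vcar (unitization_space A)"
  using assms by (auto simp: unit_rmult_def unitization_space_def A.add_closed A.mult_closed A.scale_closed)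

lemma unit_rmult_bounded:
  assumes b: "b \<in> vcar A"
  shows "bounded_op (unitization_space A) (unitization_space A) (unit_rmult b)"
  unfolding bounded_op_def
proof (intro conjI ballI allI)
  show "\<exists>K. \<forall>u\<in>vcar (unitization_space A).
      vnorm (unitization_space A) (unit_rmult b u) \<le> K * vnorm (unitization_space A) u"
    using unit_rmult_bound[OF b] by blast
  show "unit_rmult b u \<in> vcar (unitization_space A)" if "u \<in> vcar (unitization_space A)" for u
    using unit_rmult_closed b that by blast
  show "unit_rmult b (vadd (unitization_space A) u v)
      = vadd (unitization_space A) (unit_rmult b u) (unit_rmult b v)"
    if "u \<in> vcar (unitization_space A)" "v \<in> vcar (unitization_space A)" for u v
    using that b by (auto simp: unit_rmult_def unitization_space_def A.mult_add_left A.scale_add_left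
        intro!: A.add4 A.mult_closed A.scale_closed)
  show "unit_rmult b (vscale (unitization_space A) c u) = vscale (unitization_space A) c (unit_rmult b u)"
    if "u \<in> vcar (unitization_space A)" for c u
    using that b by (auto simp: unit_rmult_def unitization_space_def A.mult_scale_left A.scale_scale
        A.scale_add_right A.mult_closed A.scale_closed)
qed

lemma unit_rmult_mult:
  assumes "b \<in> vcar A" "c \<in> vcar A" "u \<in> vcar (unitization_space A)"
  shows "unit_rmult (amult A b c) u = unit_rmult c (unit_rmult b u)"
  using assms by (auto simp: unit_rmult_def unitization_space_def A.mult_add_left A.mult_assoc
      A.mult_scale_left A.scale_0 A.add_zero A.add_closed A.mult_closed A.scale_closed)

lemma unit_rmult_add:
  assumes "b \<in> vcar A" "c \<in> vcar A" "u \<in> vcar (unitization_space A)"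
  shows "unit_rmult (vadd A b c) u = vadd (unitization_space A) (unit_rmult b u) (unit_rmult c u)"
  using assms by (auto simp: unit_rmult_def unitization_space_def A.mult_add_right A.scale_add_right
      intro!: A.add4 A.mult_closed A.scale_closed)

lemma unit_rmult_scale:
  assumes "b \<in> vcar A" "u \<in> vcar (unitization_space A)"
  shows "unit_rmult (vscale A z b) u = vscale (unitization_space A) z (unit_rmult b u)"
  using assms by (auto simp: unit_rmult_def unitization_space_def A.mult_scale_right A.scale_add_right
      A.scale_scale A.mult_closed A.scale_closed mult.commute)

lemma coinduced_module_banach:
  fixes J :: "('a, 'j) lmodule"
  assumes J: "banach_left_module A J"
  shows "banach_left_module A (coinduced_module A J)"
proof -
  interpret J: banach_left_module A J by (rule J)
  have nJ: "complex_normed_space J" by unfold_locales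
  have nU: "complex_normed_space (unitization_space A)" by unfold_locales
  let ?U = "unitization_space A" and ?O = "op_space (unitization_space A) J"
  have act: "act (coinduced_module A J) b \<phi> = (\<lambda>u\<in>vcar ?U. \<phi> (unit_rmult b u))" for b \<phi>
    by (simp add: coinduced_module_def unit_rmult_def)
  have sel: "vcar (coinduced_module A J) = vcar ?O" "vadd (coinduced_module A J) = vadd ?O"
    "vscale (coinduced_module A J) = vscale ?O" "vnorm (coinduced_module A J) = vnorm ?O"
    by (simp_all add: coinduced_module_def)
  have "complex_banach_space ?O" by (rule op_space_banach[OF nU]) unfold_locales
  then have "complex_banach_space (coinduced_module A J)"
    by (simp add: coinduced_module_def complex_banach_space_extend)
  then interpret C: complex_banach_space "coinduced_module A J" .
  note rc = unit_rmult_closed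
  show ?thesis
  proof (unfold_locales, unfold act sel)
    fix b \<phi> assume b: "b \<in> vcar A" and "\<phi> \<in> vcar ?O"
    then have \<phi>: "bounded_op ?U J \<phi>" by (simp add: op_space_sel)
    show "(\<lambda>u\<in>vcar ?U. \<phi> (unit_rmult b u)) \<in> vcar ?O"
      using bounded_op_comp[OF nU nU unit_rmult_bounded[OF b] \<phi>]
      by (simp add: op_space_sel bounded_op_restrict[OF nU])
    show "(\<lambda>u\<in>vcar ?U. \<phi> (unit_rmult (vscale A z b) u))
        = vscale ?O z (\<lambda>u\<in>vcar ?U. \<phi> (unit_rmult b u))" for z
      by (auto simp: op_space_sel unit_rmult_scale[OF b] bounded_opD(3)[OF \<phi>] rc[OF b])
    show "(\<lambda>u\<in>vcar ?U. vscale ?O z \<phi> (unit_rmult b u))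
        = vscale ?O z (\<lambda>u\<in>vcar ?U. \<phi> (unit_rmult b u))" for z
      by (auto simp: op_space_sel rc[OF b])
    show "vnorm ?O (\<lambda>u\<in>vcar ?U. \<phi> (unit_rmult b u)) \<le> vnorm A b * vnorm ?O \<phi>"
    proof (rule op_norm_le[OF nU])
      have p: "0 \<le> vnorm ?O \<phi>" by (rule op_norm_nonneg[OF nU nJ \<phi>])
      then show "0 \<le> vnorm A b * vnorm ?O \<phi>" using A.norm_nonneg[OF b] by simp
      fix u assume u: "u \<in> vcar ?U"
      have "vnorm J (\<phi> (unit_rmult b u)) \<le> vnorm ?O \<phi> * vnorm ?U (unit_rmult b u)"
        by (rule op_norm_ge[OF nU nJ \<phi> rc[OF b u]])
      also have "\<dots> \<le> vnorm ?O \<phi> * (vnorm A b * vnorm ?U u)"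
        by (rule mult_left_mono[OF unit_rmult_bound[OF b u] p])
      finally show "vnorm J ((\<lambda>u\<in>vcar ?U. \<phi> (unit_rmult b u)) u) \<le> vnorm A b * vnorm ?O \<phi> * vnorm ?U u"
        using u by (simp add: mult_ac)
    qed
    show "(\<lambda>u\<in>vcar ?U. vadd ?O \<phi> \<psi> (unit_rmult b u))
        = vadd ?O (\<lambda>u\<in>vcar ?U. \<phi> (unit_rmult b u)) (\<lambda>u\<in>vcar ?U. \<psi> (unit_rmult b u))" for \<psi>
      by (auto simp: op_space_sel rc[OF b])
    fix c assume c: "c \<in> vcar A"
    show "(\<lambda>u\<in>vcar ?U. \<phi> (unit_rmult (amult A c b) u))
        = (\<lambda>u\<in>vcar ?U. (\<lambda>u\<in>vcar ?U. \<phi> (unit_rmult b u)) (unit_rmult c u))"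
      by (auto simp: rc[OF c] unit_rmult_mult[OF c b])
    show "(\<lambda>u\<in>vcar ?U. \<phi> (unit_rmult (vadd A c b) u))
        = vadd ?O (\<lambda>u\<in>vcar ?U. \<phi> (unit_rmult c u)) (\<lambda>u\<in>vcar ?U. \<phi> (unit_rmult b u))"
      by (auto simp: op_space_sel unit_rmult_add[OF c b] bounded_opD(2)[OF \<phi>] rc[OF b] rc[OF c])
  qed
qed

lemma coinduced_morphism:
  fixes J :: "('a, 'j) lmodule" and M :: "('a, 'v) lmodule"
  assumes J: "banach_left_module A J" and M: "banach_left_module A M" and Q: "bounded_op M J Q"
  shows "module_morphism A M (coinduced_module A J)
     (\<lambda>y. \<lambda>u\<in>vcar (unitization_space A). Q (unit_act M u y))"
proof -
  interpret J: banach_left_module A J by (rule J)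
  interpret M: banach_left_module A M by (rule M)
  have nJ: "complex_normed_space J" by unfold_locales
  have nM: "complex_normed_space M" by unfold_locales
  have nU: "complex_normed_space (unitization_space A)" by unfold_locales
  let ?U = "unitization_space A" and ?O = "op_space (unitization_space A) J"
  let ?P = "\<lambda>y. \<lambda>u\<in>vcar ?U. Q (unit_act M u y)"
  obtain K where K: "K \<ge> 0" "\<And>x. x \<in> vcar M \<Longrightarrow> vnorm J (Q x) \<le> K * vnorm M x"
    using bounded_op_bound[OF nM Q] by metis
  have c: "unit_act M u y \<in> vcar M" if "u \<in> vcar ?U" "y \<in> vcar M" for u y
    using that by (auto simp: unit_act_def unitization_space_def M.act_closed M.M.add_closed M.M.scale_closed)
  have le: "vnorm M (unit_act M u y) \<le> vnorm M y * vnorm ?U u" if u: "u \<in> vcar ?U" and y: "y \<in> vcar M" for u y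
  proof -
    obtain a z where u: "u = (a, z)" "a \<in> vcar A" using u by (auto simp: unitization_space_def)
    have "vnorm M (unit_act M u y) \<le> vnorm M (act M a y) + vnorm M (vscale M z y)"
      using u y by (simp add: unit_act_def M.M.norm_triangle M.act_closed M.M.scale_closed)
    also have "\<dots> \<le> vnorm A a * vnorm M y + cmod z * vnorm M y"
      using u y M.norm_act_le M.M.norm_scale by simp
    finally show ?thesis using u by (simp add: unitization_space_def algebra_simps)
  qed
  have bu: "bounded_op ?U M (\<lambda>u. unit_act M u y)" if y: "y \<in> vcar M" for y
    unfolding bounded_op_def
  proof (intro conjI ballI allI)
    show "\<exists>K. \<forall>u\<in>vcar ?U. vnorm M (unit_act M u y) \<le> K * vnorm ?U u" using le y by blast
    show "unit_act M (vadd ?U u v) y = vadd M (unit_act M u y) (unit_act M v y)"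
      if "u \<in> vcar ?U" "v \<in> vcar ?U" for u v
      using that y by (auto simp: unit_act_def unitization_space_def M.act_add_left M.M.scale_add_left
          intro!: M.M.add4 M.act_closed M.M.scale_closed)
    show "unit_act M (vscale ?U c u) y = vscale M c (unit_act M u y)" if "u \<in> vcar ?U" for c u
      using that y by (auto simp: unit_act_def unitization_space_def M.act_scale_left M.M.scale_scale
          M.M.scale_add_right M.act_closed M.M.scale_closed)
  qed (use c y in auto)
  have b: "bounded_op ?U J (\<lambda>u. Q (unit_act M u y))" if y: "y \<in> vcar M" for y
    by (rule bounded_op_comp[OF nU nM bu[OF y] Q])
  have add: "unit_act M u (vadd M x y) = vadd M (unit_act M u x) (unit_act M u y)"
    if "u \<in> vcar ?U" "x \<in> vcar M" "y \<in> vcar M" for u x y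
    using that by (auto simp: unit_act_def unitization_space_def M.act_add_right M.M.scale_add_right
          intro!: M.M.add4 M.act_closed M.M.scale_closed)
  have scale: "unit_act M u (vscale M z x) = vscale M z (unit_act M u x)"
    if "u \<in> vcar ?U" "x \<in> vcar M" for u x z
    using that by (auto simp: unit_act_def unitization_space_def M.act_scale_right M.M.scale_add_right
          M.M.scale_scale M.act_closed M.M.scale_closed mult.commute)
  have mult: "unit_act M u (act M a x) = unit_act M (unit_rmult a u) x"
    if "u \<in> vcar ?U" "a \<in> vcar A" "x \<in> vcar M" for u a x
    using that by (auto simp: unit_act_def unit_rmult_def unitization_space_def M.act_mult M.act_add_left
          M.act_scale_left A.mult_closed A.scale_closed A.add_closed M.M.scale_0 M.M.add_zero M.act_closed
          M.M.add_closed M.M.scale_closed)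
  have "bounded_op M ?O ?P"
    unfolding bounded_op_def
  proof (intro conjI ballI allI)
    show "?P y \<in> vcar ?O" if "y \<in> vcar M" for y
      using b[OF that] by (simp add: op_space_sel bounded_op_restrict[OF nU])
    show "?P (vadd M x y) = vadd ?O (?P x) (?P y)" if "x \<in> vcar M" "y \<in> vcar M" for x y
      using that by (auto simp: op_space_sel restrict_def add c bounded_opD(2)[OF Q])
    show "?P (vscale M z x) = vscale ?O z (?P x)" if "x \<in> vcar M" for x z
      using that by (auto simp: op_space_sel restrict_def scale c bounded_opD(3)[OF Q])
    have "vnorm ?O (?P y) \<le> K * vnorm M y" if y: "y \<in> vcar M" for y
    proof (rule op_norm_le[OF nU])
      show "0 \<le> K * vnorm M y" using K(1) M.M.norm_nonneg[OF y] by simp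
      fix u assume u: "u \<in> vcar ?U"
      show "vnorm J (?P y u) \<le> K * vnorm M y * vnorm ?U u"
        using K(2)[OF c[OF u y]] mult_left_mono[OF le[OF u y] K(1)] u by (simp add: mult.assoc)
    qed
    then show "\<exists>K. \<forall>x\<in>vcar M. vnorm ?O (?P x) \<le> K * vnorm M x" by blast
  qed
  moreover have "?P (act M a x) = act (coinduced_module A J) a (?P x)" if "a \<in> vcar A" "x \<in> vcar M" for a x
    using that by (auto simp: coinduced_module_def restrict_def unit_rmult_def[symmetric] mult unit_rmult_closed)
  ultimately show ?thesis
    by (simp add: module_morphism_def coinduced_module_def bounded_op_extend)
qed

lemma coinduced_retraction:
  fixes J :: "('a, 'j) lmodule"
  assumes inj: "injective_module A J"
  obtains \<rho> where "module_morphism A (coinduced_module A J) J \<rho>"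
    "\<And>x. x \<in> vcar J \<Longrightarrow> \<rho> (\<lambda>u\<in>vcar (unitization_space A). unit_act J u x) = x"
proof -
  have J: "banach_left_module A J" using inj by (simp add: injective_module_def injective_wrt_def)
  interpret J: banach_left_module A J by (rule J)
  have nJ: "complex_normed_space J" by unfold_locales
  have nU: "complex_normed_space (unitization_space A)" by unfold_locales
  let ?U = "unitization_space A" and ?O = "op_space (unitization_space A) J"
  let ?E = "const_module J :: ('a, 'a \<times> complex \<Rightarrow> 'j) lmodule"
  let ?F = "coinduced_module A J"
  let ?Q = "\<lambda>f :: 'a \<times> complex \<Rightarrow> 'j. f undefined"
  let ?T = "\<lambda>f. \<lambda>u\<in>vcar ?U. ?Q (unit_act ?E u f)"
  let ?L = "\<lambda>\<phi> :: 'a \<times> complex \<Rightarrow> 'j. \<lambda>_ :: 'a \<times> complex. \<phi> (vzero A, 1)"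
  have E: "banach_left_module A ?E" by (rule const_module_banach[OF J])
  have F: "banach_left_module A ?F" by (rule coinduced_module_banach[OF J])
  have Q: "bounded_op ?E J ?Q"
    by (auto simp: bounded_op_def const_module_def intro: exI[of _ 1])
  have Qm: "module_morphism A ?E J ?Q"
    using Q by (auto simp: module_morphism_def const_module_def)
  have T: "module_morphism A ?E ?F ?T" by (rule coinduced_morphism[OF J E Q])
  have e: "(vzero A, 1) \<in> vcar ?U" by (simp add: unitization_space_def A.zero_closed)
  have ne: "vnorm ?U (vzero A, 1) = 1" by (simp add: unitization_space_def A.norm_vzero)
  have "bounded_op ?O ?E ?L"
    unfolding bounded_op_def
  proof (intro conjI ballI allI)
    show "?L \<phi> \<in> vcar ?E" if "\<phi> \<in> vcar ?O" for \<phi>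
      using that bounded_opD(1)[OF _ e] by (auto simp: op_space_sel const_module_def)
    have "vnorm ?E (?L \<phi>) \<le> 1 * vnorm ?O \<phi>" if "\<phi> \<in> vcar ?O" for \<phi>
      using op_norm_ge[OF nU nJ _ e, of \<phi>] that ne by (simp add: op_space_sel const_module_def)
    then show "\<exists>K. \<forall>\<phi>\<in>vcar ?O. vnorm ?E (?L \<phi>) \<le> K * vnorm ?O \<phi>" by blast
  qed (use e in \<open>auto simp: op_space_sel const_module_def\<close>)
  then have L: "bounded_op ?F ?E ?L" by (simp add: coinduced_module_def bounded_op_extend')
  have act0: "act J (vzero A) x = vzero J" if "x \<in> vcar J" for x
    using J.act_scale_left[OF A.zero_closed that, of 0] J.M.scale_0[OF J.act_closed[OF A.zero_closed that]]
    by (simp add: A.scale_vzero)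
  have TT: "?T f = (\<lambda>u\<in>vcar ?U. unit_act J u (f undefined))" for f
    by (simp add: unit_act_def const_module_def)
  have LT: "?L (?T f) = f" if f: "f \<in> vcar ?E" for f
  proof -
    obtain x where x: "f = (\<lambda>_. x)" "x \<in> vcar J" using f by (auto simp: const_module_def)
    show ?thesis
      unfolding TT using x e
      by (simp add: unit_act_def act0 J.M.scale_one J.M.zero_add)
  qed
  have "inj_on ?T (vcar ?E)" by (rule inj_on_inverseI[of _ ?L]) (rule LT)
  then have "admissible_monomorphism A ?E ?F ?T"
    unfolding admissible_monomorphism_def using T L LT by blast
  then have "banach_left_module A ?E \<and> banach_left_module A ?F \<and>
      admissible_monomorphism A ?E ?F ?T \<and> module_morphism A ?E J ?Q"
    using E F Qm by blast
  with inj[unfolded injective_module_def injective_wrt_def, THEN conjunct2, THEN spec[of _ ?E],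
      THEN spec[of _ ?F], THEN spec[of _ ?T], THEN spec[of _ ?Q]]
  have "\<exists>R. module_morphism A ?F J R \<and> (\<forall>f\<in>vcar ?E. R (?T f) = ?Q f)" by (rule mp)
  then obtain \<rho> where \<rho>: "module_morphism A ?F J \<rho>" "\<And>f. f \<in> vcar ?E \<Longrightarrow> \<rho> (?T f) = ?Q f"
    by (elim exE conjE) (simp only: that)
  have "\<rho> (\<lambda>u\<in>vcar ?U. unit_act J u x) = x" if "x \<in> vcar J" for x
    using \<rho>(2)[of "\<lambda>_. x"] that unfolding TT by (simp add: const_module_def)
  with \<rho>(1) show ?thesis using that by blast
qed

end

theorem injective_module_imp_injective_wrt:
  fixes J :: "('a, 'j) lmodule"
  assumes inj: "injective_module A J"
  shows "injective_wrt TYPE('e) TYPE('f) A J"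
proof -
  have J: "banach_left_module A J" using inj by (simp add: injective_module_def injective_wrt_def)
  interpret J: banach_left_module A J by (rule J)
  have A: "banach_algebra A" by unfold_locales
  have nJ: "complex_normed_space J" by unfold_locales
  let ?C = "coinduced_module A J" and ?U = "unitization_space A"
  have bC: "banach_left_module A ?C" by (rule coinduced_module_banach[OF A J])
  interpret C: banach_left_module A ?C by (rule bC)
  have nC: "complex_normed_space ?C" by unfold_locales
  obtain \<rho> where \<rho>: "module_morphism A ?C J \<rho>"
    "\<And>x. x \<in> vcar J \<Longrightarrow> \<rho> (\<lambda>u\<in>vcar ?U. unit_act J u x) = x"
    using coinduced_retraction[OF A inj] by metis
  show ?thesis
    unfolding injective_wrt_def
  proof (intro conjI allI impI J, elim conjE)
    fix E :: "('a, 'e) lmodule" and F :: "('a, 'f) lmodule" and T S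
    assume E: "banach_left_module A E" and F: "banach_left_module A F"
      and T: "admissible_monomorphism A E F T" and S: "module_morphism A E J S"
    interpret E: banach_left_module A E by (rule E)
    interpret F: banach_left_module A F by (rule F)
    have nE: "complex_normed_space E" by unfold_locales
    have nF: "complex_normed_space F" by unfold_locales
    obtain P where P: "bounded_op F E P" "\<And>x. x \<in> vcar E \<Longrightarrow> P (T x) = x"
      using T by (auto simp: admissible_monomorphism_def)
    have Tm: "bounded_op E F T" "\<And>a x. a \<in> vcar A \<Longrightarrow> x \<in> vcar E \<Longrightarrow> T (act E a x) = act F a (T x)"
      using T by (auto simp: admissible_monomorphism_def module_morphism_def)
    have Sm: "bounded_op E J S" "\<And>a x. a \<in> vcar A \<Longrightarrow> x \<in> vcar E \<Longrightarrow> S (act E a x) = act J a (S x)"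
      using S by (auto simp: module_morphism_def)
    let ?\<Phi> = "\<lambda>y. \<lambda>u\<in>vcar ?U. S (P (unit_act F u y))"
    have \<Phi>: "module_morphism A F ?C ?\<Phi>"
      by (rule coinduced_morphism[OF A J F bounded_op_comp[OF nF nE P(1) Sm(1)]])
    let ?R = "\<lambda>y. \<rho> (?\<Phi> y)"
    have "bounded_op F J ?R"
      using \<Phi> \<rho>(1) bounded_op_comp[OF nF nC] by (auto simp: module_morphism_def)
    moreover have "?R (act F a y) = act J a (?R y)" if "a \<in> vcar A" "y \<in> vcar F" for a y
    proof -
      have "?\<Phi> (act F a y) = act ?C a (?\<Phi> y)" and "?\<Phi> y \<in> vcar ?C"
        using \<Phi> that by (auto simp: module_morphism_def bounded_op_def)
      then show ?thesis using \<rho>(1) that by (simp add: module_morphism_def)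
    qed
    moreover have "?R (T x) = S x" if x: "x \<in> vcar E" for x
    proof -
      have "S (P (unit_act F u (T x))) = unit_act J u (S x)" if u: "u \<in> vcar ?U" for u
      proof -
        have a: "fst u \<in> vcar A" using u by (auto simp: unitization_space_def)
        have c: "act E (fst u) x \<in> vcar E" "vscale E (snd u) x \<in> vcar E"
          using a x E.act_closed E.M.scale_closed by auto
        have "unit_act F u (T x) = T (unit_act E u x)"
          using c by (simp add: unit_act_def Tm(2)[OF a x, symmetric] bounded_opD(2,3)[OF Tm(1)] x)
        moreover have "unit_act E u x \<in> vcar E"
          using c by (simp add: unit_act_def E.M.add_closed)
        ultimately have "S (P (unit_act F u (T x))) = S (unit_act E u x)" using P(2) by simp
        then show ?thesis
          using c by (simp add: unit_act_def Sm(2)[OF a x] bounded_opD(2,3)[OF Sm(1)] x)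
      qed
      then have "?\<Phi> (T x) = (\<lambda>u\<in>vcar ?U. unit_act J u (S x))" by (auto simp: restrict_def)
      then show ?thesis using \<rho>(2)[OF bounded_opD(1)[OF Sm(1) x]] by simp
    qed
    ultimately show "\<exists>R. module_morphism A F J R \<and> (\<forall>x\<in>vcar E. R (T x) = S x)"
      by (intro exI[of _ ?R]) (auto simp: module_morphism_def)
  qed
qed

end

theory Submission
  imports Defs
begin

text \<open>Injectivity provides an \<open>L\<^sup>1\<close>-module retraction \<open>\<rho>\<close> of the coinduced module of bounded operators from
  the unitization of \<open>L\<^sup>1\<close> to \<open>L\<^sup>p\<close> onto \<open>L\<^sup>p\<close>. A bounded Borel function \<open>\<kappa>\<close> and a set \<open>E\<close> of finite measure
  give the operator \<open>V \<kappa> E\<close>, \<open>(a, z) \<mapsto> (a \<kappa>) * 1\<^sub>E\<close>. For a finite set \<open>S\<close> of group elements, choose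
  neighbourhoods \<open>F\<close> and \<open>B\<close> of the identity and a compact set \<open>K \<subseteq> F\<close> of comparable measure such that the sets
  \<open>s + F\<close> are disjoint and \<open>- B + K \<subseteq> F\<close>. Let \<open>b\<close> be the normalized indicator function of \<open>B\<close> and let
  \<open>M \<kappa>\<close> be the average over \<open>K\<close> of \<open>b * \<rho> (V \<kappa> F)\<close>. Then \<open>M\<close> is linear, and \<open>M 1 = 1\<close> because
  \<open>b * \<rho> (V 1 F) = b * 1\<^sub>F\<close>. Translating \<open>\<kappa>\<close> by \<open>s\<close> replaces \<open>F\<close> by \<open>s + F\<close>. If
  \<open>\<Sum>s. \<bar>\<kappa> s\<bar>\<^sup>p \<le> 1\<close> pointwise, then Jensen's inequality and disjointness bound the norms of all operators
  \<open>\<Sum>s. \<plusminus> V (\<kappa> s) (s + F)\<close>, and averaging over the signs bounds \<open>\<Sum>s. \<bar>M (\<lambda>t. \<kappa> s (t - s))\<bar>\<^sup>p\<close>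
  independently of \<open>S\<close>. Normalization and compactness turn these functionals into one mean \<open>N\<close> on the bounded Borel
  functions that satisfies such a bound for all \<open>S\<close>.

  Fix a compact set \<open>D\<close> of positive measure. The mean on \<open>L\<^sup>1\<close> is \<open>\<phi> \<mapsto> N (\<lambda>t. \<phi> (c (- t)))\<close>, where \<open>c t\<close> is
  the normalized indicator function of \<open>t + D\<close>. A Goldstine argument replaces the functionals in the
  definition of the multi-norm, which live on the bidual, by bounded Borel functions.\<close>

section \<open>Haar measure and the modular function\<close>

text \<open>Only three facts about \<open>\<rho>\<close> are available: it is bounded, it is a
  module morphism, and it inverts the canonical embedding of \<open>L\<^sup>p\<close>. It need not
  be local, and nothing relates it directly to translations. The factor \<open>b\<close> is there
  because \<open>V 1 F\<close> and the canonical image of the indicator of \<open>F\<close> differ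
  in the scalar component of the unitization, which convolution with \<open>b\<close> removes. The
  condition on \<open>K\<close> makes \<open>b * X\<close> on \<open>K\<close> depend only on
  \<open>X\<close> over \<open>F\<close>, so for one fixed \<open>X\<close> the terms over the
  disjoint sets \<open>s + F\<close> are controlled by one norm. But every \<open>s\<close> has its
  own operator; signs merge them into a single one, and averaging recovers the diagonal terms
  without any knowledge of the others. Only the ratio of the measures of \<open>F\<close> and
  \<open>K\<close> enters the bound, so \<open>F\<close> may shrink as \<open>S\<close> grows. A
  further obstacle is that neither sigma-finiteness nor a countable base is assumed. Fubini's
  theorem is used for continuous functions of compact support alone; closure and norm properties of
  convolution are taken from the module axioms that injectivity contains.\<close>

locale haar =
  fixes m :: "'g::{topological_group_add, t2_space} measure"
  assumes lc: "locally_compact_space (euclidean :: 'g topology)"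
    and haar: "left_haar_measure m"
begin

lemma sets_m [simp, measurable_cong]: "sets m = sets borel"
  using haar by (simp add: left_haar_measure_def)

lemma space_m [simp]: "space m = UNIV"
  using sets_eq_imp_space_eq[OF sets_m] by simp

lemma borel_measurable_m [simp]: "borel_measurable m = borel_measurable borel"
  by (rule measurable_cong_sets) simp_all

lemma compact_finite: "compact K \<Longrightarrow> emeasure m K < \<infinity>"
  using haar by (simp add: left_haar_measure_def)

lemma outer_regular: "A \<in> sets borel \<Longrightarrow> emeasure m A = (INF U\<in>{U. open U \<and> A \<subseteq> U}. emeasure m U)"
  using haar unfolding left_haar_measure_def by blast

lemma inner_regular: "open U \<Longrightarrow> emeasure m U = (SUP K\<in>{K. compact K \<and> K \<subseteq> U}. emeasure m K)"
  using haar unfolding left_haar_measure_def by blast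

lemma emeasure_translate: "A \<in> sets borel \<Longrightarrow> emeasure m ((\<lambda>t. s + t) ` A) = emeasure m A"
  using haar by (simp add: left_haar_measure_def)

lemma outer_approx:
  assumes "A \<in> sets borel" "emeasure m A < c"
  obtains U where "open U" "A \<subseteq> U" "emeasure m U < c"
  using assms(2) unfolding outer_regular[OF assms(1)] Inf_less_iff by blast

lemma inner_approx:
  assumes "open U" "c < emeasure m U"
  obtains K where "compact K" "K \<subseteq> U" "c < emeasure m K"
  using assms(2) unfolding inner_regular[OF assms(1)] less_Sup_iff by blast

lemma measurable_left_add [measurable]: "(\<lambda>t. s + t) \<in> borel_measurable (borel :: 'g measure)"
  by (intro borel_measurable_continuous_onI continuous_intros)

lemma measurable_right_add [measurable]: "(\<lambda>t. t + s) \<in> borel_measurable (borel :: 'g measure)"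
  by (intro borel_measurable_continuous_onI continuous_intros)

lemma continuous_on_uminus_group: "continuous_on A (uminus :: 'g \<Rightarrow> 'g)"
  unfolding continuous_on_def by (auto intro!: tendsto_intros)

lemma measurable_uminus [measurable]: "(uminus :: 'g \<Rightarrow> 'g) \<in> borel_measurable borel"
  by (intro borel_measurable_continuous_onI continuous_on_uminus_group)

lemma measurable_neg_add [measurable]: "(\<lambda>t. - t + s) \<in> borel_measurable (borel :: 'g measure)"
  by (intro borel_measurable_continuous_onI continuous_intros)

lemma left_image: "(\<lambda>t. s + t) ` A = (\<lambda>t. - s + t) -` (A :: 'g set)"
proof safe
  fix x assume "- s + x \<in> A"
  then show "x \<in> (\<lambda>t. s + t) ` A" by (intro image_eqI[of _ _ "- s + x"]) (simp_all add: add.assoc[symmetric])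
qed (simp add: add.assoc[symmetric])

lemma uminus_image: "uminus ` A = uminus -` (A :: 'g set)"
proof safe
  fix x assume "- x \<in> A"
  then show "x \<in> uminus ` A" by (intro image_eqI[of _ _ "- x"]) simp_all
qed simp

lemma left_image_sets [measurable]: "A \<in> sets borel \<Longrightarrow> (\<lambda>t. s + t) ` A \<in> sets (borel :: 'g measure)"
  unfolding left_image using measurable_sets[OF measurable_left_add, of A "- s"] by simp

lemma uminus_image_sets [measurable]: "A \<in> sets borel \<Longrightarrow> uminus ` A \<in> sets (borel :: 'g measure)"
  unfolding uminus_image using measurable_sets[OF measurable_uminus, of A] by simp

lemma open_left_image: "open A \<Longrightarrow> open ((\<lambda>t. s + t) ` (A :: 'g set))"
  unfolding left_image by (rule open_vimage) (auto intro!: continuous_intros)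

lemma open_uminus_image: "open A \<Longrightarrow> open (uminus ` (A :: 'g set))"
  unfolding uminus_image by (rule open_vimage) (auto intro!: continuous_on_uminus_group)

lemma compact_uminus_image: "compact A \<Longrightarrow> compact (uminus ` (A :: 'g set))"
  by (intro compact_continuous_image continuous_on_uminus_group)

section \<open>Left invariance of integrals and of null sets\<close>

lemma distr_left: "distr m m (\<lambda>t. s + t) = m"
proof (rule measure_eqI)
  fix A assume "A \<in> sets (distr m m (\<lambda>t. s + t))"
  then have A: "A \<in> sets borel" by simp
  have "emeasure (distr m m (\<lambda>t. s + t)) A = emeasure m ((\<lambda>t. s + t) -` A)"
    using A by (subst emeasure_distr) (simp_all add: measurable_cong_sets[OF sets_m sets_m])
  also have "(\<lambda>t. s + t) -` A = (\<lambda>t. - s + t) ` A" by (simp add: left_image)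
  finally show "emeasure (distr m m (\<lambda>t. s + t)) A = emeasure m A"
    using emeasure_translate[OF A] by simp
qed simp

lemma integral_left:
  fixes h :: "'g \<Rightarrow> 'b::{banach, second_countable_topology}"
  assumes "h \<in> borel_measurable borel"
  shows "(\<integral>t. h (s + t) \<partial>m) = (\<integral>t. h t \<partial>m)"
  using integral_distr[of "\<lambda>t. s + t" m m h] assms
  by (simp add: distr_left measurable_cong_sets[OF sets_m sets_m])

lemma integrable_left:
  fixes h :: "'g \<Rightarrow> 'b::{banach, second_countable_topology}"
  assumes "h \<in> borel_measurable borel"
  shows "integrable m (\<lambda>t. h (s + t)) \<longleftrightarrow> integrable m h"
  using integrable_distr_eq[of "\<lambda>t. s + t" m m h] assms
  by (simp add: distr_left measurable_cong_sets[OF sets_m sets_m])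

lemma AE_left:
  assumes "AE t in m. P t" shows "AE t in m. P (s + t)"
proof -
  have "AE t in distr m m (\<lambda>t. s + t). P t" unfolding distr_left by (rule assms)
  then show ?thesis by (rule AE_distrD[rotated]) (simp add: measurable_cong_sets[OF sets_m sets_m])
qed

section \<open>Compact neighbourhoods and Urysohn functions\<close>

lemma compact_nbhd:
  fixes x :: 'g
  obtains U K where "open U" "compact K" "x \<in> U" "U \<subseteq> K"
  using lc unfolding locally_compact_space_def by (simp add: compactin_euclidean_iff) metis

text \<open>For an open \<open>W\<close> around \<open>0\<close> inside a compact \<open>C0\<close>,
  the set \<open>K + W\<close> is open and lies in \<open>K + C0\<close>, which is compact as the
  image of a product under addition.\<close>

lemma compact_set_nbhd:
  fixes K :: "'g set"
  assumes "compact K"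
  obtains V C where "open V" "compact C" "K \<subseteq> V" "V \<subseteq> C"
proof -
  obtain W C0 where W: "open W" "compact C0" "(0::'g) \<in> W" "W \<subseteq> C0" using compact_nbhd by metis
  show ?thesis
  proof
    show "open (\<Union>k\<in>K. (\<lambda>t. k + t) ` W)" using W open_left_image by auto
    show "K \<subseteq> (\<Union>k\<in>K. (\<lambda>t. k + t) ` W)" using W by force
    show "compact ((\<lambda>z. fst z + snd z) ` (K \<times> C0))"
      using assms W by (intro compact_continuous_image compact_Times continuous_intros)
    show "(\<Union>k\<in>K. (\<lambda>t. k + t) ` W) \<subseteq> (\<lambda>z. fst z + snd z) ` (K \<times> C0)" using W by force
  qed
qed

lemma compact_plus: "compact K \<Longrightarrow> compact L \<Longrightarrow> compact {x + y | x y. x \<in> K \<and> y \<in> (L :: 'g set)}"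
proof -
  assume "compact K" "compact L"
  then have "compact ((\<lambda>z. fst z + snd z) ` (K \<times> L))"
    by (intro compact_continuous_image compact_Times continuous_intros)
  also have "(\<lambda>z. fst z + snd z) ` (K \<times> L) = {x + y | x y. x \<in> K \<and> y \<in> L}" by force
  finally show ?thesis .
qed

text \<open>Local compactness and the Hausdorff property give complete regularity. Separating
  \<open>K\<close> from the complement of \<open>U \<inter> V\<close>, where the open set
  \<open>V\<close> lies in a compact \<open>C\<close>, makes the function vanish both off
  \<open>U\<close> and off \<open>C\<close>.\<close>

lemma bump:
  fixes K U :: "'g set"
  assumes "compact K" "open U" "K \<subseteq> U"
  obtains f :: "'g \<Rightarrow> real" and C where "continuous_on UNIV f" "\<And>x. 0 \<le> f x" "\<And>x. f x \<le> 1"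
    "\<And>x. x \<in> K \<Longrightarrow> f x = 1" "\<And>x. x \<notin> U \<Longrightarrow> f x = 0" "compact C" "\<And>x. x \<notin> C \<Longrightarrow> f x = 0"
proof -
  obtain V C where V: "open V" "compact C" "K \<subseteq> V" "V \<subseteq> C" using compact_set_nbhd assms by metis
  have "completely_regular_space (euclidean :: 'g topology)"
    using lc by (rule locally_compact_regular_imp_completely_regular_space)
      (simp add: Hausdorff_space_def disjnt_def, metis hausdorff)
  moreover have "closedin euclidean (- (U \<inter> V))" using V assms by (simp only: closed_closedin[symmetric]) (intro closed_Compl open_Int)
  moreover have "disjnt K (- (U \<inter> V))" using V assms by (auto simp: disjnt_def)
  moreover have "compactin euclidean K" using assms by (simp add: compactin_euclidean_iff)
  ultimately obtain f where f: "continuous_map euclidean (top_of_set {0..1::real}) f"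
      "f ` (- (U \<inter> V)) \<subseteq> {0}" "f ` K \<subseteq> {1}"
    using Urysohn_completely_regular_compact_closed[of 0 1 euclidean K "- (U \<inter> V)"] by auto
  show ?thesis
  proof
    show "continuous_on UNIV f" using f(1) by (simp add: continuous_map_in_subtopology)
    have "f x \<in> {0..1}" for x using f(1) by (auto simp: continuous_map_in_subtopology)
    then show "0 \<le> f x" "f x \<le> 1" for x by auto
    show "f x = 1" if "x \<in> K" for x using f(3) that by auto
    show "f x = 0" if "x \<notin> U" for x using f(2) that by auto
    show "compact C" by fact
    show "f x = 0" if "x \<notin> C" for x using f(2) that V by auto
  qed
qed

text \<open>If \<open>U\<close> were null, so would be every compact set, since finitely many
  translates of \<open>U\<close> cover it; inner regularity of \<open>UNIV\<close> would then give
  the zero measure.\<close>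

lemma open_pos:
  assumes "open U" "x \<in> (U :: 'g set)" shows "0 < emeasure m U"
proof (rule ccontr)
  assume "\<not> ?thesis"
  then have U: "emeasure m U = 0" by simp
  have "emeasure m K = 0" if K: "compact K" for K
  proof -
    have "K \<subseteq> (\<Union>k\<in>K. (\<lambda>t. (k - x) + t) ` U)"
    proof
      fix k assume "k \<in> K"
      then show "k \<in> (\<Union>k\<in>K. (\<lambda>t. (k - x) + t) ` U)"
        using assms(2) by (intro UN_I[of k] image_eqI[of _ _ x]) auto
    qed
    then obtain T where T: "T \<subseteq> K" "finite T" "K \<subseteq> (\<Union>k\<in>T. (\<lambda>t. (k - x) + t) ` U)"
      by (rule compactE_image[OF K, rotated]) (use assms open_left_image in auto)
    have "(\<Union>k\<in>T. (\<lambda>t. (k - x) + t) ` U) \<in> null_sets m"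
      using T(2) assms(1) by (intro null_sets_UN' countable_finite) (auto simp: null_sets_def emeasure_translate U)
    then show ?thesis using T(3) compact_imp_closed[OF K]
      by (metis borel_closed null_setsD1 null_sets_subset sets_m)
  qed
  then have "emeasure m UNIV = 0"
    by (subst inner_regular) (auto intro!: SUP_eq_const exI[of _ "{}"])
  then show False using haar by (simp add: left_haar_measure_def)
qed

text \<open>The substitute for uniform continuity on compact sets. It serves the parametric
  integrals below, the choice of the set \<open>B\<close> of small shifts, and the continuity of
  translation in \<open>L\<^sup>1\<close>.\<close>

lemma tube:
  fixes K :: "'b::topological_space set" and f :: "'a::topological_space \<Rightarrow> 'b \<Rightarrow> 'c::topological_space"
  assumes "compact K" "open U" "continuous_on UNIV (\<lambda>z. f (fst z) (snd z))"
  shows "open {x. \<forall>y\<in>K. f x y \<in> U}"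
proof (rule topological_space_class.openI)
  fix x assume x: "x \<in> {x. \<forall>y\<in>K. f x y \<in> U}"
  have "open ((\<lambda>z. f (fst z) (snd z)) -` U)" using assms by (intro open_vimage)
  from Elementary_Topology.tube_lemma[OF assms(1) this, of x]
  show "\<exists>T. open T \<and> x \<in> T \<and> T \<subseteq> {x. \<forall>y\<in>K. f x y \<in> U}" using x by fastforce
qed


section \<open>Double integrals of continuous functions with compact support\<close>

definition Cc :: "('g \<Rightarrow> real) \<Rightarrow> bool" where
  "Cc f \<longleftrightarrow> continuous_on UNIV f \<and> (\<exists>C. compact C \<and> (\<forall>x. x \<notin> C \<longrightarrow> f x = 0))"

lemma compact_sets [measurable]: "compact K \<Longrightarrow> K \<in> sets (borel :: 'g measure)"
  using compact_imp_closed by (auto intro: borel_closed)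

lemma integrable_compact_support:
  fixes f :: "'g \<Rightarrow> real"
  assumes "continuous_on UNIV f" "compact C" "\<And>x. x \<notin> C \<Longrightarrow> f x = 0"
  shows "integrable m f"
proof -
  have "bounded (f ` C)"
    using assms by (intro compact_imp_bounded compact_continuous_image continuous_on_subset[OF assms(1)]) auto
  then obtain B where B: "\<And>x. x \<in> C \<Longrightarrow> \<bar>f x\<bar> \<le> B" by (auto simp: bounded_iff)
  have "integrable m (\<lambda>x. B * indicator C x)"
    using compact_finite[OF assms(2)] assms(2) by (intro integrable_mult_right) simp
  then show ?thesis
  proof (rule Bochner_Integration.integrable_bound)
    show "f \<in> borel_measurable m" using assms by (simp add: borel_measurable_continuous_onI)
    show "AE x in m. norm (f x) \<le> norm (B * indicator C x)"
      using B assms(3) by (intro AE_I2) (auto simp: indicator_def intro: order_trans[OF _ abs_ge_self])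
  qed
qed

lemma Cc_integrable: "Cc f \<Longrightarrow> integrable m f"
  by (auto simp: Cc_def intro: integrable_compact_support)

text \<open>Near \<open>x0\<close> all functions \<open>F x\<close> live on one compact set
  \<open>L\<close>, and \<open>tube\<close> makes them uniformly close to \<open>F x0\<close> there;
  the finite measure of \<open>L\<close> turns this into closeness of the integrals.\<close>

lemma continuous_parametric_integral:
  fixes F :: "'g \<Rightarrow> 'g \<Rightarrow> real"
  assumes F: "continuous_on UNIV (\<lambda>z. F (fst z) (snd z))"
    and loc: "\<And>x. \<exists>V L. open V \<and> x \<in> V \<and> compact L \<and> (\<forall>x'\<in>V. \<forall>y. y \<notin> L \<longrightarrow> F x' y = 0)"
  shows "continuous_on UNIV (\<lambda>x. \<integral>y. F x y \<partial>m)"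
  unfolding continuous_on_topological
proof (intro ballI allI impI)
  fix x0 and B :: "real set" assume B: "open B" "(\<integral>y. F x0 y \<partial>m) \<in> B"
  then obtain e where e: "e > 0" "ball (\<integral>y. F x0 y \<partial>m) e \<subseteq> B" using openE by blast
  obtain V L where V: "open V" "x0 \<in> V" "compact L" "\<And>x y. x \<in> V \<Longrightarrow> y \<notin> L \<Longrightarrow> F x y = 0"
    using loc[of x0] by metis
  have c: "continuous_on UNIV (F x)" for x
    using continuous_on_compose2[OF F, of UNIV "\<lambda>y. (x, y)"] by (simp add: continuous_intros)
  have int: "integrable m (F x)" if "x \<in> V" for x
    using integrable_compact_support[OF c V(3)] V(4)[OF that] by blast
  \<comment> \<open>The summand 1 excludes division by zero and makes \<open>d * measure m L\<close>
    strictly smaller than \<open>e\<close>.\<close>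
  define d where "d = e / (1 + measure m L)"
  have d: "d > 0" using e by (simp add: d_def add_pos_nonneg)
  have "continuous_on UNIV (\<lambda>z::'g \<times> 'g. F x0 (snd z))"
    using continuous_on_compose2[OF c, of UNIV "snd"] by (simp add: continuous_intros)
  then have "continuous_on UNIV (\<lambda>z. (\<lambda>x y. F x y - F x0 y) (fst z) (snd z))"
    using F by (simp add: continuous_on_diff)
  from tube[OF V(3) open_ball this, of 0 d]
  have U: "open {x. \<forall>y\<in>L. F x y - F x0 y \<in> ball 0 d}" .
  show "\<exists>A. open A \<and> x0 \<in> A \<and> (\<forall>y\<in>UNIV. y \<in> A \<longrightarrow> (\<integral>ya. F y ya \<partial>m) \<in> B)"
  proof (intro exI[of _ "V \<inter> {x. \<forall>y\<in>L. F x y - F x0 y \<in> ball 0 d}"] conjI ballI impI)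
    show "open (V \<inter> {x. \<forall>y\<in>L. F x y - F x0 y \<in> ball 0 d})" using U V by auto
    show "x0 \<in> V \<inter> {x. \<forall>y\<in>L. F x y - F x0 y \<in> ball 0 d}" using V d by auto
    fix x assume x: "x \<in> V \<inter> {x. \<forall>y\<in>L. F x y - F x0 y \<in> ball 0 d}"
    have le: "norm (F x y - F x0 y) \<le> d * indicator L y" for y
      using x V(4)[of x y] V(4)[of x0 y] V(2) by (cases "y \<in> L") (auto simp: dist_real_def intro: less_imp_le)
    have id: "integrable m (\<lambda>y. F x y - F x0 y)"
      using x V(2) by (intro Bochner_Integration.integrable_diff int) auto
    have "norm (\<integral>y. F x y - F x0 y \<partial>m) \<le> (\<integral>y. norm (F x y - F x0 y) \<partial>m)"
      by (rule integral_norm_bound)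
    also have "\<dots> \<le> (\<integral>y. d * indicator L y \<partial>m)"
      using compact_finite[OF V(3)] V(3)
      by (intro integral_mono integrable_norm id le integrable_mult_right) (auto simp: compact_sets)
    also have "\<dots> = d * measure m L" by simp
    also have "\<dots> < e" using e unfolding d_def by (simp add: field_simps add_pos_nonneg)
    finally have "dist (\<integral>y. F x0 y \<partial>m) (\<integral>y. F x y \<partial>m) < e"
      using x V(2) int by (simp add: dist_real_def abs_minus_commute Bochner_Integration.integral_diff)
    then show "(\<integral>y. F x y \<partial>m) \<in> B" using e by auto
  qed
qed

text \<open>A continuous function is Borel on the product space, but without a countable base the
  Borel sets of the product may exceed the product sigma-algebra. Compact support rescues
  measurability: finitely many sets \<open>U x\<close>, on which \<open>F\<close> changes by less
  than \<open>e\<close> uniformly in the second variable, cover \<open>K\<close>, so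
  \<open>F\<close> is a uniform limit of functions that are piecewise independent of the first
  variable.\<close>

lemma measurable_product:
  fixes F :: "'g \<Rightarrow> 'g \<Rightarrow> real"
  assumes F: "continuous_on UNIV (\<lambda>z. F (fst z) (snd z))" and K: "compact K" and L: "compact L"
    and z: "\<And>x y. x \<notin> K \<Longrightarrow> F x y = 0" "\<And>x y. y \<notin> L \<Longrightarrow> F x y = 0"
  shows "(\<lambda>z. F (fst z) (snd z)) \<in> borel_measurable (borel \<Otimes>\<^sub>M borel)"
proof -
  have c: "continuous_on UNIV (F x)" for x
    using continuous_on_compose2[OF F, of UNIV "\<lambda>y. (x, y)"] by (simp add: continuous_intros)
  then have cm [measurable]: "F x \<in> borel_measurable borel" for x
    by (rule borel_measurable_continuous_onI)
  have "\<exists>G \<in> borel_measurable (borel \<Otimes>\<^sub>M borel). \<forall>z. \<bar>G z - F (fst z) (snd z)\<bar> < e" if e: "e > 0" for e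
  proof -
    define U where "U x = {x'. \<forall>y\<in>L. F x' y - F x y \<in> ball 0 e}" for x
    have oU: "open (U x)" for x
    proof -
      have "continuous_on UNIV (\<lambda>z::'g \<times> 'g. F x (snd z))"
        using continuous_on_compose2[OF c, of UNIV "snd"] by (simp add: continuous_intros)
      then have "continuous_on UNIV (\<lambda>z. (\<lambda>x' y. F x' y - F x y) (fst z) (snd z))"
        using F by (simp add: continuous_on_diff)
      from tube[OF L open_ball this, of 0 e] show ?thesis unfolding U_def .
    qed
    have "\<exists>G \<in> borel_measurable (borel \<Otimes>\<^sub>M borel). \<forall>x y. x \<in> (\<Union>x\<in>T. U x) \<longrightarrow> \<bar>G (x, y) - F x y\<bar> < e"
      if "finite T" for T
      using that
    proof (induction T)
      case (insert x T)
      then obtain G where G [measurable]: "G \<in> borel_measurable (borel \<Otimes>\<^sub>M borel)"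
        and G': "\<forall>x y. x \<in> (\<Union>x\<in>T. U x) \<longrightarrow> \<bar>G (x, y) - F x y\<bar> < e" by blast
      have [measurable]: "U x \<in> sets borel" using oU by simp
      show ?case
      proof (intro bexI[of _ "\<lambda>z. if fst z \<in> U x then F x (snd z) else G z"] allI impI)
        show "(\<lambda>z. if fst z \<in> U x then F x (snd z) else G z) \<in> borel_measurable (borel \<Otimes>\<^sub>M borel)"
          by measurable
        fix x' y assume "x' \<in> (\<Union>x\<in>insert x T. U x)"
        then consider "x' \<in> U x" | "x' \<notin> U x" "x' \<in> (\<Union>x\<in>T. U x)" by blast
        then show "\<bar>(if fst (x', y) \<in> U x then F x (snd (x', y)) else G (x', y)) - F x' y\<bar> < e"
        proof cases
          case 1
          then have "\<bar>F x y - F x' y\<bar> < e" if "y \<in> L"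
            using that by (simp add: U_def dist_real_def abs_minus_commute)
          then show ?thesis using 1 z(2)[of y x] z(2)[of y x'] e by (cases "y \<in> L") simp_all
        next
          case 2
          have "\<bar>G (x', y) - F x' y\<bar> < e" by (rule G'[rule_format, OF 2(2)])
          with 2(1) show ?thesis by simp
        qed
      qed
    next
      case empty
      show ?case by (rule bexI[of _ "\<lambda>_. 0"], simp, rule measurable_const, simp)
    qed
    note approx = this
    have "K \<subseteq> (\<Union>x\<in>K. U x)" using e by (auto simp: U_def)
    then obtain T where T: "T \<subseteq> K" "finite T" "K \<subseteq> (\<Union>x\<in>T. U x)"
      using compactE_image[OF K, of K U] oU by metis
    from approx[OF T(2)] obtain G where G [measurable]: "G \<in> borel_measurable (borel \<Otimes>\<^sub>M borel)"
      and G0: "\<forall>x y. x \<in> (\<Union>x\<in>T. U x) \<longrightarrow> \<bar>G (x, y) - F x y\<bar> < e" by (elim bexE)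
    have G': "\<forall>x y. x \<in> K \<longrightarrow> \<bar>G (x, y) - F x y\<bar> < e" using G0 T(3) by blast
    show ?thesis
    proof (intro bexI[of _ "\<lambda>z. if fst z \<in> K then G z else 0"] allI)
      have [measurable]: "K \<in> sets borel" using K by simp
      show "(\<lambda>z. if fst z \<in> K then G z else 0) \<in> borel_measurable (borel \<Otimes>\<^sub>M borel)" by measurable
      fix w show "\<bar>(if fst w \<in> K then G w else 0) - F (fst w) (snd w)\<bar> < e"
        using G'[rule_format, of "fst w" "snd w"] z(1)[of "fst w" "snd w"] e by simp
    qed
  qed
  then have "\<forall>n::nat. \<exists>G \<in> borel_measurable (borel \<Otimes>\<^sub>M borel). \<forall>z. \<bar>G z - F (fst z) (snd z)\<bar> < inverse (real (Suc n))"
    by simp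
  then obtain G where G: "\<And>n. G n \<in> borel_measurable (borel \<Otimes>\<^sub>M borel)"
    "\<And>n z. \<bar>G n z - F (fst z) (snd z)\<bar> < inverse (real (Suc n))" by metis
  show ?thesis
  proof (rule borel_measurable_LIMSEQ_real[OF _ G(1)])
    fix z
    have "(\<lambda>n. G n z - F (fst z) (snd z)) \<longlonglongrightarrow> 0"
    proof (rule tendsto_rabs_zero_cancel, rule real_tendsto_sandwich[OF _ _ tendsto_const LIMSEQ_inverse_real_of_nat])
      show "\<forall>\<^sub>F n in sequentially. \<bar>G n z - F (fst z) (snd z)\<bar> \<le> inverse (real (Suc n))"
        using G(2) by (intro always_eventually allI less_imp_le)
    qed simp
    then show "(\<lambda>n. G n z) \<longlonglongrightarrow> F (fst z) (snd z)" by (simp add: LIM_zero_iff)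
  qed
qed

text \<open>Since \<open>m\<close> need not be sigma-finite, Fubini's theorem is applied to the
  finite measures with densities \<open>indicator K\<close> and \<open>indicator L\<close>. As
  \<open>F\<close> vanishes off these sets, the iterated integrals are unchanged.\<close>

lemma Fubini_compact_support:
  fixes F :: "'g \<Rightarrow> 'g \<Rightarrow> real"
  assumes F: "continuous_on UNIV (\<lambda>z. F (fst z) (snd z))" and K: "compact K" and L: "compact L"
    and z: "\<And>x y. x \<notin> K \<Longrightarrow> F x y = 0" "\<And>x y. y \<notin> L \<Longrightarrow> F x y = 0"
  shows "(\<integral>x. (\<integral>y. F x y \<partial>m) \<partial>m) = (\<integral>y. (\<integral>x. F x y \<partial>m) \<partial>m)"
proof -
  let ?K = "density m (indicator K)" and ?L = "density m (indicator L)"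
  have [measurable]: "K \<in> sets borel" "L \<in> sets borel" using K L by auto
  have fK: "finite_measure (density m (indicator C))" if "compact C" for C
    using compact_finite[OF that] that by (intro finite_measureI) (simp add: emeasure_density)
  interpret K: finite_measure ?K by (rule fK[OF K])
  interpret L: finite_measure ?L by (rule fK[OF L])
  interpret P: pair_sigma_finite ?K ?L ..
  have c1: "continuous_on UNIV (F x)" for x
    using continuous_on_compose2[OF F, of UNIV "\<lambda>y. (x, y)"] by (simp add: continuous_intros)
  have c2: "continuous_on UNIV (\<lambda>x. F x y)" for y
    using continuous_on_compose2[OF F, of UNIV "\<lambda>x. (x, y)"] by (simp add: continuous_intros)
  have dens: "(\<integral>x. f x \<partial>density m (indicator C)) = (\<integral>x. f x \<partial>m)"
    if "continuous_on UNIV f" "\<And>x. x \<notin> C \<Longrightarrow> f x = 0" "compact C" for f :: "'g \<Rightarrow> real" and C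
  proof -
    have "(\<integral>x. f x \<partial>density m (\<lambda>x. ennreal (indicator C x))) = (\<integral>x. indicator C x *\<^sub>R f x \<partial>m)"
      using that by (intro integral_density) (auto simp: borel_measurable_continuous_onI)
    also have "\<dots> = (\<integral>x. f x \<partial>m)"
      using that(2) by (intro Bochner_Integration.integral_cong) (auto simp: indicator_def)
    finally show ?thesis by (simp add: ennreal_indicator)
  qed
  have bd: "bounded ((\<lambda>z. F (fst z) (snd z)) ` (K \<times> L))"
    using K L by (intro compact_imp_bounded compact_continuous_image compact_Times continuous_on_subset[OF F]) auto
  then obtain B where "\<forall>r\<in>(\<lambda>z. F (fst z) (snd z)) ` (K \<times> L). norm r \<le> B" unfolding bounded_iff by blast
  then have B: "\<bar>F x y\<bar> \<le> B" if "x \<in> K" "y \<in> L" for x y using that by fastforce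
  have B': "\<bar>F x y\<bar> \<le> \<bar>B\<bar>" for x y
  proof (cases "x \<in> K \<and> y \<in> L")
    case True
    then show ?thesis using B[of x y] by linarith
  next
    case False
    then have "F x y = 0" using z(1)[of x y] z(2)[of y x] by blast
    then show ?thesis by simp
  qed
  have "integrable (?K \<Otimes>\<^sub>M ?L) (\<lambda>(x, y). F x y)"
  proof -
    have "emeasure (?K \<Otimes>\<^sub>M ?L) (space ?K \<times> space ?L) = emeasure ?K (space ?K) * emeasure ?L (space ?L)"
      by (rule L.emeasure_pair_measure_Times) auto
    also have "\<dots> \<noteq> \<infinity>"
      using K.emeasure_finite L.emeasure_finite by (simp add: ennreal_mult_eq_top_iff)
    finally interpret KL: finite_measure "?K \<Otimes>\<^sub>M ?L"
      by (intro finite_measureI) (simp add: space_pair_measure)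
    have "(\<lambda>z. F (fst z) (snd z)) \<in> borel_measurable (borel \<Otimes>\<^sub>M borel)" by (rule measurable_product[OF F K L z])
    moreover have "sets (?K \<Otimes>\<^sub>M ?L) = sets (borel \<Otimes>\<^sub>M borel)" by (intro sets_pair_measure_cong) simp_all
    then have "borel_measurable (?K \<Otimes>\<^sub>M ?L) = borel_measurable (borel \<Otimes>\<^sub>M borel)"
      by (rule measurable_cong_sets[OF _ refl])
    ultimately have "(\<lambda>(x, y). F x y) \<in> borel_measurable (?K \<Otimes>\<^sub>M ?L)"
      unfolding split_beta' by blast
    then show ?thesis by (intro KL.integrable_const_bound[of _ "\<bar>B\<bar>"] AE_I2) (simp_all add: split_beta' B')
  qed
  from P.Fubini_integral[OF this]
  have "(\<integral>y. (\<integral>x. F x y \<partial>?K) \<partial>?L) = (\<integral>x. (\<integral>y. F x y \<partial>?L) \<partial>?K)" .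
  moreover have "(\<integral>x. F x y \<partial>?K) = (\<integral>x. F x y \<partial>m)" for y by (rule dens[OF c2 z(1) K])
  moreover have "(\<integral>y. F x y \<partial>?L) = (\<integral>y. F x y \<partial>m)" for x by (rule dens[OF c1 z(2) L])
  \<comment> \<open>For the outer integral \<open>dens\<close> needs a continuous integrand, which
    \<open>continuous_parametric_integral\<close> supplies.\<close>
  moreover have "(\<integral>x. (\<integral>y. F x y \<partial>m) \<partial>?K) = (\<integral>x. (\<integral>y. F x y \<partial>m) \<partial>m)"
  proof (intro dens K continuous_parametric_integral[OF F])
    show "\<exists>V L. open V \<and> x \<in> V \<and> compact L \<and> (\<forall>x'\<in>V. \<forall>y. y \<notin> L \<longrightarrow> F x' y = 0)" for x
      using L z(2) by (intro exI[of _ UNIV] exI[of _ L]) auto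
  qed (simp add: z(1))
  moreover have "(\<integral>y. (\<integral>x. F x y \<partial>m) \<partial>?L) = (\<integral>y. (\<integral>x. F x y \<partial>m) \<partial>m)"
  proof (intro dens L continuous_parametric_integral)
    show "continuous_on UNIV (\<lambda>w. F (snd w) (fst w))"
      using continuous_on_compose2[OF F, of UNIV "\<lambda>w. (snd w, fst w)"] by (simp add: continuous_intros)
    show "\<exists>V L. open V \<and> y \<in> V \<and> compact L \<and> (\<forall>y'\<in>V. \<forall>x. x \<notin> L \<longrightarrow> F x y' = 0)" for y
      using K z(1) by (intro exI[of _ UNIV] exI[of _ K]) auto
  qed (simp add: z(2))
  ultimately show ?thesis by simp
qed


section \<open>Construction of the modular function\<close>

lemma CcI: "continuous_on UNIV f \<Longrightarrow> compact C \<Longrightarrow> (\<And>x. x \<notin> C \<Longrightarrow> f x = 0) \<Longrightarrow> Cc f"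
  by (auto simp: Cc_def)

lemma Cc_right: assumes "Cc f" shows "Cc (\<lambda>y. f (y + x))"
proof -
  obtain C where C: "continuous_on UNIV f" "compact C" "\<And>x. x \<notin> C \<Longrightarrow> f x = 0"
    using assms by (auto simp: Cc_def)
  show ?thesis
  proof (rule CcI)
    show "continuous_on UNIV (\<lambda>y. f (y + x))"
      by (intro continuous_on_compose2[OF C(1)] continuous_intros) auto
    show "compact ((\<lambda>t. t + - x) ` C)" using C(2) by (intro compact_continuous_image continuous_intros)
    show "f (y + x) = 0" if "y \<notin> (\<lambda>t. t + - x) ` C" for y
    proof (rule C(3))
      show "y + x \<notin> C"
      proof
        assume "y + x \<in> C"
        then have "y \<in> (\<lambda>t. t + - x) ` C" by (intro image_eqI[of _ _ "y + x"]) (simp_all add: add.assoc)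
        then show False using that by blast
      qed
    qed
  qed
qed

lemma Cc_uminus: assumes "Cc f" shows "Cc (\<lambda>y. f (- y))"
proof -
  obtain C where C: "continuous_on UNIV f" "compact C" "\<And>x. x \<notin> C \<Longrightarrow> f x = 0"
    using assms by (auto simp: Cc_def)
  show ?thesis
  proof (rule CcI)
    show "continuous_on UNIV (\<lambda>y. f (- y))"
      by (intro continuous_on_compose2[OF C(1)] continuous_on_uminus_group) auto
    show "compact (uminus ` C)" by (rule compact_uminus_image[OF C(2)])
    show "f (- y) = 0" if "y \<notin> uminus ` C" for y
      using that by (intro C(3)) (metis imageI minus_minus)
  qed
qed

lemma right_translate_continuous:
  assumes "Cc f" shows "continuous_on UNIV (\<lambda>x. \<integral>y. f (y + x) \<partial>m)"
proof (rule continuous_parametric_integral)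
  obtain C where C: "continuous_on UNIV f" "compact C" "\<And>x. x \<notin> C \<Longrightarrow> f x = 0"
    using assms by (auto simp: Cc_def)
  show "continuous_on UNIV (\<lambda>z. f (snd z + fst z))"
    by (intro continuous_on_compose2[OF C(1)] continuous_intros) auto
  fix x :: 'g
  obtain V Q where V: "open V" "compact Q" "x \<in> V" "V \<subseteq> Q" by (rule compact_nbhd[of x])
  show "\<exists>V L. open V \<and> x \<in> V \<and> compact L \<and> (\<forall>x'\<in>V. \<forall>y. y \<notin> L \<longrightarrow> f (y + x') = 0)"
  \<comment> \<open>For \<open>x'\<close> in \<open>V\<close>, a point \<open>y\<close> with
    \<open>y + x'\<close> in \<open>C\<close> lies in \<open>C - Q\<close>, and this compact set
    does not depend on \<open>x'\<close>.\<close>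
  proof (rule exI[of _ V], rule exI[of _ "{u + v | u v. u \<in> C \<and> v \<in> uminus ` Q}"], intro conjI ballI allI impI)
    show "compact {u + v | u v. u \<in> C \<and> v \<in> uminus ` Q}"
      using C(2) V(2) by (intro compact_plus compact_uminus_image)
    fix x' y assume *: "x' \<in> V" "y \<notin> {u + v | u v. u \<in> C \<and> v \<in> uminus ` Q}"
    have "y + x' \<notin> C"
    proof
      assume "y + x' \<in> C"
      moreover have "y = (y + x') + - x'" by (simp add: add.assoc)
      ultimately show False using * V(4) by blast
    qed
    then show "f (y + x') = 0" by (rule C(3))
  qed (use V in auto)
qed

text \<open>The substitution \<open>x \<mapsto> y + x\<close> in the double integral of \<open>f x * g (- x + y)\<close> exhibits \<open>m\<close> as the
  image under inversion of a multiple of \<open>m\<close> by a continuous density. Varying \<open>f\<close> shows that this density does not depend on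
  \<open>f\<close> up to a factor, which yields the modular function.\<close>

lemma integral_product_inverse:
  assumes f: "Cc f" and g: "Cc g"
  shows "(\<integral>x. g (- x) * (\<integral>y. f (y + x) \<partial>m) \<partial>m) = (\<integral>x. f x \<partial>m) * (\<integral>x. g x \<partial>m)"
proof -
  obtain C where C: "continuous_on UNIV f" "compact C" "\<And>x. x \<notin> C \<Longrightarrow> f x = 0"
    using f by (auto simp: Cc_def)
  obtain D where D: "continuous_on UNIV g" "compact D" "\<And>x. x \<notin> D \<Longrightarrow> g x = 0"
    using g by (auto simp: Cc_def)
  have [measurable]: "f \<in> borel_measurable borel" "g \<in> borel_measurable borel"
    using C(1) D(1) by (auto intro: borel_measurable_continuous_onI)
  let ?P = "{u + v | u v. u \<in> C \<and> v \<in> D}"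
  have P: "compact ?P" using C D by (intro compact_plus)
  have Pz: "f x * g (- x + y) = 0" if "y \<notin> ?P" for x y
  proof (rule ccontr)
    assume "f x * g (- x + y) \<noteq> 0"
    then have "x \<in> C" "- x + y \<in> D" using C(3)[of x] D(3)[of "- x + y"] by auto
    moreover have "y = x + (- x + y)" by (simp add: add.assoc[symmetric])
    ultimately show False using that by blast
  qed
  have Pz': "f (y + x) * g (- x) = 0" if "y \<notin> ?P" for x y
  proof (rule ccontr)
    assume "f (y + x) * g (- x) \<noteq> 0"
    then have "y + x \<in> C" "- x \<in> D" using C(3)[of "y + x"] D(3)[of "- x"] by auto
    moreover have "y = (y + x) + (- x)" by (simp add: add.assoc)
    ultimately show False using that by blast
  qed
  have "(\<integral>x. g (- x) * (\<integral>y. f (y + x) \<partial>m) \<partial>m) = (\<integral>x. (\<integral>y. f (y + x) * g (- x) \<partial>m) \<partial>m)"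
    by (simp add: mult.commute)
  also have "\<dots> = (\<integral>y. (\<integral>x. f (y + x) * g (- x) \<partial>m) \<partial>m)"
  proof (rule Fubini_compact_support[of _ "uminus ` D" ?P])
    show "continuous_on UNIV (\<lambda>z. f (snd z + fst z) * g (- fst z))"
      by (intro continuous_on_mult continuous_on_compose2[OF C(1)] continuous_on_compose2[OF D(1)]
        continuous_intros) auto
    show "compact (uminus ` D)" by (rule compact_uminus_image[OF D(2)])
    show "f (y + x) * g (- x) = 0" if "x \<notin> uminus ` D" for x y
      using that D(3)[of "- x"] by (metis imageI minus_minus mult_zero_right)
  qed (use P Pz' in auto)
  also have "\<dots> = (\<integral>y. (\<integral>x. f x * g (- x + y) \<partial>m) \<partial>m)"
  proof (rule Bochner_Integration.integral_cong[OF refl])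
    fix y
    have "(\<integral>x. f (y + x) * g (- (y + x) + y) \<partial>m) = (\<integral>x. f x * g (- x + y) \<partial>m)"
      by (rule integral_left) measurable
    then show "(\<integral>x. f (y + x) * g (- x) \<partial>m) = (\<integral>x. f x * g (- x + y) \<partial>m)"
      by (simp add: minus_add add.assoc)
  qed
  also have "\<dots> = (\<integral>x. (\<integral>y. f x * g (- x + y) \<partial>m) \<partial>m)"
  proof (rule Fubini_compact_support[symmetric, of _ C ?P])
    show "continuous_on UNIV (\<lambda>z. f (fst z) * g (- fst z + snd z))"
      by (intro continuous_on_mult continuous_on_compose2[OF C(1)] continuous_on_compose2[OF D(1)]
        continuous_intros) auto
  qed (use P Pz C in auto)
  also have "\<dots> = (\<integral>x. f x * (\<integral>y. g y \<partial>m) \<partial>m)"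
    using integral_left[of g] by (intro Bochner_Integration.integral_cong[OF refl]) simp
  finally show ?thesis by simp
qed

text \<open>The function vanishes almost everywhere, and the open set where it is positive would
  have positive measure if it were nonempty.\<close>

lemma integral_zero_imp_zero:
  fixes f :: "'g \<Rightarrow> real"
  assumes "continuous_on UNIV f" "\<And>x. 0 \<le> f x" "integrable m f" "(\<integral>x. f x \<partial>m) = 0"
  shows "f x = 0"
proof (rule ccontr)
  assume "f x \<noteq> 0"
  have "open {x. 0 < f x}" using assms(1) by (intro open_Collect_less) auto
  then have "0 < emeasure m {x. 0 < f x}" using \<open>f x \<noteq> 0\<close> assms(2)[of x] by (intro open_pos[of _ x]) auto
  moreover have "AE x in m. f x = 0" using integral_nonneg_eq_0_iff_AE[OF assms(3)] assms(2,4) by simp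
  then have "emeasure m {x. 0 < f x} = 0"
  proof (rule AE_iff_measurable[THEN iffD1, rotated 2])
    show "{x \<in> space m. f x \<noteq> 0} = {x. 0 < f x}" using assms(2) by (auto simp: order_less_le)
  qed (use \<open>open {x. 0 < f x}\<close> in simp)
  ultimately show False by simp
qed

lemma bump_point:
  fixes x :: 'g
  shows "\<exists>(f :: 'g \<Rightarrow> real) C. continuous_on UNIV f \<and> (\<forall>x. 0 \<le> f x) \<and> f x = 1 \<and> compact C \<and> (\<forall>x. x \<notin> C \<longrightarrow> f x = 0)"
  by (rule bump[of "{x}" UNIV]) (simp_all, blast)

lemma exists_normalized: "\<exists>f. Cc f \<and> (\<forall>x. 0 \<le> f x) \<and> (\<integral>x. f x \<partial>m) = 1"
proof -
  obtain f C where f: "continuous_on UNIV f" "\<And>x. 0 \<le> f x" "f (0::'g) = (1::real)" "compact C" "\<And>x. x \<notin> C \<Longrightarrow> f x = 0"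
    using bump_point[of 0] by blast
  have Cc: "Cc f" using f by (intro CcI)
  have "(\<integral>x. f x \<partial>m) \<noteq> 0" using integral_zero_imp_zero[OF f(1,2) Cc_integrable[OF Cc], of 0] f(3) by auto
  moreover have "(\<integral>x. f x \<partial>m) \<ge> 0" using f(2) by simp
  ultimately have pos: "(\<integral>x. f x \<partial>m) > 0" by simp
  show ?thesis
    using f pos by (intro exI[of _ "\<lambda>x. f x / (\<integral>x. f x \<partial>m)"] conjI CcI[of _ C] continuous_intros) auto
qed

definition f0 :: "'g \<Rightarrow> real" where
  "f0 = (SOME f. Cc f \<and> (\<forall>x. 0 \<le> f x) \<and> (\<integral>x. f x \<partial>m) = 1)"

lemma f0: "Cc f0" "0 \<le> f0 x" "(\<integral>x. f0 x \<partial>m) = 1"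
  using someI_ex[OF exists_normalized] unfolding f0_def by auto

text \<open>The modular function in the convention in which the set of all \<open>t\<close> with
  \<open>t + x\<close> in \<open>E\<close> has measure \<open>modular x * m(E)\<close>; the factor
  for the set \<open>E + x\<close> is the reciprocal. By \<open>integral_right_Cc\<close> the choice
  of \<open>f0\<close> does not matter.\<close>

definition modular :: "'g \<Rightarrow> real" where "modular x = (\<integral>y. f0 (y + x) \<partial>m)"

lemma modular_continuous: "continuous_on UNIV modular"
  unfolding modular_def by (rule right_translate_continuous[OF f0(1)])

lemma modular_nonneg: "0 \<le> modular x"
  unfolding modular_def using f0(2) by simp

lemma integral_inverse_Cc: "Cc g \<Longrightarrow> (\<integral>x. g (- x) * modular x \<partial>m) = (\<integral>x. g x \<partial>m)"
  using integral_product_inverse[OF f0(1), of g] by (simp add: f0(3) modular_def)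

text \<open>Comparing \<open>integral_product_inverse\<close> for \<open>f\<close> and for
  \<open>f0\<close> shows that the continuous defect \<open>k\<close> integrates to zero against
  every \<open>g\<close> with \<open>Cc g\<close>. Testing with \<open>b * k\<close> for a bump
  function \<open>b\<close> at \<open>x\<close> forces \<open>k x = 0\<close>.\<close>

lemma integral_right_Cc:
  assumes f: "Cc f" shows "(\<integral>y. f (y + x) \<partial>m) = modular x * (\<integral>y. f y \<partial>m)"
proof -
  define k where "k x = (\<integral>y. f (y + x) \<partial>m) - modular x * (\<integral>y. f y \<partial>m)" for x
  have ck: "continuous_on UNIV k"
    unfolding k_def by (intro continuous_intros right_translate_continuous f modular_continuous)
  have *: "(\<integral>x. g x * k x \<partial>m) = 0" if g: "Cc g" for g
  proof -
    have gm: "Cc (\<lambda>x. g (- x))" by (rule Cc_uminus[OF g])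
    have i1: "integrable m (\<lambda>x. g x * h x)" if "continuous_on UNIV h" for h
      using g that by (auto simp: Cc_def intro!: integrable_compact_support continuous_intros)
    have "(\<integral>x. g x * k x \<partial>m) = (\<integral>x. g x * (\<integral>y. f (y + x) \<partial>m) - g x * (modular x * (\<integral>y. f y \<partial>m)) \<partial>m)"
      by (simp add: k_def right_diff_distrib)
    also have "\<dots> = (\<integral>x. g x * (\<integral>y. f (y + x) \<partial>m) \<partial>m) - (\<integral>x. g x * (modular x * (\<integral>y. f y \<partial>m)) \<partial>m)"
      by (intro Bochner_Integration.integral_diff i1 right_translate_continuous f continuous_intros modular_continuous)
    also have "(\<integral>x. g x * (modular x * (\<integral>y. f y \<partial>m)) \<partial>m) = (\<integral>x. g x * modular x \<partial>m) * (\<integral>y. f y \<partial>m)"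
      by (simp add: mult.assoc[symmetric])
    finally show ?thesis
      using integral_product_inverse[OF f gm] integral_inverse_Cc[OF gm] by simp
  qed
  obtain b C where b: "continuous_on UNIV b" "\<And>x. 0 \<le> b x" "b x = (1::real)" "compact C" "\<And>x. x \<notin> C \<Longrightarrow> b x = 0"
    using bump_point[of x] by blast
  have Cb: "Cc (\<lambda>x. b x * k x)" using b ck by (intro CcI[of _ C] continuous_intros) auto
  have c: "continuous_on UNIV (\<lambda>x. b x * k x * k x)" using b ck by (intro continuous_intros)
  have "b x * k x * k x = 0"
  proof (rule integral_zero_imp_zero[OF c _ _ *[OF Cb]])
    show "0 \<le> b x * k x * k x" for x using b(2)[of x] by (simp add: mult.assoc)
    show "integrable m (\<lambda>x. b x * k x * k x)" using b by (intro integrable_compact_support[OF c b(4)]) auto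
  qed
  then show ?thesis using b(3) by (simp add: k_def)
qed

lemma modular_uminus: "modular x * modular (- x) = 1"
proof -
  have "(\<integral>y. f0 (y + - x + x) \<partial>m) = modular (- x) * modular x"
    using integral_right_Cc[OF Cc_right[OF f0(1)], of "- x" x] by (simp only: modular_def)
  then show ?thesis by (simp add: f0(3) mult.commute)
qed

lemma modular_pos: "0 < modular x"
  using modular_uminus[of x] modular_nonneg[of x] by (metis mult_zero_left order_less_le zero_neq_one)

lemma modular_uminus_ennreal: "ennreal (modular x) * ennreal (modular (- x)) = 1"
  by (simp add: ennreal_mult[symmetric] modular_nonneg modular_uminus)

section \<open>Right translation of Borel sets\<close>

lemma open_right_vimage: "open U \<Longrightarrow> open ((\<lambda>t. t + x) -` (U :: 'g set))"
  by (intro open_vimage continuous_intros)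

lemma right_vimage_sets: "E \<in> sets borel \<Longrightarrow> (\<lambda>t. t + x) -` E \<in> sets (borel :: 'g measure)"
  using measurable_sets[OF measurable_right_add, of E x] by simp

lemma right_vimage_uminus: "(\<lambda>t. t + - x) -` (\<lambda>t. t + x) -` E = (E :: 'g set)"
  "(\<lambda>t. t - x) -` (\<lambda>t. t + x) -` E = (E :: 'g set)"
  by (auto simp: add.assoc)

text \<open>Inner regularity reduces the estimate to compact \<open>K \<subseteq> U\<close>, where a
  bump function between \<open>K\<close> and \<open>U\<close> transfers it from
  \<open>integral_right_Cc\<close>.\<close>

lemma emeasure_right_open_ge:
  assumes U: "open U"
  shows "ennreal (modular x) * emeasure m U \<le> emeasure m ((\<lambda>t. t + x) -` U)"
proof -
  have "ennreal (modular x) * emeasure m K \<le> emeasure m ((\<lambda>t. t + x) -` U)"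
    if K: "compact K" "K \<subseteq> U" for K
  proof -
    obtain f C where f: "continuous_on UNIV f" "\<And>x. 0 \<le> f x" "\<And>x. f x \<le> (1::real)" "\<And>x. x \<in> K \<Longrightarrow> f x = 1"
      "\<And>x. x \<notin> U \<Longrightarrow> f x = 0" "compact C" "\<And>x. x \<notin> C \<Longrightarrow> f x = 0"
      using bump[OF K(1) U K(2)] by auto
    have Cf: "Cc f" using f by (intro CcI)
    have [measurable]: "f \<in> borel_measurable borel" "U \<in> sets borel"
      using f(1) U by (auto intro: borel_measurable_continuous_onI)
    have "emeasure m K = (\<integral>\<^sup>+ y. indicator K y \<partial>m)" using K by (simp add: compact_sets)
    also have "\<dots> \<le> (\<integral>\<^sup>+ y. ennreal (f y) \<partial>m)"
      using f(4) by (intro nn_integral_mono) (auto simp: indicator_def)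
    also have "\<dots> = ennreal (\<integral>y. f y \<partial>m)"
      using Cc_integrable[OF Cf] f(2) by (intro nn_integral_eq_integral) auto
    finally have "ennreal (modular x) * emeasure m K \<le> ennreal (modular x) * ennreal (\<integral>y. f y \<partial>m)"
      by (rule mult_left_mono) simp
    also have "\<dots> = ennreal (\<integral>y. f (y + x) \<partial>m)"
      using f(2) by (simp add: ennreal_mult[symmetric] modular_nonneg integral_right_Cc[OF Cf])
    also have "\<dots> = (\<integral>\<^sup>+ y. ennreal (f (y + x)) \<partial>m)"
      using Cc_integrable[OF Cc_right[OF Cf]] f(2) by (intro nn_integral_eq_integral[symmetric]) auto
    also have "\<dots> \<le> (\<integral>\<^sup>+ y. indicator ((\<lambda>t. t + x) -` U) y \<partial>m)"
      using f(3,5) by (intro nn_integral_mono) (auto simp: indicator_def)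
    also have "\<dots> = emeasure m ((\<lambda>t. t + x) -` U)"
      using U by (simp add: right_vimage_sets)
    finally show ?thesis .
  qed
  then show ?thesis
    unfolding inner_regular[OF U] SUP_mult_left_ennreal by (intro SUP_least) auto
qed

lemma modular_cancel:
  assumes "ennreal (modular (- x)) * a \<le> b" shows "a \<le> ennreal (modular x) * b"
proof -
  have "ennreal (modular x) * (ennreal (modular (- x)) * a) \<le> ennreal (modular x) * b"
    using assms by (rule mult_left_mono) simp
  then show ?thesis by (simp add: mult.assoc[symmetric] modular_uminus_ennreal)
qed

text \<open>Outer regularity passes from open sets to Borel sets. The upper bound for
  \<open>x\<close> is the lower bound for \<open>- x\<close>, applied to translates of open sets
  \<open>U \<supseteq> E\<close>, because \<open>modular x\<close> and \<open>modular (- x)\<close>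
  are reciprocal.\<close>

lemma emeasure_right_le:
  assumes E: "E \<in> sets borel"
  shows "emeasure m ((\<lambda>t. t + x) -` E) \<le> ennreal (modular x) * emeasure m E"
proof (rule modular_cancel)
  have "ennreal (modular (- x)) * emeasure m ((\<lambda>t. t + x) -` E) \<le> emeasure m U" if U: "open U" "E \<subseteq> U" for U
  proof -
    have "emeasure m ((\<lambda>t. t + x) -` E) \<le> emeasure m ((\<lambda>t. t + x) -` U)"
      using U by (intro emeasure_mono) (auto simp: right_vimage_sets)
    then have "ennreal (modular (- x)) * emeasure m ((\<lambda>t. t + x) -` E)
        \<le> ennreal (modular (- x)) * emeasure m ((\<lambda>t. t + x) -` U)"
      by (rule mult_left_mono) simp
    also have "\<dots> \<le> emeasure m U"
      using emeasure_right_open_ge[OF open_right_vimage[OF U(1), of x], of "- x"] by (simp add: right_vimage_uminus)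
    finally show ?thesis .
  qed
  then show "ennreal (modular (- x)) * emeasure m ((\<lambda>t. t + x) -` E) \<le> emeasure m E"
    unfolding outer_regular[OF E] by (intro INF_greatest) auto
qed

lemma emeasure_right:
  assumes E: "E \<in> sets borel"
  shows "emeasure m ((\<lambda>t. t + x) -` E) = ennreal (modular x) * emeasure m E"
proof (rule antisym[OF emeasure_right_le[OF E]])
  have "emeasure m E \<le> ennreal (modular (- x)) * emeasure m ((\<lambda>t. t + x) -` E)"
    using emeasure_right_le[OF right_vimage_sets[OF E, of x], of "- x"] by (simp add: right_vimage_uminus)
  then have "ennreal (modular x) * emeasure m E
      \<le> ennreal (modular x) * (ennreal (modular (- x)) * emeasure m ((\<lambda>t. t + x) -` E))"
    by (rule mult_left_mono) simp
  then show "ennreal (modular x) * emeasure m E \<le> emeasure m ((\<lambda>t. t + x) -` E)"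
    by (simp add: mult.assoc[symmetric] modular_uminus_ennreal)
qed

lemma distr_right: "distr m m (\<lambda>t. t + x) = density m (\<lambda>_. ennreal (modular x))"
proof (rule measure_eqI)
  fix A assume "A \<in> sets (distr m m (\<lambda>t. t + x))"
  then have A: "A \<in> sets borel" by simp
  then have "emeasure (distr m m (\<lambda>t. t + x)) A = emeasure m ((\<lambda>t. t + x) -` A)"
    by (subst emeasure_distr) (simp_all add: measurable_cong_sets[OF sets_m sets_m])
  then show "emeasure (distr m m (\<lambda>t. t + x)) A = emeasure (density m (\<lambda>_. ennreal (modular x))) A"
    using A by (simp add: emeasure_right emeasure_density_const)
qed simp

lemma integral_right:
  fixes h :: "'g \<Rightarrow> 'b::{banach, second_countable_topology}"
  assumes "h \<in> borel_measurable borel"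
  shows "(\<integral>t. h (t + x) \<partial>m) = modular x *\<^sub>R (\<integral>t. h t \<partial>m)"
  using integral_distr[of "\<lambda>t. t + x" m m h] integral_density[of h m "\<lambda>_. modular x"] assms
  by (simp add: distr_right modular_nonneg measurable_cong_sets[OF sets_m sets_m])

lemma integrable_right:
  fixes h :: "'g \<Rightarrow> 'b::{banach, second_countable_topology}"
  assumes "h \<in> borel_measurable borel" "integrable m h"
  shows "integrable m (\<lambda>t. h (t + x))"
  using integrable_distr_eq[of "\<lambda>t. t + x" m m h] integrable_density[of h m "\<lambda>_. modular x"] assms
  by (simp add: distr_right modular_nonneg measurable_cong_sets[OF sets_m sets_m])

lemma AE_right:
  assumes "AE t in m. P t" shows "AE t in m. P (t + x)"
proof -
  have "AE t in distr m m (\<lambda>t. t + x). P t"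
    unfolding distr_right using assms by (subst AE_density) (auto elim: eventually_mono)
  then show ?thesis by (rule AE_distrD[rotated]) (simp add: measurable_cong_sets[OF sets_m sets_m])
qed

section \<open>Inversion and null sets\<close>

lemma ennreal_zero_of_le:
  assumes "\<And>e. 0 < e \<Longrightarrow> (x :: ennreal) \<le> ennreal e" shows "x = 0"
proof -
  have "x \<le> 0"
  proof (rule ennreal_le_epsilon)
    fix e :: real assume "0 < e"
    from assms[OF this] show "x \<le> 0 + ennreal e" by (simp only: add_0)
  qed
  then show ?thesis by simp
qed

text \<open>On the inverse of the compact set \<open>C\<close> the continuous function
  \<open>modular\<close> is bounded below by some \<open>c > 0\<close>. Hence
  \<open>integral_inverse_Cc\<close> bounds the measure of the inverse of an open
  \<open>U \<subseteq> C\<close> by \<open>measure m U / c\<close>, and outer regularity makes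
  \<open>measure m U\<close> as small as desired.\<close>

lemma uminus_null:
  assumes N: "N \<in> sets borel" "N \<subseteq> K" "compact K" "emeasure m N = 0"
  shows "emeasure m (uminus ` N) = 0"
proof -
  obtain V C where V: "open V" "compact C" "K \<subseteq> V" "V \<subseteq> C" using compact_set_nbhd[OF N(3)] by metis
  have cC: "compact (uminus ` C)" by (rule compact_uminus_image[OF V(2)])
  obtain c where c: "c > 0" "\<And>x. x \<in> uminus ` C \<Longrightarrow> c \<le> modular x"
  proof (cases "C = {}")
    case False
    then obtain x0 where "x0 \<in> uminus ` C" "\<And>x. x \<in> uminus ` C \<Longrightarrow> modular x0 \<le> modular x"
      using continuous_attains_inf[OF cC _ continuous_on_subset[OF modular_continuous]] by auto
    then show ?thesis using that[of "modular x0"] modular_pos by blast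
  qed (use that[of 1] in auto)
  have "emeasure m (uminus ` N) \<le> ennreal e" if e: "e > 0" for e
  proof -
    have "emeasure m N < ennreal (c * e)" using c e by (simp add: N(4))
    then obtain W where W: "open W" "N \<subseteq> W" "emeasure m W < ennreal (c * e)"
      using outer_approx[OF N(1)] by blast
    define U where "U = W \<inter> V"
    have U: "open U" "N \<subseteq> U" "U \<subseteq> C" using W V N(2) by (auto simp: U_def)
    have "emeasure m U \<le> emeasure m W" using W U by (intro emeasure_mono) (auto simp: U_def)
    then have mU: "emeasure m U < ennreal (c * e)" using W(3) by simp
    have oU: "open (uminus ` U)" by (rule open_uminus_image[OF U(1)])
    have "emeasure m Q \<le> ennreal e" if Q: "compact Q" "Q \<subseteq> uminus ` U" for Q
    proof -
      obtain h D where h: "continuous_on UNIV h" "\<And>x. 0 \<le> h x" "\<And>x. h x \<le> (1::real)" "\<And>x. x \<in> Q \<Longrightarrow> h x = 1"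
        "\<And>x. x \<notin> uminus ` U \<Longrightarrow> h x = 0" "compact D" "\<And>x. x \<notin> D \<Longrightarrow> h x = 0"
        using bump[OF Q(1) oU Q(2)] by auto
      have Ch: "Cc h" using h by (intro CcI)
      have Cg: "Cc (\<lambda>x. h (- x))" by (rule Cc_uminus[OF Ch])
      have [measurable]: "h \<in> borel_measurable borel" using h(1) by (rule borel_measurable_continuous_onI)
      have "emeasure m Q = (\<integral>\<^sup>+ y. indicator Q y \<partial>m)" using Q by (simp add: compact_sets)
      also have "\<dots> \<le> (\<integral>\<^sup>+ y. ennreal (h y) \<partial>m)"
        using h(4) by (intro nn_integral_mono) (auto simp: indicator_def)
      also have "\<dots> = ennreal (\<integral>y. h y \<partial>m)"
        using Cc_integrable[OF Ch] h(2) by (intro nn_integral_eq_integral) auto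
      also have "\<dots> \<le> ennreal e"
      proof -
        have "c * (\<integral>y. h y \<partial>m) = (\<integral>y. h y * c \<partial>m)" by simp
        also have "\<dots> \<le> (\<integral>y. h y * modular y \<partial>m)"
        proof (rule integral_mono)
          show "integrable m (\<lambda>y. h y * c)" using Cc_integrable[OF Ch] by simp
          show "integrable m (\<lambda>y. h y * modular y)"
            using h(1,6,7) modular_continuous by (intro integrable_compact_support[of _ D] continuous_intros) auto
          fix y show "h y * c \<le> h y * modular y"
          proof (cases "y \<in> uminus ` U")
            case True
            then show ?thesis using U(3) c(2) h(2) by (intro mult_left_mono) auto
          qed (simp add: h(5))
        qed
        also have "\<dots> = (\<integral>y. h (- y) \<partial>m)" using integral_inverse_Cc[OF Cg] by simp
        also have "\<dots> \<le> (\<integral>y. indicator U y \<partial>m)"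
        proof (rule integral_mono)
          show "integrable m (\<lambda>y. h (- y))" by (rule Cc_integrable[OF Cg])
          show "integrable m (indicator U :: 'g \<Rightarrow> real)"
            using U(1) order_less_trans[OF mU ennreal_less_top] by simp
          show "h (- y) \<le> indicator U y" for y
            using h(3)[of "- y"] h(5)[of "- y"] by (auto simp: indicator_def image_iff)
        qed
        also have "\<dots> = measure m U" by simp
        also have "\<dots> \<le> c * e" using mU c e by (simp add: measure_def enn2real_leI less_imp_le)
        finally show ?thesis using c by (simp add: ennreal_leI)
      qed
      finally show ?thesis .
    qed
    then have "emeasure m (uminus ` U) \<le> ennreal e"
      unfolding inner_regular[OF oU] by (intro SUP_least) auto
    moreover have "emeasure m (uminus ` N) \<le> emeasure m (uminus ` U)"
      using U oU by (intro emeasure_mono) auto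
    ultimately show ?thesis by simp
  qed
  then show ?thesis by (rule ennreal_zero_of_le)
qed


text \<open>Null sets need only be stable under inversion locally, because an integrable function
  lives on a countable union of compact sets up to a null set.\<close>

lemma AE_convolution_null:
  fixes a :: "'g \<Rightarrow> complex"
  assumes a: "integrable m a" and N: "N \<in> sets borel" "emeasure m N = 0"
  shows "AE t in m. a t = 0 \<or> - t + s \<notin> N"
proof -
  have [measurable]: "a \<in> borel_measurable borel" using borel_measurable_integrable[OF a] by simp
  define Z where "Z = (\<lambda>t. - t + s) -` N"
  have [measurable]: "Z \<in> sets borel"
    using measurable_sets[OF measurable_neg_add N(1)] by (simp add: Z_def)
  have cZ: "emeasure m (Q \<inter> Z) = 0" if Q: "compact Q" for Q
  proof -
    \<comment> \<open>Points \<open>t\<close> of \<open>Q\<close> reach only the part of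
      \<open>N\<close> in the compact set \<open>- Q + s\<close>, so \<open>uminus_null\<close>
      applies to this part.\<close>
    have Q': "compact {u + v | u v. u \<in> uminus ` Q \<and> v \<in> {s}}"
      using Q by (intro compact_plus compact_uminus_image) auto
    define N' where "N' = N \<inter> {u + v | u v. u \<in> uminus ` Q \<and> v \<in> {s}}"
    have N's: "N' \<in> sets borel" using N(1) compact_sets[OF Q'] unfolding N'_def by (rule sets.Int)
    have "emeasure m N' \<le> emeasure m N" using N(1) by (intro emeasure_mono) (simp_all add: N'_def)
    then have N'0: "emeasure m N' = 0" using N(2) by simp
    have "emeasure m (uminus ` N') = 0"
      by (rule uminus_null[OF N's _ Q' N'0]) (simp add: N'_def)
    then have null: "emeasure m ((\<lambda>t. s + t) ` (uminus ` N')) = 0"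
      using emeasure_translate[OF uminus_image_sets[OF N's]] by simp
    have "Q \<inter> Z \<subseteq> (\<lambda>t. s + t) ` (uminus ` N')"
    proof
      fix t assume t: "t \<in> Q \<inter> Z"
      have "- t + s \<in> N'" using t by (auto simp: Z_def N'_def)
      moreover have "t = s + - (- t + s)" by (simp add: minus_add add.assoc[symmetric])
      ultimately show "t \<in> (\<lambda>t. s + t) ` (uminus ` N')" by blast
    qed
    then have "emeasure m (Q \<inter> Z) \<le> emeasure m ((\<lambda>t. s + t) ` (uminus ` N'))"
      by (intro emeasure_mono) (simp_all add: left_image_sets uminus_image_sets N's)
    then show ?thesis using null by simp
  qed
  \<comment> \<open>Inner regularity is granted for open sets only, hence the passage from compact
    sets to open sets of finite measure.\<close>
  have oZ: "emeasure m (U \<inter> Z) = 0" if U: "open U" "emeasure m U < \<infinity>" for U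
  proof -
    have "emeasure m (U \<inter> Z) \<le> ennreal e" if e: "e > 0" for e :: real
    proof (cases "emeasure m U = 0")
      case True
      then show ?thesis using emeasure_mono[of "U \<inter> Z" U m] U(1) by simp
    next
      case False
      then have "emeasure m U - ennreal e < emeasure m U"
        using e U(2) by (intro ennreal_between) (auto simp: less_top[symmetric] zero_less_iff_neq_zero)
      then obtain Q where Q: "compact Q" "Q \<subseteq> U" "emeasure m U - ennreal e < emeasure m Q"
        using inner_approx[OF U(1)] by blast
      have Qs: "Q \<in> sets borel" "U \<in> sets borel" using Q U by (auto simp: compact_sets)
      have "emeasure m (U \<inter> Z) \<le> emeasure m ((U - Q) \<union> (Q \<inter> Z))"
        using Qs by (intro emeasure_mono) auto
      also have "\<dots> \<le> emeasure m (U - Q) + emeasure m (Q \<inter> Z)"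
        using Qs by (intro emeasure_subadditive) auto
      also have "\<dots> = emeasure m (U - Q)" by (simp add: cZ Q)
      also have "\<dots> = emeasure m U - emeasure m Q"
        using Qs Q compact_finite[OF Q(1)] by (intro emeasure_Diff) (auto simp: less_top)
      also have "\<dots> \<le> ennreal e"
        using less_imp_le[OF Q(3)] U(2) by (auto simp: ennreal_minus_le_iff add.commute)
      finally show ?thesis .
    qed
    then show ?thesis by (rule ennreal_zero_of_le)
  qed
  \<comment> \<open>Markov's inequality gives the level set finite measure, and outer regularity
    places it in an open set of finite measure, where \<open>oZ\<close> applies.\<close>
  have null: "emeasure m ({t. inverse (real (Suc n)) \<le> cmod (a t)} \<inter> Z) = 0" for n
  proof -
    let ?E = "{t. inverse (real (Suc n)) \<le> cmod (a t)}"
    have E: "?E \<in> sets borel" by measurable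
    have "emeasure m {t\<in>space m. inverse (real (Suc n)) \<le> cmod (a t)}
        \<le> ennreal (1 / inverse (real (Suc n)) * (\<integral>t. cmod (a t) \<partial>m))"
      by (rule integral_Markov_inequality[OF integrable_norm[OF a]]) auto
    also have "\<dots> < \<infinity>" by simp
    finally have fin: "emeasure m ?E < \<infinity>" by simp
    obtain U where U: "open U" "?E \<subseteq> U" "emeasure m U < \<infinity>" by (rule outer_approx[OF E fin])
    have "emeasure m (?E \<inter> Z) \<le> emeasure m (U \<inter> Z)"
      using U by (intro emeasure_mono) auto
    then show ?thesis using oZ[OF U(1,3)] by simp
  qed
  have "(\<Union>n. {t. inverse (real (Suc n)) \<le> cmod (a t)} \<inter> Z) \<in> null_sets m"
    using null by (intro null_sets_UN) (auto simp: null_sets_def)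
  then show ?thesis
  proof (rule AE_I')
    show "{t \<in> space m. \<not> (a t = 0 \<or> - t + s \<notin> N)} \<subseteq> (\<Union>n. {t. inverse (real (Suc n)) \<le> cmod (a t)} \<inter> Z)"
    proof
      fix t assume "t \<in> {t \<in> space m. \<not> (a t = 0 \<or> - t + s \<notin> N)}"
      then have "cmod (a t) > 0" "t \<in> Z" by (auto simp: Z_def)
      then show "t \<in> (\<Union>n. {t. inverse (real (Suc n)) \<le> cmod (a t)} \<inter> Z)"
        using reals_Archimedean[of "cmod (a t)"] by (auto intro: less_imp_le)
    qed
  qed
qed

end

section \<open>Convolution of classes of functions\<close>

text \<open>Hoelder's inequality for the measure with density \<open>w\<close>, stated so that
  \<open>w\<close> need not be normalized. It results from integrating Young's inequality for
  \<open>cmod (h x) / c\<close> against \<open>w\<close>.\<close>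

lemma jensen_powr:
  fixes w :: "'a \<Rightarrow> real" and h :: "'a \<Rightarrow> complex"
  assumes p: "1 \<le> p" and w: "integrable M w" "\<And>x. 0 \<le> w x"
    and h: "h \<in> borel_measurable M" and wh: "integrable M (\<lambda>x. w x * cmod (h x) powr p)"
  shows "cmod (\<integral>x. of_real (w x) * h x \<partial>M) powr p
    \<le> (\<integral>x. w x \<partial>M) powr (p - 1) * (\<integral>x. w x * cmod (h x) powr p \<partial>M)"
proof -
  define W where "W = (\<integral>x. w x \<partial>M)"
  define B where "B = (\<integral>x. w x * cmod (h x) powr p \<partial>M)"
  have W0: "0 \<le> W" unfolding W_def using w by simp
  have B0: "0 \<le> B" unfolding B_def using w by simp
  have wm [measurable]: "w \<in> borel_measurable M" by (rule borel_measurable_integrable[OF w(1)])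
  note h [measurable]
  have le1: "w x * cmod (h x) \<le> w x + w x * cmod (h x) powr p" for x
  proof -
    have "cmod (h x) \<le> 1 + cmod (h x) powr p"
    proof (cases "cmod (h x) \<le> 1")
      case True
      then show ?thesis using powr_ge_zero[of "cmod (h x)" p] by linarith
    next
      case False
      then have "cmod (h x) powr 1 \<le> cmod (h x) powr p" using p by (intro powr_mono) auto
      then show ?thesis using False by simp
    qed
    then show ?thesis using mult_left_mono[OF _ w(2)[of x], of "cmod (h x)" "1 + cmod (h x) powr p"]
      by (simp add: distrib_left)
  qed
  have int: "integrable M (\<lambda>x. w x * cmod (h x))"
  proof (rule Bochner_Integration.integrable_bound[OF Bochner_Integration.integrable_add[OF w(1) wh]])
    show "AE x in M. norm (w x * cmod (h x)) \<le> norm (w x + w x * cmod (h x) powr p)"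
      using le1 w(2) by (intro AE_I2) (simp add: abs_of_nonneg)
  qed measurable
  define I where "I = (\<integral>x. w x * cmod (h x) \<partial>M)"
  have "cmod (\<integral>x. of_real (w x) * h x \<partial>M) \<le> I"
    unfolding I_def using integral_norm_bound[of M "\<lambda>x. of_real (w x) * h x"] w(2)
    by (simp add: norm_mult)
  then have 1: "cmod (\<integral>x. of_real (w x) * h x \<partial>M) powr p \<le> I powr p"
    using p by (intro powr_mono2) auto
  have I0: "I = 0" if "AE x in M. w x * cmod (h x) = 0"
    unfolding I_def using integral_cong_AE[OF _ _ that] by simp
  have "I powr p \<le> W powr (p - 1) * B"
  proof (cases "W = 0 \<or> B = 0")
    case True
    have "AE x in M. w x * cmod (h x) = 0"
    proof (cases "W = 0")
      case True
      then have "AE x in M. w x = 0"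
        using integral_nonneg_eq_0_iff_AE[OF w(1)] w(2) by (simp add: W_def)
      then show ?thesis by eventually_elim simp
    next
      case False
      then have "B = 0" using True by simp
      then have "AE x in M. w x * cmod (h x) powr p = 0"
        using integral_nonneg_eq_0_iff_AE[OF wh] w(2) by (simp add: B_def)
      then show ?thesis by eventually_elim auto
    qed
    then show ?thesis using I0 B0 by simp
  next
    case False
    then have pos: "0 < W" "0 < B" using W0 B0 by auto
    \<comment> \<open>This scale balances the two terms of Young's inequality: their integrals
      \<open>W / p\<close> and \<open>W * (1 - 1 / p)\<close> add up to \<open>W\<close>.\<close>
    define c where "c = (B / W) powr (1 / p)"
    have c0: "0 < c" using pos by (simp add: c_def)
    have cp: "c powr p = B / W" using pos p by (simp add: c_def powr_powr)
    have "w x * cmod (h x) \<le> c * (w x * cmod (h x) powr p / (c powr p) / p + w x * (1 - 1 / p))" for x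
    proof -
      have "cmod (h x) / c \<le> (cmod (h x) / c) powr p / p + (1 - 1 / p)"
      proof (cases "p = 1")
        case False
        then have p1: "1 < p" using p by simp
        have "(cmod (h x) / c) * 1 \<le> (cmod (h x) / c) powr p / p + 1 powr (p / (p - 1)) / (p / (p - 1))"
          using p1 c0 by (intro Youngs_inequality) (auto simp: field_simps)
        then show ?thesis using p1 by (simp add: field_simps)
      qed (use c0 in simp)
      also have "(cmod (h x) / c) powr p = cmod (h x) powr p / c powr p"
        using c0 by (simp add: powr_divide)
      finally have "w x * (cmod (h x) / c) \<le> w x * (cmod (h x) powr p / c powr p / p + (1 - 1 / p))"
        by (rule mult_left_mono[OF _ w(2)])
      then show ?thesis using c0 by (simp add: field_simps)
    qed
    then have "I \<le> (\<integral>x. c * (w x * cmod (h x) powr p / (c powr p) / p + w x * (1 - 1 / p)) \<partial>M)"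
      unfolding I_def
      by (intro integral_mono int integrable_mult_right Bochner_Integration.integrable_add
          integrable_divide integrable_mult_left wh w)
    also have "\<dots> = c * (B / (c powr p) / p + W * (1 - 1 / p))"
      using wh w by (simp add: B_def W_def)
    also have "\<dots> = c * W" using pos p by (simp add: cp field_simps)
    finally have "I \<le> c * W" .
    moreover have "0 \<le> I" unfolding I_def using w by simp
    ultimately have "I powr p \<le> (c * W) powr p" using p by (intro powr_mono2) auto
    also have "\<dots> = B / W * W powr p" using c0 pos by (simp add: powr_mult cp)
    also have "\<dots> = W powr (p - 1) * B" using pos by (simp add: powr_diff)
    finally show ?thesis .
  qed
  with 1 show ?thesis by (simp add: W_def B_def)
qed

section \<open>Classes modulo null sets and the carriers of the Lebesgue spaces\<close>

lemma (in haar) ae_class_iff: "g \<in> ae_class m f \<longleftrightarrow> g \<in> borel_measurable borel \<and> (AE t in m. g t = f t)"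
  by (simp add: ae_class_def)

context haar begin

lemma ae_class_self: "f \<in> borel_measurable borel \<Longrightarrow> f \<in> ae_class m f"
  by (simp add: ae_class_iff)

lemma ae_class_cong: assumes "AE t in m. f t = g t" shows "ae_class m f = ae_class m g"
proof -
  have "(AE t in m. h t = f t) \<longleftrightarrow> (AE t in m. h t = g t)" for h
  proof
    assume "AE t in m. h t = f t" with assms show "AE t in m. h t = g t" by eventually_elim simp
  next
    assume "AE t in m. h t = g t" with assms show "AE t in m. h t = f t" by eventually_elim simp
  qed
  then show ?thesis by (auto simp: ae_class_iff)
qed

lemma rep_in: "X \<noteq> {} \<Longrightarrow> rep X \<in> X"
  unfolding rep_def using some_in_eq by blast

lemma rep_ae_class:
  assumes "f \<in> borel_measurable borel"
  shows "AE t in m. rep (ae_class m f) t = f t" "rep (ae_class m f) \<in> borel_measurable borel"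
proof -
  have "rep (ae_class m f) \<in> ae_class m f" using ae_class_self[OF assms] by (intro rep_in) blast
  then show "AE t in m. rep (ae_class m f) t = f t" "rep (ae_class m f) \<in> borel_measurable borel"
    by (simp_all add: ae_class_iff)
qed

lemma lp_mem:
  "f \<in> borel_measurable borel \<Longrightarrow> integrable m (\<lambda>t. cmod (f t) powr q) \<Longrightarrow> ae_class m f \<in> vcar (lp_space m q)"
  by (simp add: lp_space_def)

lemma lp_memD:
  assumes "X \<in> vcar (lp_space m q)"
  shows "rep X \<in> borel_measurable borel" "integrable m (\<lambda>t. cmod (rep X t) powr q)" "ae_class m (rep X) = X"
proof -
  obtain f where f: "f \<in> borel_measurable borel" "integrable m (\<lambda>t. cmod (f t) powr q)" "X = ae_class m f"
    using assms by (auto simp: lp_space_def)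
  show r: "rep X \<in> borel_measurable borel" using rep_ae_class(2)[OF f(1)] f(3) by simp
  have ae: "AE t in m. rep X t = f t" using rep_ae_class(1)[OF f(1)] f(3) by simp
  then show "ae_class m (rep X) = X" unfolding f(3) by (rule ae_class_cong)
  have "AE t in m. cmod (rep X t) powr q = cmod (f t) powr q" using ae by eventually_elim simp
  then show "integrable m (\<lambda>t. cmod (rep X t) powr q)"
    using integrable_cong_AE[of "\<lambda>t. cmod (rep X t) powr q" m "\<lambda>t. cmod (f t) powr q"] f r by simp
qed

text \<open>Measurability of \<open>f\<close> is not assumed: the class is nonempty because it lies
  in the carrier, and every member equals \<open>f\<close> almost everywhere. This suits
  \<open>conv_fun\<close>, for which membership comes from the module axioms.\<close>

lemma lp_rep:
  assumes "ae_class m f \<in> vcar (lp_space m q)"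
  shows "AE t in m. rep (ae_class m f) t = f t"
proof -
  obtain g where g: "g \<in> borel_measurable borel" "ae_class m f = ae_class m g"
    using assms by (auto simp: lp_space_def)
  then have "ae_class m f \<noteq> {}" using ae_class_self by blast
  then show ?thesis using rep_in[of "ae_class m f"] by (simp add: ae_class_iff)
qed

lemma lp_add:
  assumes "ae_class m f \<in> vcar (lp_space m q)" "ae_class m g \<in> vcar (lp_space m q)"
  shows "vadd (lp_space m r) (ae_class m f) (ae_class m g) = ae_class m (\<lambda>t. f t + g t)"
proof -
  have "AE t in m. rep (ae_class m f) t + rep (ae_class m g) t = f t + g t"
    using lp_rep[OF assms(1)] lp_rep[OF assms(2)] by eventually_elim simp
  then show ?thesis by (simp add: lp_space_def ae_class_cong)
qed

lemma lp_scale: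
  assumes "ae_class m f \<in> vcar (lp_space m q)"
  shows "vscale (lp_space m r) c (ae_class m f) = ae_class m (\<lambda>t. c * f t)"
proof -
  have "AE t in m. c * rep (ae_class m f) t = c * f t"
    using lp_rep[OF assms(1)] by eventually_elim simp
  then show ?thesis by (simp add: lp_space_def ae_class_cong)
qed

lemma lp_zero: "vzero (lp_space m q) = ae_class m (\<lambda>t. 0)"
  by (simp add: lp_space_def)

lemma lp_norm_rep: "vnorm (lp_space m q) X = (\<integral>t. cmod (rep X t) powr q \<partial>m) powr (1 / q)"
  by (simp add: lp_space_def)

lemma lp_norm:
  assumes "f \<in> borel_measurable borel"
  shows "vnorm (lp_space m q) (ae_class m f) = (\<integral>t. cmod (f t) powr q \<partial>m) powr (1 / q)"
proof -
  have "AE t in m. cmod (rep (ae_class m f) t) powr q = cmod (f t) powr q"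
    using rep_ae_class(1)[OF assms] by eventually_elim simp
  then have "(\<integral>t. cmod (rep (ae_class m f) t) powr q \<partial>m) = (\<integral>t. cmod (f t) powr q \<partial>m)"
    using assms rep_ae_class(2)[OF assms] by (intro integral_cong_AE) simp_all
  then show ?thesis by (simp add: lp_norm_rep)
qed

lemma lp_norm_powr: "q > 0 \<Longrightarrow> vnorm (lp_space m q) X powr q = (\<integral>t. cmod (rep X t) powr q \<partial>m)"
  by (simp add: lp_norm_rep powr_powr)

lemma l1_mem: assumes "integrable m f" shows "ae_class m f \<in> vcar (lp_space m 1)"
  using assms borel_measurable_integrable[OF assms] by (intro lp_mem) simp_all

lemma l1_memD:
  assumes "X \<in> vcar (lp_space m 1)" shows "integrable m (rep X)"
  using lp_memD(1,2)[OF assms] by (simp add: integrable_norm_iff)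

lemma l1_norm_rep: "vnorm (lp_space m 1) X = (\<integral>t. cmod (rep X t) \<partial>m)"
  by (simp add: lp_norm_rep)

lemma l1_norm: "integrable m f \<Longrightarrow> vnorm (lp_space m 1) (ae_class m f) = (\<integral>t. cmod (f t) \<partial>m)"
  using lp_norm[of f 1] borel_measurable_integrable[of m f] by simp

section \<open>Convolution on representatives\<close>

definition conv_fun :: "('g \<Rightarrow> complex) \<Rightarrow> ('g \<Rightarrow> complex) \<Rightarrow> 'g \<Rightarrow> complex" where
  "conv_fun a y s = (\<integral>t. a t * y (- t + s) \<partial>m)"

lemma convolution_rep: "convolution m X Y = ae_class m (conv_fun (rep X) (rep Y))"
  unfolding convolution_def conv_fun_def[abs_def] ..

lemma measurable_reflect [measurable]:
  assumes [measurable]: "y \<in> borel_measurable borel"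
  shows "(\<lambda>t. y (- t + s)) \<in> borel_measurable (borel :: 'g measure)"
  by measurable

text \<open>The equality holds at every \<open>s\<close>, not merely almost everywhere: by
  \<open>AE_convolution_null\<close> the reflected exceptional set of \<open>y\<close> meets the set
  where \<open>a\<close> is nonzero in a null set.\<close>

lemma conv_fun_cong_AE:
  assumes a: "integrable m a" "a' \<in> borel_measurable borel" "AE t in m. a' t = a t"
    and y: "y \<in> borel_measurable borel" "y' \<in> borel_measurable borel" "AE t in m. y' t = y t"
  shows "conv_fun a' y' s = conv_fun a y s"
proof -
  note [measurable] = borel_measurable_integrable[OF a(1), simplified] a(2) y(1,2)
  have "{t \<in> space m. y' t \<noteq> y t} \<in> sets m" by measurable
  then have N: "{t. y' t \<noteq> y t} \<in> sets borel" by simp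
  have "emeasure m {t. y' t \<noteq> y t} = 0"
    using y(3) N by (subst AE_iff_measurable[symmetric, OF _ _ , of _ _ "\<lambda>t. y' t = y t"]) auto
  from AE_convolution_null[OF a(1) N this, of s] a(3)
  have "AE t in m. a' t * y' (- t + s) = a t * y (- t + s)"
    by eventually_elim auto
  then show ?thesis unfolding conv_fun_def by (intro integral_cong_AE) simp_all
qed

lemma convolution_ae_class:
  assumes a: "integrable m a" and y: "y \<in> borel_measurable borel"
  shows "convolution m (ae_class m a) (ae_class m y) = ae_class m (conv_fun a y)"
proof -
  have am: "a \<in> borel_measurable borel" using borel_measurable_integrable[OF a] by simp
  have "conv_fun (rep (ae_class m a)) (rep (ae_class m y)) = conv_fun a y"
    by (rule ext, rule conv_fun_cong_AE) (use a y am rep_ae_class in auto)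
  then show ?thesis by (simp add: convolution_rep)
qed

lemma conv_fun_left_translate:
  assumes [measurable]: "a \<in> borel_measurable borel" "y \<in> borel_measurable borel"
  shows "conv_fun (\<lambda>t. a (- s + t)) y r = conv_fun a y (- s + r)"
proof -
  have "(\<integral>t. a (- s + (s + t)) * y (- (s + t) + r) \<partial>m) = (\<integral>t. a (- s + t) * y (- t + r) \<partial>m)"
    by (rule integral_left[of "\<lambda>t. a (- s + t) * y (- t + r)"]) measurable
  then show ?thesis by (simp add: conv_fun_def add.assoc[symmetric] minus_add)
qed

text \<open>Right translation of the left factor moves across the convolution as a left translation
  of the right factor; the factor \<open>modular (- s)\<close> of the substitution cancels
  \<open>modular s\<close>. Through this identity a shift of \<open>\<kappa>\<close> becomes a shift
  of the set \<open>F\<close>.\<close>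

lemma conv_fun_right_translate:
  assumes [measurable]: "a \<in> borel_measurable borel" "y \<in> borel_measurable borel"
  shows "conv_fun (\<lambda>t. of_real (modular s) * a (t - s)) y r = conv_fun a (\<lambda>t. y (- s + t)) r"
proof -
  have "(\<integral>t. a (t + - s) * y (- ((t + - s) + s) + r) \<partial>m)
      = modular (- s) *\<^sub>R (\<integral>t. a t * y (- (t + s) + r) \<partial>m)"
    by (rule integral_right[of "\<lambda>t. a t * y (- (t + s) + r)"]) measurable
  then have "of_real (modular s) * (\<integral>t. a (t - s) * y (- t + r) \<partial>m)
      = of_real (modular s * modular (- s)) * (\<integral>t. a t * y (- s + (- t + r)) \<partial>m)"
    by (simp add: add.assoc[symmetric] minus_add scaleR_conv_of_real)
  then show ?thesis by (simp add: conv_fun_def modular_uminus mult.assoc)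
qed

end

section \<open>Bounded multipliers, translations and the operators \<open>V\<close>\<close>

locale lp_module = haar m for m :: "'g::{topological_group_add, t2_space} measure" +
  fixes p :: real
  assumes p: "1 < p" and module: "banach_left_module (L1_algebra m) (Lp_module m p)"
begin

abbreviation "A \<equiv> L1_algebra m"
abbreviation "J \<equiv> Lp_module m p"
abbreviation "L1 \<equiv> lp_space m 1"
abbreviation "Lp \<equiv> lp_space m p"
abbreviation "U \<equiv> unitization_space A"

lemma A_sel [simp]:
  "vcar A = vcar L1" "vzero A = vzero L1" "vadd A = vadd L1" "vscale A = vscale L1" "vnorm A = vnorm L1"
  "amult A = convolution m"
  by (simp_all add: L1_algebra_def nspace.extend_def balgebra.fields_def)

lemma J_sel [simp]:
  "vcar J = vcar Lp" "vzero J = vzero Lp" "vadd J = vadd Lp" "vscale J = vscale Lp" "vnorm J = vnorm Lp"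
  "act J = convolution m"
  by (simp_all add: Lp_module_def)

sublocale J: banach_left_module A J by (rule module)

lemma nA: "complex_normed_space A" by unfold_locales
lemma nJ: "complex_normed_space J" by unfold_locales

sublocale U: complex_normed_space U by (rule unitization_space_normed[OF nA])

lemma nU: "complex_normed_space U" by unfold_locales

sublocale O: complex_normed_space "op_space U J" by (rule op_space_normed[OF nU nJ])

lemma U_car: "u \<in> vcar U \<longleftrightarrow> fst u \<in> vcar L1"
  by (cases u) (simp add: unitization_space_def)

text \<open>Closure under convolution and submultiplicativity are read off from the algebra and
  module axioms. Here and in \<open>conv_Lp\<close> they take the place of an application of
  Fubini's theorem to general integrable functions.\<close>

lemma conv_L1: "X \<in> vcar L1 \<Longrightarrow> Y \<in> vcar L1 \<Longrightarrow> convolution m X Y \<in> vcar L1"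
  "X \<in> vcar L1 \<Longrightarrow> Y \<in> vcar L1 \<Longrightarrow> vnorm L1 (convolution m X Y) \<le> vnorm L1 X * vnorm L1 Y"
  using J.A.mult_closed[of X Y] J.A.norm_mult_le[of X Y] by simp_all

lemma conv_Lp: "X \<in> vcar L1 \<Longrightarrow> Y \<in> vcar Lp \<Longrightarrow> convolution m X Y \<in> vcar Lp"
  "X \<in> vcar L1 \<Longrightarrow> Y \<in> vcar Lp \<Longrightarrow> vnorm Lp (convolution m X Y) \<le> vnorm L1 X * vnorm Lp Y"
  using J.act_closed[of X Y] J.norm_act_le[of X Y] by simp_all

text \<open>Everywhere defined functions instead of classes modulo null sets, so that no description
  of the dual of \<open>L1\<close> is needed; functionals on \<open>L1\<close> enter only through
  \<open>orbit_fun\<close>, which yields such functions.\<close>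

definition bdd_borel :: "('g \<Rightarrow> complex) \<Rightarrow> bool" where
  "bdd_borel \<kappa> \<longleftrightarrow> \<kappa> \<in> borel_measurable borel \<and> (\<exists>B. \<forall>t. cmod (\<kappa> t) \<le> B)"

lemma bdd_borel_measurable: "bdd_borel \<kappa> \<Longrightarrow> \<kappa> \<in> borel_measurable borel"
  by (simp add: bdd_borel_def)

lemma bdd_borel_bound: assumes "bdd_borel \<kappa>" obtains B where "0 \<le> B" "\<And>t. cmod (\<kappa> t) \<le> B"
  using assms unfolding bdd_borel_def by (metis norm_ge_zero order_trans)

lemma bdd_borel_integrable:
  assumes a: "integrable m a" and k: "bdd_borel \<kappa>" shows "integrable m (\<lambda>t. a t * \<kappa> t :: complex)"
proof -
  obtain B where B: "0 \<le> B" "\<And>t. cmod (\<kappa> t) \<le> B" using bdd_borel_bound[OF k] by metis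
  note [measurable] = borel_measurable_integrable[OF a, simplified] bdd_borel_measurable[OF k]
  show ?thesis
  proof (rule Bochner_Integration.integrable_bound[of m "\<lambda>t. B * cmod (a t)"])
    show "integrable m (\<lambda>t. B * cmod (a t))" using a by simp
    show "AE t in m. norm (a t * \<kappa> t) \<le> norm (B * cmod (a t))"
      using B mult_left_mono[OF B(2), of "cmod (a _)"] by (intro AE_I2) (simp add: norm_mult mult.commute)
  qed simp
qed

lemma bdd_borel_indicator: "E \<in> sets borel \<Longrightarrow> bdd_borel (indicator E)"
  unfolding bdd_borel_def by (auto intro!: exI[of _ 1] simp: indicator_def)

lemma bdd_borel_mult: assumes "bdd_borel \<kappa>" "bdd_borel \<mu>" shows "bdd_borel (\<lambda>t. \<kappa> t * \<mu> t)"
proof -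
  obtain B where B: "0 \<le> B" "\<And>t. cmod (\<kappa> t) \<le> B" using bdd_borel_bound[OF assms(1)] by metis
  obtain C where C: "0 \<le> C" "\<And>t. cmod (\<mu> t) \<le> C" using bdd_borel_bound[OF assms(2)] by metis
  have "cmod (\<kappa> t * \<mu> t) \<le> B * C" for t
    using mult_mono[OF B(2) C(2) B(1)] by (simp add: norm_mult)
  then show ?thesis using assms unfolding bdd_borel_def by auto
qed

lemma bdd_borel_add: assumes "bdd_borel \<kappa>" "bdd_borel \<mu>" shows "bdd_borel (\<lambda>t. \<kappa> t + \<mu> t)"
proof -
  obtain B where B: "0 \<le> B" "\<And>t. cmod (\<kappa> t) \<le> B" using bdd_borel_bound[OF assms(1)] by metis
  obtain C where C: "0 \<le> C" "\<And>t. cmod (\<mu> t) \<le> C" using bdd_borel_bound[OF assms(2)] by metis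
  have "cmod (\<kappa> t + \<mu> t) \<le> B + C" for t
    using norm_triangle_mono[OF B(2) C(2)] .
  then show ?thesis using assms unfolding bdd_borel_def by auto
qed

lemma bdd_borel_const: "bdd_borel (\<lambda>t. c)"
  unfolding bdd_borel_def by auto

lemma bdd_borel_scale: "bdd_borel \<kappa> \<Longrightarrow> bdd_borel (\<lambda>t. c * \<kappa> t)"
  by (rule bdd_borel_mult[OF bdd_borel_const])

lemma bdd_borel_right: "bdd_borel \<kappa> \<Longrightarrow> bdd_borel (\<lambda>t. \<kappa> (t - s))"
  unfolding bdd_borel_def using measurable_compose[OF measurable_right_add[of "- s"], of \<kappa> borel] by auto

lemma bdd_borel_reflect: "bdd_borel \<kappa> \<Longrightarrow> bdd_borel (\<lambda>t. \<kappa> (- t + s))"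
  unfolding bdd_borel_def using measurable_reflect[of \<kappa> s] by auto

definition mult_class :: "('g \<Rightarrow> complex) \<Rightarrow> ('g \<Rightarrow> complex) set \<Rightarrow> ('g \<Rightarrow> complex) set" where
  "mult_class \<kappa> X = ae_class m (\<lambda>t. rep X t * \<kappa> t)"

text \<open>The factor \<open>modular s\<close> makes this an isometry of \<open>L1\<close> and lets
  it move across convolutions without a further factor.\<close>

definition right_translate :: "'g \<Rightarrow> ('g \<Rightarrow> complex) set \<Rightarrow> ('g \<Rightarrow> complex) set" where
  "right_translate s X = ae_class m (\<lambda>t. of_real (modular s) * rep X (t - s))"

abbreviation ind :: "'g set \<Rightarrow> ('g \<Rightarrow> complex) set" where
  "ind E \<equiv> ae_class m (indicator E)"

lemma AE_minus: "AE t in m. P t \<Longrightarrow> AE t in m. P (t - s)"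
  using AE_right[of P "- s"] by simp

lemma mult_class_class:
  assumes "AE t in m. rep (ae_class m f) t = f t"
  shows "mult_class \<kappa> (ae_class m f) = ae_class m (\<lambda>t. f t * \<kappa> t)"
  unfolding mult_class_def
proof (rule ae_class_cong)
  show "AE t in m. rep (ae_class m f) t * \<kappa> t = f t * \<kappa> t" using assms by eventually_elim simp
qed

lemma right_translate_class:
  assumes "AE t in m. rep (ae_class m f) t = f t"
  shows "right_translate s (ae_class m f) = ae_class m (\<lambda>t. of_real (modular s) * f (t - s))"
  unfolding right_translate_def
proof (rule ae_class_cong)
  show "AE t in m. of_real (modular s) * rep (ae_class m f) (t - s) = of_real (modular s) * f (t - s)"
    using AE_minus[OF assms, of s] by eventually_elim simp
qed

lemma translate_class:
  assumes "AE t in m. rep (ae_class m f) t = f t"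
  shows "L1_translate m s (ae_class m f) = ae_class m (\<lambda>t. f (- s + t))"
  unfolding L1_translate_def
proof (rule ae_class_cong)
  show "AE t in m. rep (ae_class m f) (- s + t) = f (- s + t)"
    using AE_left[OF assms, of "- s"] by eventually_elim simp
qed

lemma integrable_minus:
  assumes "integrable m (a :: 'g \<Rightarrow> complex)" shows "integrable m (\<lambda>t. a (t - s))"
  using integrable_right[of a "- s"] assms borel_measurable_integrable[OF assms] by simp

lemma integrable_translate:
  assumes "integrable m (a :: 'g \<Rightarrow> complex)" shows "integrable m (\<lambda>t. a (s + t))"
  using integrable_left[of a s] assms borel_measurable_integrable[OF assms] by simp

lemma mult_class_mem: "bdd_borel \<kappa> \<Longrightarrow> X \<in> vcar L1 \<Longrightarrow> mult_class \<kappa> X \<in> vcar L1"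
  unfolding mult_class_def by (intro l1_mem bdd_borel_integrable l1_memD)

lemma mult_class_norm:
  assumes k: "bdd_borel \<kappa>" and B: "\<And>t. cmod (\<kappa> t) \<le> B" and X: "X \<in> vcar L1"
  shows "vnorm L1 (mult_class \<kappa> X) \<le> B * vnorm L1 X"
proof -
  have i: "integrable m (\<lambda>t. rep X t * \<kappa> t)" by (intro bdd_borel_integrable l1_memD X k)
  have "vnorm L1 (mult_class \<kappa> X) = (\<integral>t. cmod (rep X t * \<kappa> t) \<partial>m)"
    unfolding mult_class_def by (rule l1_norm[OF i])
  also have "\<dots> \<le> (\<integral>t. B * cmod (rep X t) \<partial>m)"
  proof (rule integral_mono)
    show "integrable m (\<lambda>t. cmod (rep X t * \<kappa> t))" using i by simp
    show "integrable m (\<lambda>t. B * cmod (rep X t))" using l1_memD[OF X] by simp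
    show "cmod (rep X t * \<kappa> t) \<le> B * cmod (rep X t)" for t
      using mult_left_mono[OF B[of t], of "cmod (rep X t)"] by (simp add: norm_mult mult.commute)
  qed
  also have "\<dots> = B * vnorm L1 X" by (simp add: l1_norm_rep)
  finally show ?thesis .
qed

lemma right_translate_mem: "X \<in> vcar L1 \<Longrightarrow> right_translate s X \<in> vcar L1"
  unfolding right_translate_def using l1_memD by (intro l1_mem integrable_mult_right integrable_minus)

lemma L1_add: "X \<in> vcar L1 \<Longrightarrow> Y \<in> vcar L1 \<Longrightarrow> vadd L1 X Y = ae_class m (\<lambda>t. rep X t + rep Y t)"
  by (simp add: lp_space_def)

lemma L1_scale: "vscale (lp_space m q) c X = ae_class m (\<lambda>t. c * rep X t)"
  by (simp add: lp_space_def)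

lemma L1_add_rep:
  assumes "X \<in> vcar L1" "Y \<in> vcar L1"
  shows "AE t in m. rep (ae_class m (\<lambda>t. rep X t + rep Y t)) t = rep X t + rep Y t"
  using lp_memD(1)[OF assms(1)] lp_memD(1)[OF assms(2)] by (intro rep_ae_class(1)) simp

lemma L1_scale_rep:
  assumes "X \<in> vcar L1" shows "AE t in m. rep (ae_class m (\<lambda>t. c * rep X t)) t = c * rep X t"
  using lp_memD(1)[OF assms] by (intro rep_ae_class(1)) simp

lemma mult_class_add:
  assumes "bdd_borel \<kappa>" "X \<in> vcar L1" "Y \<in> vcar L1"
  shows "mult_class \<kappa> (vadd L1 X Y) = vadd L1 (mult_class \<kappa> X) (mult_class \<kappa> Y)"
  unfolding L1_add[OF assms(2,3)] mult_class_class[OF L1_add_rep[OF assms(2,3)]]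
  using lp_add[OF mult_class_mem[OF assms(1,2), unfolded mult_class_def] mult_class_mem[OF assms(1,3), unfolded mult_class_def], of 1]
  by (simp add: mult_class_def distrib_right)

lemma mult_class_scale:
  assumes "bdd_borel \<kappa>" "X \<in> vcar L1"
  shows "mult_class \<kappa> (vscale L1 c X) = vscale L1 c (mult_class \<kappa> X)"
  unfolding L1_scale[of 1 c X] mult_class_class[OF L1_scale_rep[OF assms(2)]]
  using lp_scale[OF mult_class_mem[OF assms, unfolded mult_class_def], of 1 c]
  by (simp add: mult_class_def mult.assoc)

lemma right_translate_add:
  assumes "X \<in> vcar L1" "Y \<in> vcar L1"
  shows "right_translate s (vadd L1 X Y) = vadd L1 (right_translate s X) (right_translate s Y)"
  unfolding L1_add[OF assms] right_translate_class[OF L1_add_rep[OF assms]]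
  using lp_add[OF right_translate_mem[OF assms(1), unfolded right_translate_def] right_translate_mem[OF assms(2), unfolded right_translate_def], of 1]
  by (simp add: right_translate_def distrib_left)

lemma right_translate_scale:
  assumes "X \<in> vcar L1" shows "right_translate s (vscale L1 c X) = vscale L1 c (right_translate s X)"
  unfolding L1_scale[of 1 c X] right_translate_class[OF L1_scale_rep[OF assms]]
  using lp_scale[OF right_translate_mem[OF assms, unfolded right_translate_def], of 1 c]
  by (simp add: right_translate_def mult.left_commute)

lemma rep_conv_L1:
  assumes "X \<in> vcar L1" "Y \<in> vcar L1"
  shows "AE t in m. rep (ae_class m (conv_fun (rep X) (rep Y))) t = conv_fun (rep X) (rep Y) t"
  using lp_rep conv_L1(1)[OF assms] unfolding convolution_rep by blast

lemma conv_right_translate: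
  assumes X: "X \<in> vcar L1" and Y: "Y \<in> vcar L1"
  shows "convolution m X (right_translate s Y) = right_translate s (convolution m X Y)"
proof -
  note [measurable] = lp_memD(1)[OF X] lp_memD(1)[OF Y]
  have "convolution m (ae_class m (rep X)) (right_translate s Y)
      = ae_class m (conv_fun (rep X) (\<lambda>t. of_real (modular s) * rep Y (t - s)))"
    unfolding right_translate_def using measurable_compose[OF measurable_right_add[of "- s"] lp_memD(1)[OF Y]]
    by (intro convolution_ae_class l1_memD X) simp
  also have "conv_fun (rep X) (\<lambda>t. of_real (modular s) * rep Y (t - s))
      = (\<lambda>r. of_real (modular s) * conv_fun (rep X) (rep Y) (r - s))"
    unfolding conv_fun_def by (rule ext)
      (simp add: mult.left_commute[of _ "complex_of_real (modular s)"] add_diff_eq)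
  also have "ae_class m \<dots> = right_translate s (convolution m X Y)"
    unfolding convolution_rep right_translate_class[OF rep_conv_L1[OF X Y]] ..
  finally show ?thesis by (simp add: lp_memD(3)[OF X])
qed

lemma conv_right_translate_ind:
  assumes X: "X \<in> vcar L1" and E [measurable]: "E \<in> sets borel"
  shows "convolution m (right_translate s X) (ind E) = convolution m X (ind ((\<lambda>t. s + t) ` E))"
proof -
  note [measurable] = lp_memD(1)[OF X]
  have i: "(indicator ((\<lambda>t. s + t) ` E) :: 'g \<Rightarrow> complex) = (\<lambda>t. indicator E (- s + t))"
    unfolding left_image by (auto simp: indicator_def)
  have "convolution m (right_translate s X) (ind E)
      = ae_class m (conv_fun (\<lambda>t. of_real (modular s) * rep X (t - s)) (indicator E))"
    unfolding right_translate_def using l1_memD[OF X] by (intro convolution_ae_class integrable_mult_right integrable_minus) simp_all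
  also have "conv_fun (\<lambda>t. of_real (modular s) * rep X (t - s)) (indicator E)
      = conv_fun (rep X) (\<lambda>t. indicator E (- s + t))"
    by (rule ext, rule conv_fun_right_translate) simp_all
  also have "ae_class m \<dots> = convolution m (ae_class m (rep X)) (ind ((\<lambda>t. s + t) ` E))"
    unfolding i[symmetric] by (intro convolution_ae_class[symmetric] l1_memD X) simp
  finally show ?thesis by (simp add: lp_memD(3)[OF X])
qed

lemma mult_class_right_translate:
  assumes X: "X \<in> vcar L1" and k: "bdd_borel \<kappa>"
  shows "mult_class (\<lambda>t. \<kappa> (t - s)) (right_translate s X) = right_translate s (mult_class \<kappa> X)"
proof -
  have 1: "AE t in m. rep (ae_class m (\<lambda>t. of_real (modular s) * rep X (t - s))) t = of_real (modular s) * rep X (t - s)"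
    using lp_rep[OF right_translate_mem[OF X, unfolded right_translate_def]] .
  have 2: "AE t in m. rep (ae_class m (\<lambda>t. rep X t * \<kappa> t)) t = rep X t * \<kappa> t"
    using lp_rep[OF mult_class_mem[OF k X, unfolded mult_class_def]] .
  show ?thesis
    unfolding right_translate_def[of s X] mult_class_def[of \<kappa> X] mult_class_class[OF 1] right_translate_class[OF 2] by (simp add: mult.assoc)
qed

lemma ind_mem:
  assumes "E \<in> sets borel" "emeasure m E < \<infinity>" shows "ind E \<in> vcar (lp_space m q)"
proof (rule lp_mem)
  show "indicator E \<in> borel_measurable (borel :: 'g measure)" using assms by simp
  have "(\<lambda>t. cmod (indicator E t) powr q) = (\<lambda>t. indicator E t :: real)" by (auto simp: indicator_def)
  then show "integrable m (\<lambda>t. cmod (indicator E t) powr q)" using assms by simp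
qed

lemma ind_norm:
  assumes "E \<in> sets borel" shows "vnorm (lp_space m q) (ind E) = measure m E powr (1 / q)"
proof -
  have "(\<lambda>t. cmod (indicator E t) powr q) = (\<lambda>t. indicator E t :: real)" by (auto simp: indicator_def)
  then show ?thesis using assms by (subst lp_norm) simp_all
qed

text \<open>The scalar component of \<open>u\<close> is ignored. Hence
  \<open>V (\<lambda>t. 1) E\<close> agrees with the canonical image of \<open>ind E\<close> in the
  coinduced module only on pairs \<open>(a, 0)\<close>, and \<open>\<rho>\<close> is known on it
  only after convolution with an element of \<open>L1\<close>.\<close>

definition V :: "('g \<Rightarrow> complex) \<Rightarrow> 'g set \<Rightarrow> ('g \<Rightarrow> complex) set \<times> complex \<Rightarrow> ('g \<Rightarrow> complex) set" where
  "V \<kappa> E = (\<lambda>u\<in>vcar U. convolution m (mult_class \<kappa> (fst u)) (ind E))"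

lemma U_sel: "vadd U u v = (vadd L1 (fst u) (fst v), snd u + snd v)"
  "vscale U c u = (vscale L1 c (fst u), c * snd u)" "vnorm U u = vnorm L1 (fst u) + cmod (snd u)"
  by (cases u; cases v; simp add: unitization_space_def)+

lemma V_bound:
  assumes k: "bdd_borel \<kappa>" and B: "0 \<le> B" "\<And>t. cmod (\<kappa> t) \<le> B" and E: "E \<in> sets borel" "emeasure m E < \<infinity>"
    and u: "u \<in> vcar U"
  shows "vnorm Lp (convolution m (mult_class \<kappa> (fst u)) (ind E)) \<le> (B * vnorm Lp (ind E)) * vnorm U u"
proof -
  have X: "fst u \<in> vcar L1" using u by (simp add: U_car)
  have nE: "0 \<le> vnorm Lp (ind E)" using J.M.norm_nonneg[of "ind E"] ind_mem[OF E] by simp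
  have "vnorm Lp (convolution m (mult_class \<kappa> (fst u)) (ind E)) \<le> vnorm L1 (mult_class \<kappa> (fst u)) * vnorm Lp (ind E)"
    by (intro conv_Lp mult_class_mem k X ind_mem E)
  also have "\<dots> \<le> (B * vnorm L1 (fst u)) * vnorm Lp (ind E)"
    by (intro mult_right_mono mult_class_norm k B X nE)
  also have "\<dots> \<le> (B * vnorm U u) * vnorm Lp (ind E)"
    by (intro mult_right_mono mult_left_mono nE B) (simp add: U_sel)
  finally show ?thesis by (simp add: mult_ac)
qed

lemma V_mem:
  assumes k: "bdd_borel \<kappa>" and E: "E \<in> sets borel" "emeasure m E < \<infinity>"
  shows "V \<kappa> E \<in> vcar (op_space U J)"
proof -
  obtain B where B: "0 \<le> B" "\<And>t. cmod (\<kappa> t) \<le> B" using bdd_borel_bound[OF k] by metis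
  note mem = mult_class_mem[OF k] ind_mem[OF E]
  have "bounded_op U J (\<lambda>u. convolution m (mult_class \<kappa> (fst u)) (ind E))"
    unfolding bounded_op_def
  proof (intro conjI ballI allI)
    show "\<exists>K. \<forall>u\<in>vcar U. vnorm J (convolution m (mult_class \<kappa> (fst u)) (ind E)) \<le> K * vnorm U u"
      unfolding J_sel using V_bound[OF k B E] by blast
    fix u assume u: "u \<in> vcar U"
    then show "convolution m (mult_class \<kappa> (fst u)) (ind E) \<in> vcar J" by (simp add: conv_Lp mem U_car)
    show "convolution m (mult_class \<kappa> (fst (vscale U c u))) (ind E) = vscale J c (convolution m (mult_class \<kappa> (fst u)) (ind E))" for c
      using u J.act_scale_left[of "mult_class \<kappa> (fst u)" "ind E" c] by (simp add: U_sel U_car mult_class_scale[OF k] mem)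
    fix v assume v: "v \<in> vcar U"
    show "convolution m (mult_class \<kappa> (fst (vadd U u v))) (ind E)
        = vadd J (convolution m (mult_class \<kappa> (fst u)) (ind E)) (convolution m (mult_class \<kappa> (fst v)) (ind E))"
      using u v J.act_add_left[of "mult_class \<kappa> (fst u)" "mult_class \<kappa> (fst v)" "ind E"]
      by (simp add: U_sel U_car mult_class_add[OF k] mem)
  qed
  then show ?thesis by (simp add: op_space_sel V_def bounded_op_restrict[OF nU])
qed

end

section \<open>Norm estimates\<close>

lemma powr_sum_disjoint:
  fixes f :: "'s \<Rightarrow> complex"
  assumes "finite S" "disjoint_family_on E S"
  shows "cmod (\<Sum>s\<in>S. f s * indicator (E s) x) powr p = (\<Sum>s\<in>S. cmod (f s) powr p * indicator (E s) x)"
proof (cases "\<exists>s\<in>S. x \<in> E s")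
  case True
  then obtain s0 where s0: "s0 \<in> S" "x \<in> E s0" by blast
  have ind: "x \<in> E s \<longleftrightarrow> s = s0" if "s \<in> S" for s
    using assms(2) s0 that unfolding disjoint_family_on_def by blast
  have "(\<Sum>s\<in>S. f s * indicator (E s) x) = (\<Sum>s\<in>S. if s = s0 then f s else 0)"
    using ind by (intro sum.cong) (auto simp: indicator_def)
  moreover have "(\<Sum>s\<in>S. cmod (f s) powr p * indicator (E s) x) = (\<Sum>s\<in>S. if s = s0 then cmod (f s) powr p else 0)"
    using ind by (intro sum.cong) (auto simp: indicator_def)
  ultimately show ?thesis using assms(1) s0 by simp
next
  case False
  then have "(\<Sum>s\<in>S. f s * indicator (E s) x) = 0" "(\<Sum>s\<in>S. cmod (f s) powr p * indicator (E s) x) = 0"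
    by (intro sum.neutral ballI; simp add: indicator_def)+
  then show ?thesis by simp
qed

context lp_module begin

text \<open>Written as a formula on representatives and not as a sum of operators, because the norm
  estimate works pointwise in \<open>r\<close>; \<open>V_sum_insert\<close> identifies it with the
  iterated sum in the operator space.\<close>

definition V_sum :: "('s \<Rightarrow> 'g \<Rightarrow> complex) \<Rightarrow> ('s \<Rightarrow> 'g set) \<Rightarrow> 's set
    \<Rightarrow> ('g \<Rightarrow> complex) set \<times> complex \<Rightarrow> ('g \<Rightarrow> complex) set" where
  "V_sum \<kappa> E S = (\<lambda>u\<in>vcar U. ae_class m
     (\<lambda>r. \<Sum>s\<in>S. conv_fun (\<lambda>t. rep (fst u) t * \<kappa> s t) (indicator (E s)) r))"

lemma V_class:
  assumes k: "bdd_borel \<kappa>" and E: "E \<in> sets borel" and u: "u \<in> vcar U"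
  shows "V \<kappa> E u = ae_class m (conv_fun (\<lambda>t. rep (fst u) t * \<kappa> t) (indicator E))"
  using u E unfolding V_def mult_class_def
  by (simp add: U_car) (intro convolution_ae_class bdd_borel_integrable l1_memD k; simp)

lemma op_car: "T \<in> vcar (op_space U J) \<Longrightarrow> u \<in> vcar U \<Longrightarrow> T u \<in> vcar Lp"
  using bounded_opD(1)[of U J T u] by (simp add: op_space_sel)

lemma V_sum_empty: "V_sum \<kappa> E {} = vzero (op_space U J)"
  by (simp add: V_sum_def op_space_sel lp_zero)

lemma V_sum_insert:
  assumes "finite S" "s \<notin> S" and k: "bdd_borel (\<kappa> s)" and E: "E s \<in> sets borel" "emeasure m (E s) < \<infinity>"
    and S: "V_sum \<kappa> E S \<in> vcar (op_space U J)"
  shows "V_sum \<kappa> E (insert s S) = vadd (op_space U J) (V (\<kappa> s) (E s)) (V_sum \<kappa> E S)"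
proof -
  have eq: "ae_class m (\<lambda>r. \<Sum>s\<in>insert s S. conv_fun (\<lambda>t. rep (fst u) t * \<kappa> s t) (indicator (E s)) r)
      = vadd Lp (V (\<kappa> s) (E s) u) (V_sum \<kappa> E S u)" if u: "u \<in> vcar U" for u
  proof -
    note 1 = op_car[OF V_mem[OF k E] u] and 2 = op_car[OF S u]
    note 1 = 1[unfolded V_class[OF k E(1) u]]
    have 3: "V_sum \<kappa> E S u = ae_class m (\<lambda>r. \<Sum>s\<in>S. conv_fun (\<lambda>t. rep (fst u) t * \<kappa> s t) (indicator (E s)) r)"
      using u by (simp add: V_sum_def)
    show ?thesis
      unfolding V_class[OF k E(1) u] 3 using lp_add[OF 1 2[unfolded 3], of p] assms(1,2) by simp
  qed
  show ?thesis
    unfolding V_sum_def[of _ _ "insert s S"] op_space_sel by (rule restrict_ext) (simp only: eq J_sel)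
qed

lemma V_sum_mem:
  assumes "finite S" "\<And>s. s \<in> S \<Longrightarrow> bdd_borel (\<kappa> s)" "\<And>s. s \<in> S \<Longrightarrow> E s \<in> sets borel" "\<And>s. s \<in> S \<Longrightarrow> emeasure m (E s) < \<infinity>"
  shows "V_sum \<kappa> E S \<in> vcar (op_space U J)"
  using assms
proof (induction S)
  case empty
  show ?case unfolding V_sum_empty by (rule O.zero_closed)
next
  case (insert s S)
  then have IH: "V_sum \<kappa> E S \<in> vcar (op_space U J)" by simp
  have k: "bdd_borel (\<kappa> s)" "E s \<in> sets borel" "emeasure m (E s) < \<infinity>" using insert.prems by simp_all
  show ?case
    unfolding V_sum_insert[OF insert.hyps(1,2) k IH] by (intro O.add_closed V_mem k IH)
qed

text \<open>For fixed \<open>r\<close> the functions \<open>\<lambda>t. indicator (E s) (- t + r)\<close> have disjoint supports, so Jensen's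
  inequality bounds the \<open>p\<close>-th power of the sum by a sum of convolutions in \<open>L\<^sup>1\<close>, whose integrals are
  controlled by the Banach algebra norm.\<close>

lemma V_sum_norm:
  assumes fS: "finite S" and k: "\<And>s. s \<in> S \<Longrightarrow> bdd_borel (\<kappa> s)"
    and E: "\<And>s. s \<in> S \<Longrightarrow> E s \<in> sets borel" "\<And>s. s \<in> S \<Longrightarrow> emeasure m (E s) < \<infinity>"
    and M: "\<And>s. s \<in> S \<Longrightarrow> measure m (E s) = M" "0 \<le> M" and dis: "disjoint_family_on E S"
    and le1: "\<And>t. (\<Sum>s\<in>S. cmod (\<kappa> s t) powr p) \<le> 1"
  shows "vnorm (op_space U J) (V_sum \<kappa> E S) \<le> M powr (1 / p)"
proof (rule op_norm_le[OF nU])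
  show "0 \<le> M powr (1 / p)" by simp
  fix u assume u: "u \<in> vcar U"
  define a where "a = rep (fst u)"
  have X: "fst u \<in> vcar L1" using u by (simp add: U_car)
  have ai: "integrable m a" unfolding a_def by (rule l1_memD[OF X])
  have am [measurable]: "a \<in> borel_measurable borel" unfolding a_def by (rule lp_memD(1)[OF X])
  define h where "h r = (\<Sum>s\<in>S. conv_fun (\<lambda>t. a t * \<kappa> s t) (indicator (E s)) r)" for r
  have VSu: "V_sum \<kappa> E S u = ae_class m h" using u by (simp add: V_sum_def h_def[abs_def] a_def)
  have hm: "ae_class m h \<in> vcar Lp" using op_car[OF V_sum_mem[of S \<kappa> E, OF fS k E] u] by (simp add: VSu)
  \<comment> \<open>The weight that Jensen's inequality leaves behind, made complex so that it has a
    class in \<open>L1\<close>.\<close>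
  define w where "w s t = complex_of_real (cmod (a t) * cmod (\<kappa> s t) powr p)" for s t
  have kp: "bdd_borel (\<lambda>t. complex_of_real (cmod (\<kappa> s t) powr p))" if s: "s \<in> S" for s
    unfolding bdd_borel_def
  proof (intro conjI exI[of _ 1] allI)
    show "(\<lambda>t. complex_of_real (cmod (\<kappa> s t) powr p)) \<in> borel_measurable borel"
      using bdd_borel_measurable[OF k[OF s]] by simp
    show "cmod (complex_of_real (cmod (\<kappa> s t) powr p)) \<le> 1" for t
      using le1[of t] member_le_sum[OF s, of "\<lambda>s. cmod (\<kappa> s t) powr p"] fS by simp
  qed
  have wi: "integrable m (w s)" if s: "s \<in> S" for s
  proof -
    have "integrable m (\<lambda>t. complex_of_real (cmod (a t)))" using ai by simp
    from bdd_borel_integrable[OF this kp[OF s]] show ?thesis by (simp add: w_def[abs_def])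
  qed
  \<comment> \<open>As a product in the Banach algebra, \<open>G s\<close> has norm at most the norm
    of \<open>w s\<close> times \<open>M\<close>, which bounds the double integral.\<close>
  define G where "G s = convolution m (ae_class m (w s)) (ind (E s))" for s
  have Gc: "G s = ae_class m (conv_fun (w s) (indicator (E s)))" if s: "s \<in> S" for s
    unfolding G_def using wi[OF s] E(1)[OF s] by (intro convolution_ae_class) simp_all
  have Gm: "G s \<in> vcar L1" if s: "s \<in> S" for s
    unfolding G_def by (intro conv_L1 l1_mem wi ind_mem E s)
  have Gn: "(\<integral>r. cmod (rep (G s) r) \<partial>m) \<le> (\<integral>t. cmod (a t) * cmod (\<kappa> s t) powr p \<partial>m) * M" if s: "s \<in> S" for s
  proof -
    have "vnorm L1 (G s) \<le> vnorm L1 (ae_class m (w s)) * vnorm L1 (ind (E s))"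
      unfolding G_def by (intro conv_L1 l1_mem wi ind_mem E s)
    also have "vnorm L1 (ae_class m (w s)) = (\<integral>t. cmod (a t) * cmod (\<kappa> s t) powr p \<partial>m)"
      by (subst l1_norm[OF wi[OF s]]) (simp add: w_def norm_mult)
    also have "vnorm L1 (ind (E s)) = M" using ind_norm[OF E(1)[OF s], of 1] M(1)[OF s] M(2) by simp
    finally show ?thesis by (simp add: l1_norm_rep)
  qed
  define W where "W = (\<integral>t. cmod (a t) \<partial>m)"
  have W0: "0 \<le> W" by (simp add: W_def)
  have ptw: "cmod (h r) powr p \<le> W powr (p - 1) * (\<Sum>s\<in>S. Re (conv_fun (w s) (indicator (E s)) r))" for r
  proof -
    \<comment> \<open>The phase of \<open>a\<close> is moved into \<open>q\<close>, so that the
      weight in Jensen's inequality is the nonnegative function \<open>cmod (a t)\<close>.\<close>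
    define q where "q t = sgn (a t) * (\<Sum>s\<in>S. \<kappa> s t * indicator (E s) (- t + r))" for t
    have km [measurable]: "\<kappa> s \<in> borel_measurable borel" "(\<lambda>t. indicator (E s) (- t + r) :: complex) \<in> borel_measurable borel"
      if "s \<in> S" for s
      using that bdd_borel_measurable[OF k] E(1) by (auto intro: measurable_reflect)
    have i1: "integrable m (\<lambda>t. (a t * \<kappa> s t) * indicator (E s) (- t + r))" if s: "s \<in> S" for s
      by (intro bdd_borel_integrable ai k s bdd_borel_reflect bdd_borel_indicator E)
    have "h r = (\<integral>t. (\<Sum>s\<in>S. (a t * \<kappa> s t) * indicator (E s) (- t + r)) \<partial>m)"
      unfolding h_def conv_fun_def using i1 by (intro Bochner_Integration.integral_sum[symmetric])
    also have "(\<lambda>t. \<Sum>s\<in>S. (a t * \<kappa> s t) * indicator (E s) (- t + r)) = (\<lambda>t. of_real (cmod (a t)) * q t)"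
    proof
      fix t
      have "a t = of_real (cmod (a t)) * sgn (a t)" by (cases "a t = 0") (simp_all add: sgn_eq)
      then have "of_real (cmod (a t)) * q t = a t * (\<Sum>s\<in>S. \<kappa> s t * indicator (E s) (- t + r))"
        unfolding q_def by (simp only: mult.assoc[symmetric])
      then show "(\<Sum>s\<in>S. (a t * \<kappa> s t) * indicator (E s) (- t + r)) = of_real (cmod (a t)) * q t"
        by (simp add: sum_distrib_left mult.assoc)
    qed
    finally have hr: "h r = (\<integral>t. of_real (cmod (a t)) * q t \<partial>m)" .
    have chi: "cmod (a t) * cmod (q t) powr p = (\<Sum>s\<in>S. Re (w s t * indicator (E s) (- t + r)))" for t
    proof -
      have "cmod (a t) * cmod (q t) powr p
          = cmod (a t) * (cmod (\<Sum>s\<in>S. \<kappa> s t * indicator (E s) (- t + r)) powr p)"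
        by (cases "a t = 0") (simp_all add: q_def norm_mult norm_sgn)
      moreover have "Re (w s t * indicator (E s) x) = cmod (a t) * (cmod (\<kappa> s t) powr p * indicator (E s) x)" for s x
        by (cases "x \<in> E s") (simp_all add: w_def)
      ultimately show ?thesis
        unfolding powr_sum_disjoint[OF fS dis] sum_distrib_left by (simp only:)
    qed
    have i2: "integrable m (\<lambda>t. w s t * indicator (E s) (- t + r))" if s: "s \<in> S" for s
      by (intro bdd_borel_integrable wi s bdd_borel_reflect bdd_borel_indicator E)
    have i3: "integrable m (\<lambda>t. cmod (a t) * cmod (q t) powr p)"
      unfolding chi by (intro Bochner_Integration.integrable_sum integrable_Re i2)
    have "cmod (h r) powr p \<le> W powr (p - 1) * (\<integral>t. cmod (a t) * cmod (q t) powr p \<partial>m)"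
      unfolding hr W_def
    proof (rule jensen_powr)
      have "sgn \<in> borel_measurable (borel :: complex measure)" unfolding sgn_div_norm[abs_def] by measurable
      then have [measurable]: "(\<lambda>t. sgn (a t)) \<in> borel_measurable borel" by (rule measurable_compose[OF am])
      show "q \<in> borel_measurable m" unfolding q_def by (simp add: borel_measurable_sum km)
    qed (use p ai i3 in auto)
    also have "(\<integral>t. cmod (a t) * cmod (q t) powr p \<partial>m) = (\<Sum>s\<in>S. Re (conv_fun (w s) (indicator (E s)) r))"
    proof -
      have "(\<integral>t. cmod (a t) * cmod (q t) powr p \<partial>m) = (\<Sum>s\<in>S. \<integral>t. Re (w s t * indicator (E s) (- t + r)) \<partial>m)"
        unfolding chi by (intro Bochner_Integration.integral_sum integrable_Re i2)
      also have "\<dots> = (\<Sum>s\<in>S. Re (conv_fun (w s) (indicator (E s)) r))"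
        unfolding conv_fun_def by (intro sum.cong refl integral_Re i2)
      finally show ?thesis .
    qed
    finally show ?thesis .
  qed
  have "AE r in m. \<forall>s\<in>S. rep (G s) r = conv_fun (w s) (indicator (E s)) r"
  proof (rule AE_finite_allI[OF fS])
    fix s assume s: "s \<in> S"
    show "AE r in m. rep (G s) r = conv_fun (w s) (indicator (E s)) r"
      using lp_rep[OF Gm[OF s, unfolded Gc[OF s]]] unfolding Gc[OF s] .
  qed
  with lp_rep[OF hm]
  have ae: "AE r in m. cmod (rep (ae_class m h) r) powr p \<le> W powr (p - 1) * (\<Sum>s\<in>S. cmod (rep (G s) r))"
  proof eventually_elim
    fix r assume 1: "rep (ae_class m h) r = h r" and 2: "\<forall>s\<in>S. rep (G s) r = conv_fun (w s) (indicator (E s)) r"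
    have "(\<Sum>s\<in>S. Re (conv_fun (w s) (indicator (E s)) r)) \<le> (\<Sum>s\<in>S. cmod (rep (G s) r))"
      using 2 by (intro sum_mono) (simp add: complex_Re_le_cmod)
    with ptw[of r] 1 show "cmod (rep (ae_class m h) r) powr p \<le> W powr (p - 1) * (\<Sum>s\<in>S. cmod (rep (G s) r))"
      by (simp add: order_trans[OF _ mult_left_mono])
  qed
  have "(\<integral>r. cmod (rep (ae_class m h) r) powr p \<partial>m) \<le> (\<integral>r. W powr (p - 1) * (\<Sum>s\<in>S. cmod (rep (G s) r)) \<partial>m)"
    using lp_memD(2)[OF hm] l1_memD[OF Gm]
    by (intro integral_mono_AE ae integrable_mult_right Bochner_Integration.integrable_sum) auto
  also have "\<dots> = W powr (p - 1) * (\<Sum>s\<in>S. \<integral>r. cmod (rep (G s) r) \<partial>m)"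
    using l1_memD[OF Gm] by simp
  also have "\<dots> \<le> W powr (p - 1) * (\<Sum>s\<in>S. (\<integral>t. cmod (a t) * cmod (\<kappa> s t) powr p \<partial>m) * M)"
    by (intro mult_left_mono sum_mono Gn) auto
  also have "(\<Sum>s\<in>S. (\<integral>t. cmod (a t) * cmod (\<kappa> s t) powr p \<partial>m) * M)
      = (\<integral>t. (\<Sum>s\<in>S. cmod (a t) * cmod (\<kappa> s t) powr p) \<partial>m) * M"
  proof -
    have "integrable m (\<lambda>t. cmod (a t) * cmod (\<kappa> s t) powr p)" if "s \<in> S" for s
      using integrable_Re[OF wi[OF that]] by (simp add: w_def)
    then show ?thesis by (simp add: sum_distrib_right)
  qed
  \<comment> \<open>Here the pointwise bound on \<open>\<kappa>\<close> enters: the weights add up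
    to at most \<open>cmod (a t)\<close>, and the result does not depend on the number of
    summands.\<close>
  also have "W powr (p - 1) * \<dots> \<le> W powr (p - 1) * (W * M)"
  proof (intro mult_left_mono mult_right_mono M)
    have "integrable m (\<lambda>t. cmod (a t) * cmod (\<kappa> s t) powr p)" if "s \<in> S" for s
      using integrable_Re[OF wi[OF that]] by (simp add: w_def)
    then show "(\<integral>t. (\<Sum>s\<in>S. cmod (a t) * cmod (\<kappa> s t) powr p) \<partial>m) \<le> W"
      unfolding W_def using ai mult_left_mono[OF le1, of "cmod (a _)"]
      by (intro integral_mono Bochner_Integration.integrable_sum) (auto simp: sum_distrib_left)
  qed simp
  also have "\<dots> = W powr p * M"
    using W0 by (cases "W = 0") (simp_all add: powr_diff)
  finally have "(\<integral>r. cmod (rep (ae_class m h) r) powr p \<partial>m) powr (1 / p) \<le> (W powr p * M) powr (1 / p)"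
    using p by (intro powr_mono2) auto
  also have "\<dots> = M powr (1 / p) * W" using p W0 M(2) by (simp add: powr_mult powr_powr)
  also have "\<dots> \<le> M powr (1 / p) * vnorm U u"
    unfolding U_sel by (intro mult_left_mono) (simp_all add: l1_norm_rep W_def a_def)
  finally show "vnorm J (V_sum \<kappa> E S u) \<le> M powr (1 / p) * vnorm U u"
    by (simp add: VSu lp_norm_rep)
qed

section \<open>Local averages of convolutions\<close>

definition \<psi> :: "('g \<Rightarrow> complex) set \<Rightarrow> 'g set \<Rightarrow> ('g \<Rightarrow> complex) set \<Rightarrow> complex" where
  "\<psi> B K X = (\<integral>r. of_real (indicator K r) * rep (convolution m B X) r \<partial>m)"

lemma integrable_indicator_powr:
  assumes X: "X \<in> vcar Lp" and K [measurable]: "K \<in> sets borel"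
  shows "integrable m (\<lambda>r. indicator K r * cmod (rep X r) powr p)"
proof (rule Bochner_Integration.integrable_bound[OF lp_memD(2)[OF X]])
  have [measurable]: "rep X \<in> borel_measurable borel" by (rule lp_memD(1)[OF X])
  show "(\<lambda>r. indicator K r * cmod (rep X r) powr p) \<in> borel_measurable m" by simp
qed (auto simp: indicator_def)

lemma Lp_local_integrable:
  assumes X: "X \<in> vcar Lp" and K [measurable]: "K \<in> sets borel" and fK: "emeasure m K < \<infinity>"
  shows "integrable m (\<lambda>r. complex_of_real (indicator K r) * rep X r)"
proof (rule Bochner_Integration.integrable_bound)
  have [measurable]: "rep X \<in> borel_measurable borel" by (rule lp_memD(1)[OF X])
  show "integrable m (\<lambda>r. indicator K r + cmod (rep X r) powr p)"
    using lp_memD(2)[OF X] fK by (intro Bochner_Integration.integrable_add) simp_all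
  show "(\<lambda>r. complex_of_real (indicator K r) * rep X r) \<in> borel_measurable m" by simp
  have "cmod z \<le> 1 + cmod z powr p" for z :: complex
  proof (cases "cmod z \<le> 1")
    case True
    then show ?thesis using powr_ge_zero[of "cmod z" p] by linarith
  next
    case False
    then have "cmod z powr 1 \<le> cmod z powr p" using p by (intro powr_mono) auto
    then show ?thesis using False by simp
  qed
  then show "AE r in m. norm (complex_of_real (indicator K r) * rep X r) \<le> norm (indicator K r + cmod (rep X r) powr p)"
    by (intro AE_I2) (auto simp: indicator_def)
qed

lemma psi_add:
  assumes "B \<in> vcar L1" "X \<in> vcar Lp" "Y \<in> vcar Lp" "K \<in> sets borel" "emeasure m K < \<infinity>"
  shows "\<psi> B K (vadd Lp X Y) = \<psi> B K X + \<psi> B K Y"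
proof -
  let ?X = "convolution m B X" and ?Y = "convolution m B Y"
  have mem: "?X \<in> vcar Lp" "?Y \<in> vcar Lp" using assms by (auto intro: conv_Lp)
  note [measurable] = lp_memD(1)[OF mem(1)] lp_memD(1)[OF mem(2)] assms(4)
  have eq: "convolution m B (vadd Lp X Y) = ae_class m (\<lambda>t. rep ?X t + rep ?Y t)"
    using J.act_add_right[of B X Y] assms(1,2,3) by (simp add: lp_space_def)
  have ae: "AE r in m. rep (ae_class m (\<lambda>t. rep ?X t + rep ?Y t)) r = rep ?X r + rep ?Y r"
    and [measurable]: "rep (ae_class m (\<lambda>t. rep ?X t + rep ?Y t)) \<in> borel_measurable borel"
    by (rule rep_ae_class; simp)+
  have "\<psi> B K (vadd Lp X Y) = (\<integral>r. of_real (indicator K r) * rep ?X r + of_real (indicator K r) * rep ?Y r \<partial>m)"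
    unfolding \<psi>_def eq
  proof (rule integral_cong_AE)
    show "AE r in m. complex_of_real (indicator K r) * rep (ae_class m (\<lambda>t. rep ?X t + rep ?Y t)) r
        = of_real (indicator K r) * rep ?X r + of_real (indicator K r) * rep ?Y r"
      using ae by eventually_elim (simp add: distrib_left)
  qed simp_all
  then show ?thesis
    unfolding \<psi>_def using Lp_local_integrable[OF mem(1) assms(4,5)] Lp_local_integrable[OF mem(2) assms(4,5)] by simp
qed

lemma psi_scale:
  assumes "B \<in> vcar L1" "X \<in> vcar Lp" "K \<in> sets borel"
  shows "\<psi> B K (vscale Lp c X) = c * \<psi> B K X"
proof -
  let ?X = "convolution m B X"
  have mem: "?X \<in> vcar Lp" using assms by (auto intro: conv_Lp)
  note [measurable] = lp_memD(1)[OF mem] assms(3)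
  have eq: "convolution m B (vscale Lp c X) = ae_class m (\<lambda>t. c * rep ?X t)"
    using J.act_scale_right[of B X c] assms(1,2) by (simp add: lp_space_def)
  have ae: "AE r in m. rep (ae_class m (\<lambda>t. c * rep ?X t)) r = c * rep ?X r"
    and [measurable]: "rep (ae_class m (\<lambda>t. c * rep ?X t)) \<in> borel_measurable borel"
    by (rule rep_ae_class; simp)+
  have "\<psi> B K (vscale Lp c X) = (\<integral>r. c * (of_real (indicator K r) * rep ?X r) \<partial>m)"
    unfolding \<psi>_def eq
  proof (rule integral_cong_AE)
    show "AE r in m. complex_of_real (indicator K r) * rep (ae_class m (\<lambda>t. c * rep ?X t)) r
        = c * (of_real (indicator K r) * rep ?X r)"
      using ae by eventually_elim simp
  qed simp_all
  then show ?thesis unfolding \<psi>_def by simp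
qed

text \<open>On \<open>K s\<close> the convolution with \<open>b s\<close> only sees the restriction of \<open>X\<close> to \<open>E s\<close>.\<close>

lemma psi_local:
  assumes fS: "finite S" and X: "X \<in> vcar Lp" and b: "\<And>s. s \<in> S \<Longrightarrow> integrable m (b s)"
    and b1: "\<And>s. s \<in> S \<Longrightarrow> (\<integral>t. cmod (b s t) \<partial>m) \<le> 1"
    and K: "\<And>s. s \<in> S \<Longrightarrow> K s \<in> sets borel" "\<And>s. s \<in> S \<Longrightarrow> emeasure m (K s) < \<infinity>" "\<And>s. s \<in> S \<Longrightarrow> measure m (K s) = M"
    and E: "\<And>s. s \<in> S \<Longrightarrow> E s \<in> sets borel" and dis: "disjoint_family_on E S"
    and supp: "\<And>s t r. s \<in> S \<Longrightarrow> b s t \<noteq> 0 \<Longrightarrow> r \<in> K s \<Longrightarrow> - t + r \<in> E s"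
  shows "(\<Sum>s\<in>S. cmod (\<psi> (ae_class m (b s)) (K s) X) powr p) \<le> M powr (p - 1) * vnorm Lp X powr p"
proof -
  note xm [measurable] = lp_memD(1)[OF X]
  have each: "cmod (\<psi> (ae_class m (b s)) (K s) X) powr p
      \<le> M powr (p - 1) * (\<integral>t. indicator (E s) t * cmod (rep X t) powr p \<partial>m)" if s: "s \<in> S" for s
  proof -
    note [measurable] = E[OF s] K(1)[OF s]
    let ?x = "\<lambda>t. indicator (E s) t * rep X t"
    have pw: "cmod (?x t) powr p = indicator (E s) t * cmod (rep X t) powr p" for t
      by (simp add: indicator_def)
    have Z: "ae_class m ?x \<in> vcar Lp"
      using integrable_indicator_powr[OF X E[OF s]] by (intro lp_mem) (simp_all only: pw, simp)
    let ?B = "ae_class m (b s)"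
    have B: "?B \<in> vcar L1" by (rule l1_mem[OF b[OF s]])
    have BX: "convolution m ?B X \<in> vcar Lp" "convolution m ?B (ae_class m ?x) \<in> vcar Lp"
      by (intro conv_Lp B X Z)+
    have c1: "convolution m ?B X = ae_class m (conv_fun (b s) (rep X))"
      using convolution_ae_class[OF b[OF s] xm] by (simp add: lp_memD(3)[OF X])
    have c2: "convolution m ?B (ae_class m ?x) = ae_class m (conv_fun (b s) ?x)"
      by (rule convolution_ae_class[OF b[OF s]]) simp
    have cveq: "conv_fun (b s) ?x r = conv_fun (b s) (rep X) r" if "r \<in> K s" for r
      unfolding conv_fun_def using supp[OF s _ that]
      by (intro Bochner_Integration.integral_cong refl) (auto simp: indicator_def)
    let ?Y = "rep (convolution m ?B (ae_class m ?x))"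
    note [measurable] = lp_memD(1)[OF BX(1)] lp_memD(1)[OF BX(2)]
    have "\<psi> ?B (K s) X = (\<integral>r. of_real (indicator (K s) r) * ?Y r \<partial>m)"
      unfolding \<psi>_def
    proof (rule integral_cong_AE)
      show "AE r in m. complex_of_real (indicator (K s) r) * rep (convolution m ?B X) r = of_real (indicator (K s) r) * ?Y r"
        using lp_rep[OF BX(1)[unfolded c1]] lp_rep[OF BX(2)[unfolded c2]] unfolding c1 c2
      proof eventually_elim
        case (elim r)
        then show ?case using cveq[of r] by (cases "r \<in> K s") simp_all
      qed
    qed simp_all
    \<comment> \<open>Jensen's inequality on \<open>K s\<close> produces the factor
      \<open>M powr (p - 1)\<close>.\<close>
    then have "cmod (\<psi> ?B (K s) X) powr p
        \<le> (\<integral>r. indicator (K s) r \<partial>m) powr (p - 1) * (\<integral>r. indicator (K s) r * cmod (?Y r) powr p \<partial>m)"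
      using jensen_powr[of p m "indicator (K s)" ?Y] p K(1,2)[OF s] integrable_indicator_powr[OF BX(2) K(1)[OF s]]
      by simp
    also have "\<dots> \<le> M powr (p - 1) * (\<integral>r. cmod (?Y r) powr p \<partial>m)"
    proof -
      have "indicator (K s) r * cmod (?Y r) powr p \<le> cmod (?Y r) powr p" for r
        by (cases "r \<in> K s") simp_all
      then have "(\<integral>r. indicator (K s) r * cmod (?Y r) powr p \<partial>m) \<le> (\<integral>r. cmod (?Y r) powr p \<partial>m)"
        by (intro integral_mono integrable_indicator_powr[OF BX(2) K(1)[OF s]] lp_memD(2)[OF BX(2)])
      then show ?thesis using K(3)[OF s] by (simp add: mult_left_mono)
    qed
    also have "(\<integral>r. cmod (?Y r) powr p \<partial>m) = vnorm Lp (convolution m ?B (ae_class m ?x)) powr p"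
      using p by (simp add: lp_norm_powr)
    \<comment> \<open>Convolution by a function of norm at most 1 in \<open>L1\<close> does not
      increase the norm; this bound is part of the module axioms.\<close>
    also have "\<dots> \<le> vnorm Lp (ae_class m ?x) powr p"
    proof (rule powr_mono2)
      have "vnorm Lp (convolution m ?B (ae_class m ?x)) \<le> vnorm L1 ?B * vnorm Lp (ae_class m ?x)"
        by (intro conv_Lp B Z)
      also have "\<dots> \<le> 1 * vnorm Lp (ae_class m ?x)"
        using b1[OF s] J.M.norm_nonneg[of "ae_class m ?x"] Z by (intro mult_right_mono) (simp_all add: l1_norm[OF b[OF s]])
      finally show "vnorm Lp (convolution m ?B (ae_class m ?x)) \<le> vnorm Lp (ae_class m ?x)" by simp
    qed (use p J.M.norm_nonneg[of "convolution m ?B (ae_class m ?x)"] BX in auto)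
    also have "\<dots> = (\<integral>t. cmod (?x t) powr p \<partial>m)"
      using p lp_norm[of ?x p] by (simp add: powr_powr)
    finally show ?thesis unfolding pw by (simp add: mult_left_mono)
  qed
  have "(\<Sum>s\<in>S. cmod (\<psi> (ae_class m (b s)) (K s) X) powr p)
      \<le> (\<Sum>s\<in>S. M powr (p - 1) * (\<integral>t. indicator (E s) t * cmod (rep X t) powr p \<partial>m))"
    by (intro sum_mono each)
  also have "\<dots> = M powr (p - 1) * (\<integral>t. (\<Sum>s\<in>S. indicator (E s) t * cmod (rep X t) powr p) \<partial>m)"
    using integrable_indicator_powr[OF X E] by (simp add: sum_distrib_left)
  also have "\<dots> \<le> M powr (p - 1) * (\<integral>t. cmod (rep X t) powr p \<partial>m)"
  proof (intro mult_left_mono integral_mono Bochner_Integration.integrable_sum integrable_indicator_powr X E lp_memD(2)[OF X])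
    fix t
    have "(\<Sum>s\<in>S. indicator (E s) t) \<le> (1::real)"
    proof (cases "\<exists>s\<in>S. t \<in> E s")
      case True
      then obtain s0 where s0: "s0 \<in> S" "t \<in> E s0" by blast
      have "(\<Sum>s\<in>S. indicator (E s) t) = (\<Sum>s\<in>S. if s = s0 then 1 else (0::real))"
        using dis s0 unfolding disjoint_family_on_def by (intro sum.cong) (auto simp: indicator_def)
      then show ?thesis using fS s0 by simp
    next
      case False
      then have "(\<Sum>s\<in>S. indicator (E s) t) = (0::real)" by (intro sum.neutral) (auto simp: indicator_def)
      then show ?thesis by simp
    qed
    then have "(\<Sum>s\<in>S. indicator (E s) t) * cmod (rep X t) powr p \<le> 1 * cmod (rep X t) powr p"
      by (rule mult_right_mono) simp
    then show "(\<Sum>s\<in>S. indicator (E s) t * cmod (rep X t) powr p) \<le> cmod (rep X t) powr p"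
      by (simp add: sum_distrib_right)
  qed simp_all
  also have "(\<integral>t. cmod (rep X t) powr p \<partial>m) = vnorm Lp X powr p" using p by (simp add: lp_norm_powr)
  finally show ?thesis .
qed

end

section \<open>Averages over signs\<close>

lemma jensen_powr_sum:
  fixes w :: "'a \<Rightarrow> real" and h :: "'a \<Rightarrow> complex"
  assumes "finite A" "1 \<le> p" "\<And>x. 0 \<le> w x"
  shows "cmod (\<Sum>x\<in>A. of_real (w x) * h x) powr p
    \<le> (\<Sum>x\<in>A. w x) powr (p - 1) * (\<Sum>x\<in>A. w x * cmod (h x) powr p)"
  using jensen_powr[of p "count_space A" w h] assms
  by (simp add: lebesgue_integral_count_space_finite integrable_count_space)

text \<open>Convexity of the \<open>p\<close>-th power, as Jensen's inequality with two equal
  weights at \<open>y - a\<close> and \<open>y + a\<close>.\<close>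

lemma powr_midpoint:
  assumes "1 \<le> p" shows "2 * cmod y powr p \<le> cmod (y - a) powr p + cmod (y + a) powr p"
proof -
  have "cmod (\<Sum>b\<in>(UNIV::bool set). of_real 1 * (if b then y + a else y - a)) powr p
      \<le> (\<Sum>b\<in>(UNIV::bool set). 1) powr (p - 1) * (\<Sum>b\<in>UNIV. 1 * cmod (if b then y + a else y - a) powr p)"
    using assms by (intro jensen_powr_sum) auto
  then have "cmod (2 * y) powr p \<le> 2 powr (p - 1) * (cmod (y - a) powr p + cmod (y + a) powr p)"
    by (simp add: UNIV_bool)
  moreover have "cmod (2 * y) powr p = 2 powr (p - 1) * (2 * cmod y powr p)"
    by (simp add: norm_mult powr_mult powr_diff)
  ultimately show ?thesis by simp
qed

text \<open>A choice of signs is encoded by the set of indices with sign +, so that averages over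
  signs become sums over \<open>Pow S\<close>.\<close>

definition signs :: "'s set \<Rightarrow> 's \<Rightarrow> complex" where
  "signs E s = (if s \<in> E then 1 else - 1)"

lemma sum_Pow_insert:
  assumes "finite S" "s \<notin> S"
  shows "(\<Sum>E\<in>Pow (insert s S). f E) = (\<Sum>E\<in>Pow S. f E + f (insert s E))"
proof -
  have "inj_on (insert s) (Pow S)" using assms(2) by (intro inj_onI) (metis PowD insert_ident subsetD)
  moreover have "Pow S \<inter> insert s ` Pow S = {}" using assms(2) by auto
  ultimately show ?thesis
    using assms(1) by (simp add: Pow_insert sum.union_disjoint sum.reindex sum.distrib)
qed

lemma sum_signs_insert:
  assumes "finite S" "s \<notin> S" "E \<subseteq> S"
  shows "(\<Sum>i\<in>insert s S. signs E i * a i) = (\<Sum>i\<in>S. signs E i * a i) - a s"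
    "(\<Sum>i\<in>insert s S. signs (insert s E) i * a i) = (\<Sum>i\<in>S. signs E i * a i) + a s"
proof -
  have "(\<Sum>i\<in>S. signs (insert s E) i * a i) = (\<Sum>i\<in>S. signs E i * a i)"
    using assms(2) by (intro sum.cong) (auto simp: signs_def)
  then show "(\<Sum>i\<in>insert s S. signs E i * a i) = (\<Sum>i\<in>S. signs E i * a i) - a s"
    "(\<Sum>i\<in>insert s S. signs (insert s E) i * a i) = (\<Sum>i\<in>S. signs E i * a i) + a s"
    using assms by (auto simp: signs_def)
qed

text \<open>A new index splits the sum into those for the shifts \<open>y - a s\<close> and
  \<open>y + a s\<close>, which \<open>powr_midpoint\<close> compares with \<open>y\<close>. The
  induction therefore has to vary \<open>y\<close>.\<close>

lemma sign_average_shift: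
  assumes "finite S" "1 \<le> p"
  shows "2 ^ card S * cmod y powr p \<le> (\<Sum>E\<in>Pow S. cmod (y + (\<Sum>i\<in>S. signs E i * a i)) powr p)"
  using assms(1)
proof (induction S arbitrary: y)
  case (insert s S)
  have "2 ^ card (insert s S) * cmod y powr p = 2 ^ card S * (2 * cmod y powr p)"
    using insert.hyps by simp
  also have "\<dots> \<le> 2 ^ card S * (cmod (y - a s) powr p + cmod (y + a s) powr p)"
    by (intro mult_left_mono powr_midpoint assms) simp
  also have "\<dots> \<le> (\<Sum>E\<in>Pow S. cmod (y - a s + (\<Sum>i\<in>S. signs E i * a i)) powr p)
      + (\<Sum>E\<in>Pow S. cmod (y + a s + (\<Sum>i\<in>S. signs E i * a i)) powr p)"
    unfolding distrib_left by (intro add_mono insert.IH)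
  also have "\<dots> = (\<Sum>E\<in>Pow (insert s S). cmod (y + (\<Sum>i\<in>insert s S. signs E i * a i)) powr p)"
    unfolding sum_Pow_insert[OF insert.hyps(1,2)] sum.distrib[symmetric]
  proof (rule sum.cong[OF refl])
    fix E assume "E \<in> Pow S"
    then have "E \<subseteq> S" by simp
    from sum_signs_insert[OF insert.hyps(1,2) this, of a]
    show "cmod (y - a s + (\<Sum>i\<in>S. signs E i * a i)) powr p + cmod (y + a s + (\<Sum>i\<in>S. signs E i * a i)) powr p
      = cmod (y + (\<Sum>i\<in>insert s S. signs E i * a i)) powr p + cmod (y + (\<Sum>i\<in>insert s S. signs (insert s E) i * a i)) powr p"
      by (simp only: add.assoc diff_conv_add_uminus add.commute add.left_commute)
  qed
  finally show ?case .
qed simp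

text \<open>In row \<open>s\<close>, the sum is \<open>\<plusminus> x s s\<close> plus a signed sum
  of the other entries, whose average \<open>sign_average_shift\<close> discards. Interchanging the
  sums over rows and over signs then bounds the diagonal by the common bound \<open>c\<close>, with
  no assumption on the other entries.\<close>

lemma sign_average_diagonal:
  fixes x :: "'s \<Rightarrow> 's \<Rightarrow> complex"
  assumes S: "finite S" and p: "1 \<le> p"
    and le: "\<And>E. E \<subseteq> S \<Longrightarrow> (\<Sum>s\<in>S. cmod (\<Sum>i\<in>S. signs E i * x s i) powr p) \<le> c"
  shows "(\<Sum>s\<in>S. cmod (x s s) powr p) \<le> c"
proof -
  have row: "2 ^ card S * cmod (x s s) powr p \<le> (\<Sum>E\<in>Pow S. cmod (\<Sum>i\<in>S. signs E i * x s i) powr p)"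
    if s: "s \<in> S" for s
  proof -
    obtain S' where S': "S = insert s S'" "s \<notin> S'" using s by (meson Set.set_insert)
    then have fS': "finite S'" using S by simp
    have "2 ^ card S * cmod (x s s) powr p
        = 2 ^ card S' * cmod (- x s s) powr p + 2 ^ card S' * cmod (x s s) powr p"
      using S' fS' by simp
    also have "\<dots> \<le> (\<Sum>E\<in>Pow S'. cmod (- x s s + (\<Sum>i\<in>S'. signs E i * x s i)) powr p)
        + (\<Sum>E\<in>Pow S'. cmod (x s s + (\<Sum>i\<in>S'. signs E i * x s i)) powr p)"
      by (intro add_mono sign_average_shift fS' p)
    also have "\<dots> = (\<Sum>E\<in>Pow S. cmod (\<Sum>i\<in>S. signs E i * x s i) powr p)"
      unfolding S'(1) sum_Pow_insert[OF fS' S'(2)] sum.distrib[symmetric]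
    proof (rule sum.cong[OF refl])
      fix E assume "E \<in> Pow S'"
      then have "E \<subseteq> S'" by simp
      from sum_signs_insert[OF fS' S'(2) this, of "x s"]
      show "cmod (- x s s + (\<Sum>i\<in>S'. signs E i * x s i)) powr p + cmod (x s s + (\<Sum>i\<in>S'. signs E i * x s i)) powr p
        = cmod (\<Sum>i\<in>insert s S'. signs E i * x s i) powr p + cmod (\<Sum>i\<in>insert s S'. signs (insert s E) i * x s i) powr p"
        by (simp only: diff_conv_add_uminus add.commute)
    qed
    finally show ?thesis .
  qed
  have "2 ^ card S * (\<Sum>s\<in>S. cmod (x s s) powr p) \<le> (\<Sum>s\<in>S. \<Sum>E\<in>Pow S. cmod (\<Sum>i\<in>S. signs E i * x s i) powr p)"
    unfolding sum_distrib_left by (intro sum_mono row)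
  also have "\<dots> = (\<Sum>E\<in>Pow S. \<Sum>s\<in>S. cmod (\<Sum>i\<in>S. signs E i * x s i) powr p)"
    by (rule sum.swap)
  also have "\<dots> \<le> (\<Sum>E\<in>Pow S. c)" by (intro sum_mono le) auto
  also have "\<dots> = 2 ^ card S * c" using S by (simp add: card_Pow)
  finally show ?thesis by simp
qed

section \<open>Almost invariant functionals\<close>

locale injective_lp = lp_module m p for m :: "'g::{topological_group_add, t2_space} measure" and p +
  fixes \<rho> :: "(('g \<Rightarrow> complex) set \<times> complex \<Rightarrow> ('g \<Rightarrow> complex) set) \<Rightarrow> ('g \<Rightarrow> complex) set"
  assumes rho: "module_morphism (L1_algebra m) (coinduced_module (L1_algebra m) (Lp_module m p)) (Lp_module m p) \<rho>"
    and rho_id: "\<And>x. x \<in> vcar (Lp_module m p) \<Longrightarrow>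
      \<rho> (\<lambda>u\<in>vcar (unitization_space (L1_algebra m)). unit_act (Lp_module m p) u x) = x"
begin

abbreviation "Op \<equiv> op_space U J"

lemma rho_op: "bounded_op Op J \<rho>"
  using rho by (simp add: module_morphism_def coinduced_module_def bounded_op_extend')

lemma rho_mem: "T \<in> vcar Op \<Longrightarrow> \<rho> T \<in> vcar Lp"
  using bounded_opD(1)[OF rho_op] by simp

lemma rho_add: "S \<in> vcar Op \<Longrightarrow> T \<in> vcar Op \<Longrightarrow> \<rho> (vadd Op S T) = vadd Lp (\<rho> S) (\<rho> T)"
  using bounded_opD(2)[OF rho_op] by simp

lemma rho_scale: "T \<in> vcar Op \<Longrightarrow> \<rho> (vscale Op c T) = vscale Lp c (\<rho> T)"
  using bounded_opD(3)[OF rho_op] by simp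

text \<open>The product of \<open>u\<close> and \<open>B\<close> in the unitization. It lies in
  \<open>L1\<close>, an ideal of the unitization.\<close>

definition W :: "('g \<Rightarrow> complex) set \<Rightarrow> ('g \<Rightarrow> complex) set \<times> complex \<Rightarrow> ('g \<Rightarrow> complex) set" where
  "W B u = vadd L1 (convolution m (fst u) B) (vscale L1 (snd u) B)"

lemma W_mem: "B \<in> vcar L1 \<Longrightarrow> u \<in> vcar U \<Longrightarrow> W B u \<in> vcar L1"
  unfolding W_def using J.A.add_closed J.A.scale_closed by (simp add: U_car conv_L1)

lemma rho_act:
  assumes "B \<in> vcar L1" "T \<in> vcar Op"
  shows "\<rho> (\<lambda>u\<in>vcar U. T (W B u, 0)) = convolution m B (\<rho> T)"
  using rho assms by (simp add: module_morphism_def coinduced_module_def W_def)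

lemma W_right_translate:
  assumes "B \<in> vcar L1" "u \<in> vcar U" shows "W (right_translate s B) u = right_translate s (W B u)"
proof -
  have "fst u \<in> vcar L1" using assms(2) by (simp add: U_car)
  moreover have "vscale L1 (snd u) B \<in> vcar L1" using J.A.scale_closed assms(1) by simp
  ultimately show ?thesis
    unfolding W_def using assms(1) by (simp add: conv_right_translate right_translate_add conv_L1 right_translate_scale)
qed

lemma U_pair: "X \<in> vcar L1 \<Longrightarrow> (X, z) \<in> vcar U"
  by (simp add: U_car)

lemma translate_ind_sets:
  assumes "E \<in> sets borel" "emeasure m E < \<infinity>"
  shows "(\<lambda>t. s + t) ` E \<in> sets borel" "emeasure m ((\<lambda>t. s + t) ` E) < \<infinity>"
  using assms by (simp_all add: emeasure_translate left_image_sets)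

text \<open>The morphism property is all that is known of \<open>\<rho>\<close>, so the shift is
  carried by the convolution factor. The left translate of \<open>B\<close> is written as a right
  translate of \<open>B'\<close>; right translation commutes with \<open>W\<close>, turns the
  shifted \<open>\<kappa>\<close> back into \<open>\<kappa>\<close>, and moves across the
  convolution onto \<open>E\<close>.\<close>

lemma equivariance:
  assumes k: "bdd_borel \<kappa>" and E: "E \<in> sets borel" "emeasure m E < \<infinity>"
    and B: "B' \<in> vcar L1" "L1_translate m s B = right_translate s B'"
  shows "convolution m (L1_translate m s B) (\<rho> (V (\<lambda>t. \<kappa> (t - s)) E))
    = convolution m B' (\<rho> (V \<kappa> ((\<lambda>t. s + t) ` E)))"
proof -
  have "convolution m (right_translate s B') (\<rho> (V (\<lambda>t. \<kappa> (t - s)) E))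
      = \<rho> (\<lambda>u\<in>vcar U. V (\<lambda>t. \<kappa> (t - s)) E (W (right_translate s B') u, 0))"
    by (intro rho_act[symmetric] right_translate_mem B V_mem bdd_borel_right k E)
  also have "(\<lambda>u\<in>vcar U. V (\<lambda>t. \<kappa> (t - s)) E (W (right_translate s B') u, 0))
      = (\<lambda>u\<in>vcar U. V \<kappa> ((\<lambda>t. s + t) ` E) (W B' u, 0))"
  proof (rule restrict_ext)
    fix u assume u: "u \<in> vcar U"
    have W: "W B' u \<in> vcar L1" by (rule W_mem[OF B(1) u])
    have "V (\<lambda>t. \<kappa> (t - s)) E (W (right_translate s B') u, 0)
        = convolution m (mult_class (\<lambda>t. \<kappa> (t - s)) (right_translate s (W B' u))) (ind E)"
      by (simp add: V_def W_right_translate[OF B(1) u] U_pair right_translate_mem W)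
    also have "\<dots> = convolution m (mult_class \<kappa> (W B' u)) (ind ((\<lambda>t. s + t) ` E))"
      unfolding mult_class_right_translate[OF W k] by (intro conv_right_translate_ind mult_class_mem k W E)
    finally show "V (\<lambda>t. \<kappa> (t - s)) E (W (right_translate s B') u, 0) = V \<kappa> ((\<lambda>t. s + t) ` E) (W B' u, 0)"
      by (simp add: V_def U_pair W)
  qed
  also have "\<rho> \<dots> = convolution m B' (\<rho> (V \<kappa> ((\<lambda>t. s + t) ` E)))"
    by (intro rho_act B V_mem k translate_ind_sets E)
  finally show ?thesis by (simp only: B)
qed

text \<open>Left translation of \<open>b\<close> translates the convolution, and left invariance of
  \<open>m\<close> compensates this by the translate of \<open>K\<close>; \<open>X\<close> itself
  stays fixed.\<close>

lemma psi_translate: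
  assumes b: "integrable m b" and X: "X \<in> vcar Lp" and K [measurable]: "K \<in> sets borel"
  shows "\<psi> (ae_class m b) K X = \<psi> (ae_class m (\<lambda>t. b (- s + t))) ((\<lambda>t. s + t) ` K) X"
proof -
  note [measurable] = borel_measurable_integrable[OF b, simplified] lp_memD(1)[OF X]
  let ?B = "ae_class m b" and ?B' = "ae_class m (\<lambda>t. b (- s + t))"
  have b': "integrable m (\<lambda>t. b (- s + t))" by (rule integrable_translate[OF b])
  have mem: "convolution m ?B X \<in> vcar Lp" "convolution m ?B' X \<in> vcar Lp"
    by (intro conv_Lp l1_mem b b' X)+
  have c: "convolution m ?B X = ae_class m (conv_fun b (rep X))"
    "convolution m ?B' X = ae_class m (conv_fun (\<lambda>t. b (- s + t)) (rep X))"
    using convolution_ae_class[OF b, of "rep X"] convolution_ae_class[OF b', of "rep X"]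
    by (simp_all add: lp_memD(3)[OF X])
  note [measurable] = lp_memD(1)[OF mem(1)] lp_memD(1)[OF mem(2)]
  let ?h = "\<lambda>r. complex_of_real (indicator K r) * rep (convolution m ?B X) r"
  have "\<psi> ?B' ((\<lambda>t. s + t) ` K) X = (\<integral>r. ?h (- s + r) \<partial>m)"
    unfolding \<psi>_def
  proof (rule integral_cong_AE)
    have [measurable]: "?h \<in> borel_measurable borel" by measurable
    show "(\<lambda>r. ?h (- s + r)) \<in> borel_measurable m"
      using measurable_compose[OF measurable_left_add, of ?h borel "- s"] by simp
    show "AE r in m. complex_of_real (indicator ((\<lambda>t. s + t) ` K) r) * rep (convolution m ?B' X) r = ?h (- s + r)"
      using lp_rep[OF mem(2)[unfolded c]] AE_left[OF lp_rep[OF mem(1)[unfolded c]], of "- s"] unfolding c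
    proof eventually_elim
      case (elim r)
      have "indicator ((\<lambda>t. s + t) ` K) r = (indicator K (- s + r) :: real)"
        unfolding left_image by (simp add: indicator_def)
      then show ?case using elim conv_fun_left_translate[of b "rep X" s r] by simp
    qed
  qed simp
  also have "\<dots> = \<psi> ?B K X" unfolding \<psi>_def by (rule integral_left) measurable
  finally show ?thesis by simp
qed

lemma mult_class_one: "X \<in> vcar L1 \<Longrightarrow> mult_class (\<lambda>t. 1) X = X"
  by (simp add: mult_class_def lp_memD(3))

lemma V_scale:
  assumes k: "bdd_borel \<kappa>" and E: "E \<in> sets borel" "emeasure m E < \<infinity>"
  shows "V (\<lambda>t. c * \<kappa> t) E = vscale Op c (V \<kappa> E)"
proof -
  have "mult_class (\<lambda>t. c * \<kappa> t) X = vscale L1 c (mult_class \<kappa> X)" if X: "X \<in> vcar L1" for X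
    unfolding mult_class_def using lp_scale[OF mult_class_mem[OF k X, unfolded mult_class_def], of 1 c] by (simp add: mult.left_commute)
  then show ?thesis
    unfolding V_def op_space_sel using J.act_scale_left[of _ "ind E" c] ind_mem[OF E, of p] mult_class_mem[OF k]
    by (intro restrict_ext) (simp add: U_car)
qed

lemma V_add:
  assumes k: "bdd_borel \<kappa>" "bdd_borel \<mu>" and E: "E \<in> sets borel" "emeasure m E < \<infinity>"
  shows "V (\<lambda>t. \<kappa> t + \<mu> t) E = vadd Op (V \<kappa> E) (V \<mu> E)"
proof -
  have "mult_class (\<lambda>t. \<kappa> t + \<mu> t) X = vadd L1 (mult_class \<kappa> X) (mult_class \<mu> X)" if X: "X \<in> vcar L1" for X
    unfolding mult_class_def using lp_add[OF mult_class_mem[OF k(1) X, unfolded mult_class_def] mult_class_mem[OF k(2) X, unfolded mult_class_def], of 1]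
    by (simp add: distrib_left)
  then show ?thesis
    unfolding V_def op_space_sel using J.act_add_left[of _ _ "ind E"] ind_mem[OF E, of p] mult_class_mem[OF k(1)] mult_class_mem[OF k(2)]
    by (intro restrict_ext) (simp add: U_car)
qed

lemma psi_rho_V_sum:
  assumes "finite S" "\<And>s. s \<in> S \<Longrightarrow> bdd_borel (\<kappa> s)" "\<And>s. s \<in> S \<Longrightarrow> E s \<in> sets borel" "\<And>s. s \<in> S \<Longrightarrow> emeasure m (E s) < \<infinity>"
    and B: "B \<in> vcar L1" and K: "K \<in> sets borel" "emeasure m K < \<infinity>"
  shows "\<psi> B K (\<rho> (V_sum \<kappa> E S)) = (\<Sum>s\<in>S. \<psi> B K (\<rho> (V (\<kappa> s) (E s))))"
  using assms(1-4)
proof (induction S)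
  case empty
  have "V_sum \<kappa> E {} = vscale Op 0 (vzero Op)"
    unfolding V_sum_empty by (simp add: O.scale_vzero)
  then show ?case
    using psi_scale[OF B rho_mem[OF O.zero_closed] K(1), of 0] rho_scale[OF O.zero_closed, of 0] by simp
next
  case (insert s S)
  have S: "V_sum \<kappa> E S \<in> vcar Op" using insert by (intro V_sum_mem) simp_all
  have k: "bdd_borel (\<kappa> s)" "E s \<in> sets borel" "emeasure m (E s) < \<infinity>" using insert.prems by simp_all
  show ?case
    unfolding V_sum_insert[OF insert.hyps(1,2) k S] rho_add[OF V_mem[OF k] S]
      psi_add[OF B rho_mem[OF V_mem[OF k]] rho_mem[OF S] K]
    using insert by simp
qed


text \<open>The sets \<open>s + F\<close> and \<open>s' + F\<close> can meet only if
  \<open>- s + s'\<close> is a difference of two elements of \<open>F\<close>. The finite set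
  \<open>T\<close> of these values for \<open>s \<noteq> s'\<close> is closed and omits
  \<open>0\<close>, so continuity of subtraction at \<open>(0, 0)\<close> yields
  \<open>F\<close>.\<close>

lemma disjoint_translates:
  fixes S :: "'g set"
  assumes S: "finite S"
  obtains F where "open F" "0 \<in> F" "emeasure m F < \<infinity>" "disjoint_family_on (\<lambda>s. (\<lambda>t. s + t) ` F) S"
proof -
  define T where "T = (\<lambda>(s, s'). - s + s') ` {(s, s') \<in> S \<times> S. s \<noteq> s'}"
  have "finite T" unfolding T_def by (rule finite_imageI, rule finite_subset[of _ "S \<times> S"]) (use S in auto)
  then have "open (- T)" by (intro open_Compl finite_imp_closed)
  then have o: "open ((\<lambda>z. fst z + - snd z) -` (- T))" by (rule open_vimage) (intro continuous_intros)
  have "0 \<notin> T"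
  proof
    assume "0 \<in> T"
    then obtain z where z: "0 = (\<lambda>(s, s'). - s + s') z" "z \<in> {(s, s') \<in> S \<times> S. s \<noteq> s'}"
      unfolding T_def by (rule imageE)
    obtain s s' where ss: "z = (s, s')" by (cases z)
    have "s \<noteq> s'" "0 = - s + s'" using z unfolding ss by auto
    then have "s + (- s + s') = s" by simp
    then have "s' = s" by (simp add: add.assoc[symmetric])
    with \<open>s \<noteq> s'\<close> show False by simp
  qed
  then have "(0, 0) \<in> (\<lambda>z. fst z + - snd z) -` (- T)" by simp
  then obtain P Q where PQ: "open P" "open Q" "(0, 0) \<in> P \<times> Q" "P \<times> Q \<subseteq> (\<lambda>z. fst z + - snd z) -` (- T)"
    by (rule open_prod_elim[OF o])
  obtain N C where N: "open N" "compact C" "(0::'g) \<in> N" "N \<subseteq> C" by (rule compact_nbhd[of 0])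
  show ?thesis
  proof
    show "open (P \<inter> Q \<inter> N)" using PQ N by auto
    show "0 \<in> P \<inter> Q \<inter> N" using PQ N by auto
    have "emeasure m (P \<inter> Q \<inter> N) \<le> emeasure m C" using N by (intro emeasure_mono) (auto simp: compact_sets)
    then show "emeasure m (P \<inter> Q \<inter> N) < \<infinity>" using compact_finite[OF N(2)] by simp
    show "disjoint_family_on (\<lambda>s. (\<lambda>t. s + t) ` (P \<inter> Q \<inter> N)) S"
      unfolding disjoint_family_on_def
    proof (intro ballI impI equals0I)
      fix s s' x assume s: "s \<in> S" "s' \<in> S" "s \<noteq> s'"
        and x: "x \<in> (\<lambda>t. s + t) ` (P \<inter> Q \<inter> N) \<inter> (\<lambda>t. s' + t) ` (P \<inter> Q \<inter> N)"
      then obtain f f' where f: "f \<in> P" "f' \<in> Q" "s + f = s' + f'" by auto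
      have "- s + (s + f) + - f' = - s + (s' + f') + - f'" using f(3) by simp
      then have "f + - f' = - s + s'" by (simp add: add.assoc[symmetric])
      moreover have "- s + s' \<in> T" unfolding T_def using s by (intro image_eqI[of _ _ "(s, s')"]) simp_all
      moreover have "(f, f') \<in> P \<times> Q" using f by simp
      ultimately have "(f, f') \<in> (\<lambda>z. fst z + - snd z) -` (- T)" using PQ(4) by blast
      with \<open>f + - f' = - s + s'\<close> \<open>- s + s' \<in> T\<close> show False by simp
    qed
  qed
qed

text \<open>Inner regularity of the open set \<open>F\<close> gives \<open>K\<close>. Since
  \<open>K \<subseteq> F\<close>, the shift \<open>0\<close> is admissible, and by
  \<open>tube\<close> the admissible shifts form an open set; intersecting it with a neighbourhood
  of \<open>0\<close> inside a compact set makes its measure finite.\<close>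

lemma exists_kernel_sets:
  fixes S :: "'g set"
  assumes S: "finite S" and c: "1 < (c::real)"
  obtains F K B where "open F" "emeasure m F < \<infinity>" "disjoint_family_on (\<lambda>s. (\<lambda>t. s + t) ` F) S"
    "compact K" "0 < measure m K" "measure m F \<le> c * measure m K"
    "open B" "emeasure m B < \<infinity>" "0 < measure m B" "\<And>t r. t \<in> B \<Longrightarrow> r \<in> K \<Longrightarrow> - t + r \<in> F"
proof -
  obtain F where F: "open F" "0 \<in> F" "emeasure m F < \<infinity>" "disjoint_family_on (\<lambda>s. (\<lambda>t. s + t) ` F) S"
    by (rule disjoint_translates[OF S])
  have pF: "0 < measure m F"
    using open_pos[OF F(1,2)] F(3) by (simp add: measure_def enn2real_positive_iff)
  have eF: "emeasure m F = ennreal (measure m F)" using F(3) by (simp add: emeasure_eq_ennreal_measure)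
  have "measure m F / c < measure m F" using c pF by (simp add: field_simps)
  then have "ennreal (measure m F / c) < emeasure m F" using pF unfolding eF by (simp add: ennreal_lessI)
  then obtain K where K: "compact K" "K \<subseteq> F" "ennreal (measure m F / c) < emeasure m K"
    by (rule inner_approx[OF F(1)])
  have "emeasure m K = ennreal (measure m K)" using compact_finite[OF K(1)] by (simp add: emeasure_eq_ennreal_measure)
  then have mK: "measure m F / c < measure m K" using K(3) pF c by (simp add: ennreal_less_iff)
  moreover have "0 < measure m F / c" using pF c by simp
  ultimately have pK: "0 < measure m K" by linarith
  have "open {t. \<forall>r\<in>K. - t + r \<in> F}" by (intro tube K(1) F(1) continuous_intros)
  moreover obtain N C where N: "open N" "compact C" "(0::'g) \<in> N" "N \<subseteq> C" by (rule compact_nbhd[of 0])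
  ultimately have oB: "open ({t. \<forall>r\<in>K. - t + r \<in> F} \<inter> N)" by auto
  have "emeasure m ({t. \<forall>r\<in>K. - t + r \<in> F} \<inter> N) \<le> emeasure m C"
    using N by (intro emeasure_mono) (auto simp: compact_sets)
  then have fB: "emeasure m ({t. \<forall>r\<in>K. - t + r \<in> F} \<inter> N) < \<infinity>" using compact_finite[OF N(2)] by simp
  have "0 < emeasure m ({t. \<forall>r\<in>K. - t + r \<in> F} \<inter> N)"
    by (rule open_pos[OF oB, of 0]) (use N K in auto)
  then have pB: "0 < measure m ({t. \<forall>r\<in>K. - t + r \<in> F} \<inter> N)"
    using fB by (simp add: measure_def enn2real_positive_iff)
  have "measure m F \<le> c * measure m K" using mK c by (simp add: field_simps)
  from that[OF F(1,3,4) K(1) pK this oB fB pB] show ?thesis by simp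
qed

text \<open>The bound is uniform in \<open>S\<close> because the measures cancel:
  \<open>psi_local\<close> contributes \<open>measure m K powr (p - 1)\<close>,
  \<open>V_sum_norm\<close> contributes \<open>measure m F\<close>, and the ratio
  \<open>2 powr p\<close> of the kernel sets turns the product into a multiple of
  \<open>measure m K powr p\<close>, which the averaging in \<open>M\<close> divides out. The factor
  2 in \<open>2 * C\<close> is the \<open>p\<close>-th root of that ratio.\<close>

lemma almost_invariant_functional:
  obtains C where "0 \<le> C" "\<And>S. finite S \<Longrightarrow> \<exists>M.
    (\<forall>\<kappa> \<mu>. bdd_borel \<kappa> \<longrightarrow> bdd_borel \<mu> \<longrightarrow> M (\<lambda>t. \<kappa> t + \<mu> t) = M \<kappa> + M \<mu>) \<and> (\<forall>c \<kappa>. bdd_borel \<kappa> \<longrightarrow> M (\<lambda>t. c * \<kappa> t) = c * M \<kappa>) \<and>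
    M (\<lambda>t. 1) = (1::complex) \<and>
    (\<forall>T \<kappa>. T \<subseteq> S \<longrightarrow> (\<forall>s\<in>T. bdd_borel (\<kappa> s)) \<longrightarrow> (\<forall>t. (\<Sum>s\<in>T. cmod (\<kappa> s t) powr p) \<le> 1) \<longrightarrow>
      (\<Sum>s\<in>T. cmod (M (\<lambda>t. \<kappa> s (t - s))) powr p) \<le> C powr p)"
proof -
  have nOp: "complex_normed_space Op" by unfold_locales
  obtain C where C: "0 \<le> C" "\<And>T. T \<in> vcar Op \<Longrightarrow> vnorm J (\<rho> T) \<le> C * vnorm Op T"
    using bounded_op_bound[OF nOp rho_op] by blast
  show ?thesis
  proof (rule that[of "2 * C"])
    show "0 \<le> 2 * C" using C by simp
    fix S :: "'g set" assume S: "finite S"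
    have p1: "1 \<le> p" and p2: "1 < 2 powr p" using p by simp_all
    obtain F K B where FKB: "open F" "emeasure m F < \<infinity>" "disjoint_family_on (\<lambda>s. (\<lambda>t. s + t) ` F) S"
      "compact K" "0 < measure m K" "measure m F \<le> 2 powr p * measure m K"
      "open B" "emeasure m B < \<infinity>" "0 < measure m B" "\<And>t r. t \<in> B \<Longrightarrow> r \<in> K \<Longrightarrow> - t + r \<in> F"
      using exists_kernel_sets[OF S p2] by metis
    have F: "F \<in> sets borel" "emeasure m F < \<infinity>" using FKB by simp_all
    have K: "K \<in> sets borel" "emeasure m K < \<infinity>" using FKB compact_finite by (simp_all add: compact_sets)
    have Bs [measurable]: "B \<in> sets borel" using FKB by simp
    define b where "b t = complex_of_real (indicator B t / measure m B)" for t
    have bi: "integrable m b"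
      unfolding b_def[abs_def] using FKB(8) by (intro integrable_of_real integrable_divide_zero) simp
    have b1: "(\<integral>t. b t \<partial>m) = 1" "(\<integral>t. cmod (b t) \<partial>m) = 1"
      unfolding b_def using FKB(8,9) by (simp_all add: norm_divide)
    have bm [measurable]: "b \<in> borel_measurable borel" unfolding b_def[abs_def] by simp
    \<comment> \<open>Chosen so that the left translate of \<open>b\<close> by \<open>s\<close> is
      the right translate of \<open>bs s\<close> by \<open>s\<close>, as \<open>equivariance\<close>
      demands. The factor \<open>modular (- s)\<close> keeps its norm equal to 1.\<close>
    define bs where "bs s t = complex_of_real (modular (- s)) * b (- s + (t + s))" for s t
    have bsi: "integrable m (bs s)" for s
      unfolding bs_def[abs_def]
      using integrable_right[OF _ integrable_translate[OF bi, of "- s"], of s]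
      by (intro integrable_mult_right) simp
    have bs1: "(\<integral>t. cmod (bs s t) \<partial>m) = 1" for s
    proof -
      have "(\<integral>t. cmod (bs s t) \<partial>m) = modular (- s) * (\<integral>t. cmod (b (- s + (t + s))) \<partial>m)"
        using modular_nonneg by (simp add: bs_def norm_mult)
      also have "(\<integral>t. cmod (b (- s + (t + s))) \<partial>m) = modular s *\<^sub>R (\<integral>t. cmod (b (- s + t)) \<partial>m)"
        by (rule integral_right[of "\<lambda>t. cmod (b (- s + t))"]) measurable
      also have "(\<integral>t. cmod (b (- s + t)) \<partial>m) = (\<integral>t. cmod (b t) \<partial>m)"
        by (rule integral_left[of "\<lambda>t. cmod (b t)"]) measurable
      finally show ?thesis using modular_uminus[of s] by (simp add: b1 mult.commute)
    qed
    have bsB: "ae_class m (bs s) \<in> vcar L1" for s by (rule l1_mem[OF bsi])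
    have BL: "ae_class m b \<in> vcar L1" by (rule l1_mem[OF bi])
    have tr: "L1_translate m s (ae_class m b) = ae_class m (\<lambda>t. b (- s + t))" for s
      by (rule translate_class) (rule rep_ae_class, measurable)
    have trs: "L1_translate m s (ae_class m b) = right_translate s (ae_class m (bs s))" for s
    proof -
      have "right_translate s (ae_class m (bs s)) = ae_class m (\<lambda>t. of_real (modular s) * bs s (t - s))"
        by (rule right_translate_class) (rule rep_ae_class, use borel_measurable_integrable[OF bsi] in simp)
      also have "(\<lambda>t. of_real (modular s) * bs s (t - s)) = (\<lambda>t. b (- s + t))"
      proof
        fix t
        have "of_real (modular s) * bs s (t - s) = complex_of_real (modular s * modular (- s)) * b (- s + t)"
          by (simp add: bs_def)
        then show "of_real (modular s) * bs s (t - s) = b (- s + t)" by (simp add: modular_uminus)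
      qed
      finally show ?thesis by (simp only: tr)
    qed
    define M where "M \<kappa> = \<psi> (ae_class m b) K (\<rho> (V \<kappa> F)) / measure m K" for \<kappa>
    \<comment> \<open>A shift of \<open>\<kappa>\<close> moves both the set \<open>F\<close> and the
      window \<open>K\<close> by \<open>s\<close>, and there different \<open>s\<close> no longer
      interfere.\<close>
    have M_s: "M (\<lambda>t. \<kappa> (t - s)) = \<psi> (ae_class m (bs s)) ((\<lambda>t. s + t) ` K) (\<rho> (V \<kappa> ((\<lambda>t. s + t) ` F))) / measure m K"
      if k: "bdd_borel \<kappa>" for \<kappa> s
    proof -
      have "\<psi> (ae_class m b) K (\<rho> (V (\<lambda>t. \<kappa> (t - s)) F))
          = \<psi> (L1_translate m s (ae_class m b)) ((\<lambda>t. s + t) ` K) (\<rho> (V (\<lambda>t. \<kappa> (t - s)) F))"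
        unfolding tr by (intro psi_translate bi rho_mem V_mem bdd_borel_right k F K)
      also have "\<dots> = \<psi> (ae_class m (bs s)) ((\<lambda>t. s + t) ` K) (\<rho> (V \<kappa> ((\<lambda>t. s + t) ` F)))"
        unfolding \<psi>_def equivariance[OF k F bsB trs] ..
      finally show ?thesis by (simp add: M_def)
    qed
    show "\<exists>M. (\<forall>\<kappa> \<mu>. bdd_borel \<kappa> \<longrightarrow> bdd_borel \<mu> \<longrightarrow> M (\<lambda>t. \<kappa> t + \<mu> t) = M \<kappa> + M \<mu>) \<and>
      (\<forall>c \<kappa>. bdd_borel \<kappa> \<longrightarrow> M (\<lambda>t. c * \<kappa> t) = c * M \<kappa>) \<and> M (\<lambda>t. 1) = (1::complex) \<and>
      (\<forall>T \<kappa>. T \<subseteq> S \<longrightarrow> (\<forall>s\<in>T. bdd_borel (\<kappa> s)) \<longrightarrow> (\<forall>t. (\<Sum>s\<in>T. cmod (\<kappa> s t) powr p) \<le> 1) \<longrightarrow>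
        (\<Sum>s\<in>T. cmod (M (\<lambda>t. \<kappa> s (t - s))) powr p) \<le> (2 * C) powr p)"
    proof (intro exI[of _ M] conjI allI impI)
      fix \<kappa> \<mu> assume k: "bdd_borel \<kappa>" "bdd_borel \<mu>"
      show "M (\<lambda>t. \<kappa> t + \<mu> t) = M \<kappa> + M \<mu>"
        unfolding M_def V_add[OF k F] rho_add[OF V_mem[OF k(1) F] V_mem[OF k(2) F]]
        by (subst psi_add[OF BL rho_mem[OF V_mem[OF k(1) F]] rho_mem[OF V_mem[OF k(2) F]] K]) (simp add: add_divide_distrib)
    next
      fix c \<kappa> assume k: "bdd_borel \<kappa>"
      show "M (\<lambda>t. c * \<kappa> t) = c * M \<kappa>"
        unfolding M_def V_scale[OF k F] rho_scale[OF V_mem[OF k F]]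
        by (subst psi_scale[OF BL rho_mem[OF V_mem[OF k F]] K(1)]) simp
    next
      \<comment> \<open>The canonical image of \<open>ind F\<close>, which \<open>\<rho>\<close>
        maps back to \<open>ind F\<close>. It coincides with \<open>V (\<lambda>t. 1) F\<close> on
        pairs \<open>(a, 0)\<close>, and these are the only arguments left after acting with
        \<open>b\<close>.\<close>
      let ?T = "\<lambda>u\<in>vcar U. unit_act J u (ind F)"
      have iF: "ind F \<in> vcar Lp" by (rule ind_mem[OF F])
      have T: "?T \<in> vcar Op"
      proof -
        have "bounded_op U J (\<lambda>u. unit_act J u (ind F))"
          unfolding bounded_op_def
        proof (intro conjI ballI allI)
          show "\<exists>K. \<forall>u\<in>vcar U. vnorm J (unit_act J u (ind F)) \<le> K * vnorm U u"
          proof (intro exI[of _ "vnorm Lp (ind F)"] ballI)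
            fix u assume "u \<in> vcar U"
            then have u: "fst u \<in> vcar L1" by (simp add: U_car)
            have "vnorm J (unit_act J u (ind F)) \<le> vnorm J (act J (fst u) (ind F)) + vnorm J (vscale J (snd u) (ind F))"
              unfolding unit_act_def using u iF by (intro J.M.norm_triangle J.act_closed J.M.scale_closed) simp_all
            also have "\<dots> \<le> vnorm L1 (fst u) * vnorm Lp (ind F) + cmod (snd u) * vnorm Lp (ind F)"
              using J.norm_act_le[of "fst u" "ind F"] J.M.norm_scale[of "ind F" "snd u"] u iF by simp
            finally show "vnorm J (unit_act J u (ind F)) \<le> vnorm Lp (ind F) * vnorm U u"
              by (simp add: U_sel algebra_simps)
          qed
          fix u assume u: "u \<in> vcar U"
          show "unit_act J u (ind F) \<in> vcar J"
            unfolding unit_act_def using u iF by (intro J.M.add_closed J.act_closed J.M.scale_closed) (simp_all add: U_car)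
          show "unit_act J (vscale U c u) (ind F) = vscale J c (unit_act J u (ind F))" for c
            using u iF J.act_scale_left[of "fst u" "ind F" c] J.M.scale_add_right[of "act J (fst u) (ind F)" "vscale J (snd u) (ind F)" c]
              J.M.scale_scale[of "ind F" c "snd u"] J.act_closed[of "fst u" "ind F"] J.M.scale_closed[of "ind F" "snd u"]
            by (simp add: unit_act_def U_sel U_car)
          fix v assume v: "v \<in> vcar U"
          show "unit_act J (vadd U u v) (ind F) = vadd J (unit_act J u (ind F)) (unit_act J v (ind F))"
            using u v iF J.act_add_left[of "fst u" "fst v" "ind F"] J.M.scale_add_left[of "ind F" "snd u" "snd v"]
              J.M.add4[of "act J (fst u) (ind F)" "act J (fst v) (ind F)" "vscale J (snd u) (ind F)" "vscale J (snd v) (ind F)"]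
              J.act_closed[of "fst u" "ind F"] J.M.scale_closed[of "ind F" "snd u"]
              J.act_closed[of "fst v" "ind F"] J.M.scale_closed[of "ind F" "snd v"]
            by (simp add: unit_act_def U_sel U_car)
        qed
        then show ?thesis by (simp add: op_space_sel bounded_op_restrict[OF nU])
      qed
      have one: "V (\<lambda>t. 1) F (W (ae_class m b) u, 0) = ?T (W (ae_class m b) u, 0)" if u: "u \<in> vcar U" for u
        using W_mem[OF BL u] iF J.M.scale_0[of "ind F"] J.M.add_zero[of "act J (W (ae_class m b) u) (ind F)"]
          J.act_closed[of "W (ae_class m b) u" "ind F"]
        by (simp add: V_def U_pair mult_class_one unit_act_def)
      have "convolution m (ae_class m b) (\<rho> (V (\<lambda>t. 1) F)) = \<rho> (\<lambda>u\<in>vcar U. V (\<lambda>t. 1) F (W (ae_class m b) u, 0))"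
        by (intro rho_act[symmetric] BL V_mem bdd_borel_const F)
      also have "(\<lambda>u\<in>vcar U. V (\<lambda>t. 1) F (W (ae_class m b) u, 0)) = (\<lambda>u\<in>vcar U. ?T (W (ae_class m b) u, 0))"
        by (rule restrict_ext) (rule one)
      also have "\<rho> \<dots> = convolution m (ae_class m b) (\<rho> ?T)" by (rule rho_act[OF BL T])
      also have "\<rho> ?T = ind F" using rho_id[of "ind F"] iF by simp
      also have "convolution m (ae_class m b) (ind F) = ae_class m (conv_fun b (indicator F))"
        by (rule convolution_ae_class[OF bi]) (use F in simp)
      finally have eq: "convolution m (ae_class m b) (\<rho> (V (\<lambda>t. 1) F)) = ae_class m (conv_fun b (indicator F))" .
      have mem: "ae_class m (conv_fun b (indicator F)) \<in> vcar Lp"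
        unfolding eq[symmetric] by (intro conv_Lp BL rho_mem V_mem bdd_borel_const F)
      note [measurable] = lp_memD(1)[OF mem] K(1)
      have "\<psi> (ae_class m b) K (\<rho> (V (\<lambda>t. 1) F)) = (\<integral>r. complex_of_real (indicator K r) \<partial>m)"
        unfolding \<psi>_def eq
      proof (rule integral_cong_AE)
        show "AE r in m. complex_of_real (indicator K r) * rep (ae_class m (conv_fun b (indicator F))) r = complex_of_real (indicator K r)"
          using lp_rep[OF mem]
        proof eventually_elim
          case (elim r)
          \<comment> \<open>For \<open>r\<close> in \<open>K\<close> and \<open>t\<close> in
            \<open>B\<close> the point \<open>- t + r\<close> lies in \<open>F\<close>, so the
            indicator is 1 wherever \<open>b\<close> does not vanish.\<close>
          have "conv_fun b (indicator F) r = (\<integral>t. b t \<partial>m)" if "r \<in> K"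
            unfolding conv_fun_def using FKB(10)[OF _ that]
            by (intro Bochner_Integration.integral_cong refl) (auto simp: b_def indicator_def)
          then show ?case using elim b1 by (cases "r \<in> K") simp_all
        qed
      qed simp_all
      also have "\<dots> = measure m K" using K by simp
      finally show "M (\<lambda>t. 1) = 1" using FKB(5) by (simp add: M_def)
    next
      fix T \<kappa> assume TS: "T \<subseteq> S" and k: "\<forall>s\<in>T. bdd_borel (\<kappa> s)"
        and le1: "\<forall>t. (\<Sum>s\<in>T. cmod (\<kappa> s t) powr p) \<le> (1::real)"
      have fT: "finite T" using TS S by (rule finite_subset)
      let ?F = "\<lambda>s. (\<lambda>t. s + t) ` F" and ?K = "\<lambda>s. (\<lambda>t. s + t) ` K"
      have dis: "disjoint_family_on ?F T" using FKB(3) TS by (rule disjoint_family_on_mono[rotated])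
      note Fs = translate_ind_sets[OF F] and Ks = translate_ind_sets[OF K]
      have mF: "measure m (?F s) = measure m F" and mK: "measure m (?K s) = measure m K" for s
        using F K by (simp_all add: measure_def emeasure_translate)
      \<comment> \<open>Row \<open>s\<close> is the window at \<open>s + K\<close>, column
        \<open>i\<close> the operator at \<open>i + F\<close>. Only the diagonal is related to
        \<open>M\<close>; the other entries appear because \<open>\<rho>\<close> need not be
        local.\<close>
      define x where "x s i = \<psi> (ae_class m (bs s)) (?K s) (\<rho> (V (\<kappa> i) (?F i)))" for s i
      have "(\<Sum>s\<in>T. cmod (x s s) powr p) \<le> (2 * C * measure m K) powr p"
      proof (rule sign_average_diagonal[where x = x, OF fT p1])
        fix E assume "E \<subseteq> T"
        let ?V = "V_sum (\<lambda>s t. signs E s * \<kappa> s t) ?F T"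
        have kE: "bdd_borel (\<lambda>t. signs E s * \<kappa> s t)" if "s \<in> T" for s using k that by (intro bdd_borel_scale) simp
        have Vm: "?V \<in> vcar Op" by (intro V_sum_mem fT kE Fs)
        have "(\<Sum>i\<in>T. signs E i * x s i) = \<psi> (ae_class m (bs s)) (?K s) (\<rho> ?V)" for s
        proof -
          have "\<psi> (ae_class m (bs s)) (?K s) (\<rho> ?V)
              = (\<Sum>i\<in>T. \<psi> (ae_class m (bs s)) (?K s) (\<rho> (V (\<lambda>t. signs E i * \<kappa> i t) (?F i))))"
            by (intro psi_rho_V_sum fT kE Fs Ks bsB)
          also have "\<dots> = (\<Sum>i\<in>T. signs E i * x s i)"
          proof (rule sum.cong[OF refl])
            fix i assume "i \<in> T"
            then have ki: "bdd_borel (\<kappa> i)" using k by simp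
            show "\<psi> (ae_class m (bs s)) (?K s) (\<rho> (V (\<lambda>t. signs E i * \<kappa> i t) (?F i))) = signs E i * x s i"
              unfolding V_scale[OF ki Fs] rho_scale[OF V_mem[OF ki Fs]] x_def
              by (rule psi_scale[OF bsB rho_mem[OF V_mem[OF ki Fs]] Ks(1)])
          qed
          finally show ?thesis by simp
        qed
        then have "(\<Sum>s\<in>T. cmod (\<Sum>i\<in>T. signs E i * x s i) powr p)
            = (\<Sum>s\<in>T. cmod (\<psi> (ae_class m (bs s)) (?K s) (\<rho> ?V)) powr p)" by simp
        also have "\<dots> \<le> measure m K powr (p - 1) * vnorm Lp (\<rho> ?V) powr p"
        proof (rule psi_local[where b = bs and K = ?K and E = ?F, OF fT rho_mem[OF Vm] bsi eq_refl[OF bs1] Ks(1) Ks(2) mK Fs(1) dis])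
          fix s t r assume "s \<in> T" "bs s t \<noteq> 0" "r \<in> ?K s"
          then have "- s + (t + s) \<in> B" "- s + r \<in> K" by (auto simp: bs_def b_def left_image indicator_eq_0_iff)
          from FKB(10)[OF this] have "- s + (- t + r) \<in> F" by (simp add: minus_add add.assoc[symmetric])
          then show "- t + r \<in> ?F s" by (simp add: left_image)
        qed
        also have "\<dots> \<le> measure m K powr (p - 1) * (C * measure m F powr (1 / p)) powr p"
        proof (intro mult_left_mono powr_mono2)
          have "vnorm Lp (\<rho> ?V) \<le> C * vnorm Op ?V" using C(2)[OF Vm] by simp
          also have "\<dots> \<le> C * measure m F powr (1 / p)"
          proof (intro mult_left_mono C V_sum_norm fT kE Fs mF dis)
            fix t
            have "(\<Sum>s\<in>T. cmod (signs E s * \<kappa> s t) powr p) = (\<Sum>s\<in>T. cmod (\<kappa> s t) powr p)"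
              by (intro sum.cong) (auto simp: signs_def)
            then show "(\<Sum>s\<in>T. cmod (signs E s * \<kappa> s t) powr p) \<le> 1" using le1 by simp
          qed simp_all
          finally show "vnorm Lp (\<rho> ?V) \<le> C * measure m F powr (1 / p)" .
          show "0 \<le> vnorm Lp (\<rho> ?V)" using J.M.norm_nonneg[of "\<rho> ?V"] rho_mem[OF Vm] by simp
        qed (use p in simp_all)
        also have "\<dots> = measure m K powr (p - 1) * (C powr p * measure m F)"
          using p C(1) by (simp add: powr_mult powr_powr)
        also have "\<dots> \<le> measure m K powr (p - 1) * (C powr p * (2 powr p * measure m K))"
          by (intro mult_left_mono FKB(6)) simp_all
        also have "\<dots> = (2 * C * measure m K) powr p"
          using FKB(5) C(1) by (simp add: powr_mult powr_diff)
        finally show "(\<Sum>s\<in>T. cmod (\<Sum>i\<in>T. signs E i * x s i) powr p) \<le> (2 * C * measure m K) powr p" .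
      qed
      then have "(\<Sum>s\<in>T. cmod (x s s) powr p) / measure m K powr p \<le> (2 * C) powr p"
        using FKB(5) C(1) by (simp add: divide_le_eq powr_mult)
      moreover have "cmod (M (\<lambda>t. \<kappa> s (t - s))) powr p = cmod (x s s) powr p / measure m K powr p" if "s \<in> T" for s
        using FKB(5) k that by (simp add: M_s x_def norm_divide powr_divide)
      ultimately show "(\<Sum>s\<in>T. cmod (M (\<lambda>t. \<kappa> s (t - s))) powr p) \<le> (2 * C) powr p"
        by (simp add: sum_divide_distrib)
    qed
  qed
qed

end

section \<open>Means on bounded Borel functions\<close>

context lp_module begin

definition lin :: "(('g \<Rightarrow> complex) \<Rightarrow> complex) \<Rightarrow> bool" where
  "lin M \<longleftrightarrow> (\<forall>\<kappa> \<mu>. bdd_borel \<kappa> \<longrightarrow> bdd_borel \<mu> \<longrightarrow> M (\<lambda>t. \<kappa> t + \<mu> t) = M \<kappa> + M \<mu>)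
     \<and> (\<forall>c \<kappa>. bdd_borel \<kappa> \<longrightarrow> M (\<lambda>t. c * \<kappa> t) = c * M \<kappa>)"

definition blin :: "real \<Rightarrow> (('g \<Rightarrow> complex) \<Rightarrow> complex) \<Rightarrow> bool" where
  "blin B M \<longleftrightarrow> lin M \<and> (\<forall>\<kappa>. bdd_borel \<kappa> \<longrightarrow> (\<forall>t. cmod (\<kappa> t) \<le> 1) \<longrightarrow> cmod (M \<kappa>) \<le> B)"

text \<open>For bounded functions the pointwise condition says that the weak
  \<open>p\<close>-summing norm is at most 1. The definition therefore bounds the
  \<open>(p,p)\<close>-multi-norm of translates of \<open>M\<close>, tested on functions only and
  without repeated group elements.\<close>

definition multi :: "real \<Rightarrow> 'g set \<Rightarrow> (('g \<Rightarrow> complex) \<Rightarrow> complex) \<Rightarrow> bool" where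
  "multi C S M \<longleftrightarrow> (\<forall>T \<kappa>. T \<subseteq> S \<longrightarrow> (\<forall>s\<in>T. bdd_borel (\<kappa> s)) \<longrightarrow>
     (\<forall>t. (\<Sum>s\<in>T. cmod (\<kappa> s t) powr p) \<le> 1) \<longrightarrow>
     (\<Sum>s\<in>T. cmod (M (\<lambda>t. \<kappa> s (t - s))) powr p) \<le> C powr p)"

lemma blinD: "blin B M \<Longrightarrow> bdd_borel \<kappa> \<Longrightarrow> (\<And>t. cmod (\<kappa> t) \<le> 1) \<Longrightarrow> cmod (M \<kappa>) \<le> B"
  by (simp add: blin_def)

lemma lin_add: "lin M \<Longrightarrow> bdd_borel \<kappa> \<Longrightarrow> bdd_borel \<mu> \<Longrightarrow> M (\<lambda>t. \<kappa> t + \<mu> t) = M \<kappa> + M \<mu>"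
  by (simp add: lin_def)

lemma lin_scale: "lin M \<Longrightarrow> bdd_borel \<kappa> \<Longrightarrow> M (\<lambda>t. c * \<kappa> t) = c * M \<kappa>"
  by (simp add: lin_def)

lemma multiD:
  assumes "multi C S M" "T \<subseteq> S" "\<And>s. s \<in> T \<Longrightarrow> bdd_borel (\<kappa> s)" "\<And>t. (\<Sum>s\<in>T. cmod (\<kappa> s t) powr p) \<le> 1"
  shows "(\<Sum>s\<in>T. cmod (M (\<lambda>t. \<kappa> s (t - s))) powr p) \<le> C powr p"
  using assms unfolding multi_def by blast

lemma lin_zero: "lin M \<Longrightarrow> M (\<lambda>t. 0) = 0"
  using lin_scale[of M "\<lambda>t. 0" 0] bdd_borel_const[of 0] by simp

lemma bdd_borel_sum: "finite I \<Longrightarrow> (\<And>i. i \<in> I \<Longrightarrow> bdd_borel (\<kappa> i)) \<Longrightarrow> bdd_borel (\<lambda>t. \<Sum>i\<in>I. \<kappa> i t)"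
  by (induction I rule: finite_induct) (simp_all add: bdd_borel_const bdd_borel_add)

lemma lin_sum:
  assumes "lin M" "finite I" "\<And>i. i \<in> I \<Longrightarrow> bdd_borel (\<kappa> i)"
  shows "M (\<lambda>t. \<Sum>i\<in>I. \<kappa> i t) = (\<Sum>i\<in>I. M (\<kappa> i))"
  using assms(2,3)
proof (induction I rule: finite_induct)
  case (insert i I)
  then show ?case using lin_add[OF assms(1), of "\<kappa> i" "\<lambda>t. \<Sum>i\<in>I. \<kappa> i t"] by (simp add: bdd_borel_sum)
qed (simp add: lin_zero assms)

lemma powr_le_cancel_base:
  assumes "0 \<le> a" "0 \<le> b" "a powr p \<le> b powr p" shows "a \<le> (b :: real)"
  using assms p powr_less_mono2[of p b a] by force

text \<open>The one-element family at the identity turns the multi-estimate into a norm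
  bound.\<close>

lemma multi_bound:
  assumes "multi C S M" "0 \<in> S" "0 \<le> C" "bdd_borel \<kappa>" "\<And>t. cmod (\<kappa> t) \<le> 1"
  shows "cmod (M \<kappa>) \<le> C"
proof -
  have "(\<Sum>s\<in>{0}. cmod (M (\<lambda>t. \<kappa> (t - s))) powr p) \<le> C powr p"
  proof (rule multiD[OF assms(1)])
    show "{0} \<subseteq> S" using assms(2) by simp
    show "bdd_borel \<kappa>" by (rule assms(4))
    show "(\<Sum>s\<in>{0::'g}. cmod (\<kappa> t) powr p) \<le> 1" for t
      using assms(5)[of t] powr_mono2[of p "cmod (\<kappa> t)" 1] p by simp
  qed
  then have "cmod (M \<kappa>) powr p \<le> C powr p" by simp
  then show ?thesis by (rule powr_le_cancel_base[OF norm_ge_zero assms(3)])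
qed

text \<open>Multiplying by a function \<open>h\<close> that nearly attains the norm of \<open>M\<close> makes the norm nearly equal to the
  value at \<open>1\<close>, and keeps the estimate of \<open>multi\<close> because \<open>\<bar>h\<bar> \<le> 1\<close>.\<close>

lemma normalize:
  assumes M: "lin M" "M (\<lambda>t. 1) = 1" "multi C S M" "0 \<in> S" "0 \<le> C" and e: "0 < e"
  shows "\<exists>N. blin (1 + e) N \<and> N (\<lambda>t. 1) = 1 \<and> multi ((1 + e) * C) S N"
proof -
  define H where "H = {h. bdd_borel h \<and> (\<forall>t. cmod (h t) \<le> 1)}"
  define N0 where "N0 = (SUP h\<in>H. cmod (M h))"
  have bdd: "bdd_above ((\<lambda>h. cmod (M h)) ` H)"
    using multi_bound[OF M(3-5)] by (intro bdd_aboveI2[of _ _ C]) (auto simp: H_def)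
  have 1: "(\<lambda>t. 1) \<in> H" by (simp add: H_def bdd_borel_const)
  have "cmod (M (\<lambda>t. 1)) \<le> N0" unfolding N0_def by (rule cSUP_upper[OF 1 bdd])
  then have N1: "1 \<le> N0" using M(2) by simp
  \<comment> \<open>Since \<open>N0 \<ge> 1\<close>, a function \<open>h\<close> that attains
    \<open>N0\<close> up to the factor \<open>1 + e\<close> makes both
    \<open>N0 / cmod (M h)\<close> and \<open>1 / cmod (M h)\<close> at most \<open>1 + e\<close>;
    the first bounds the norm, the second the multi-estimate.\<close>
  have "N0 / (1 + e) < N0" using N1 e by (simp add: field_simps)
  then obtain h where h: "h \<in> H" "N0 / (1 + e) < cmod (M h)"
    unfolding N0_def using less_cSUP_iff[OF _ bdd] 1 by blast
  have hb: "bdd_borel h" "\<And>t. cmod (h t) \<le> 1" using h(1) by (auto simp: H_def)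
  have "0 < N0 / (1 + e)" using N1 e by simp
  then have pos: "0 < cmod (M h)" using h(2) by linarith
  have le: "N0 / cmod (M h) \<le> 1 + e" using h(2) pos e by (simp add: field_simps)
  then have le1: "1 / cmod (M h) \<le> 1 + e" using N1 pos by (meson divide_right_mono norm_ge_zero order_trans)
  define N where "N \<kappa> = M (\<lambda>t. h t * \<kappa> t) / M h" for \<kappa>
  have "lin N"
    unfolding lin_def
  proof (intro conjI allI impI)
    fix \<kappa> \<mu> assume "bdd_borel \<kappa>" "bdd_borel \<mu>"
    then show "N (\<lambda>t. \<kappa> t + \<mu> t) = N \<kappa> + N \<mu>"
      using lin_add[OF M(1) bdd_borel_mult[OF hb(1)] bdd_borel_mult[OF hb(1)], of \<kappa> \<mu>] by (simp add: N_def distrib_left add_divide_distrib)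
  next
    fix c \<kappa> assume "bdd_borel \<kappa>"
    then show "N (\<lambda>t. c * \<kappa> t) = c * N \<kappa>"
      using lin_scale[OF M(1) bdd_borel_mult[OF hb(1)], of \<kappa> c] by (simp add: N_def mult.left_commute)
  qed
  moreover have "cmod (N \<kappa>) \<le> 1 + e" if k: "bdd_borel \<kappa>" "\<forall>t. cmod (\<kappa> t) \<le> 1" for \<kappa>
  proof -
    have "(\<lambda>t. h t * \<kappa> t) \<in> H"
      unfolding H_def using k hb mult_mono[OF hb(2) k(2)[rule_format]] by (auto simp: bdd_borel_mult norm_mult)
    then have "cmod (M (\<lambda>t. h t * \<kappa> t)) \<le> N0" unfolding N0_def by (rule cSUP_upper[OF _ bdd])
    then have "cmod (N \<kappa>) \<le> N0 / cmod (M h)" unfolding N_def norm_divide by (rule divide_right_mono) simp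
    with le show ?thesis by simp
  qed
  moreover have "N (\<lambda>t. 1) = 1" using pos by (simp add: N_def)
  moreover have "multi ((1 + e) * C) S N"
    unfolding multi_def
  proof (intro allI impI)
    fix T \<kappa> assume T: "T \<subseteq> S" and k: "\<forall>s\<in>T. bdd_borel (\<kappa> s)" and k1: "\<forall>t. (\<Sum>s\<in>T. cmod (\<kappa> s t) powr p) \<le> (1::real)"
    \<comment> \<open>The shift of \<open>h\<close> is chosen so that
      \<open>\<mu> s (t - s) = h t * \<kappa> s (t - s)\<close>.\<close>
    define \<mu> where "\<mu> s t = h (t + s) * \<kappa> s t" for s t
    have "(\<Sum>s\<in>T. cmod (M (\<lambda>t. \<mu> s (t - s))) powr p) \<le> C powr p"
    proof (rule multiD[OF M(3) T])
      show "bdd_borel (\<mu> s)" if "s \<in> T" for s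
        unfolding \<mu>_def using bdd_borel_right[OF hb(1), of "- s"] k that by (intro bdd_borel_mult) simp_all
      have "cmod (\<mu> s t) powr p \<le> cmod (\<kappa> s t) powr p" for s t
        using p mult_right_mono[OF hb(2)[of "t + s"], of "cmod (\<kappa> s t)"]
        by (intro powr_mono2) (simp_all add: \<mu>_def norm_mult)
      then show "(\<Sum>s\<in>T. cmod (\<mu> s t) powr p) \<le> 1" for t
        using k1 by (meson order_trans sum_mono)
    qed
    then have "(\<Sum>s\<in>T. cmod (M (\<lambda>t. \<mu> s (t - s))) powr p) * (1 / cmod (M h)) powr p \<le> C powr p * (1 + e) powr p"
      using le1 pos p e by (intro mult_mono powr_mono2 sum_nonneg) simp_all
    moreover have eq: "cmod (N (\<lambda>t. \<kappa> s (t - s))) powr p = cmod (M (\<lambda>t. \<mu> s (t - s))) powr p * (1 / cmod (M h)) powr p" for s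
      using pos by (simp add: N_def \<mu>_def norm_divide powr_divide)
    moreover have "C powr p * (1 + e) powr p = ((1 + e) * C) powr p"
      using e M(5) by (simp add: powr_mult mult.commute)
    ultimately show "(\<Sum>s\<in>T. cmod (N (\<lambda>t. \<kappa> s (t - s))) powr p) \<le> ((1 + e) * C) powr p"
      unfolding eq sum_distrib_right[symmetric] by (simp only:)
  qed
  ultimately show ?thesis unfolding blin_def by blast
qed

section \<open>Compactness in the topology of pointwise convergence\<close>

lemma continuous_eval: "continuous_on UNIV (\<lambda>N :: 'a \<Rightarrow> complex. N x)"
  by (rule continuous_on_product_coordinates)

lemma closed_lin: "closed {M. lin M}"
  unfolding lin_def
  by (intro closed_Collect_conj closed_Collect_all closed_Collect_imp open_Collect_const closed_Collect_eq
      continuous_intros continuous_eval)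

lemma closed_blin: "closed {M. blin B M}"
  unfolding blin_def
  by (intro closed_Collect_conj closed_lin closed_Collect_all closed_Collect_imp open_Collect_const closed_Collect_le
      continuous_intros continuous_eval)

lemma closed_multi: "closed {M. multi C S M}"
  unfolding multi_def using p
  by (intro closed_Collect_all closed_Collect_imp open_Collect_const closed_Collect_le
      continuous_on_sum continuous_on_powr' continuous_on_norm continuous_on_const continuous_eval) auto

lemma blin_bound:
  assumes "blin B M" "bdd_borel \<kappa>" "\<And>t. cmod (\<kappa> t) \<le> b" "0 \<le> b" "0 \<le> B"
  shows "cmod (M \<kappa>) \<le> B * b"
proof (cases "b = 0")
  case True
  then have "\<kappa> = (\<lambda>t. 0)" using assms(3) by (metis norm_le_zero_iff)
  then show ?thesis using lin_zero[of M] assms by (simp add: blin_def)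
next
  case False
  then have b: "0 < b" using assms by simp
  have "bdd_borel (\<lambda>t. of_real (1 / b) * \<kappa> t)" by (rule bdd_borel_scale[OF assms(2)])
  moreover have "cmod (of_real (1 / b) * \<kappa> t) \<le> 1" for t
    using assms(3)[of t] b by (simp add: norm_mult norm_divide divide_le_eq)
  ultimately have "cmod (M (\<lambda>t. of_real (1 / b) * \<kappa> t)) \<le> B" by (rule blinD[OF assms(1)])
  moreover have "M (\<lambda>t. of_real (1 / b) * \<kappa> t) = of_real (1 / b) * M \<kappa>"
    using assms by (intro lin_scale) (auto simp: blin_def)
  ultimately show ?thesis using b by (simp add: norm_mult norm_divide divide_le_eq)
qed

lemma multi_mono:
  assumes "multi C S M" "S' \<subseteq> S" "0 \<le> C" "C \<le> D" shows "multi D S' M"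
  unfolding multi_def
proof (intro allI impI)
  fix T \<kappa> assume "T \<subseteq> S'" "\<forall>s\<in>T. bdd_borel (\<kappa> s)" "\<forall>t. (\<Sum>s\<in>T. cmod (\<kappa> s t) powr p) \<le> (1::real)"
  then have "(\<Sum>s\<in>T. cmod (M (\<lambda>t. \<kappa> s (t - s))) powr p) \<le> C powr p"
    using assms(2) by (intro multiD[OF assms(1)]) auto
  also have "\<dots> \<le> D powr p" using assms p by (intro powr_mono2) simp_all
  finally show "(\<Sum>s\<in>T. cmod (M (\<lambda>t. \<kappa> s (t - s))) powr p) \<le> D powr p" .
qed

text \<open>Because \<open>normalize\<close> attains norm 1 only up to \<open>e\<close>, the closed
  conditions \<open>Q\<close> are indexed by pairs \<open>(S, e)\<close> and intersected within a
  compact product of discs. The limit removes \<open>e\<close> from the norm bound; in the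
  multi-estimate \<open>e \<le> 1\<close> is absorbed into the factor 2.\<close>

lemma multi_limit:
  assumes C: "0 \<le> C" and ex: "\<And>S. finite S \<Longrightarrow> \<exists>M. lin M \<and> M (\<lambda>t. 1) = 1 \<and> multi C S M"
  obtains N where "blin 1 N" "N (\<lambda>t. 1) = 1" "\<And>S. finite S \<Longrightarrow> multi (2 * C) S N"
proof -
  define r where "r \<kappa> = (if bdd_borel \<kappa> then 2 * (SUP t. cmod (\<kappa> t)) else 0)" for \<kappa> :: "'g \<Rightarrow> complex"
  define \<K> where "\<K> = (PiE UNIV (\<lambda>\<kappa>. cball (0::complex) (r \<kappa>)))"
  define Q where "Q i = {N. blin (1 + snd i) N} \<inter> {N. N (\<lambda>t. 1) = 1} \<inter> {N. multi (2 * C) (fst i) N}" for i :: "'g set \<times> real"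
  define I where "I = {i :: 'g set \<times> real. finite (fst i) \<and> 0 < snd i}"
  have "compactin (product_topology (\<lambda>_. euclidean) UNIV) \<K>"
    unfolding \<K>_def compactin_PiE by (simp add: compactin_euclidean_iff)
  then have "compact \<K>" by (simp add: euclidean_product_topology compactin_euclidean_iff)
  then have "\<K> \<inter> (\<Inter>i\<in>I. Q i) \<noteq> {}"
  proof (rule compact_imp_fip_image)
    show "closed (Q i)" if "i \<in> I" for i
      unfolding Q_def by (intro closed_Int closed_blin closed_multi closed_Collect_eq continuous_intros continuous_eval)
    fix I' assume I': "finite I'" "I' \<subseteq> I"
    \<comment> \<open>The element \<open>0\<close> is needed for \<open>normalize\<close>; the
      number 1 inserted in the minimum below caps \<open>e\<close> and covers the case of an empty
      \<open>I'\<close>.\<close>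
    define S where "S = insert 0 (\<Union>i\<in>I'. fst i)"
    define e where "e = Min (insert 1 (snd ` I'))"
    have S: "finite S" "0 \<in> S" "\<And>i. i \<in> I' \<Longrightarrow> fst i \<subseteq> S" using I' by (auto simp: S_def I_def)
    have e: "0 < e" "e \<le> 1" "\<And>i. i \<in> I' \<Longrightarrow> e \<le> snd i"
      using I' by (auto simp: e_def I_def)
    obtain M where M: "lin M" "M (\<lambda>t. 1) = 1" "multi C S M" using ex[OF S(1)] by blast
    obtain N where N: "blin (1 + e) N" "N (\<lambda>t. 1) = 1" "multi ((1 + e) * C) S N"
      using normalize[OF M S(2) C e(1)] by blast
    \<comment> \<open>Values off the bounded Borel functions are arbitrary in \<open>lin\<close>;
      setting them to 0 puts the functional into the compact product.\<close>
    define N' where "N' \<kappa> = (if bdd_borel \<kappa> then N \<kappa> else 0)" for \<kappa>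
    have lin': "lin N'"
      using N(1) unfolding lin_def blin_def N'_def by (simp add: bdd_borel_add bdd_borel_scale)
    have "N' \<in> \<K>"
      unfolding \<K>_def
    proof (intro PiE_I)
      fix \<kappa>
      show "N' \<kappa> \<in> cball 0 (r \<kappa>)"
      proof (cases "bdd_borel \<kappa>")
        case True
        then obtain B where B: "\<And>t. cmod (\<kappa> t) \<le> B" using bdd_borel_bound by metis
        have bd: "bdd_above (range (\<lambda>t. cmod (\<kappa> t)))" using B by (intro bdd_aboveI2) auto
        have up: "cmod (\<kappa> t) \<le> (SUP t. cmod (\<kappa> t))" for t by (rule cSUP_upper[OF _ bd]) simp
        have s0: "0 \<le> (SUP t. cmod (\<kappa> t))" using up[of 0] norm_ge_zero order_trans by blast
        have "cmod (N \<kappa>) \<le> (1 + e) * (SUP t. cmod (\<kappa> t))"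
          using e by (intro blin_bound[OF N(1) True up s0]) simp
        also have "\<dots> \<le> 2 * (SUP t. cmod (\<kappa> t))" using e s0 by (intro mult_right_mono) simp_all
        finally show ?thesis using True by (simp add: N'_def r_def)
      qed (simp add: N'_def r_def)
    qed simp
    moreover have "N' \<in> Q i" if i: "i \<in> I'" for i
    proof -
      have "blin (1 + snd i) N'"
        unfolding blin_def
      proof (intro conjI lin' allI impI)
        fix \<kappa> assume k: "bdd_borel \<kappa>" "\<forall>t. cmod (\<kappa> t) \<le> 1"
        then have "cmod (N \<kappa>) \<le> 1 + e" using N(1) by (simp add: blin_def)
        then show "cmod (N' \<kappa>) \<le> 1 + snd i" using e(3)[OF i] k by (simp add: N'_def)
      qed
      moreover have "N' (\<lambda>t. 1) = 1" using N(2) by (simp add: N'_def bdd_borel_const)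
      moreover have "multi (2 * C) (fst i) N'"
      proof -
        have "multi ((1 + e) * C) S N'"
          unfolding multi_def
        proof (intro allI impI)
          fix T \<kappa> assume a: "T \<subseteq> S" "\<forall>s\<in>T. bdd_borel (\<kappa> s)" "\<forall>t. (\<Sum>s\<in>T. cmod (\<kappa> s t) powr p) \<le> (1::real)"
          have "(\<Sum>s\<in>T. cmod (N' (\<lambda>t. \<kappa> s (t - s))) powr p) = (\<Sum>s\<in>T. cmod (N (\<lambda>t. \<kappa> s (t - s))) powr p)"
            using a(2) by (intro sum.cong) (simp_all add: N'_def bdd_borel_right)
          also have "\<dots> \<le> ((1 + e) * C) powr p" using a by (intro multiD[OF N(3)]) auto
          finally show "(\<Sum>s\<in>T. cmod (N' (\<lambda>t. \<kappa> s (t - s))) powr p) \<le> ((1 + e) * C) powr p" .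
        qed
        then show ?thesis
        proof (rule multi_mono[OF _ S(3)[OF i]])
          show "0 \<le> (1 + e) * C" using e C by simp
          show "(1 + e) * C \<le> 2 * C" using e C by (intro mult_right_mono) simp_all
        qed
      qed
      ultimately show ?thesis by (simp add: Q_def)
    qed
    ultimately show "\<K> \<inter> (\<Inter>i\<in>I'. Q i) \<noteq> {}" by blast
  qed
  then obtain N where N: "\<And>i. i \<in> I \<Longrightarrow> N \<in> Q i" by blast
  have 1: "({}, 1) \<in> I" by (simp add: I_def)
  have l: "lin N" "N (\<lambda>t. 1) = 1" using N[OF 1] by (simp_all add: Q_def blin_def)
  have "cmod (N \<kappa>) \<le> 1" if k: "bdd_borel \<kappa>" "\<forall>t. cmod (\<kappa> t) \<le> 1" for \<kappa>
  proof (rule field_le_epsilon)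
    fix e :: real assume "0 < e"
    then have "N \<in> Q ({}, e)" by (intro N) (simp add: I_def)
    then show "cmod (N \<kappa>) \<le> 1 + e" using k by (simp add: Q_def blin_def)
  qed
  then have "blin 1 N" using l by (simp add: blin_def)
  moreover have "multi (2 * C) S N" if "finite S" for S
    using N[of "(S, 1)"] that by (simp add: I_def Q_def)
  ultimately show ?thesis using that l(2) by blast
qed

end

text \<open>The coefficients form the norming functional of \<open>z\<close> in the
  finite-dimensional space with the \<open>p\<close>-norm. Weighted Jensen with weights
  \<open>cmod (z i) powr p\<close> gives its norm bound without mention of the conjugate
  exponent.\<close>

lemma norming_coefficients:
  fixes z :: "'i \<Rightarrow> complex"
  assumes I: "finite I" and p: "1 < (p::real)"
  shows "\<exists>\<alpha>. cmod (\<Sum>i\<in>I. \<alpha> i * z i) powr p = (\<Sum>i\<in>I. cmod (z i) powr p) \<and>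
    (\<forall>w. cmod (\<Sum>i\<in>I. \<alpha> i * w i) powr p \<le> (\<Sum>i\<in>I. cmod (w i) powr p))"
proof -
  define Z where "Z = (\<Sum>i\<in>I. cmod (z i) powr p)"
  have Z0: "0 \<le> Z" unfolding Z_def by (intro sum_nonneg) simp
  show ?thesis
  proof (cases "Z = 0")
    case True
    then show ?thesis
      by (intro exI[of _ "\<lambda>_. 0"]) (auto simp: Z_def[symmetric] intro: sum_nonneg)
  next
    case False
    then have Zp: "0 < Z" using Z0 by simp
    \<comment> \<open>For \<open>z i = 0\<close> the quotient is 0 by convention, which is the right
      coefficient.\<close>
    define \<alpha> where "\<alpha> i = of_real (cmod (z i) powr p) / z i / of_real (Z powr (1 - 1 / p))" for i
    have e: "(1 - 1 / p) * p = p - 1" using p by (simp add: field_simps)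
    have "(\<Sum>i\<in>I. \<alpha> i * z i) = of_real (Z / Z powr (1 - 1 / p))"
    proof -
      have "\<alpha> i * z i = of_real (cmod (z i) powr p / Z powr (1 - 1 / p))" for i
        by (cases "z i = 0") (simp_all add: \<alpha>_def)
      then show ?thesis by (simp add: Z_def sum_divide_distrib)
    qed
    then have "cmod (\<Sum>i\<in>I. \<alpha> i * z i) = Z / Z powr (1 - 1 / p)"
      using Zp by (simp only: norm_of_real) (simp add: abs_of_pos)
    then have 1: "cmod (\<Sum>i\<in>I. \<alpha> i * z i) powr p = Z"
      using Zp p by (simp add: powr_divide powr_powr e powr_diff)
    have "cmod (\<Sum>i\<in>I. \<alpha> i * w i) powr p \<le> (\<Sum>i\<in>I. cmod (w i) powr p)" for w
    proof -
      define Y where "Y = (\<Sum>i\<in>I. of_real (cmod (z i) powr p) * (w i / z i))"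
      have "cmod Y powr p \<le> Z powr (p - 1) * (\<Sum>i\<in>I. cmod (z i) powr p * cmod (w i / z i) powr p)"
        unfolding Y_def Z_def using p by (intro jensen_powr_sum I) simp_all
      also have "\<dots> \<le> Z powr (p - 1) * (\<Sum>i\<in>I. cmod (w i) powr p)"
      proof (intro mult_left_mono sum_mono)
        show "cmod (z i) powr p * cmod (w i / z i) powr p \<le> cmod (w i) powr p" for i
          by (cases "z i = 0") (simp_all add: norm_divide powr_divide)
      qed simp
      finally have Y: "cmod Y powr p \<le> Z powr (p - 1) * (\<Sum>i\<in>I. cmod (w i) powr p)" .
      have "(\<Sum>i\<in>I. \<alpha> i * w i) = Y / of_real (Z powr (1 - 1 / p))"
        unfolding Y_def sum_divide_distrib by (intro sum.cong) (simp_all add: \<alpha>_def)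
      then have "cmod (\<Sum>i\<in>I. \<alpha> i * w i) powr p = cmod Y powr p / Z powr (p - 1)"
        by (simp add: norm_divide powr_divide powr_powr e)
      with Y show ?thesis using Zp by (simp add: divide_le_eq mult.commute)
    qed
    then show ?thesis using 1 unfolding Z_def by blast
  qed
qed

context lp_module begin

text \<open>In \<open>multi\<close> every group element carries one function, whereas a tuple may
  repeat elements. The functions at the same \<open>x\<close> are merged into \<open>\<mu> x\<close>
  with norming coefficients: the \<open>p\<close>-th power sum of the values of \<open>N\<close> is
  preserved, and the pointwise one does not increase.\<close>

lemma multi_tuple:
  fixes s :: "nat \<Rightarrow> 'g"
  assumes N: "lin N" "\<And>S. finite S \<Longrightarrow> multi C S N"
    and k: "\<And>i. i < n \<Longrightarrow> bdd_borel (\<kappa> i)" "\<And>t. (\<Sum>i<n. cmod (\<kappa> i t) powr p) \<le> 1"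
  shows "(\<Sum>i<n. cmod (N (\<lambda>t. \<kappa> i (t - s i))) powr p) \<le> C powr p"
proof -
  define z where "z i = N (\<lambda>t. \<kappa> i (t - s i))" for i
  define I where "I x = {i \<in> {..<n}. s i = x}" for x
  have fI: "finite (I x)" for x by (simp add: I_def)
  have "\<forall>x. \<exists>\<alpha>. cmod (\<Sum>i\<in>I x. \<alpha> i * z i) powr p = (\<Sum>i\<in>I x. cmod (z i) powr p) \<and>
      (\<forall>w. cmod (\<Sum>i\<in>I x. \<alpha> i * w i) powr p \<le> (\<Sum>i\<in>I x. cmod (w i) powr p))"
    by (intro allI norming_coefficients fI p)
  from choice[OF this] obtain \<alpha> where \<alpha>': "\<forall>x. cmod (\<Sum>i\<in>I x. \<alpha> x i * z i) powr p = (\<Sum>i\<in>I x. cmod (z i) powr p) \<and>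
      (\<forall>w. cmod (\<Sum>i\<in>I x. \<alpha> x i * w i) powr p \<le> (\<Sum>i\<in>I x. cmod (w i) powr p))" by (elim exE)
  have \<alpha>: "cmod (\<Sum>i\<in>I x. \<alpha> x i * z i) powr p = (\<Sum>i\<in>I x. cmod (z i) powr p)"
    "cmod (\<Sum>i\<in>I x. \<alpha> x i * w i) powr p \<le> (\<Sum>i\<in>I x. cmod (w i) powr p)" for x w
    using spec[OF \<alpha>', of x] by simp_all
  have gen: "(\<Sum>i<n. h i) = (\<Sum>x\<in>s ` {..<n}. \<Sum>i\<in>I x. h i)" for h :: "nat \<Rightarrow> real"
    unfolding I_def by (rule sum.image_gen) simp
  define \<mu> where "\<mu> x t = (\<Sum>i\<in>I x. \<alpha> x i * \<kappa> i t)" for x t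
  have "N (\<lambda>t. \<mu> x (t - x)) = (\<Sum>i\<in>I x. \<alpha> x i * z i)" for x
  proof -
    have b: "bdd_borel (\<lambda>t. \<kappa> i (t - x))" if "i \<in> I x" for i using that k(1) by (intro bdd_borel_right) (simp add: I_def)
    have "N (\<lambda>t. \<mu> x (t - x)) = (\<Sum>i\<in>I x. N (\<lambda>t. \<alpha> x i * \<kappa> i (t - x)))"
      unfolding \<mu>_def by (intro lin_sum N(1) fI bdd_borel_scale b)
    also have "\<dots> = (\<Sum>i\<in>I x. \<alpha> x i * z i)"
      using lin_scale[OF N(1) b] by (intro sum.cong) (auto simp: z_def I_def)
    finally show ?thesis .
  qed
  then have "(\<Sum>i<n. cmod (z i) powr p) = (\<Sum>x\<in>s ` {..<n}. cmod (N (\<lambda>t. \<mu> x (t - x))) powr p)"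
    unfolding gen by (simp add: \<alpha>(1))
  also have "\<dots> \<le> C powr p"
  proof (rule multiD[OF N(2) order_refl])
    show "bdd_borel (\<mu> x)" for x
      unfolding \<mu>_def using k(1) by (intro bdd_borel_sum fI bdd_borel_scale) (simp add: I_def)
    have "(\<Sum>x\<in>s ` {..<n}. cmod (\<mu> x t) powr p) \<le> (\<Sum>i<n. cmod (\<kappa> i t) powr p)" for t
      unfolding gen \<mu>_def by (intro sum_mono \<alpha>(2))
    then show "(\<Sum>x\<in>s ` {..<n}. cmod (\<mu> x t) powr p) \<le> 1" for t using k(2)[of t] by (rule order_trans)
  qed simp
  finally show ?thesis unfolding z_def .
qed

section \<open>Means as positive functionals on real functions\<close>

definition mean :: "(('g \<Rightarrow> complex) \<Rightarrow> complex) \<Rightarrow> bool" where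
  "mean N \<longleftrightarrow> blin 1 N \<and> N (\<lambda>t. 1) = 1"

definition rbdd_borel :: "('g \<Rightarrow> real) \<Rightarrow> bool" where
  "rbdd_borel f \<longleftrightarrow> f \<in> borel_measurable borel \<and> (\<exists>B. \<forall>t. \<bar>f t\<bar> \<le> B)"

lemma rbdd_borel_bdd_borel: "rbdd_borel f \<longleftrightarrow> bdd_borel (\<lambda>t. of_real (f t))"
proof -
  have "f \<in> borel_measurable borel" if "(\<lambda>t. complex_of_real (f t)) \<in> borel_measurable borel"
    using measurable_compose[OF that borel_measurable_Re] by simp
  moreover have "(\<lambda>t. complex_of_real (f t)) \<in> borel_measurable borel" if "f \<in> borel_measurable borel"
    using that by simp
  ultimately have "f \<in> borel_measurable borel \<longleftrightarrow> (\<lambda>t. complex_of_real (f t)) \<in> borel_measurable borel" by blast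
  then show ?thesis unfolding rbdd_borel_def bdd_borel_def by (simp only: norm_of_real)
qed

lemma rbdd_borel_add: "rbdd_borel f \<Longrightarrow> rbdd_borel g \<Longrightarrow> rbdd_borel (\<lambda>t. f t + g t)"
  using bdd_borel_add[of "\<lambda>t. of_real (f t)" "\<lambda>t. of_real (g t)"] by (simp add: rbdd_borel_bdd_borel)

lemma rbdd_borel_mult: "rbdd_borel f \<Longrightarrow> rbdd_borel g \<Longrightarrow> rbdd_borel (\<lambda>t. f t * g t)"
  using bdd_borel_mult[of "\<lambda>t. of_real (f t)" "\<lambda>t. of_real (g t)"] by (simp add: rbdd_borel_bdd_borel)

lemma rbdd_borel_const: "rbdd_borel (\<lambda>t. c)"
  by (simp add: rbdd_borel_bdd_borel bdd_borel_const)

lemma rbdd_borel_scale: "rbdd_borel f \<Longrightarrow> rbdd_borel (\<lambda>t. c * f t)"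
  by (rule rbdd_borel_mult[OF rbdd_borel_const])

lemma rbdd_borel_diff: "rbdd_borel f \<Longrightarrow> rbdd_borel g \<Longrightarrow> rbdd_borel (\<lambda>t. f t - g t)"
  using rbdd_borel_add[OF _ rbdd_borel_scale[of g "-1"], of f] by simp

lemma rbdd_borel_power2: "rbdd_borel f \<Longrightarrow> rbdd_borel (\<lambda>t. (f t)\<^sup>2)"
  unfolding power2_eq_square by (rule rbdd_borel_mult)

lemma rbdd_borel_indicator: "E \<in> sets borel \<Longrightarrow> rbdd_borel (indicator E)"
  unfolding rbdd_borel_def by (auto intro!: exI[of _ 1] simp: indicator_def)

lemma rbdd_borel_Re: assumes "bdd_borel \<kappa>" shows "rbdd_borel (\<lambda>t. Re (\<kappa> t))"
proof -
  obtain B where B: "\<And>t. cmod (\<kappa> t) \<le> B" using bdd_borel_bound[OF assms] by blast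
  have "\<bar>Re (\<kappa> t)\<bar> \<le> B" for t by (rule order_trans[OF abs_Re_le_cmod B])
  then show ?thesis
    unfolding rbdd_borel_def using measurable_compose[OF bdd_borel_measurable[OF assms] borel_measurable_Re] by blast
qed

lemma rbdd_borel_Im: assumes "bdd_borel \<kappa>" shows "rbdd_borel (\<lambda>t. Im (\<kappa> t))"
proof -
  obtain B where B: "\<And>t. cmod (\<kappa> t) \<le> B" using bdd_borel_bound[OF assms] by blast
  have "\<bar>Im (\<kappa> t)\<bar> \<le> B" for t by (rule order_trans[OF abs_Im_le_cmod B])
  then show ?thesis
    unfolding rbdd_borel_def using measurable_compose[OF bdd_borel_measurable[OF assms] borel_measurable_Im] by blast
qed

definition pos_functional :: "(('g \<Rightarrow> real) \<Rightarrow> real) \<Rightarrow> bool" where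
  "pos_functional l \<longleftrightarrow> (\<forall>f g. rbdd_borel f \<longrightarrow> rbdd_borel g \<longrightarrow> l (\<lambda>t. f t + g t) = l f + l g)
     \<and> (\<forall>c f. rbdd_borel f \<longrightarrow> l (\<lambda>t. c * f t) = c * l f) \<and> (\<forall>f. rbdd_borel f \<longrightarrow> (\<forall>t. 0 \<le> f t) \<longrightarrow> 0 \<le> l f)"

lemma pos_functional_add: "pos_functional l \<Longrightarrow> rbdd_borel f \<Longrightarrow> rbdd_borel g \<Longrightarrow> l (\<lambda>t. f t + g t) = l f + l g"
  by (simp add: pos_functional_def)

lemma pos_functional_scale: "pos_functional l \<Longrightarrow> rbdd_borel f \<Longrightarrow> l (\<lambda>t. c * f t) = c * l f"
  by (simp add: pos_functional_def)

lemma pos_functional_nonneg: "pos_functional l \<Longrightarrow> rbdd_borel f \<Longrightarrow> (\<And>t. 0 \<le> f t) \<Longrightarrow> 0 \<le> l f"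
  by (simp add: pos_functional_def)

lemma pos_functional_diff: assumes "pos_functional l" "rbdd_borel f" "rbdd_borel g" shows "l (\<lambda>t. f t - g t) = l f - l g"
  using pos_functional_add[OF assms(1,2) rbdd_borel_scale[OF assms(3)], of "-1"] pos_functional_scale[OF assms(1,3), of "-1"] by simp

lemma pos_functional_mono:
  assumes "pos_functional l" "rbdd_borel f" "rbdd_borel g" "\<And>t. f t \<le> g t" shows "l f \<le> l g"
  using pos_functional_nonneg[OF assms(1) rbdd_borel_diff[OF assms(3,2)]] pos_functional_diff[OF assms(1,3,2)] assms(4) by simp

lemma pos_functional_abs:
  assumes "pos_functional l" "rbdd_borel f" "\<And>t. \<bar>f t\<bar> \<le> B" shows "\<bar>l f\<bar> \<le> B * l (\<lambda>t. 1)"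
proof -
  have B: "l (\<lambda>t. B) = B * l (\<lambda>t. 1)" "l (\<lambda>t. - B) = - B * l (\<lambda>t. 1)"
    using pos_functional_scale[OF assms(1) rbdd_borel_const[of 1], of B] pos_functional_scale[OF assms(1) rbdd_borel_const[of 1], of "- B"] by simp_all
  have "l f \<le> l (\<lambda>t. B)"
  proof (rule pos_functional_mono[OF assms(1,2) rbdd_borel_const])
    show "f t \<le> B" for t using assms(3)[of t] by linarith
  qed
  moreover have "l (\<lambda>t. - B) \<le> l f"
  proof (rule pos_functional_mono[OF assms(1) rbdd_borel_const assms(2)])
    show "- B \<le> f t" for t using assms(3)[of t] by linarith
  qed
  ultimately show ?thesis unfolding B by linarith
qed

text \<open>An approximate Radon-Nikodym theorem for finitely additive measures: nearly minimize the
  quadratic functional \<open>\<nu> (d\<^sup>2) - 2 * l d\<close>, which is bounded below because \<open>l ((d - 1)\<^sup>2) \<ge> 0\<close>.\<close>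

lemma approximate_density:
  assumes l: "pos_functional l" and \<nu>: "pos_functional \<nu>" and le: "\<And>f. rbdd_borel f \<Longrightarrow> (\<And>t. 0 \<le> f t) \<Longrightarrow> l f \<le> \<nu> f"
    and c: "\<nu> (\<lambda>t. 1) \<le> c" "0 < c" and e: "0 < e"
  shows "\<exists>d. rbdd_borel d \<and> (\<forall>f. rbdd_borel f \<longrightarrow> (\<forall>t. \<bar>f t\<bar> \<le> 1) \<longrightarrow> \<bar>\<nu> (\<lambda>t. d t * f t) - l f\<bar> \<le> e)"
proof -
  define q where "q d = \<nu> (\<lambda>t. (d t)\<^sup>2) - 2 * l d" for d
  have low: "- l (\<lambda>t. 1) \<le> q d" if d: "rbdd_borel d" for d
  proof -
    \<comment> \<open>The quadratic term is afterwards enlarged from \<open>l\<close> to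
      \<open>\<nu>\<close>, as domination permits.\<close>
    have "0 \<le> l (\<lambda>t. (d t - 1)\<^sup>2)" by (rule pos_functional_nonneg[OF l rbdd_borel_power2[OF rbdd_borel_diff[OF d rbdd_borel_const]]]) simp
    also have "(\<lambda>t. (d t - 1)\<^sup>2) = (\<lambda>t. ((d t)\<^sup>2 + (- 2) * d t) + 1)"
      by (auto simp: power2_eq_square algebra_simps)
    also have "l \<dots> = l (\<lambda>t. (d t)\<^sup>2) + (- 2) * l d + l (\<lambda>t. 1)"
      using pos_functional_add[OF l rbdd_borel_add[OF rbdd_borel_power2[OF d] rbdd_borel_scale[OF d, of "- 2"]] rbdd_borel_const[of 1]]
        pos_functional_add[OF l rbdd_borel_power2[OF d] rbdd_borel_scale[OF d, of "- 2"]] pos_functional_scale[OF l d, of "- 2"] by simp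
    finally show ?thesis using le[OF rbdd_borel_power2[OF d]] by (simp add: q_def)
  qed
  define Q where "Q = q ` {d. rbdd_borel d}"
  have ne: "Q \<noteq> {}" using rbdd_borel_const[of 0] by (auto simp: Q_def)
  have bdd: "bdd_below Q" unfolding Q_def using low by (intro bdd_belowI2[of _ "- l (\<lambda>t. 1)"]) simp
  have "Inf Q < Inf Q + e\<^sup>2 / c" using e c by simp
  then obtain y where "y \<in> Q" "y < Inf Q + e\<^sup>2 / c" using cInf_less_iff[OF ne bdd] by blast
  then obtain d where d: "rbdd_borel d" "q d < Inf Q + e\<^sup>2 / c" unfolding Q_def by blast
  have "\<bar>\<nu> (\<lambda>t. d t * f t) - l f\<bar> \<le> e" if f: "rbdd_borel f" "\<forall>t. \<bar>f t\<bar> \<le> 1" for f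
  proof -
    define D where "D = \<nu> (\<lambda>t. d t * f t) - l f"
    \<comment> \<open>The minimizer of \<open>2 * \<tau> * D + \<tau>\<^sup>2 * c\<close>, with
      minimum \<open>- D\<^sup>2 / c\<close>. As \<open>d\<close> is within
      \<open>e\<^sup>2 / c\<close> of the infimum, the variation in direction \<open>f\<close>
      forces \<open>\<bar>D\<bar> < e\<close>.\<close>
    define \<tau> where "\<tau> = - D / c"
    have "q (\<lambda>t. d t + \<tau> * f t) = q d + 2 * \<tau> * D + \<tau>\<^sup>2 * \<nu> (\<lambda>t. (f t)\<^sup>2)"
    proof -
      have "(\<lambda>t. (d t + \<tau> * f t)\<^sup>2) = (\<lambda>t. ((d t)\<^sup>2 + (2 * \<tau>) * (d t * f t)) + \<tau>\<^sup>2 * (f t)\<^sup>2)"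
        by (auto simp: power2_eq_square algebra_simps)
      moreover have "\<nu> (\<lambda>t. ((d t)\<^sup>2 + (2 * \<tau>) * (d t * f t)) + \<tau>\<^sup>2 * (f t)\<^sup>2)
          = \<nu> (\<lambda>t. (d t)\<^sup>2 + (2 * \<tau>) * (d t * f t)) + \<nu> (\<lambda>t. \<tau>\<^sup>2 * (f t)\<^sup>2)"
        by (rule pos_functional_add[OF \<nu> rbdd_borel_add[OF rbdd_borel_power2[OF d(1)] rbdd_borel_scale[OF rbdd_borel_mult[OF d(1) f(1)]]] rbdd_borel_scale[OF rbdd_borel_power2[OF f(1)]]])
      moreover have "\<nu> (\<lambda>t. (d t)\<^sup>2 + (2 * \<tau>) * (d t * f t)) = \<nu> (\<lambda>t. (d t)\<^sup>2) + \<nu> (\<lambda>t. (2 * \<tau>) * (d t * f t))"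
        by (rule pos_functional_add[OF \<nu> rbdd_borel_power2[OF d(1)] rbdd_borel_scale[OF rbdd_borel_mult[OF d(1) f(1)]]])
      moreover have "l (\<lambda>t. d t + \<tau> * f t) = l d + \<tau> * l f"
        using pos_functional_add[OF l d(1) rbdd_borel_scale[OF f(1)], of \<tau>] pos_functional_scale[OF l f(1), of \<tau>] by simp
      ultimately show ?thesis
        using pos_functional_scale[OF \<nu> rbdd_borel_mult[OF d(1) f(1)], of "2 * \<tau>"] pos_functional_scale[OF \<nu> rbdd_borel_power2[OF f(1)], of "\<tau>\<^sup>2"]
        by (simp add: q_def D_def algebra_simps)
    qed
    moreover have "Inf Q \<le> q (\<lambda>t. d t + \<tau> * f t)"
    proof (rule cInf_lower[OF _ bdd])
      have "rbdd_borel (\<lambda>t. d t + \<tau> * f t)" by (rule rbdd_borel_add[OF d(1) rbdd_borel_scale[OF f(1)]])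
      then show "q (\<lambda>t. d t + \<tau> * f t) \<in> Q" unfolding Q_def by blast
    qed
    ultimately have "0 < 2 * \<tau> * D + \<tau>\<^sup>2 * \<nu> (\<lambda>t. (f t)\<^sup>2) + e\<^sup>2 / c" using d(2) by linarith
    moreover have "\<tau>\<^sup>2 * \<nu> (\<lambda>t. (f t)\<^sup>2) \<le> \<tau>\<^sup>2 * c"
    proof (rule mult_left_mono)
      have "\<nu> (\<lambda>t. (f t)\<^sup>2) \<le> \<nu> (\<lambda>t. 1)"
        using f(2) by (intro pos_functional_mono[OF \<nu> rbdd_borel_power2[OF f(1)] rbdd_borel_const]) (simp add: abs_square_le_1)
      then show "\<nu> (\<lambda>t. (f t)\<^sup>2) \<le> c" using c by simp
    qed simp
    moreover have "2 * \<tau> * D + \<tau>\<^sup>2 * c = - D\<^sup>2 / c"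
      using c by (simp add: \<tau>_def power2_eq_square field_simps)
    ultimately have "D\<^sup>2 / c < e\<^sup>2 / c" by simp
    then have "D\<^sup>2 < e\<^sup>2" using c by (simp add: divide_less_cancel)
    then have "\<bar>D\<bar> < e" using e by (intro power2_less_imp_less[of "\<bar>D\<bar>" e]) simp_all
    then show ?thesis using e by (simp add: D_def)
  qed
  with d show ?thesis by blast
qed

text \<open>Rounding a bounded density down to multiples of \<open>h\<close> leaves finitely many
  values and costs at most \<open>h * c\<close>, which is half of the tolerance. Finitely many
  values give the finite partition that \<open>goldstine_tuple\<close> needs.\<close>

lemma approximate_simple_density:
  assumes l: "pos_functional l" and \<nu>: "pos_functional \<nu>" and le: "\<And>f. rbdd_borel f \<Longrightarrow> (\<And>t. 0 \<le> f t) \<Longrightarrow> l f \<le> \<nu> f"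
    and c: "\<nu> (\<lambda>t. 1) \<le> c" "0 < c" and e: "0 < e"
  shows "\<exists>d. rbdd_borel d \<and> finite (range d) \<and>
    (\<forall>f. rbdd_borel f \<longrightarrow> (\<forall>t. \<bar>f t\<bar> \<le> 1) \<longrightarrow> \<bar>\<nu> (\<lambda>t. d t * f t) - l f\<bar> \<le> e)"
proof -
  obtain d where d: "rbdd_borel d" "\<And>f. rbdd_borel f \<Longrightarrow> (\<forall>t. \<bar>f t\<bar> \<le> 1) \<Longrightarrow> \<bar>\<nu> (\<lambda>t. d t * f t) - l f\<bar> \<le> e / 2"
    using approximate_density[OF l \<nu> le c half_gt_zero[OF e]] by blast
  define h where "h = e / (2 * c)"
  have h: "0 < h" using e c by (simp add: h_def)
  define d' where "d' t = h * of_int \<lfloor>d t / h\<rfloor>" for t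
  have close: "\<bar>d' t - d t\<bar> \<le> h" for t
  proof -
    have "\<bar>of_int \<lfloor>d t / h\<rfloor> - d t / h\<bar> \<le> 1" by linarith
    then have "h * \<bar>of_int \<lfloor>d t / h\<rfloor> - d t / h\<bar> \<le> h * 1" using h by (intro mult_left_mono) simp_all
    moreover have "d' t - d t = h * (of_int \<lfloor>d t / h\<rfloor> - d t / h)" using h by (simp add: d'_def right_diff_distrib)
    ultimately show ?thesis using h by (simp add: abs_mult)
  qed
  obtain B where B: "\<And>t. \<bar>d t\<bar> \<le> B" using d(1) unfolding rbdd_borel_def by blast
  have "\<bar>d' t\<bar> \<le> B + h" for t using close[of t] B[of t] by linarith
  moreover have "d' \<in> borel_measurable borel"
  proof -
    have "d \<in> borel_measurable borel" using d(1) unfolding rbdd_borel_def by blast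
    then have "(\<lambda>t. d t / h) \<in> borel_measurable borel" by (intro borel_measurable_divide borel_measurable_const)
    from measurable_compose[OF this borel_measurable_real_floor] show ?thesis
      unfolding d'_def[abs_def] by (intro borel_measurable_times borel_measurable_const)
  qed
  ultimately have d'b: "rbdd_borel d'" unfolding rbdd_borel_def by blast
  have "range d' \<subseteq> (\<lambda>k. h * of_int k) ` {\<lfloor>- B / h\<rfloor>..\<lfloor>B / h\<rfloor>}"
  proof
    fix x assume "x \<in> range d'"
    then obtain t where t: "x = d' t" by blast
    have "- B \<le> d t" "d t \<le> B" using B[of t] by linarith+
    then have "- B / h \<le> d t / h" "d t / h \<le> B / h" using h by (intro divide_right_mono; simp)+
    then have "\<lfloor>d t / h\<rfloor> \<in> {\<lfloor>- B / h\<rfloor>..\<lfloor>B / h\<rfloor>}" by (auto intro: floor_mono)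
    then show "x \<in> (\<lambda>k. h * of_int k) ` {\<lfloor>- B / h\<rfloor>..\<lfloor>B / h\<rfloor>}" unfolding t d'_def by blast
  qed
  then have fin: "finite (range d')" by (rule finite_subset) simp
  have "\<bar>\<nu> (\<lambda>t. d' t * f t) - l f\<bar> \<le> e" if f: "rbdd_borel f" "\<forall>t. \<bar>f t\<bar> \<le> 1" for f
  proof -
    have "\<nu> (\<lambda>t. d' t * f t) - \<nu> (\<lambda>t. d t * f t) = \<nu> (\<lambda>t. (d' t - d t) * f t)"
      using pos_functional_diff[OF \<nu> rbdd_borel_mult[OF d'b f(1)] rbdd_borel_mult[OF d(1) f(1)]] by (simp add: left_diff_distrib)
    also have "\<bar>\<dots>\<bar> \<le> h * \<nu> (\<lambda>t. 1)"
    proof (rule pos_functional_abs[OF \<nu> rbdd_borel_mult[OF rbdd_borel_diff[OF d'b d(1)] f(1)]])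
      show "\<bar>(d' t - d t) * f t\<bar> \<le> h" for t
        using mult_mono[OF close[of t] f(2)[rule_format, of t]] h by (simp add: abs_mult)
    qed
    also have "\<dots> \<le> h * c" using h c by (intro mult_left_mono) simp_all
    also have "\<dots> = e / 2" using c by (simp add: h_def)
    finally show ?thesis using d(2)[OF f] by linarith
  qed
  with d'b fin show ?thesis by blast
qed

lemma meanD:
  assumes "mean N" shows "blin 1 N" "lin N" "N (\<lambda>t. 1) = 1"
  using assms by (simp_all add: mean_def blin_def)

lemma mean_bound:
  assumes "mean N" "bdd_borel \<kappa>" "\<And>t. cmod (\<kappa> t) \<le> b" "0 \<le> b" shows "cmod (N \<kappa>) \<le> b"
  using blin_bound[OF meanD(1)[OF assms(1)] assms(2,3,4)] by simp

lemma mean_const: assumes "mean N" shows "N (\<lambda>t. c) = c"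
  using lin_scale[OF meanD(2)[OF assms] bdd_borel_const[of 1], of c] meanD(3)[OF assms] by simp

lemma mean_right: assumes "mean N" shows "mean (\<lambda>\<kappa>. N (\<lambda>t. \<kappa> (t - s)))"
proof -
  have "lin (\<lambda>\<kappa>. N (\<lambda>t. \<kappa> (t - s)))"
    unfolding lin_def
  proof (intro conjI allI impI)
    fix \<kappa> \<mu> assume "bdd_borel \<kappa>" "bdd_borel \<mu>"
    then show "N (\<lambda>t. \<kappa> (t - s) + \<mu> (t - s)) = N (\<lambda>t. \<kappa> (t - s)) + N (\<lambda>t. \<mu> (t - s))"
      by (intro lin_add[OF meanD(2)[OF assms]] bdd_borel_right)
  next
    fix c \<kappa> assume "bdd_borel \<kappa>"
    then show "N (\<lambda>t. c * \<kappa> (t - s)) = c * N (\<lambda>t. \<kappa> (t - s))"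
      by (intro lin_scale[OF meanD(2)[OF assms]] bdd_borel_right)
  qed
  moreover have "cmod (N (\<lambda>t. \<kappa> (t - s))) \<le> 1" if k: "bdd_borel \<kappa>" "\<forall>t. cmod (\<kappa> t) \<le> 1" for \<kappa>
    by (rule blinD[OF meanD(1)[OF assms] bdd_borel_right[OF k(1)]]) (rule k(2)[rule_format])
  ultimately show ?thesis using meanD(3)[OF assms] by (simp add: mean_def blin_def)
qed

text \<open>Adding an imaginary constant gives
  \<open>(Im z + \<tau>)\<^sup>2 \<le> B\<^sup>2 + \<tau>\<^sup>2\<close> for every real
  \<open>\<tau>\<close>; the term linear in \<open>\<tau>\<close> must vanish, so
  \<open>Im z = 0\<close>.\<close>

lemma mean_real:
  assumes N: "mean N" and f: "rbdd_borel f"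
  shows "N (\<lambda>t. of_real (f t)) = of_real (Re (N (\<lambda>t. of_real (f t))))"
proof -
  obtain B where B: "\<And>t. \<bar>f t\<bar> \<le> B" using f unfolding rbdd_borel_def by blast
  have B0: "0 \<le> B" using B[of 0] by linarith
  have fb: "bdd_borel (\<lambda>t. of_real (f t))" using f by (simp add: rbdd_borel_bdd_borel)
  define z where "z = N (\<lambda>t. of_real (f t))"
  have le: "(Im z + \<tau>)\<^sup>2 \<le> B\<^sup>2 + \<tau>\<^sup>2" for \<tau> :: real
  proof -
    have "N (\<lambda>t. of_real (f t) + \<i> * of_real \<tau>) = z + \<i> * of_real \<tau>"
      using lin_add[OF meanD(2)[OF N] fb bdd_borel_const[of "\<i> * of_real \<tau>"]] mean_const[OF N] by (simp add: z_def)
    moreover have "cmod (N (\<lambda>t. of_real (f t) + \<i> * of_real \<tau>)) \<le> sqrt (B\<^sup>2 + \<tau>\<^sup>2)"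
    proof (rule mean_bound[OF N bdd_borel_add[OF fb bdd_borel_const]])
      fix t
      have "\<bar>f t\<bar>\<^sup>2 \<le> B\<^sup>2" by (rule power_mono[OF B]) simp
      then show "cmod (of_real (f t) + \<i> * of_real \<tau>) \<le> sqrt (B\<^sup>2 + \<tau>\<^sup>2)"
        unfolding cmod_def by (intro real_sqrt_le_mono) simp
    qed simp
    ultimately have "sqrt ((Re z)\<^sup>2 + (Im z + \<tau>)\<^sup>2) \<le> sqrt (B\<^sup>2 + \<tau>\<^sup>2)" by (simp add: cmod_def)
    then have "(Re z)\<^sup>2 + (Im z + \<tau>)\<^sup>2 \<le> B\<^sup>2 + \<tau>\<^sup>2" by simp
    moreover have "0 \<le> (Re z)\<^sup>2" by simp
    ultimately show ?thesis by linarith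
  qed
  have "Im z = 0"
  proof (rule ccontr)
    assume ne: "Im z \<noteq> 0"
    have "(Im z)\<^sup>2 + 2 * Im z * \<tau> \<le> B\<^sup>2" for \<tau>
      using le[of \<tau>] by (simp add: power2_eq_square algebra_simps)
    from this[of "(B\<^sup>2 + 1) / (2 * Im z)"] have "(Im z)\<^sup>2 + (B\<^sup>2 + 1) \<le> B\<^sup>2" using ne by simp
    moreover have "0 \<le> (Im z)\<^sup>2" by simp
    ultimately show False by linarith
  qed
  then show ?thesis unfolding z_def[symmetric] by (simp add: complex_eq_iff)
qed

definition re :: "(('g \<Rightarrow> complex) \<Rightarrow> complex) \<Rightarrow> ('g \<Rightarrow> real) \<Rightarrow> real" where
  "re N f = Re (N (\<lambda>t. of_real (f t)))"

lemma mean_re: "mean N \<Longrightarrow> rbdd_borel f \<Longrightarrow> N (\<lambda>t. of_real (f t)) = of_real (re N f)"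
  unfolding re_def by (rule mean_real)

text \<open>Norm 1 together with value 1 at the constant 1 forces positivity: from
  \<open>0 \<le> f \<le> B\<close> follows \<open>\<bar>B - f\<bar> \<le> B\<close>, hence
  \<open>B - re N f \<le> B\<close>.\<close>

lemma mean_pos_functional: assumes N: "mean N" shows "pos_functional (re N)"
  unfolding pos_functional_def
proof (intro conjI allI impI)
  fix f g assume "rbdd_borel f" "rbdd_borel g"
  then show "re N (\<lambda>t. f t + g t) = re N f + re N g"
    using lin_add[OF meanD(2)[OF N], of "\<lambda>t. of_real (f t)" "\<lambda>t. of_real (g t)"] by (simp add: re_def rbdd_borel_bdd_borel)
next
  fix c f assume "rbdd_borel f"
  then show "re N (\<lambda>t. c * f t) = c * re N f"
    using lin_scale[OF meanD(2)[OF N], of "\<lambda>t. of_real (f t)" "of_real c"] by (simp add: re_def rbdd_borel_bdd_borel)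
next
  fix f assume f: "rbdd_borel f" and pos: "\<forall>t. 0 \<le> f t"
  obtain B where B: "\<And>t. \<bar>f t\<bar> \<le> B" using f unfolding rbdd_borel_def by blast
  have B0: "0 \<le> B" using B[of 0] by linarith
  have fb: "bdd_borel (\<lambda>t. of_real (f t))" using f by (simp add: rbdd_borel_bdd_borel)
  have b: "bdd_borel (\<lambda>t. of_real B + (- 1) * of_real (f t))" by (intro bdd_borel_add bdd_borel_const bdd_borel_scale fb)
  have "cmod (N (\<lambda>t. of_real B + (- 1) * of_real (f t))) \<le> B"
  proof (rule mean_bound[OF N b _ B0])
    fix t
    have "cmod (of_real (B - f t)) \<le> B" unfolding norm_of_real using B[of t] pos[rule_format, of t] by linarith
    then show "cmod (of_real B + (- 1) * of_real (f t)) \<le> B" by simp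
  qed
  moreover have "N (\<lambda>t. of_real B + (- 1) * of_real (f t)) = of_real B - N (\<lambda>t. of_real (f t))"
    using lin_add[OF meanD(2)[OF N] bdd_borel_const[of "of_real B"] bdd_borel_scale[OF fb, of "- 1"]] lin_scale[OF meanD(2)[OF N] fb, of "- 1"]
      mean_const[OF N] by simp
  moreover have "B - Re (N (\<lambda>t. of_real (f t))) \<le> cmod (of_real B - N (\<lambda>t. of_real (f t)))"
    using complex_Re_le_cmod[of "of_real B - N (\<lambda>t. of_real (f t))"] by simp
  ultimately show "0 \<le> re N f" unfolding re_def by simp
qed

lemma mean_complex:
  assumes N: "mean N" and k: "bdd_borel \<kappa>"
  shows "N \<kappa> = Complex (re N (\<lambda>t. Re (\<kappa> t))) (re N (\<lambda>t. Im (\<kappa> t)))"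
proof -
  have b: "bdd_borel (\<lambda>t. of_real (Re (\<kappa> t)))" "bdd_borel (\<lambda>t. of_real (Im (\<kappa> t)))"
    using rbdd_borel_Re[OF k] rbdd_borel_Im[OF k] by (simp_all add: rbdd_borel_bdd_borel)
  have "\<kappa> = (\<lambda>t. of_real (Re (\<kappa> t)) + \<i> * of_real (Im (\<kappa> t)))" by (simp add: complex_eq_iff fun_eq_iff)
  then have "N \<kappa> = N (\<lambda>t. of_real (Re (\<kappa> t)) + \<i> * of_real (Im (\<kappa> t)))" by simp
  also have "\<dots> = of_real (re N (\<lambda>t. Re (\<kappa> t))) + \<i> * of_real (re N (\<lambda>t. Im (\<kappa> t)))"
    using lin_add[OF meanD(2)[OF N] b(1) bdd_borel_scale[OF b(2)]] lin_scale[OF meanD(2)[OF N] b(2)]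
    by (simp add: mean_re[OF N rbdd_borel_Re[OF k]] mean_re[OF N rbdd_borel_Im[OF k]])
  finally show ?thesis by (simp add: complex_eq_iff)
qed

text \<open>With \<open>\<nu> = (\<Sum>i. N i)\<close> the mean \<open>N i\<close> is nearly \<open>d i * \<nu>\<close> for a simple function \<open>d i\<close>; on each set
  \<open>E k\<close> where all \<open>d i\<close> are constant, \<open>\<kappa> i\<close> is the value of \<open>G i\<close> at the normalized restriction of \<open>\<nu>\<close>.\<close>

lemma goldstine_tuple:
  fixes N :: "nat \<Rightarrow> ('g \<Rightarrow> complex) \<Rightarrow> complex" and G :: "nat \<Rightarrow> (('g \<Rightarrow> complex) \<Rightarrow> complex) \<Rightarrow> complex"
  assumes N: "\<And>i. i < n \<Longrightarrow> mean (N i)"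
    and cong: "\<And>i F F'. i < n \<Longrightarrow> (\<And>\<kappa>. bdd_borel \<kappa> \<Longrightarrow> F \<kappa> = F' \<kappa>) \<Longrightarrow> G i F = G i F'"
    and lin: "\<And>i F F' B B' c. i < n \<Longrightarrow> blin B F \<Longrightarrow> blin B' F' \<Longrightarrow> 0 \<le> B \<Longrightarrow> 0 \<le> B' \<Longrightarrow>
      G i (\<lambda>\<kappa>. c * F \<kappa> + F' \<kappa>) = c * G i F + G i F'"
    and bound: "\<And>F B. blin B F \<Longrightarrow> 0 \<le> B \<Longrightarrow> (\<Sum>i<n. cmod (G i F) powr p) \<le> B powr p"
    and e: "0 < e"
  shows "\<exists>\<kappa>. (\<forall>i<n. bdd_borel (\<kappa> i)) \<and> (\<forall>t. (\<Sum>i<n. cmod (\<kappa> i t) powr p) \<le> 1) \<and>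
    (\<forall>i<n. cmod (G i (N i) - N i (\<kappa> i)) \<le> e)"
proof (cases "n = 0")
  case False
  define \<nu> where "\<nu> f = (\<Sum>i<n. re (N i) f)" for f
  define Nu where "Nu \<kappa> = (\<Sum>i<n. N i \<kappa>)" for \<kappa>
  have pl: "pos_functional (re (N i))" if "i < n" for i by (rule mean_pos_functional[OF N[OF that]])
  have \<nu>: "pos_functional \<nu>"
    unfolding pos_functional_def
  proof (intro conjI allI impI)
    fix f g assume "rbdd_borel f" "rbdd_borel g"
    then show "\<nu> (\<lambda>t. f t + g t) = \<nu> f + \<nu> g"
      unfolding \<nu>_def sum.distrib[symmetric] by (intro sum.cong refl pos_functional_add[OF pl]) simp_all
  next
    fix c f assume "rbdd_borel f"
    then show "\<nu> (\<lambda>t. c * f t) = c * \<nu> f"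
      unfolding \<nu>_def sum_distrib_left by (intro sum.cong refl pos_functional_scale[OF pl]) simp_all
  next
    fix f assume "rbdd_borel f" "\<forall>t. 0 \<le> f t"
    then show "0 \<le> \<nu> f" unfolding \<nu>_def by (intro sum_nonneg pos_functional_nonneg[OF pl]) simp_all
  qed
  have Nu_lin: "lin Nu"
    unfolding lin_def
  proof (intro conjI allI impI)
    fix \<kappa> \<mu> assume "bdd_borel \<kappa>" "bdd_borel \<mu>"
    then show "Nu (\<lambda>t. \<kappa> t + \<mu> t) = Nu \<kappa> + Nu \<mu>"
      unfolding Nu_def sum.distrib[symmetric] by (intro sum.cong refl lin_add[OF meanD(2)[OF N]]) simp_all
  next
    fix c \<kappa> assume "bdd_borel \<kappa>"
    then show "Nu (\<lambda>t. c * \<kappa> t) = c * Nu \<kappa>"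
      unfolding Nu_def sum_distrib_left by (intro sum.cong refl lin_scale[OF meanD(2)[OF N]]) simp_all
  qed
  have Nu_complex: "Nu \<kappa> = Complex (\<nu> (\<lambda>t. Re (\<kappa> t))) (\<nu> (\<lambda>t. Im (\<kappa> t)))" if k: "bdd_borel \<kappa>" for \<kappa>
  proof -
    have "Nu \<kappa> = (\<Sum>i<n. Complex (re (N i) (\<lambda>t. Re (\<kappa> t))) (re (N i) (\<lambda>t. Im (\<kappa> t))))"
      unfolding Nu_def by (intro sum.cong refl mean_complex N k) simp
    then show ?thesis by (simp add: complex_eq_iff \<nu>_def)
  qed
  have \<nu>1: "\<nu> (\<lambda>t. 1) \<le> real n"
    using meanD(3)[OF N] by (simp add: \<nu>_def re_def)
  have le: "re (N i) f \<le> \<nu> f" if i: "i < n" and f: "rbdd_borel f" "\<And>t. 0 \<le> f t" for i f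
    unfolding \<nu>_def using i by (intro member_le_sum pos_functional_nonneg[OF pl] f) simp_all
  have e4: "0 < e / 4" using e by simp
  have n0: "0 < real n" using False by simp
  have "\<forall>i\<in>{..<n}. \<exists>d. rbdd_borel d \<and> finite (range d) \<and>
      (\<forall>f. rbdd_borel f \<longrightarrow> (\<forall>t. \<bar>f t\<bar> \<le> 1) \<longrightarrow> \<bar>\<nu> (\<lambda>t. d t * f t) - re (N i) f\<bar> \<le> e / 4)"
  proof
    fix i assume "i \<in> {..<n}"
    then have i: "i < n" by simp
    show "\<exists>d. rbdd_borel d \<and> finite (range d) \<and>
      (\<forall>f. rbdd_borel f \<longrightarrow> (\<forall>t. \<bar>f t\<bar> \<le> 1) \<longrightarrow> \<bar>\<nu> (\<lambda>t. d t * f t) - re (N i) f\<bar> \<le> e / 4)"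
      by (rule approximate_simple_density[OF pl[OF i] \<nu> le[OF i] \<nu>1 n0 e4])
  qed
  from bchoice[OF this] obtain d where d0: "\<forall>i\<in>{..<n}. rbdd_borel (d i) \<and> finite (range (d i)) \<and>
      (\<forall>f. rbdd_borel f \<longrightarrow> (\<forall>t. \<bar>f t\<bar> \<le> 1) \<longrightarrow> \<bar>\<nu> (\<lambda>t. d i t * f t) - re (N i) f\<bar> \<le> e / 4)" by (elim exE)
  have d: "rbdd_borel (d i)" "finite (range (d i))" if "i < n" for i using d0 that by blast+
  have dN: "\<bar>\<nu> (\<lambda>t. d i t * f t) - re (N i) f\<bar> \<le> e / 4" if "i < n" "rbdd_borel f" "\<And>t. \<bar>f t\<bar> \<le> 1" for i f
    using d0 that by blast
  have db: "bdd_borel (\<lambda>t. of_real (d i t))" if "i < n" for i using d(1)[OF that] by (simp add: rbdd_borel_bdd_borel)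
  have dNc: "cmod (Nu (\<lambda>t. of_real (d i t) * \<kappa> t) - N i \<kappa>) \<le> e / 2"
    if i: "i < n" and k: "bdd_borel \<kappa>" "\<And>t. cmod (\<kappa> t) \<le> 1" for i \<kappa>
  proof -
    have b: "bdd_borel (\<lambda>t. of_real (d i t) * \<kappa> t)" by (rule bdd_borel_mult[OF db[OF i] k(1)])
    have 1: "\<bar>\<nu> (\<lambda>t. d i t * Re (\<kappa> t)) - re (N i) (\<lambda>t. Re (\<kappa> t))\<bar> \<le> e / 4"
      by (rule dN[OF i rbdd_borel_Re[OF k(1)]]) (rule order_trans[OF abs_Re_le_cmod k(2)])
    have 2: "\<bar>\<nu> (\<lambda>t. d i t * Im (\<kappa> t)) - re (N i) (\<lambda>t. Im (\<kappa> t))\<bar> \<le> e / 4"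
      by (rule dN[OF i rbdd_borel_Im[OF k(1)]]) (rule order_trans[OF abs_Im_le_cmod k(2)])
    have "cmod (Nu (\<lambda>t. of_real (d i t) * \<kappa> t) - N i \<kappa>)
        \<le> \<bar>Re (Nu (\<lambda>t. of_real (d i t) * \<kappa> t) - N i \<kappa>)\<bar> + \<bar>Im (Nu (\<lambda>t. of_real (d i t) * \<kappa> t) - N i \<kappa>)\<bar>"
      by (rule cmod_le)
    also have "\<dots> = \<bar>\<nu> (\<lambda>t. d i t * Re (\<kappa> t)) - re (N i) (\<lambda>t. Re (\<kappa> t))\<bar>
        + \<bar>\<nu> (\<lambda>t. d i t * Im (\<kappa> t)) - re (N i) (\<lambda>t. Im (\<kappa> t))\<bar>"
      unfolding Nu_complex[OF b] mean_complex[OF N[OF i] k(1)] by simp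
    finally show ?thesis using 1 2 by linarith
  qed
  define \<tau> where "\<tau> t = restrict (\<lambda>i. d i t) {..<n}" for t
  define R where "R = range \<tau>"
  have "R \<subseteq> PiE {..<n} (\<lambda>i. range (d i))" unfolding R_def by (rule image_subsetI) (simp add: \<tau>_def restrict_PiE_iff)
  moreover have "finite (PiE {..<n} (\<lambda>i. range (d i)))" by (intro finite_PiE d) simp_all
  ultimately have fR: "finite R" by (rule finite_subset)
  define E where "E k = {t. \<tau> t = k}" for k
  have Es: "E k \<in> sets borel" if "k \<in> R" for k
  proof -
    have ext: "k \<in> extensional {..<n}" using that by (auto simp: R_def \<tau>_def)
    have "E k = (\<Inter>i\<in>{..<n}. d i -` {k i})"
    proof (intro set_eqI iffI)
      fix t assume "t \<in> (\<Inter>i\<in>{..<n}. d i -` {k i})"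
      then have "\<tau> t = k" using ext by (intro extensionalityI[of _ "{..<n}"]) (simp_all add: \<tau>_def)
      then show "t \<in> E k" by (simp add: E_def)
    qed (auto simp: E_def \<tau>_def)
    moreover have "(\<Inter>i\<in>{..<n}. d i -` {k i}) \<in> sets borel"
    proof (rule sets.finite_INT)
      show "{..<n} \<noteq> {}" using False by (simp add: lessThan_empty_iff)
      fix i assume "i \<in> {..<n}"
      then have "d i \<in> borel_measurable borel" using d(1)[of i] by (simp add: rbdd_borel_def)
      from measurable_sets[OF this, of "{k i}"] show "d i -` {k i} \<in> sets borel" by simp
    qed simp
    ultimately show ?thesis by (simp only:)
  qed
  have kE: "bdd_borel (\<lambda>t. indicator (E k) t * \<kappa> t)" if "k \<in> R" "bdd_borel \<kappa>" for k \<kappa>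
    by (rule bdd_borel_mult[OF bdd_borel_indicator[OF Es[OF that(1)]] that(2)])
  define w where "w k = \<nu> (indicator (E k))" for k
  have w0: "0 \<le> w k" if "k \<in> R" for k
    unfolding w_def by (rule pos_functional_nonneg[OF \<nu> rbdd_borel_indicator[OF Es[OF that]]]) simp
  define y where "y k \<kappa> = Nu (\<lambda>t. indicator (E k) t * \<kappa> t)" for k \<kappa>
  have y: "blin (w k) (y k)" if k: "k \<in> R" for k
  proof -
    have "lin (y k)"
      unfolding lin_def y_def
    proof (intro conjI allI impI)
      fix \<kappa> \<mu> assume "bdd_borel \<kappa>" "bdd_borel \<mu>"
      then show "Nu (\<lambda>t. indicator (E k) t * (\<kappa> t + \<mu> t)) = Nu (\<lambda>t. indicator (E k) t * \<kappa> t) + Nu (\<lambda>t. indicator (E k) t * \<mu> t)"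
        unfolding distrib_left by (intro lin_add[OF Nu_lin] kE k)
    next
      fix c \<kappa> assume "bdd_borel \<kappa>"
      then show "Nu (\<lambda>t. indicator (E k) t * (c * \<kappa> t)) = c * Nu (\<lambda>t. indicator (E k) t * \<kappa> t)"
        unfolding mult.left_commute[of _ c] by (intro lin_scale[OF Nu_lin] kE k)
    qed
    moreover have "cmod (y k \<kappa>) \<le> w k" if b: "bdd_borel \<kappa>" "\<forall>t. cmod (\<kappa> t) \<le> 1" for \<kappa>
    proof (cases "y k \<kappa> = 0")
      case True
      then show ?thesis using w0[OF k] by simp
    next
      case False
      \<comment> \<open>Rotation by this phase makes the value real, so that it is
        \<open>\<nu>\<close> of a real part and monotonicity of \<open>\<nu>\<close>
        applies.\<close>
      define u where "u = cnj (sgn (y k \<kappa>))"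
      have u1: "cmod u = 1" using False by (simp add: u_def norm_sgn)
      have "of_real (cmod (y k \<kappa>)) = u * y k \<kappa>"
      proof -
        have "y k \<kappa> = of_real (cmod (y k \<kappa>)) * sgn (y k \<kappa>)" using False by (simp add: sgn_eq)
        then have "u * y k \<kappa> = of_real (cmod (y k \<kappa>)) * (sgn (y k \<kappa>) * cnj (sgn (y k \<kappa>)))"
          unfolding u_def by (metis mult.assoc mult.commute)
        then show ?thesis using False by (simp add: complex_norm_square[symmetric] norm_sgn)
      qed
      also have "u * y k \<kappa> = Nu (\<lambda>t. u * (indicator (E k) t * \<kappa> t))"
        unfolding y_def by (rule lin_scale[OF Nu_lin kE[OF k b(1)], symmetric])
      finally have "cmod (y k \<kappa>) = Re (Nu (\<lambda>t. u * (indicator (E k) t * \<kappa> t)))" by (metis Re_complex_of_real)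
      also have "\<dots> = \<nu> (\<lambda>t. Re (u * (indicator (E k) t * \<kappa> t)))"
        by (subst Nu_complex[OF bdd_borel_scale[OF kE[OF k b(1)]]]) simp
      also have "\<dots> \<le> w k"
        unfolding w_def
      proof (rule pos_functional_mono[OF \<nu> rbdd_borel_Re[OF bdd_borel_scale[OF kE[OF k b(1)]]] rbdd_borel_indicator[OF Es[OF k]]])
        fix t
        have "Re (u * (indicator (E k) t * \<kappa> t)) \<le> cmod (u * (indicator (E k) t * \<kappa> t))" by (rule complex_Re_le_cmod)
        also have "\<dots> \<le> indicator (E k) t"
          using b(2)[rule_format, of t] by (cases "t \<in> E k") (simp_all add: norm_mult u1)
        finally show "Re (u * (indicator (E k) t * \<kappa> t)) \<le> indicator (E k) t" .
      qed
      finally show ?thesis .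
    qed
    ultimately show ?thesis unfolding blin_def by blast
  qed
  have G1: "cmod (G i F) \<le> B" if "i < n" "blin B F" "0 \<le> B" for i F B
  proof -
    have "cmod (G i F) powr p \<le> (\<Sum>i<n. cmod (G i F) powr p)"
      using that(1) by (intro member_le_sum) simp_all
    also have "\<dots> \<le> B powr p" by (rule bound[OF that(2,3)])
    finally show ?thesis by (rule powr_le_cancel_base[OF norm_ge_zero that(3)])
  qed
  \<comment> \<open>Where \<open>w k = 0\<close> the quotient is 0 by convention; \<open>G1\<close>
    gives \<open>G i (y k) = 0\<close> there, so the cancellation of \<open>w k\<close> below still
    holds.\<close>
  define \<kappa> where "\<kappa> i t = (\<Sum>k\<in>R. indicator (E k) t * (G i (y k) / of_real (w k)))" for i t
  have \<kappa>v: "\<kappa> i t = G i (y (\<tau> t)) / of_real (w (\<tau> t))" for i t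
  proof -
    have "\<kappa> i t = (\<Sum>k\<in>R. if k = \<tau> t then G i (y k) / of_real (w k) else 0)"
      unfolding \<kappa>_def by (intro sum.cong refl) (simp add: E_def indicator_def)
    then show ?thesis using fR by (simp add: R_def)
  qed
  have \<kappa>b: "bdd_borel (\<kappa> i)" for i
    unfolding \<kappa>_def by (intro bdd_borel_sum fR kE bdd_borel_const)
  have \<kappa>1: "(\<Sum>i<n. cmod (\<kappa> i t) powr p) \<le> 1" for t
  proof -
    have k: "\<tau> t \<in> R" by (simp add: R_def)
    show ?thesis
    proof (cases "w (\<tau> t) = 0")
      case True
      then show ?thesis by (simp add: \<kappa>v)
    next
      case ne: False
      then have wp: "0 < w (\<tau> t)" using w0[OF k] by simp
      have "(\<Sum>i<n. cmod (\<kappa> i t) powr p) = (\<Sum>i<n. cmod (G i (y (\<tau> t))) powr p) / w (\<tau> t) powr p"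
        using wp by (simp add: \<kappa>v norm_divide powr_divide sum_divide_distrib)
      also have "\<dots> \<le> w (\<tau> t) powr p / w (\<tau> t) powr p"
        by (intro divide_right_mono bound[OF y[OF k] w0[OF k]]) simp
      finally show ?thesis using wp by simp
    qed
  qed
  have \<kappa>le: "cmod (\<kappa> i t) \<le> 1" if i: "i < n" for i t
  proof -
    have "cmod (\<kappa> i t) powr p \<le> (\<Sum>i<n. cmod (\<kappa> i t) powr p)" using i by (intro member_le_sum) simp_all
    also have "\<dots> \<le> 1 powr p" using \<kappa>1[of t] by simp
    finally show ?thesis by (rule powr_le_cancel_base[OF norm_ge_zero zero_le_one])
  qed
  have "cmod (G i (N i) - N i (\<kappa> i)) \<le> e" if i: "i < n" for i
  proof -
    have dk: "d i t = k i" if "t \<in> E k" for k t using that i by (auto simp: E_def \<tau>_def)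
    have split: "of_real (d i t) * \<mu> t = (\<Sum>k\<in>R. of_real (k i) * (indicator (E k) t * \<mu> t))" for \<mu> :: "'g \<Rightarrow> complex" and t
    proof -
      have "(\<Sum>k\<in>R. of_real (k i) * (indicator (E k) t * \<mu> t)) = (\<Sum>k\<in>R. if k = \<tau> t then of_real (k i) * \<mu> t else 0)"
        by (intro sum.cong refl) (simp add: E_def indicator_def)
      also have "\<dots> = of_real (\<tau> t i) * \<mu> t" using fR by (simp add: R_def)
      finally show ?thesis using i by (simp add: \<tau>_def)
    qed
    \<comment> \<open>This is the density \<open>d i\<close> times \<open>Nu\<close>, written as a
      finite combination of the \<open>y k\<close>, so that linearity computes \<open>G i F\<close>
      explicitly.\<close>
    define F where "F \<mu> = (\<Sum>k\<in>R. of_real (k i) * y k \<mu>)" for \<mu>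
    have FNu: "Nu (\<lambda>t. of_real (d i t) * \<mu> t) = F \<mu>" if "bdd_borel \<mu>" for \<mu>
      unfolding split F_def y_def
      by (subst lin_sum[OF Nu_lin fR]) (intro bdd_borel_scale kE that sum.cong refl lin_scale[OF Nu_lin]; assumption)+
    have GF: "blin (\<Sum>k\<in>T. \<bar>k i\<bar> * w k) (\<lambda>\<mu>. \<Sum>k\<in>T. of_real (k i) * y k \<mu>) \<and>
        G i (\<lambda>\<mu>. \<Sum>k\<in>T. of_real (k i) * y k \<mu>) = (\<Sum>k\<in>T. of_real (k i) * G i (y k))" if "finite T" "T \<subseteq> R" for T
      using that
    proof (induction T rule: finite_induct)
      case empty
      have b0: "blin 0 (\<lambda>\<mu>. 0)" by (simp add: blin_def lin_def)
      then show ?case using G1[OF i b0] by simp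
    next
      case (insert k T)
      let ?S = "\<lambda>\<mu>. \<Sum>k\<in>T. of_real (k i) * y k \<mu>"
      have IH: "blin (\<Sum>k\<in>T. \<bar>k i\<bar> * w k) ?S" "G i ?S = (\<Sum>k\<in>T. of_real (k i) * G i (y k))" and k: "k \<in> R"
        using insert by simp_all
      have s0: "0 \<le> (\<Sum>k\<in>T. \<bar>k i\<bar> * w k)" using insert.prems by (intro sum_nonneg mult_nonneg_nonneg w0) auto
      have eq: "(\<lambda>\<mu>. \<Sum>k\<in>insert k T. of_real (k i) * y k \<mu>) = (\<lambda>\<mu>. of_real (k i) * y k \<mu> + ?S \<mu>)"
        using insert.hyps by simp
      have "lin (\<lambda>\<mu>. of_real (k i) * y k \<mu> + ?S \<mu>)"
        using y[OF k] IH(1) unfolding blin_def lin_def by (simp add: algebra_simps)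
      moreover have "cmod (of_real (k i) * y k \<mu> + ?S \<mu>) \<le> \<bar>k i\<bar> * w k + (\<Sum>k\<in>T. \<bar>k i\<bar> * w k)"
        if m: "bdd_borel \<mu>" "\<forall>t. cmod (\<mu> t) \<le> 1" for \<mu>
      proof (rule norm_triangle_mono)
        show "cmod (of_real (k i) * y k \<mu>) \<le> \<bar>k i\<bar> * w k"
          unfolding norm_mult norm_of_real by (intro mult_left_mono blinD[OF y[OF k] m(1)] m(2)[rule_format]) simp
        show "cmod (?S \<mu>) \<le> (\<Sum>k\<in>T. \<bar>k i\<bar> * w k)" by (rule blinD[OF IH(1) m(1) m(2)[rule_format]])
      qed
      ultimately have "blin (\<bar>k i\<bar> * w k + (\<Sum>k\<in>T. \<bar>k i\<bar> * w k)) (\<lambda>\<mu>. of_real (k i) * y k \<mu> + ?S \<mu>)"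
        unfolding blin_def by blast
      moreover have "G i (\<lambda>\<mu>. of_real (k i) * y k \<mu> + ?S \<mu>) = of_real (k i) * G i (y k) + G i ?S"
        by (rule lin[OF i y[OF k] IH(1) w0[OF k] s0])
      ultimately show ?case unfolding eq using insert.hyps IH(2) by simp
    qed
    have F: "blin (\<Sum>k\<in>R. \<bar>k i\<bar> * w k) F" "G i F = (\<Sum>k\<in>R. of_real (k i) * G i (y k))"
      using GF[OF fR order_refl] unfolding F_def[abs_def] by blast+
    have sR: "0 \<le> (\<Sum>k\<in>R. \<bar>k i\<bar> * w k)" by (intro sum_nonneg mult_nonneg_nonneg w0) auto
    \<comment> \<open>By the choice of \<open>\<kappa>\<close> one has
      \<open>F (\<kappa> i) = G i F\<close>. Replacing \<open>N i\<close> by \<open>F\<close> costs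
      \<open>e / 2\<close> under \<open>G i\<close> and another \<open>e / 2\<close> at
      \<open>\<kappa> i\<close>.\<close>
    define D where "D \<mu> = - 1 * F \<mu> + N i \<mu>" for \<mu>
    have GD: "G i D = - 1 * G i F + G i (N i)"
      unfolding D_def[abs_def] by (rule lin[OF i F(1) meanD(1)[OF N[OF i]] sR zero_le_one])
    have "blin (e / 2) D"
    proof -
      have "lin D" using F(1) meanD(2)[OF N[OF i]] unfolding blin_def lin_def D_def by (simp add: algebra_simps)
      moreover have "cmod (D \<mu>) \<le> e / 2" if m: "bdd_borel \<mu>" "\<forall>t. cmod (\<mu> t) \<le> 1" for \<mu>
        using dNc[OF i m(1) m(2)[rule_format]] unfolding FNu[OF m(1)] by (simp add: D_def norm_minus_commute)
      ultimately show ?thesis unfolding blin_def by blast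
    qed
    from G1[OF i this] have 1: "cmod (G i (N i) - G i F) \<le> e / 2" using e GD by simp
    have "F (\<kappa> i) = (\<Sum>k\<in>R. of_real (k i) * G i (y k))"
      unfolding F_def
    proof (rule sum.cong[OF refl])
      fix k assume k: "k \<in> R"
      have eq: "(\<lambda>t. indicator (E k) t * \<kappa> i t) = (\<lambda>t. (G i (y k) / of_real (w k)) * indicator (E k) t)"
        by (rule ext) (simp add: \<kappa>v E_def indicator_def)
      have "y k (\<kappa> i) = Nu (\<lambda>t. (G i (y k) / of_real (w k)) * indicator (E k) t)"
        by (simp only: y_def[of k "\<kappa> i"] eq)
      also have "\<dots> = (G i (y k) / of_real (w k)) * Nu (indicator (E k))"
        by (rule lin_scale[OF Nu_lin bdd_borel_indicator[OF Es[OF k]]])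
      also have "Nu (indicator (E k)) = of_real (w k)"
      proof -
        have "(\<lambda>t. Re (indicator (E k) t)) = indicator (E k)" "(\<lambda>t. Im (indicator (E k) t)) = (\<lambda>t. 0 * 1)"
          by (auto simp: indicator_def)
        then show ?thesis
          unfolding Nu_complex[OF bdd_borel_indicator[OF Es[OF k]]] w_def
          using pos_functional_scale[OF \<nu> rbdd_borel_const[of 1], of 0] by (simp add: complex_eq_iff)
      qed
      also have "(G i (y k) / of_real (w k)) * of_real (w k) = G i (y k)"
        using G1[OF i y[OF k] w0[OF k]] by (cases "w k = 0") simp_all
      finally show "of_real (k i) * y k (\<kappa> i) = of_real (k i) * G i (y k)" by simp
    qed
    then have "cmod (G i F - N i (\<kappa> i)) \<le> e / 2"
      using dNc[OF i \<kappa>b \<kappa>le[OF i]] unfolding FNu[OF \<kappa>b] F(2) by simp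
    moreover have "cmod (G i (N i) - N i (\<kappa> i)) \<le> cmod (G i (N i) - G i F) + cmod (G i F - N i (\<kappa> i))"
      using norm_triangle_ineq[of "G i (N i) - G i F" "G i F - N i (\<kappa> i)"] by simp
    ultimately show ?thesis using 1 by linarith
  qed
  then show ?thesis using \<kappa>b \<kappa>1 by blast
qed simp

end

section \<open>Means on the space of integrable functions\<close>

lemma complex_space_sel [simp]:
  "vcar complex_space = UNIV" "vzero complex_space = 0" "vadd complex_space = (+)"
  "vscale complex_space = (*)" "vnorm complex_space = cmod"
  by (simp_all add: complex_space_def)

lemma complex_space_normed: "complex_normed_space complex_space"
  by unfold_locales (simp_all add: algebra_simps norm_triangle_ineq norm_mult)

lemma dual_normed: "complex_normed_space V \<Longrightarrow> complex_normed_space (dual V)"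
  unfolding dual_def by (intro op_space_normed complex_space_normed)

lemma dualD:
  assumes "f \<in> vcar (dual V)"
  shows "x \<in> vcar V \<Longrightarrow> y \<in> vcar V \<Longrightarrow> f (vadd V x y) = f x + f y"
    "x \<in> vcar V \<Longrightarrow> f (vscale V c x) = c * f x"
    "f \<in> extensional (vcar V)"
  using assms bounded_opD[of V complex_space f] by (simp_all add: dual_def op_space_sel)

lemma dual_bound:
  assumes "complex_normed_space V" "f \<in> vcar (dual V)" "x \<in> vcar V"
  shows "cmod (f x) \<le> vnorm (dual V) f * vnorm V x"
  using op_norm_ge[OF assms(1) complex_space_normed _ assms(3), of f] assms(2) by (simp add: dual_def op_space_sel)

lemma dual_zero: assumes "complex_normed_space V" "f \<in> vcar (dual V)" shows "f (vzero V) = 0"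
proof -
  interpret V: complex_normed_space V by fact
  show ?thesis using dualD(2)[OF assms(2) V.zero_closed, of 0] by (simp add: V.scale_vzero)
qed

lemma dualI:
  assumes V: "complex_normed_space V" and K: "0 \<le> K"
    and add: "\<And>x y. x \<in> vcar V \<Longrightarrow> y \<in> vcar V \<Longrightarrow> f (vadd V x y) = f x + f y"
    and scale: "\<And>x c. x \<in> vcar V \<Longrightarrow> f (vscale V c x) = c * f x"
    and bound: "\<And>x. x \<in> vcar V \<Longrightarrow> cmod (f x) \<le> K * vnorm V x"
  shows "restrict f (vcar V) \<in> vcar (dual V)" "vnorm (dual V) (restrict f (vcar V)) \<le> K"
proof -
  have "bounded_op V complex_space f" unfolding bounded_op_def
    by (intro conjI ballI allI exI[of _ K]) (simp_all add: add scale bound)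
  then show "restrict f (vcar V) \<in> vcar (dual V)"
    by (simp add: dual_def op_space_sel bounded_op_restrict[OF V])
  show "vnorm (dual V) (restrict f (vcar V)) \<le> K"
    unfolding dual_def by (rule op_norm_le[OF V K]) (simp add: bound)
qed

lemma dual_vadd: "x \<in> vcar V \<Longrightarrow> vadd (dual V) f g x = f x + g x"
  and dual_vscale: "x \<in> vcar V \<Longrightarrow> vscale (dual V) c f x = c * f x"
  by (simp_all add: dual_def op_space_sel)

text \<open>Evaluation at a point of the unit ball of \<open>X\<close> belongs to the unit ball of \<open>X''\<close>.\<close>

lemma weak_summing_norm_dual:
  assumes X: "complex_normed_space X" and p: "1 < (p::real)"
    and \<Theta>: "\<And>i. i < n \<Longrightarrow> \<Theta> i \<in> vcar (dual X)" and le: "weak_summing_norm (dual X) p n \<Theta> \<le> 1"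
    and x: "x \<in> vcar X" "vnorm X x \<le> B" and B: "0 \<le> B"
  shows "(\<Sum>i<n. cmod (\<Theta> i x) powr p) \<le> B powr p"
proof -
  interpret X: complex_normed_space X by fact
  have dX: "complex_normed_space (dual X)" by (rule dual_normed[OF X])
  interpret D: complex_normed_space "dual X" by (rule dX)
  have unit: "(\<Sum>i<n. cmod (\<Theta> i z) powr p) \<le> 1" if z: "z \<in> vcar X" "vnorm X z \<le> 1" for z
  proof -
    define ev where "ev = (\<lambda>f\<in>vcar (dual X). f z)"
    have ev: "ev \<in> vcar (dual (dual X))" "vnorm (dual (dual X)) ev \<le> 1"
    proof -
      have le1: "cmod (f z) \<le> 1 * vnorm (dual X) f" if f: "f \<in> vcar (dual X)" for f
      proof -
      have "cmod (f z) \<le> vnorm (dual X) f * vnorm X z" by (rule dual_bound[OF X f z(1)])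
      also have "\<dots> \<le> vnorm (dual X) f * 1" by (rule mult_left_mono[OF z(2) D.norm_nonneg[OF f]])
      finally show ?thesis by simp
      qed
      show "ev \<in> vcar (dual (dual X))" unfolding ev_def
        by (rule dualI(1)[where K = 1, OF dX _ _ _ le1]) (simp_all add: dual_vadd dual_vscale z)
      show "vnorm (dual (dual X)) ev \<le> 1" unfolding ev_def
        by (rule dualI(2)[where K = 1, OF dX _ _ _ le1]) (simp_all add: dual_vadd dual_vscale z)
    qed
    let ?h = "\<lambda>\<phi>. (\<Sum>i<n. cmod (\<phi> (\<Theta> i)) powr p) powr (1 / p)"
    let ?S = "{\<phi> \<in> vcar (dual (dual X)). vnorm (dual (dual X)) \<phi> \<le> 1}"
    \<comment> \<open>A real supremum bounds its members only once boundedness is known; the norms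
      of the \<open>\<Theta> i\<close> provide it.\<close>
    have "bdd_above (?h ` ?S)"
    proof (rule bdd_aboveI2)
      fix \<phi> assume \<phi>: "\<phi> \<in> ?S"
      show "?h \<phi> \<le> (\<Sum>i<n. vnorm (dual X) (\<Theta> i) powr p) powr (1 / p)"
      proof (intro powr_mono2 sum_mono sum_nonneg)
        fix i assume "i \<in> {..<n}"
        then have t: "\<Theta> i \<in> vcar (dual X)" using \<Theta> by simp
        have "cmod (\<phi> (\<Theta> i)) \<le> vnorm (dual (dual X)) \<phi> * vnorm (dual X) (\<Theta> i)"
          using \<phi> by (intro dual_bound[OF dX] t) simp
        also have "\<dots> \<le> 1 * vnorm (dual X) (\<Theta> i)" using \<phi> by (intro mult_right_mono D.norm_nonneg t) simp
        finally show "cmod (\<phi> (\<Theta> i)) \<le> vnorm (dual X) (\<Theta> i)" by simp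
      qed (use p in simp_all)
    qed
    then have "?h ev \<le> weak_summing_norm (dual X) p n \<Theta>"
      unfolding weak_summing_norm_def using ev by (intro cSUP_upper) simp_all
    then have "?h ev \<le> 1" using le by simp
    moreover have "(\<Sum>i<n. cmod (ev (\<Theta> i)) powr p) = (\<Sum>i<n. cmod (\<Theta> i z) powr p)"
      using \<Theta> by (intro sum.cong) (simp_all add: ev_def)
    ultimately have "(\<Sum>i<n. cmod (\<Theta> i z) powr p) powr (1 / p) \<le> 1" by simp
    then have "((\<Sum>i<n. cmod (\<Theta> i z) powr p) powr (1 / p)) powr p \<le> 1 powr p"
      using p by (intro powr_mono2) simp_all
    then show ?thesis using p by (simp add: powr_powr sum_nonneg)
  qed
  show ?thesis
  proof (cases "B = 0")
    case True
    then have "x = vzero X" using x X.norm_nonneg[OF x(1)] X.norm_zero_iff[OF x(1)] by simp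
    then show ?thesis using dual_zero[OF X \<Theta>] by simp
  next
    case False
    then have Bp: "0 < B" using B by simp
    let ?z = "vscale X (of_real (1 / B)) x"
    have "vnorm X ?z = vnorm X x / B" using Bp by (simp add: X.norm_scale[OF x(1)] norm_divide)
    then have "(\<Sum>i<n. cmod (\<Theta> i ?z) powr p) \<le> 1"
      using x Bp by (intro unit X.scale_closed) simp_all
    moreover have "cmod (\<Theta> i ?z) powr p = cmod (\<Theta> i x) powr p / B powr p" if "i < n" for i
      using Bp by (simp add: dualD(2)[OF \<Theta>[OF that] x(1)] norm_mult norm_divide powr_divide)
    ultimately have "(\<Sum>i<n. cmod (\<Theta> i x) powr p) / B powr p \<le> 1" by (simp add: sum_divide_distrib)
    then show ?thesis using Bp by (simp add: divide_le_eq)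
  qed
qed

text \<open>The set of tuples with \<open>p\<close>-th power sum at most \<open>c\<close> is closed;
  this removes the error \<open>e\<close> left by \<open>goldstine_tuple\<close>.\<close>

lemma sum_powr_limit:
  fixes a :: "nat \<Rightarrow> complex"
  assumes p: "0 < (p::real)"
    and ex: "\<And>e. 0 < e \<Longrightarrow> \<exists>u. (\<Sum>i<n. cmod (u i) powr p) \<le> c \<and> (\<forall>i<n. cmod (a i - u i) \<le> e)"
  shows "(\<Sum>i<n. cmod (a i) powr p) \<le> c"
proof -
  have "\<forall>k. \<exists>u. (\<Sum>i<n. cmod (u i) powr p) \<le> c \<and> (\<forall>i<n. cmod (a i - u i) \<le> inverse (real (Suc k)))"
    by (intro allI ex) simp
  from choice[OF this] obtain u where u0: "\<forall>k. (\<Sum>i<n. cmod (u k i) powr p) \<le> c \<and> (\<forall>i<n. cmod (a i - u k i) \<le> inverse (real (Suc k)))"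
    by (elim exE)
  have u: "(\<lambda>k. u k i) \<longlonglongrightarrow> a i" if i: "i < n" for i
  proof -
    have "(\<lambda>k. a i - u k i) \<longlonglongrightarrow> 0"
    proof (rule tendsto_norm_zero_cancel, rule real_tendsto_sandwich[OF _ _ tendsto_const LIMSEQ_inverse_real_of_nat])
      show "\<forall>\<^sub>F k in sequentially. norm (a i - u k i) \<le> inverse (real (Suc k))"
        using u0 i by (intro always_eventually) blast
    qed simp
    from tendsto_diff[OF tendsto_const[of "a i"] this] show ?thesis by simp
  qed
  have "(\<lambda>k. \<Sum>i<n. cmod (u k i) powr p) \<longlonglongrightarrow> (\<Sum>i<n. cmod (a i) powr p)"
  proof (rule tendsto_sum)
    fix i assume "i \<in> {..<n}"
    then have "(\<lambda>k. cmod (u k i)) \<longlonglongrightarrow> cmod (a i)" by (intro tendsto_norm u) simp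
    then show "(\<lambda>k. cmod (u k i) powr p) \<longlonglongrightarrow> cmod (a i) powr p"
      using p by (intro tendsto_powr') (auto intro: always_eventually)
  qed
  then show ?thesis by (rule LIMSEQ_le_const2) (use u0 in blast)
qed

context lp_module begin

section \<open>Translation on \<open>L1\<close> and continuity of orbits\<close>

lemma nL1: "complex_normed_space L1"
  using nA unfolding complex_normed_space_def A_sel .

lemma translate_mem: "X \<in> vcar L1 \<Longrightarrow> L1_translate m s X \<in> vcar L1"
  unfolding L1_translate_def by (intro l1_mem integrable_translate l1_memD)

lemma translate_add:
  assumes "X \<in> vcar L1" "Y \<in> vcar L1"
  shows "L1_translate m s (vadd L1 X Y) = vadd L1 (L1_translate m s X) (L1_translate m s Y)"
  unfolding L1_add[OF assms] translate_class[OF L1_add_rep[OF assms]]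
  using lp_add[OF translate_mem[OF assms(1), unfolded L1_translate_def] translate_mem[OF assms(2), unfolded L1_translate_def], of 1]
  by (simp add: L1_translate_def)

lemma translate_scale:
  assumes "X \<in> vcar L1" shows "L1_translate m s (vscale L1 c X) = vscale L1 c (L1_translate m s X)"
  unfolding L1_scale[of 1 c X] translate_class[OF L1_scale_rep[OF assms]]
  using lp_scale[OF translate_mem[OF assms, unfolded L1_translate_def], of 1 c]
  by (simp add: L1_translate_def)

lemma translate_norm:
  assumes "X \<in> vcar L1" shows "vnorm L1 (L1_translate m s X) = vnorm L1 X"
proof -
  have [measurable]: "rep X \<in> borel_measurable borel" by (rule lp_memD(1)[OF assms])
  have "vnorm L1 (L1_translate m s X) = (\<integral>t. cmod (rep X (- s + t)) \<partial>m)"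
    unfolding L1_translate_def by (intro l1_norm integrable_translate l1_memD assms)
  also have "\<dots> = (\<integral>t. cmod (rep X t) \<partial>m)" by (rule integral_left[of "\<lambda>t. cmod (rep X t)"]) measurable
  finally show ?thesis by (simp add: l1_norm_rep)
qed

definition unif_class :: "'g set \<Rightarrow> 'g \<Rightarrow> ('g \<Rightarrow> complex) set" where
  "unif_class D t = ae_class m (\<lambda>x. of_real (indicator ((\<lambda>u. t + u) ` D) x / measure m D))"

text \<open>Outer regularity gives an open \<open>Q\<close> around \<open>t0 + D\<close> of measure
  below \<open>measure m D + d\<close>, and by \<open>tube\<close> it contains \<open>t + D\<close>
  for all \<open>t\<close> near \<open>t0\<close>. The two normalized indicators then differ in
  \<open>L1\<close> by at most twice the excess of \<open>Q\<close> over \<open>D\<close>, divided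
  by \<open>measure m D\<close>.\<close>

lemma orbit_continuous:
  assumes D: "compact D" "0 < measure m D" and f: "f \<in> vcar (dual L1)"
  shows "continuous_on UNIV (\<lambda>t. f (unif_class D t))"
proof -
  have Ds: "D \<in> sets borel" "emeasure m D < \<infinity>" using D compact_finite by (simp_all add: compact_sets)
  have tD: "(\<lambda>u. t + u) ` D \<in> sets borel" "emeasure m ((\<lambda>u. t + u) ` D) = emeasure m D" for t
    using Ds by (simp_all add: left_image_sets emeasure_translate)
  have ti: "integrable m (\<lambda>x. indicator ((\<lambda>u. t + u) ` D) x :: real)" for t using tD Ds by simp
  have ci: "integrable m (\<lambda>x. complex_of_real (indicator ((\<lambda>u. t + u) ` D) x / measure m D))" for t
    by (intro integrable_of_real integrable_divide_zero ti)
  have mem: "unif_class D t \<in> vcar L1" for t unfolding unif_class_def by (rule l1_mem[OF ci])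
  define B where "B = vnorm (dual L1) f"
  have B: "0 \<le> B" unfolding B_def by (rule complex_normed_space.norm_nonneg[OF dual_normed[OF nL1] f])
  show ?thesis
    unfolding continuous_on_topological
  proof (intro ballI allI impI)
    fix t0 and P :: "complex set" assume P: "open P" "f (unif_class D t0) \<in> P"
    then obtain e where e: "e > 0" "ball (f (unif_class D t0)) e \<subseteq> P" using openE by blast
    define d where "d = e * measure m D / (2 * (B + 1))"
    have d: "0 < d" using e D B by (simp add: d_def)
    have "emeasure m ((\<lambda>u. t0 + u) ` D) < emeasure m D + ennreal d"
      unfolding tD using Ds d by (simp add: ennreal_add_left_cancel_less less_top[symmetric])
    then obtain Q where Q: "open Q" "(\<lambda>u. t0 + u) ` D \<subseteq> Q" "emeasure m Q < emeasure m D + ennreal d"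
      by (rule outer_approx[OF tD(1)])
    have fQ: "emeasure m Q < \<infinity>" using Q(3) Ds by (metis ennreal_add_eq_top ennreal_neq_top infinity_ennreal_def less_top order_less_trans top.not_eq_extremum)
    have mQ: "measure m Q < measure m D + d"
    proof -
      have "ennreal (measure m Q) < ennreal (measure m D) + ennreal d"
        using Q(3) fQ Ds by (simp add: emeasure_eq_ennreal_measure)
      also have "\<dots> = ennreal (measure m D + d)" using d by (simp add: ennreal_plus)
      finally show ?thesis by (simp add: ennreal_less_iff)
    qed
    have Qi: "integrable m (\<lambda>x. indicator Q x :: real)" using Q(1) fQ by simp
    have "continuous_on UNIV (\<lambda>z::'g \<times> 'g. fst z + snd z)" by (intro continuous_intros)
    then have op: "open {t. \<forall>x\<in>D. t + x \<in> Q}" by (rule tube[OF D(1) Q(1)])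
    have close: "dist (f (unif_class D t0)) (f (unif_class D t)) < e" if t: "t \<in> {t. \<forall>x\<in>D. t + x \<in> Q}" for t
    proof -
      have tQ: "(\<lambda>u. t + u) ` D \<subseteq> Q" using t by blast
      let ?g = "\<lambda>t x. complex_of_real (indicator ((\<lambda>u. t + u) ` D) x / measure m D)"
      have sm: "vscale L1 (- 1) (unif_class D t) = ae_class m (\<lambda>x. - 1 * ?g t x)"
        unfolding unif_class_def by (rule lp_scale[OF mem[unfolded unif_class_def]])
      have smem: "vscale L1 (- 1) (unif_class D t) \<in> vcar L1"
        by (rule complex_normed_space.scale_closed[OF nL1 mem])
      have di: "integrable m (\<lambda>x. ?g t0 x + - 1 * ?g t x)"
        by (intro Bochner_Integration.integrable_add integrable_mult_right ci)
      have diff: "vadd L1 (unif_class D t0) (vscale L1 (- 1) (unif_class D t)) = ae_class m (\<lambda>x. ?g t0 x + - 1 * ?g t x)"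
        unfolding sm unfolding unif_class_def by (rule lp_add[OF mem[unfolded unif_class_def] smem[unfolded sm]])
      have "f (unif_class D t0) - f (unif_class D t) = f (vadd L1 (unif_class D t0) (vscale L1 (- 1) (unif_class D t)))"
        by (simp add: dualD(1)[OF f mem smem] dualD(2)[OF f mem])
      also have "cmod \<dots> \<le> B * vnorm L1 (ae_class m (\<lambda>x. ?g t0 x + - 1 * ?g t x))"
        unfolding diff B_def by (intro dual_bound nL1 f l1_mem di)
      also have "vnorm L1 (ae_class m (\<lambda>x. ?g t0 x + - 1 * ?g t x)) = (\<integral>x. cmod (?g t0 x + - 1 * ?g t x) \<partial>m)"
        by (rule l1_norm[OF di])
      also have "\<dots> \<le> (\<integral>x. ((indicator Q x - indicator ((\<lambda>u. t0 + u) ` D) x)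
          + (indicator Q x - indicator ((\<lambda>u. t + u) ` D) x)) / measure m D \<partial>m)"
      proof (rule integral_mono)
        show "integrable m (\<lambda>x. cmod (?g t0 x + - 1 * ?g t x))" by (rule integrable_norm[OF di])
        show "integrable m (\<lambda>x. ((indicator Q x - indicator ((\<lambda>u. t0 + u) ` D) x)
          + (indicator Q x - indicator ((\<lambda>u. t + u) ` D) x)) / measure m D)"
          by (intro integrable_divide_zero Bochner_Integration.integrable_add Bochner_Integration.integrable_diff Qi ti)
        fix x
        let ?a = "indicator ((\<lambda>u. t0 + u) ` D) x :: real" and ?b = "indicator ((\<lambda>u. t + u) ` D) x :: real"
          and ?q = "indicator Q x :: real"
        have le: "\<bar>?a - ?b\<bar> \<le> (?q - ?a) + (?q - ?b)"
          using Q(2) tQ by (auto simp: indicator_def)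
        have "?g t0 x + - 1 * ?g t x = of_real ((?a - ?b) / measure m D)" by (simp add: diff_divide_distrib)
        then have "cmod (?g t0 x + - 1 * ?g t x) = \<bar>?a - ?b\<bar> / measure m D"
          using D(2) by (simp only: norm_of_real) simp
        then show "cmod (?g t0 x + - 1 * ?g t x) \<le> ((?q - ?a) + (?q - ?b)) / measure m D"
          using divide_right_mono[OF le, of "measure m D"] by simp
      qed
      also have "\<dots> = 2 * (measure m Q - measure m D) / measure m D"
      proof -
        have mt: "measure m ((\<lambda>u. s + u) ` D) = measure m D" for s using tD(2) by (simp add: measure_def)
        show ?thesis using Qi ti by (simp add: mt)
      qed
      also have "B * \<dots> \<le> B * (2 * d / measure m D)"
        using mQ D B by (intro mult_left_mono divide_right_mono) simp_all
      also have "\<dots> = e * (B / (B + 1))"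
      proof -
        have "2 * d / measure m D = e / (B + 1)" using D(2) B by (simp add: d_def divide_simps)
        then show ?thesis by simp
      qed
      also have "\<dots> < e" using e B by (simp add: field_simps)
      finally show ?thesis by (simp add: dist_norm mult_left_mono B)
    qed
    show "\<exists>A. open A \<and> t0 \<in> A \<and> (\<forall>t\<in>UNIV. t \<in> A \<longrightarrow> f (unif_class D t) \<in> P)"
      using op Q(2) close e(2) by (intro exI[of _ "{t. \<forall>x\<in>D. t + x \<in> Q}"]) auto
  qed
qed

section \<open>Transfer of means to the bidual of \<open>L1\<close>\<close>

lemma exists_compact_nbhd:
  obtains D where "compact D" "0 < measure m D"
proof -
  obtain N D where N: "open N" "compact D" "(0::'g) \<in> N" "N \<subseteq> D" by (rule compact_nbhd[of 0])
  have "0 < emeasure m N" by (rule open_pos[OF N(1,3)])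
  also have "\<dots> \<le> emeasure m D" using N by (intro emeasure_mono) (simp_all add: compact_sets)
  finally have "0 < measure m D"
    using compact_finite[OF N(2)] by (simp add: measure_def enn2real_positive_iff)
  with N(2) show ?thesis by (rule that)
qed

text \<open>The argument is reflected because left translation by \<open>s\<close> sends the class
  at \<open>- t\<close> to the class at \<open>s - t = - (t - s)\<close>. Translation of functionals
  on \<open>L1\<close> thereby becomes the shift \<open>\<kappa> (t - s)\<close> that
  \<open>multi\<close> controls.\<close>

definition orbit_fun :: "'g set \<Rightarrow> (('g \<Rightarrow> complex) set \<Rightarrow> complex) \<Rightarrow> 'g \<Rightarrow> complex" where
  "orbit_fun D \<phi> t = \<phi> (unif_class D (- t))"

definition pullback :: "'g set \<Rightarrow> (('g \<Rightarrow> complex) \<Rightarrow> complex) \<Rightarrow> ((('g \<Rightarrow> complex) set \<Rightarrow> complex) \<Rightarrow> complex)" where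
  "pullback D F = (\<lambda>\<phi>\<in>vcar (dual L1). F (orbit_fun D \<phi>))"

context
  fixes D :: "'g set"
  assumes D: "compact D" "0 < measure m D"
begin

lemma unif_class_integrable: "integrable m (\<lambda>x. complex_of_real (indicator ((\<lambda>u. t + u) ` D) x / measure m D))"
  using compact_finite[OF D(1)] compact_sets[OF D(1)]
  by (intro integrable_of_real integrable_divide_zero) (simp add: left_image_sets emeasure_translate)

lemma unif_class_mem: "unif_class D t \<in> vcar L1"
  unfolding unif_class_def by (rule l1_mem[OF unif_class_integrable])

lemma unif_class_integral: "(\<integral>x. complex_of_real (indicator ((\<lambda>u. t + u) ` D) x / measure m D) \<partial>m) = 1"
  "(\<integral>x. cmod (complex_of_real (indicator ((\<lambda>u. t + u) ` D) x / measure m D)) \<partial>m) = 1"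
proof -
  have mt: "measure m ((\<lambda>u. t + u) ` D) = measure m D"
    using compact_sets[OF D(1)] by (simp add: measure_def emeasure_translate)
  have s: "(\<lambda>u. t + u) ` D \<in> sets borel" by (rule left_image_sets[OF compact_sets[OF D(1)]])
  have r: "(\<integral>x. indicator ((\<lambda>u. t + u) ` D) x / measure m D \<partial>m) = 1"
    using D(2) s by (simp add: mt)
  show "(\<integral>x. complex_of_real (indicator ((\<lambda>u. t + u) ` D) x / measure m D) \<partial>m) = 1"
    unfolding integral_complex_of_real r by simp
  have "(\<lambda>x. cmod (complex_of_real (indicator ((\<lambda>u. t + u) ` D) x / measure m D)))
      = (\<lambda>x. indicator ((\<lambda>u. t + u) ` D) x / measure m D)"
    unfolding norm_of_real by simp
  then show "(\<integral>x. cmod (complex_of_real (indicator ((\<lambda>u. t + u) ` D) x / measure m D)) \<partial>m) = 1"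
    using r by (simp only:)
qed

lemma unif_class_norm: "vnorm L1 (unif_class D t) = 1"
  unfolding unif_class_def l1_norm[OF unif_class_integrable] by (rule unif_class_integral)

lemma unif_class_translate: "L1_translate m s (unif_class D t) = unif_class D (s + t)"
proof -
  have "L1_translate m s (unif_class D t) = ae_class m (\<lambda>x. complex_of_real (indicator ((\<lambda>u. t + u) ` D) (- s + x) / measure m D))"
    unfolding unif_class_def by (rule translate_class[OF lp_rep[OF unif_class_mem[unfolded unif_class_def]]])
  also have "(\<lambda>x. complex_of_real (indicator ((\<lambda>u. t + u) ` D) (- s + x) / measure m D))
      = (\<lambda>x. complex_of_real (indicator ((\<lambda>u. s + t + u) ` D) x / measure m D))"
    unfolding left_image by (simp add: indicator_def minus_add diff_conv_add_uminus add.assoc del: add_uminus_conv_diff)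
  finally show ?thesis by (simp only: unif_class_def)
qed

lemma orbit_fun_le:
  assumes f: "f \<in> vcar (dual L1)" shows "cmod (orbit_fun D f t) \<le> vnorm (dual L1) f"
  using dual_bound[OF nL1 f unif_class_mem[of "- t"]] by (simp add: orbit_fun_def unif_class_norm)

lemma orbit_fun_bdd_borel:
  assumes f: "f \<in> vcar (dual L1)" shows "bdd_borel (orbit_fun D f)"
proof -
  have "(\<lambda>t. f (unif_class D t)) \<in> borel_measurable borel"
    by (rule borel_measurable_continuous_onI[OF orbit_continuous[OF D f]])
  from measurable_compose[OF measurable_uminus this] have "orbit_fun D f \<in> borel_measurable borel"
    unfolding orbit_fun_def[abs_def] .
  then show ?thesis unfolding bdd_borel_def using orbit_fun_le[OF f] by blast
qed

lemma orbit_fun_add: "orbit_fun D (vadd (dual L1) f g) = (\<lambda>t. orbit_fun D f t + orbit_fun D g t)"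
  by (rule ext) (simp add: orbit_fun_def dual_vadd unif_class_mem)

lemma orbit_fun_scale: "orbit_fun D (vscale (dual L1) c f) = (\<lambda>t. c * orbit_fun D f t)"
  by (rule ext) (simp add: orbit_fun_def dual_vscale unif_class_mem)

lemma nDL1: "complex_normed_space (dual L1)" by (rule dual_normed[OF nL1])

lemma pullback_mem:
  assumes F: "blin B F" "0 \<le> B"
  shows "pullback D F \<in> vcar (L1_bidual m)" "vnorm (L1_bidual m) (pullback D F) \<le> B"
proof -
  have lF: "lin F" using F(1) by (simp add: blin_def)
  have add: "F (orbit_fun D (vadd (dual L1) f g)) = F (orbit_fun D f) + F (orbit_fun D g)"
    if "f \<in> vcar (dual L1)" "g \<in> vcar (dual L1)" for f g
    unfolding orbit_fun_add by (rule lin_add[OF lF orbit_fun_bdd_borel[OF that(1)] orbit_fun_bdd_borel[OF that(2)]])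
  have scale: "F (orbit_fun D (vscale (dual L1) c f)) = c * F (orbit_fun D f)" if "f \<in> vcar (dual L1)" for f c
    unfolding orbit_fun_scale by (rule lin_scale[OF lF orbit_fun_bdd_borel[OF that]])
  have bound: "cmod (F (orbit_fun D f)) \<le> B * vnorm (dual L1) f" if f: "f \<in> vcar (dual L1)" for f
    by (rule blin_bound[OF F(1) orbit_fun_bdd_borel[OF f] orbit_fun_le[OF f] complex_normed_space.norm_nonneg[OF nDL1 f] F(2)])
  show "pullback D F \<in> vcar (L1_bidual m)" "vnorm (L1_bidual m) (pullback D F) \<le> B"
    unfolding pullback_def L1_bidual_def by (rule dualI[OF nDL1 F(2) add scale bound]; assumption)+
qed

lemma pullback_cong:
  assumes "\<And>\<kappa>. bdd_borel \<kappa> \<Longrightarrow> F \<kappa> = F' \<kappa>" shows "pullback D F = pullback D F'"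
  unfolding pullback_def by (rule restrict_ext) (rule assms[OF orbit_fun_bdd_borel])

lemma pullback_lin:
  "pullback D (\<lambda>\<kappa>. c * F \<kappa> + F' \<kappa>) = vadd (L1_bidual m) (vscale (L1_bidual m) c (pullback D F)) (pullback D F')"
  unfolding pullback_def L1_bidual_def by (auto simp: dual_def op_space_sel restrict_def)

text \<open>The normalized indicators have integral 1, so the functional of the constant function 1
  has constant orbit function 1. Its norm is at most 1, which bounds the norm of the mean from
  below; \<open>pullback_mem\<close> bounds it from above.\<close>

lemma pullback_mean:
  assumes N: "mean N" shows "is_mean m (pullback D N)"
proof -
  let ?one = "Linf_functional m (\<lambda>t. 1)"
  have one: "?one \<in> vcar (dual L1)" "vnorm (dual L1) ?one \<le> 1"
  proof -
    have eq: "?one = (\<lambda>X\<in>vcar L1. \<integral>t. rep X t \<partial>m)" by (simp add: Linf_functional_def)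
    have add: "(\<integral>t. rep (vadd L1 X Y) t \<partial>m) = (\<integral>t. rep X t \<partial>m) + (\<integral>t. rep Y t \<partial>m)"
      if X: "X \<in> vcar L1" and Y: "Y \<in> vcar L1" for X Y
    proof -
      have "(\<integral>t. rep (vadd L1 X Y) t \<partial>m) = (\<integral>t. rep X t + rep Y t \<partial>m)"
        unfolding L1_add[OF X Y] using lp_memD(1)[OF X] lp_memD(1)[OF Y]
        by (intro integral_cong_AE L1_add_rep X Y) (simp_all add: rep_ae_class(2))
      then show ?thesis using l1_memD[OF X] l1_memD[OF Y] by simp
    qed
    have scale: "(\<integral>t. rep (vscale L1 c X) t \<partial>m) = c * (\<integral>t. rep X t \<partial>m)" if X: "X \<in> vcar L1" for X c
    proof -
      have "(\<integral>t. rep (vscale L1 c X) t \<partial>m) = (\<integral>t. c * rep X t \<partial>m)"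
        unfolding L1_scale using lp_memD(1)[OF X]
        by (intro integral_cong_AE L1_scale_rep X) (simp_all add: rep_ae_class(2))
      then show ?thesis by simp
    qed
    have bound: "cmod (\<integral>t. rep X t \<partial>m) \<le> 1 * vnorm L1 X" if "X \<in> vcar L1" for X
      unfolding l1_norm_rep using integral_norm_bound[of m "rep X"] by simp
    show "?one \<in> vcar (dual L1)" "vnorm (dual L1) ?one \<le> 1"
      unfolding eq by (rule dualI[OF nL1 zero_le_one add scale bound]; assumption)+
  qed
  have "orbit_fun D ?one = (\<lambda>t. 1)"
  proof
    fix t
    have "orbit_fun D ?one t = (\<integral>x. rep (unif_class D (- t)) x \<partial>m)" using unif_class_mem by (simp add: orbit_fun_def Linf_functional_def)
    also have "\<dots> = (\<integral>x. complex_of_real (indicator ((\<lambda>u. - t + u) ` D) x / measure m D) \<partial>m)"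
      using lp_memD(1)[OF unif_class_mem] borel_measurable_integrable[OF unif_class_integrable]
      unfolding unif_class_def by (intro integral_cong_AE lp_rep[OF unif_class_mem[unfolded unif_class_def]]) simp_all
    finally show "orbit_fun D ?one t = 1" by (simp only: unif_class_integral)
  qed
  then have val: "pullback D N ?one = 1" using one(1) meanD(3)[OF N] by (simp add: pullback_def)
  note mem = pullback_mem[OF meanD(1)[OF N] zero_le_one]
  have "1 = cmod (pullback D N ?one)" by (simp add: val)
  also have "\<dots> \<le> vnorm (L1_bidual m) (pullback D N) * vnorm (dual L1) ?one"
    using mem(1) one(1) unfolding L1_bidual_def by (intro dual_bound nDL1)
  also have "\<dots> \<le> vnorm (L1_bidual m) (pullback D N) * 1"
    by (rule mult_left_mono[OF one(2) complex_normed_space.norm_nonneg[OF _ mem(1)]])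
      (simp add: L1_bidual_def dual_normed nDL1)
  finally show ?thesis using mem val by (simp add: is_mean_def)
qed

lemma pullback_translate:
  assumes N: "mean N" shows "bidual_translate m s (pullback D N) = pullback D (\<lambda>\<kappa>. N (\<lambda>t. \<kappa> (t - s)))"
proof -
  have mem: "pullback D N \<in> vcar (dual (dual L1))"
    using pullback_mem(1)[OF meanD(1)[OF N] zero_le_one] by (simp add: L1_bidual_def)
  have "bidual_translate m s (pullback D N) = (\<lambda>f\<in>vcar (dual L1). pullback D N (\<lambda>X\<in>vcar L1. f (L1_translate m s X)))"
    using mem by (simp add: bidual_translate_def adjoint_op_def cong: restrict_cong)
  also have "\<dots> = pullback D (\<lambda>\<kappa>. N (\<lambda>t. \<kappa> (t - s)))"
    unfolding pullback_def[of D "\<lambda>\<kappa>. N (\<lambda>t. \<kappa> (t - s))"]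
  proof (rule restrict_ext)
    fix f assume f: "f \<in> vcar (dual L1)"
    let ?f = "\<lambda>X\<in>vcar L1. f (L1_translate m s X)"
    have "?f \<in> vcar (dual L1)"
    proof (rule dualI(1)[OF nL1])
      show "0 \<le> vnorm (dual L1) f" by (rule complex_normed_space.norm_nonneg[OF nDL1 f])
      fix X assume X: "X \<in> vcar L1"
      show "f (L1_translate m s (vscale L1 c X)) = c * f (L1_translate m s X)" for c
        unfolding translate_scale[OF X] by (rule dualD(2)[OF f translate_mem[OF X]])
      show "cmod (f (L1_translate m s X)) \<le> vnorm (dual L1) f * vnorm L1 X"
        using dual_bound[OF nL1 f translate_mem[OF X]] by (simp add: translate_norm[OF X])
      fix Y assume Y: "Y \<in> vcar L1"
      show "f (L1_translate m s (vadd L1 X Y)) = f (L1_translate m s X) + f (L1_translate m s Y)"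
        unfolding translate_add[OF X Y] by (rule dualD(1)[OF f translate_mem[OF X] translate_mem[OF Y]])
    qed
    moreover have "orbit_fun D ?f = (\<lambda>t. orbit_fun D f (t - s))"
      by (rule ext) (simp add: orbit_fun_def unif_class_mem unif_class_translate)
    ultimately show "pullback D N ?f = N (\<lambda>t. orbit_fun D f (t - s))" by (simp add: pullback_def)
  qed
  finally show ?thesis .
qed

text \<open>The test functionals live on the bidual of \<open>L1\<close> and need not come from
  functions. Composed with \<open>pullback\<close> they act on functionals of bounded Borel
  functions, where \<open>goldstine_tuple\<close> replaces them by functions up to \<open>e\<close>;
  \<open>multi_tuple\<close> then applies, and \<open>sum_powr_limit\<close> lets \<open>e\<close>
  tend to 0, so the constant \<open>C\<close> survives unchanged.\<close>

lemma pullback_multi_norm: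
  assumes N: "mean N" and C: "0 \<le> C" "\<And>S. finite S \<Longrightarrow> multi C S N"
  shows "pq_multi_norm (L1_bidual m) p p n (\<lambda>i. bidual_translate m (s i) (pullback D N)) \<le> C"
  unfolding pq_multi_norm_def
proof (rule cSUP_least)
  let ?X = "L1_bidual m"
  have nX: "complex_normed_space ?X" unfolding L1_bidual_def by (rule dual_normed[OF nDL1])
  have nX': "complex_normed_space (dual ?X)" and nX'': "complex_normed_space (dual (dual ?X))"
    by (intro dual_normed nX)+
  \<comment> \<open>A real supremum can be estimated only over a nonempty set; the zero tuple is an
    admissible test tuple.\<close>
  have "weak_summing_norm (dual ?X) p n (\<lambda>_. vzero (dual ?X)) \<le> 1"
    unfolding weak_summing_norm_def
  proof (rule cSUP_least)
    have "vzero (dual (dual ?X)) \<in> {\<phi> \<in> vcar (dual (dual ?X)). vnorm (dual (dual ?X)) \<phi> \<le> 1}"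
      using complex_normed_space.zero_closed[OF nX''] complex_normed_space.norm_vzero[OF nX''] by simp
    then show "{\<phi> \<in> vcar (dual (dual ?X)). vnorm (dual (dual ?X)) \<phi> \<le> 1} \<noteq> {}" by blast
    fix \<phi> assume "\<phi> \<in> {\<phi> \<in> vcar (dual (dual ?X)). vnorm (dual (dual ?X)) \<phi> \<le> 1}"
    then have "\<phi> (vzero (dual ?X)) = 0" using dual_zero[OF nX'] by blast
    then show "(\<Sum>i<n. cmod (\<phi> (vzero (dual ?X))) powr p) powr (1 / p) \<le> 1"
      using p by simp
  qed
  then have "(\<lambda>_. vzero (dual ?X)) \<in> {\<phi>. (\<forall>i<n. \<phi> i \<in> vcar (dual ?X)) \<and> weak_summing_norm (dual ?X) p n \<phi> \<le> 1}"
    using complex_normed_space.zero_closed[OF nX'] by simp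
  then show "{\<phi>. (\<forall>i<n. \<phi> i \<in> vcar (dual ?X)) \<and> weak_summing_norm (dual ?X) p n \<phi> \<le> 1} \<noteq> {}" by (rule ex_in_conv[THEN iffD1, OF exI])
  fix \<Theta> assume "\<Theta> \<in> {\<phi>. (\<forall>i<n. \<phi> i \<in> vcar (dual ?X)) \<and> weak_summing_norm (dual ?X) p n \<phi> \<le> 1}"
  then have T: "(\<forall>i<n. \<Theta> i \<in> vcar (dual ?X)) \<and> weak_summing_norm (dual ?X) p n \<Theta> \<le> 1"
    by (rule CollectD)
  note \<Theta>' = T[THEN conjunct1] and \<Theta>2 = T[THEN conjunct2]
  have \<Theta>1: "\<Theta> i \<in> vcar (dual ?X)" if "i < n" for i using \<Theta>' that by (simp only:)
  define N' where "N' i = (\<lambda>\<kappa>. N (\<lambda>t. \<kappa> (t - s i)))" for i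
  \<comment> \<open>The weak summing norm of \<open>\<Theta>\<close> bounds the \<open>p\<close>-th
    power sum of the \<open>G i F\<close>, because a pullback has at most the norm of the functional
    that is pulled back.\<close>
  define G where "G i F = \<Theta> i (pullback D F)" for i F
  have "(\<Sum>i<n. cmod (G i (N' i)) powr p) \<le> C powr p"
  proof (rule sum_powr_limit)
    show "0 < p" using p by simp
    fix e :: real assume e: "0 < e"
    have "\<exists>\<kappa>. (\<forall>i<n. bdd_borel (\<kappa> i)) \<and> (\<forall>t. (\<Sum>i<n. cmod (\<kappa> i t) powr p) \<le> 1) \<and>
        (\<forall>i<n. cmod (G i (N' i) - N' i (\<kappa> i)) \<le> e)"
    proof (rule goldstine_tuple[OF _ _ _ _ e])
      show "mean (N' i)" for i unfolding N'_def by (rule mean_right[OF N])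
      show "G i F = G i F'" if "\<And>\<kappa>. bdd_borel \<kappa> \<Longrightarrow> F \<kappa> = F' \<kappa>" for i F F'
        unfolding G_def by (rule arg_cong[where f = "\<Theta> i"], rule pullback_cong[OF that])
      show "G i (\<lambda>\<kappa>. c * F \<kappa> + F' \<kappa>) = c * G i F + G i F'"
        if i: "i < n" and F: "blin B F" "blin B' F'" "0 \<le> B" "0 \<le> B'" for i F F' B B' c
        unfolding G_def pullback_lin
        using dualD(1)[OF \<Theta>1[OF i] complex_normed_space.scale_closed[OF nX pullback_mem(1)[OF F(1,3)]] pullback_mem(1)[OF F(2,4)], of c]
          dualD(2)[OF \<Theta>1[OF i] pullback_mem(1)[OF F(1,3)], of c]
        by (simp only:)
      show "(\<Sum>i<n. cmod (G i F) powr p) \<le> B powr p" if F: "blin B F" "0 \<le> B" for F B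
        unfolding G_def by (rule weak_summing_norm_dual[OF nX p \<Theta>1 \<Theta>2 pullback_mem[OF F] F(2)])
    qed
    then obtain \<kappa> where k: "\<forall>i<n. bdd_borel (\<kappa> i)" "\<forall>t. (\<Sum>i<n. cmod (\<kappa> i t) powr p) \<le> 1"
      "\<forall>i<n. cmod (G i (N' i) - N' i (\<kappa> i)) \<le> e" by blast
    have "(\<Sum>i<n. cmod (N (\<lambda>t. \<kappa> i (t - s i))) powr p) \<le> C powr p"
    proof (rule multi_tuple[OF meanD(2)[OF N] C(2)])
      show "bdd_borel (\<kappa> i)" if "i < n" for i using k(1) that by blast
      show "(\<Sum>i<n. cmod (\<kappa> i t) powr p) \<le> 1" for t using k(2) by blast
    qed
    then show "\<exists>u. (\<Sum>i<n. cmod (u i) powr p) \<le> C powr p \<and> (\<forall>i<n. cmod (G i (N' i) - u i) \<le> e)"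
      using k(3) by (intro exI[of _ "\<lambda>i. N' i (\<kappa> i)"]) (simp add: N'_def)
  qed
  moreover have "G i (N' i) = \<Theta> i (bidual_translate m (s i) (pullback D N))" for i
    unfolding G_def N'_def pullback_translate[OF N] ..
  ultimately have "(\<Sum>i<n. cmod (\<Theta> i (bidual_translate m (s i) (pullback D N))) powr p) \<le> C powr p" by simp
  then have "(\<Sum>i<n. cmod (\<Theta> i (bidual_translate m (s i) (pullback D N))) powr p) powr (1 / p) \<le> (C powr p) powr (1 / p)"
    using p by (intro powr_mono2 sum_nonneg) simp_all
  also have "\<dots> = C" using p C(1) by (simp add: powr_powr)
  finally show "(\<Sum>i<n. cmod (\<Theta> i (bidual_translate m (s i) (pullback D N))) powr p) powr (1 / p) \<le> C" .
qed

end

end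

theorem theorem5p7:
  fixes m :: "'g::{topological_group_add, t2_space} measure" and p :: real
  assumes "locally_compact_space (euclidean :: 'g topology)"
    and "left_haar_measure m"
    and "1 < p"
    and "injective_module (L1_algebra m) (Lp_module m p)"
  shows "pq_amenable m p p"
proof -
  have module: "banach_left_module (L1_algebra m) (Lp_module m p)"
    using assms(4) by (simp add: injective_module_def injective_wrt_def)
  interpret lp_module m p by (rule lp_module.intro haar.intro lp_module_axioms.intro assms(1-3) module)+
  have alg: "banach_algebra (L1_algebra m)" using module by (simp add: banach_left_module_def)
  obtain \<rho> where \<rho>: "module_morphism (L1_algebra m) (coinduced_module (L1_algebra m) (Lp_module m p)) (Lp_module m p) \<rho>"
    "\<And>x. x \<in> vcar (Lp_module m p) \<Longrightarrow>
      \<rho> (\<lambda>u\<in>vcar (unitization_space (L1_algebra m)). unit_act (Lp_module m p) u x) = x"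
    
  proof (rule coinduced_retraction[OF alg assms(4)], goal_cases)
    case (1 \<rho>)
    show ?case by (rule 1(1)[OF 1(2,3)])
  qed
  interpret injective_lp m p \<rho> by (rule injective_lp.intro lp_module_axioms injective_lp_axioms.intro \<rho>; assumption?)+
  obtain C where C: "0 \<le> C" and M: "\<And>S. finite S \<Longrightarrow> \<exists>M. lin M \<and> M (\<lambda>t. 1) = 1 \<and> multi C S M"
    unfolding lin_def multi_def conj_assoc
  proof (rule almost_invariant_functional, goal_cases)
    case (1 C)
    show ?case by (rule 1(1)[OF 1(2,3)])
  qed
  obtain N where N: "blin 1 N" "N (\<lambda>t. 1) = 1" "\<And>S. finite S \<Longrightarrow> multi (2 * C) S N"
    using multi_limit[OF C M] by blast
  have mN: "mean N" using N by (simp add: mean_def)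
  obtain D where D: "compact D" "0 < measure m D" by (rule exists_compact_nbhd)
  have "left_pq_multi_invariant m p p (pullback D N)"
    unfolding left_pq_multi_invariant_def
  proof (rule bdd_aboveI)
    fix x assume "x \<in> {pq_multi_norm (L1_bidual m) p p n (\<lambda>i. bidual_translate m (s i) (pullback D N)) |
       (n::nat) (s :: nat \<Rightarrow> 'g). n \<ge> 1}"
    then obtain n s where "x = pq_multi_norm (L1_bidual m) p p n (\<lambda>i. bidual_translate m (s i) (pullback D N))" by blast
    \<comment> \<open>The factor 2 is the one lost in \<open>multi_limit\<close>.\<close>
    then show "x \<le> 2 * C" using pullback_multi_norm[OF D mN _ N(3)] C by simp
  qed
  then show ?thesis using pullback_mean[OF D mN] unfolding pq_amenable_def by blast
qed

end
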